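(* Let $X$ be a Banach space and consider the initial value problem $u'(t)=Au(t)+g(t,u(t))=F(t,u(t))$, $u(t_0)=u_0$, on $[t_0,T]$. Assume: (1) The linear operator $A$ is the infinitesimal generator of an analytic semigroup $e^{tA}$ on $X$. (2) The solution $u:[t_0,T]\to X$ is sufficiently smooth with derivatives in $X$, and $g:[t_0,T]\times X\to X$ is sufficiently often Fréchet differentiable in a strip along the exact solution, all occurring derivatives being uniformly bounded. Let $p$ be an integer with $2\le p\le 5$. Consider for the numerical solution of this problem, with constant step size $h>0$, an $s$-stage explicit exponential Runge–Kutta method (as defined in the context, with nodes $c_i$ and coefficients $a_{ij}(hA)$, $b_i(hA)$) started from $u_0$, which fulfills all the stiff order conditions of orders $\le p$ listed in the context in the strong form (i.e. as stated there), with the single exception that the condition $\psi_p(Z)=0$ is required to hold only in the weakened form $\psi_p(0)=0$. Then the method is convergent of order $p$. In particular, the numerical solution $u_n$ satisfies the error bound $$\|u_n-u(t_n)\|\le C h^p$$ uniformly on compact time intervals $t_0\le t_n=t_0+nh\le T$, with a constant $C$ that depends on $T-t_0$ but is independent of $n$ and $h$.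
   Context: Setting. $g(t,u)$ is assumed to satisfy a local Lipschitz condition (in $u$) in a strip along the exact solution. Put $F(t,u)=Au+g(t,u)$. The $\varphi$-functions are the entire functions $$\varphi_k(z)=\int_0^1 e^{(1-\theta)z}\frac{\theta^{k-1}}{(k-1)!}\,d\theta,\qquad k\ge 1,$$ with $\varphi_k(hA)$ defined through the semigroup $e^{tA}$ by the same formula. Method. An $s$-stage explicit exponential Runge–Kutta method with nodes $0<c_i\le 1$ ($2\le i\le s$) and step size $h=t_{n+1}-t_n>0$ is $$U_{ni}=u_n+c_ih\,\varphi_1(c_ihA)F(t_n,u_n)+h\sum_{j=2}^{i-1}a_{ij}(hA)D_{nj},\qquad 2\le i\le s,$$ $$u_{n+1}=u_n+h\,\varphi_1(hA)F(t_n,u_n)+h\sum_{i=2}^{s}b_i(hA)D_{ni},$$ $$D_{ni}=g(t_n+c_ih,U_{ni})-g(t_n,u_n),\qquad 2\le i\le s.$$ The coefficient functions $a_{ij}(z)$ and $b_i(z)$ are linear combinations of the functions $\varphi_k(z)$ and their scaled versions $\varphi_k(c_lz)$; in particular $a_{ij}(hA)$ and $b_i(hA)$ are bounded operators on $X$. Auxiliary functions. For $j\ge 2$ and $2\le i\le s$, $$\psi_j(Z)=\sum_{i=2}^{s}b_i(Z)\frac{c_i^{j-1}}{(j-1)!}-\varphi_j(Z),\qquad \psi_{j,i}(Z)=\sum_{k=2}^{i-1}a_{ik}(Z)\frac{c_k^{j-1}}{(j-1)!}-c_i^{j}\varphi_j(c_iZ)$$ (empty sums are zero). Stiff order conditions.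 In the following, $Z,J,K,L$ denote arbitrary square matrices and $B$ an arbitrary bilinear mapping of appropriate dimensions; each condition is required to hold for all of them. Order 2: 1. $\psi_2(Z)=0$. Order 3: 2. $\psi_3(Z)=0$. 3. $\sum_{i=2}^{s}b_i(Z)J\psi_{2,i}(Z)=0$. Order 4: 4. $\psi_4(Z)=0$. 5. $\sum_{i=2}^{s}b_i(Z)J\psi_{3,i}(Z)=0$. 6. $\sum_{i=2}^{s}b_i(Z)J\sum_{j=2}^{i-1}a_{ij}(Z)J\psi_{2,j}(Z)=0$. 7. $\sum_{i=2}^{s}b_i(Z)c_iK\psi_{2,i}(Z)=0$. Order 5: 8. $\psi_5(Z)=0$. 9. $\sum_{i=2}^{s}b_i(Z)J\psi_{4,i}(Z)=0$. 10. $\sum_{i=2}^{s}b_i(Z)J\sum_{j=2}^{i-1}a_{ij}(Z)J\psi_{3,j}(Z)=0$. 11. $\sum_{i=2}^{s}b_i(Z)J\sum_{j=2}^{i-1}a_{ij}(Z)J\sum_{k=2}^{j-1}a_{jk}(Z)J\psi_{2,k}(Z)=0$. 12. $\sum_{i=2}^{s}b_i(Z)J\sum_{j=2}^{i-1}a_{ij}(Z)c_jK\psi_{2,j}(Z)=0$. 13. $\sum_{i=2}^{s}b_i(Z)c_iK\psi_{3,i}(Z)=0$. 14. $\sum_{i=2}^{s}b_i(Z)c_iK\sum_{j=2}^{i-1}a_{ij}(Z)J\psi_{2,j}(Z)=0$. 15. $\sum_{i=2}^{s}b_i(Z)B\big(\psi_{2,i}(Z),\psi_{2,i}(Z)\big)=0$.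 16. $\sum_{i=2}^{s}b_i(Z)c_i^2L\psi_{2,i}(Z)=0$. The conditions "up to order $p$" are all conditions listed under the orders $2,\dots,p$.
   Formalization: The error bound is stated for all sufficiently small step sizes 0 < h ≤ h0, with h0 and C independent of n and h: since g is controlled only in a strip along the exact solution, large steps can leave the strip and the bound can then fail. *)

theory Defs
  imports "HOL-Analysis.Analysis" "Jordan_Normal_Form.Matrix"
begin

section \<open>Analytic semigroups and their generators\<close>

definition C0_semigroup :: "(real \<Rightarrow> 'a::banach \<Rightarrow>\<^sub>L 'a) \<Rightarrow> bool" where
  "C0_semigroup S \<longleftrightarrow>
     S 0 = id_blinfun \<and>
     (\<forall>t\<ge>0. \<forall>r\<ge>0. S (t + r) = S t o\<^sub>L S r) \<and>
     (\<forall>x. ((\<lambda>t. blinfun_apply (S t) x) \<longlongrightarrow> x) (at_right 0))"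

text \<open>An unbounded operator is a pair of a domain \<open>D\<close> and a function \<open>A\<close>; the values of \<open>A\<close>
  outside \<open>D\<close> are irrelevant.\<close>

definition infinitesimal_generator ::
    "(real \<Rightarrow> 'a::banach \<Rightarrow>\<^sub>L 'a) \<Rightarrow> 'a set \<Rightarrow> ('a \<Rightarrow> 'a) \<Rightarrow> bool" where
  "infinitesimal_generator S D A \<longleftrightarrow>
     D = {x. \<exists>y. ((\<lambda>t. (blinfun_apply (S t) x - x) /\<^sub>R t) \<longlongrightarrow> y) (at_right 0)} \<and>
     (\<forall>x\<in>D. ((\<lambda>t. (blinfun_apply (S t) x - x) /\<^sub>R t) \<longlongrightarrow> A x) (at_right 0))"

text \<open>Analyticity in a complex sector is a statement about the complexification
  \<open>X + i X\<close> of the real Banach space \<open>X\<close>. It is represented by \<open>X \<times> X\<close>, where \<open>(x, y)\<close> stands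
  for \<open>x + i y\<close>. The product norm is not homogeneous for complex scalars, but it is equivalent
  to the complex norms usually put on \<open>X + i X\<close>, so the topological notions below agree.
  If \<open>X\<close> is itself a complex Banach space and the semigroup is complex-linear, then the
  complexified semigroup is the direct sum of the semigroup and its conjugate, and the notion
  is the usual one on \<open>X\<close>.\<close>

lift_definition cscale :: "complex \<Rightarrow> ('a \<times> 'a) \<Rightarrow>\<^sub>L ('a::real_normed_vector \<times> 'a)" is
  "\<lambda>z (x, y). (Re z *\<^sub>R x - Im z *\<^sub>R y, Re z *\<^sub>R y + Im z *\<^sub>R x)"
  unfolding case_prod_unfold
  by (intro bounded_linear_Pair bounded_linear_sub bounded_linear_add
        bounded_linear_const_scaleR bounded_linear_fst bounded_linear_snd)

lift_definition complexify :: "('a::real_normed_vector \<Rightarrow>\<^sub>L 'a) \<Rightarrow> ('a \<times> 'a) \<Rightarrow>\<^sub>L ('a \<times> 'a)" is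
  "\<lambda>f (x, y). (f x, f y)"
  unfolding case_prod_unfold
  by (intro bounded_linear_Pair bounded_linear_compose[OF _ bounded_linear_fst]
        bounded_linear_compose[OF _ bounded_linear_snd])

definition sector :: "real \<Rightarrow> complex set" where
  "sector \<delta> = {z. z \<noteq> 0 \<and> \<bar>Arg z\<bar> < \<delta>}"

definition analytic_semigroup :: "(real \<Rightarrow> 'a::banach \<Rightarrow>\<^sub>L 'a) \<Rightarrow> bool" where
  "analytic_semigroup S \<longleftrightarrow>
     C0_semigroup S \<and>
     (\<exists>\<delta> E. 0 < \<delta> \<and> \<delta> \<le> pi / 2 \<and>
        (\<forall>t>0. E (complex_of_real t) = complexify (S t)) \<and>
        (\<forall>z\<in>sector \<delta>. \<forall>w. E z o\<^sub>L cscale w = cscale w o\<^sub>L E z) \<and>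
        (\<forall>z\<in>sector \<delta>. \<forall>w\<in>sector \<delta>. E (z + w) = E z o\<^sub>L E w) \<and>
        (\<forall>z\<in>sector \<delta>. \<exists>E'. (E has_derivative (\<lambda>h. cscale h o\<^sub>L E')) (at z)) \<and>
        (\<forall>v. ((\<lambda>z. blinfun_apply (E z) v) \<longlongrightarrow> v) (at 0 within sector \<delta>)))"


section \<open>Smoothness\<close>

definition C_k_on_interval :: "nat \<Rightarrow> (real \<Rightarrow> 'a::real_normed_vector) \<Rightarrow> real \<Rightarrow> real \<Rightarrow> bool" where
  "C_k_on_interval m u t0 T \<longleftrightarrow>
     (\<exists>v. (\<forall>t\<in>{t0..T}. v 0 t = u t) \<and>
        (\<forall>k<m. \<forall>t\<in>{t0..T}. (v k has_vector_derivative v (Suc k) t) (at t within {t0..T})) \<and>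
        continuous_on {t0..T} (v m))"

text \<open>A \<open>k\<close>-linear map is a function on lists, of which only the values on lists of length \<open>k\<close>
  matter. This keeps all higher Frechet derivatives in one type.\<close>

definition multilinear_map ::
    "nat \<Rightarrow> ('b::real_vector list \<Rightarrow> 'c::real_vector) \<Rightarrow> bool" where
  "multilinear_map k L \<longleftrightarrow>
     (\<forall>vs i. length vs = k \<and> i < k \<longrightarrow> linear (\<lambda>v. L (vs[i := v])))"

text \<open>\<open>f\<close> is \<open>m\<close> times Frechet differentiable on \<open>W\<close> (relative to \<open>W\<close>), and the derivatives of
  orders \<open>1,...,m\<close> are bounded on \<open>W\<close> uniformly in the operator norm. \<open>G k x\<close> is the \<open>k\<close>-th
  derivative at \<open>x\<close>; the fourth clause says that \<open>G (Suc k) x\<close> is the derivative of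
  \<open>y \<mapsto> G k y\<close> at \<open>x\<close> with respect to the operator norm on \<open>k\<close>-linear maps.\<close>

definition bounded_frechet_differentiable ::
    "nat \<Rightarrow> ('b::real_normed_vector \<Rightarrow> 'c::real_normed_vector) \<Rightarrow> 'b set \<Rightarrow> bool" where
  "bounded_frechet_differentiable m f W \<longleftrightarrow>
     (\<exists>G :: nat \<Rightarrow> 'b \<Rightarrow> 'b list \<Rightarrow> 'c.
        (\<forall>x\<in>W. G 0 x [] = f x) \<and>
        (\<forall>k\<le>m. \<forall>x\<in>W. multilinear_map k (G k x)) \<and>
        (\<exists>M. \<forall>k\<in>{1..m}. \<forall>x\<in>W. \<forall>vs. length vs = k \<longrightarrow>
              norm (G k x vs) \<le> M * prod_list (map norm vs)) \<and>
        (\<forall>k<m. \<forall>x\<in>W. \<forall>\<epsilon>>0. \<exists>\<eta>>0. \<forall>y\<in>W. norm (y - x) < \<eta> \<longrightarrow>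
              (\<forall>vs. length vs = k \<longrightarrow>
                 norm (G k y vs - G k x vs - G (Suc k) x ((y - x) # vs))
                   \<le> \<epsilon> * norm (y - x) * prod_list (map norm vs))))"

definition strip :: "real \<Rightarrow> real \<Rightarrow> (real \<Rightarrow> 'a::real_normed_vector) \<Rightarrow> real \<Rightarrow> (real \<times> 'a) set" where
  "strip t0 T u R = {(t, x). t \<in> {t0..T} \<and> norm (x - u t) < R}"


section \<open>Explicit exponential Runge-Kutta methods\<close>

text \<open>A coefficient function is a formal linear combination: the list of the triples
  \<open>(\<alpha>, k, \<sigma>)\<close> stands for \<open>z \<mapsto> \<Sum> \<alpha> \<phi>\<^sub>k(\<sigma> z)\<close>. It can be evaluated both at square
  matrices and, through the semigroup, at \<open>hA\<close>.\<close>

type_synonym coefficient = "(real \<times> nat \<times> real) list"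

record erk_method =
  stages :: nat
  node :: "nat \<Rightarrow> real"
  acoef :: "nat \<Rightarrow> nat \<Rightarrow> coefficient"
  bcoef :: "nat \<Rightarrow> coefficient"

definition valid_coefficient :: "erk_method \<Rightarrow> coefficient \<Rightarrow> bool" where
  "valid_coefficient M cf \<longleftrightarrow>
     (\<forall>(\<alpha>, k, \<sigma>) \<in> set cf. 1 \<le> k \<and> (\<sigma> = 1 \<or> \<sigma> \<in> node M ` {2..stages M}))"

definition valid_erk_method :: "erk_method \<Rightarrow> bool" where
  "valid_erk_method M \<longleftrightarrow>
     (\<forall>i\<in>{2..stages M}. 0 < node M i \<and> node M i \<le> 1) \<and>
     (\<forall>i\<in>{2..stages M}. valid_coefficient M (bcoef M i)) \<and>
     (\<forall>i\<in>{2..stages M}. \<forall>j\<in>{2..<i}. valid_coefficient M (acoef M i j))"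

text \<open>\<open>phi_op S k h x\<close> is \<open>\<phi>\<^sub>k(hA) x\<close> for the generator \<open>A\<close> of \<open>S\<close>.\<close>

definition phi_op :: "(real \<Rightarrow> 'a::banach \<Rightarrow>\<^sub>L 'a) \<Rightarrow> nat \<Rightarrow> real \<Rightarrow> 'a \<Rightarrow> 'a" where
  "phi_op S k h x =
     integral {0..1} (\<lambda>\<theta>. (\<theta> ^ (k - 1) / fact (k - 1)) *\<^sub>R blinfun_apply (S ((1 - \<theta>) * h)) x)"

definition coef_op :: "(real \<Rightarrow> 'a::banach \<Rightarrow>\<^sub>L 'a) \<Rightarrow> coefficient \<Rightarrow> real \<Rightarrow> 'a \<Rightarrow> 'a" where
  "coef_op S cf h x = (\<Sum>(\<alpha>, k, \<sigma>)\<leftarrow>cf. \<alpha> *\<^sub>R phi_op S k (\<sigma> * h) x)"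

context
  fixes M :: erk_method
    and S :: "real \<Rightarrow> 'a::banach \<Rightarrow>\<^sub>L 'a"
    and A :: "'a \<Rightarrow> 'a"
    and g :: "real \<Rightarrow> 'a \<Rightarrow> 'a"
    and h :: real
begin

text \<open>Started from the value \<open>v\<close> at time \<open>t\<close>, \<open>erk_stage t v i\<close> is the stage value \<open>U\<^sub>n\<^sub>i\<close>.
  The method is written with \<open>F(t, v) = A v + g(t, v)\<close>, which needs \<open>v\<close> in the domain of \<open>A\<close>.
  This holds for all numerical solutions started in the domain: \<open>S h\<close> leaves the domain
  invariant and every \<open>\<phi>\<^sub>k(\<sigma>hA)\<close> with \<open>k \<ge> 1\<close> and \<open>\<sigma>, h > 0\<close> maps into it.\<close>

function erk_stage :: "real \<Rightarrow> 'a \<Rightarrow> nat \<Rightarrow> 'a" where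
  "erk_stage t v i =
     v + (node M i * h) *\<^sub>R phi_op S 1 (node M i * h) (A v + g t v)
       + h *\<^sub>R (\<Sum>j\<in>{2..<i}. coef_op S (acoef M i j) h
                   (g (t + node M j * h) (erk_stage t v j) - g t v))"
  by auto
termination by (relation "Wellfounded.measure (\<lambda>(t, v, i). i)") auto

declare erk_stage.simps [simp del]

definition erk_step :: "real \<Rightarrow> 'a \<Rightarrow> 'a" where
  "erk_step t v =
     v + h *\<^sub>R phi_op S 1 h (A v + g t v)
       + h *\<^sub>R (\<Sum>i\<in>{2..stages M}. coef_op S (bcoef M i) h
                   (g (t + node M i * h) (erk_stage t v i) - g t v))"

primrec erk_solution :: "real \<Rightarrow> 'a \<Rightarrow> nat \<Rightarrow> 'a" where
  "erk_solution t0 u0 0 = u0"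
| "erk_solution t0 u0 (Suc n) = erk_step (t0 + real n * h) (erk_solution t0 u0 n)"

end


section \<open>Stiff order conditions\<close>

text \<open>The matrices are the real square matrices of arbitrary dimension \<open>d\<close>. In all functions below
  the dimension is an explicit argument. Sums are taken entrywise, since matrices of
  unspecified dimension have no zero element.\<close>

definition mat_exp :: "nat \<Rightarrow> real mat \<Rightarrow> real mat" where
  "mat_exp d Z = Matrix.mat d d (\<lambda>(r, q). \<Sum>m. (Z ^\<^sub>m m) $$ (r, q) / fact m)"

definition phi_mat :: "nat \<Rightarrow> nat \<Rightarrow> real mat \<Rightarrow> real mat" where
  "phi_mat d k Z = Matrix.mat d d (\<lambda>(r, q).
     integral {0..1} (\<lambda>\<theta>. (\<theta> ^ (k - 1) / fact (k - 1)) * mat_exp d ((1 - \<theta>) \<cdot>\<^sub>m Z) $$ (r, q)))"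

definition coef_mat :: "nat \<Rightarrow> coefficient \<Rightarrow> real mat \<Rightarrow> real mat" where
  "coef_mat d cf Z = Matrix.mat d d (\<lambda>(r, q).
     \<Sum>(\<alpha>, k, \<sigma>)\<leftarrow>cf. \<alpha> * phi_mat d k (\<sigma> \<cdot>\<^sub>m Z) $$ (r, q))"

definition mat_sum :: "nat \<Rightarrow> nat set \<Rightarrow> (nat \<Rightarrow> real mat) \<Rightarrow> real mat" where
  "mat_sum d I N = Matrix.mat d d (\<lambda>(r, q). \<Sum>i\<in>I. N i $$ (r, q))"

definition vec_sum :: "nat \<Rightarrow> nat set \<Rightarrow> (nat \<Rightarrow> real Matrix.vec) \<Rightarrow> real Matrix.vec" where
  "vec_sum d I w = Matrix.vec d (\<lambda>r. \<Sum>i\<in>I. vec_index (w i) r)"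

definition bilinear_map ::
    "nat \<Rightarrow> (real Matrix.vec \<Rightarrow> real Matrix.vec \<Rightarrow> real Matrix.vec) \<Rightarrow> bool" where
  "bilinear_map d B \<longleftrightarrow>
     (\<forall>x\<in>carrier_vec d. \<forall>y\<in>carrier_vec d. B x y \<in> carrier_vec d) \<and>
     (\<forall>x\<in>carrier_vec d. \<forall>y\<in>carrier_vec d. \<forall>z\<in>carrier_vec d.
        B (x + y) z = B x z + B y z \<and> B z (x + y) = B z x + B z y) \<and>
     (\<forall>r. \<forall>x\<in>carrier_vec d. \<forall>y\<in>carrier_vec d.
        B (r \<cdot>\<^sub>v x) y = r \<cdot>\<^sub>v B x y \<and> B x (r \<cdot>\<^sub>v y) = r \<cdot>\<^sub>v B x y)"

context
  fixes M :: erk_method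
begin

definition a_mat :: "nat \<Rightarrow> nat \<Rightarrow> nat \<Rightarrow> real mat \<Rightarrow> real mat" where
  "a_mat d i j Z = coef_mat d (acoef M i j) Z"

definition b_mat :: "nat \<Rightarrow> nat \<Rightarrow> real mat \<Rightarrow> real mat" where
  "b_mat d i Z = coef_mat d (bcoef M i) Z"

definition psi :: "nat \<Rightarrow> nat \<Rightarrow> real mat \<Rightarrow> real mat" where
  "psi d j Z =
     mat_sum d {2..stages M} (\<lambda>i. (node M i ^ (j - 1) / fact (j - 1)) \<cdot>\<^sub>m b_mat d i Z)
     - phi_mat d j Z"

definition psi_stage :: "nat \<Rightarrow> nat \<Rightarrow> nat \<Rightarrow> real mat \<Rightarrow> real mat" where
  "psi_stage d j i Z =
     mat_sum d {2..<i} (\<lambda>k. (node M k ^ (j - 1) / fact (j - 1)) \<cdot>\<^sub>m a_mat d i k Z)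
     - (node M i ^ j) \<cdot>\<^sub>m phi_mat d j (node M i \<cdot>\<^sub>m Z)"

definition psi_condition :: "nat \<Rightarrow> bool" where
  "psi_condition j \<longleftrightarrow> (\<forall>d. \<forall>Z\<in>carrier_mat d d. psi d j Z = 0\<^sub>m d d)"

definition weak_psi_condition :: "nat \<Rightarrow> bool" where
  "weak_psi_condition j \<longleftrightarrow> (\<forall>d. psi d j (0\<^sub>m d d) = 0\<^sub>m d d)"

definition coupling_conditions_3 :: bool where
  "coupling_conditions_3 \<longleftrightarrow>
     (\<forall>d. \<forall>Z\<in>carrier_mat d d. \<forall>J\<in>carrier_mat d d.
        mat_sum d {2..stages M} (\<lambda>i. b_mat d i Z * J * psi_stage d 2 i Z) = 0\<^sub>m d d)"

definition coupling_conditions_4 :: bool where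
  "coupling_conditions_4 \<longleftrightarrow>
     (\<forall>d. \<forall>Z\<in>carrier_mat d d. \<forall>J\<in>carrier_mat d d. \<forall>K\<in>carrier_mat d d.
        mat_sum d {2..stages M} (\<lambda>i. b_mat d i Z * J * psi_stage d 3 i Z) = 0\<^sub>m d d \<and>
        mat_sum d {2..stages M} (\<lambda>i. b_mat d i Z * J *
            mat_sum d {2..<i} (\<lambda>j. a_mat d i j Z * J * psi_stage d 2 j Z)) = 0\<^sub>m d d \<and>
        mat_sum d {2..stages M} (\<lambda>i. b_mat d i Z * (node M i \<cdot>\<^sub>m K) * psi_stage d 2 i Z) = 0\<^sub>m d d)"

definition coupling_conditions_5 :: bool where
  "coupling_conditions_5 \<longleftrightarrow>
     (\<forall>d. \<forall>Z\<in>carrier_mat d d. \<forall>J\<in>carrier_mat d d. \<forall>K\<in>carrier_mat d d. \<forall>L\<in>carrier_mat d d.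
        mat_sum d {2..stages M} (\<lambda>i. b_mat d i Z * J * psi_stage d 4 i Z) = 0\<^sub>m d d \<and>
        mat_sum d {2..stages M} (\<lambda>i. b_mat d i Z * J *
            mat_sum d {2..<i} (\<lambda>j. a_mat d i j Z * J * psi_stage d 3 j Z)) = 0\<^sub>m d d \<and>
        mat_sum d {2..stages M} (\<lambda>i. b_mat d i Z * J *
            mat_sum d {2..<i} (\<lambda>j. a_mat d i j Z * J *
              mat_sum d {2..<j} (\<lambda>k. a_mat d j k Z * J * psi_stage d 2 k Z))) = 0\<^sub>m d d \<and>
        mat_sum d {2..stages M} (\<lambda>i. b_mat d i Z * J *
            mat_sum d {2..<i} (\<lambda>j. a_mat d i j Z * (node M j \<cdot>\<^sub>m K) * psi_stage d 2 j Z)) = 0\<^sub>m d d \<and>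
        mat_sum d {2..stages M} (\<lambda>i. b_mat d i Z * (node M i \<cdot>\<^sub>m K) * psi_stage d 3 i Z) = 0\<^sub>m d d \<and>
        mat_sum d {2..stages M} (\<lambda>i. b_mat d i Z * (node M i \<cdot>\<^sub>m K) *
            mat_sum d {2..<i} (\<lambda>j. a_mat d i j Z * J * psi_stage d 2 j Z)) = 0\<^sub>m d d \<and>
        mat_sum d {2..stages M}
            (\<lambda>i. b_mat d i Z * ((node M i)\<^sup>2 \<cdot>\<^sub>m L) * psi_stage d 2 i Z) = 0\<^sub>m d d) \<and>
     (\<forall>d. \<forall>Z\<in>carrier_mat d d. \<forall>B. bilinear_map d B \<longrightarrow>
        (\<forall>x\<in>carrier_vec d. \<forall>y\<in>carrier_vec d.
           vec_sum d {2..stages M} (\<lambda>i. b_mat d i Z *\<^sub>v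
              B (psi_stage d 2 i Z *\<^sub>v x) (psi_stage d 2 i Z *\<^sub>v y)) = 0\<^sub>v d))"

definition stiff_conditions_weakened :: "nat \<Rightarrow> bool" where
  "stiff_conditions_weakened p \<longleftrightarrow>
     (\<forall>j\<in>{2..<p}. psi_condition j) \<and> weak_psi_condition p \<and>
     (3 \<le> p \<longrightarrow> coupling_conditions_3) \<and>
     (4 \<le> p \<longrightarrow> coupling_conditions_4) \<and>
     (5 \<le> p \<longrightarrow> coupling_conditions_5)"

end

end

theory Submission
  imports Defs
begin

text \<open>Write \<open>S t\<close> for the semigroup, \<open>f(t) = g(t, u(t))\<close> and \<open>e\<^sub>n\<close> for the error at \<open>t\<^sub>n\<close>. The proof rests on
an error recursion
  \<open>e\<^sub>n\<^sub>+\<^sub>1 = S(h) e\<^sub>n + h r\<^sub>n + h^p \<psi>\<^sub>p(hA) f^(p-1)(t\<^sub>n) + O(h^(p+1))\<close> with \<open>r\<^sub>n = O(\<parallel>e\<^sub>n\<parallel>)\<close>.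
Here \<open>r\<^sub>n\<close> comes from the stability of one step (lemma \<open>stability\<close>): the unbounded operator enters
only through \<open>S(h)\<close>, because \<open>v + h \<phi>\<^sub>1(hA) A v = S(h) v\<close>. Solving the recursion and applying a
discrete Gronwall lemma proves the theorem (lemma \<open>convergence\<close>), provided that the sums
\<open>\<Sum>\<^sub>j S((n-1-j)h) \<psi>\<^sub>p(hA) f^(p-1)(t\<^sub>j)\<close> are bounded uniformly in \<open>n\<close> and \<open>h\<close>. A naive bound of these
sums loses one power of \<open>h\<close>; this is where the weakened condition \<open>\<psi>\<^sub>p(0) = 0\<close> and the analyticity
of the semigroup are needed. Parabolic smoothing gives
  \<open>S(jh) \<psi>\<^sub>p(hA) = \<kappa> (S((j+1)h) - S(jh)) + O(1/j^2)\<close>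
with a constant \<open>\<kappa>\<close>, so the sums of these operators telescope up to a convergent series (lemma
\<open>sum_orbit_coef_bounded\<close>), and a summation by parts moves the varying factors \<open>f^(p-1)(t\<^sub>j)\<close> out of the
way (lemma \<open>weighted_sum_orbit_coef_bounded\<close>).

For the local error, the defects of the exact solution in the stages and in the final row are
expanded with the variation-of-constants formula (lemma \<open>row_expansion\<close>). The stage errors satisfy
\<open>E\<^sub>i = h^2 E\<^sub>2\<^sub>,\<^sub>i + h^3 E\<^sub>3\<^sub>,\<^sub>i + h^4 E\<^sub>4\<^sub>,\<^sub>i + O(h^5)\<close>, where the coefficients are built from the operators
\<open>\<psi>\<^sub>j\<^sub>,\<^sub>i(hA)\<close> and the derivatives \<open>J\<close>, \<open>K\<close>, \<open>L\<close>, \<open>B\<close> of \<open>g\<close> along the solution; substituting this into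
\<open>g\<close> produces exactly the elementary differentials that occur in the stiff order conditions.

The order conditions are given for matrices, but they are used for the operator \<open>hA\<close> and for bounded
linear maps on \<open>X\<close>. The transfer goes through scalar identities. If \<open>Z\<close> is diagonal and \<open>J\<close>
is a shift matrix, then one entry of a matrix condition such as \<open>\<Sum>\<^sub>i b\<^sub>i(Z) J \<psi>\<^sub>2\<^sub>,\<^sub>i(Z) = 0\<close> reads
\<open>\<Sum>\<^sub>i b\<^sub>i(z\<^sub>0) \<psi>\<^sub>2\<^sub>,\<^sub>i(z\<^sub>1) = 0\<close> with independent real variables. The functions \<open>z \<mapsto> \<phi>\<^sub>k(\<sigma> z)\<close> are
linearly independent, even with vector coefficients (lemma \<open>phi_real_independent\<close>). Hence such an
identity holds formally in each variable, and each \<open>\<phi>\<^sub>k(\<sigma> z)\<close> may be replaced by \<open>\<phi>\<^sub>k(\<sigma> hA)\<close> with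
arbitrary linear maps in between (lemmas \<open>coefficient_transfer\<close> and \<open>operator_chain_1\<close> to
\<open>operator_bilinear\<close>).\<close>

section \<open>The uniform boundedness principle\<close>

text \<open>If \<open>T\<close> were small at both \<open>x + \<xi>\<close> and \<open>x - \<xi>\<close>, then \<open>2 T \<xi>\<close> would be small as well. With the factor
\<open>2/3\<close> in place of \<open>1\<close> a maximising \<open>\<xi>\<close> need not exist.\<close>

lemma exists_large_value_near:
  fixes T :: "'a::real_normed_vector \<Rightarrow>\<^sub>L 'b::real_normed_vector"
  assumes "r > 0"
  shows "\<exists>y. norm (y - x) \<le> r \<and> norm (T y) \<ge> 2/3 * r * norm T"
proof (rule ccontr)
  assume neg: "\<not> ?thesis"
  have "norm (T w) \<le> 2/3 * norm T * norm w" for w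
  proof (cases "w = 0")
    case False
    define \<xi> where "\<xi> = (r / norm w) *\<^sub>R w"
    have n: "norm \<xi> = r" using False assms by (simp add: \<xi>_def)
    have 1: "norm (T (x + \<xi>)) < 2/3 * r * norm T"
      using neg[unfolded not_ex, THEN spec[of _ "x + \<xi>"]] n by auto
    have 2: "norm (T (x - \<xi>)) < 2/3 * r * norm T"
      using neg[unfolded not_ex, THEN spec[of _ "x - \<xi>"]] n by auto
    have "2 *\<^sub>R T \<xi> = T (x + \<xi>) - T (x - \<xi>)"
      by (simp add: blinfun.add_right blinfun.diff_right scaleR_2)
    then have "2 * norm (T \<xi>) \<le> norm (T (x + \<xi>)) + norm (T (x - \<xi>))"
      using norm_triangle_ineq4[of "T (x + \<xi>)" "T (x - \<xi>)"] by (metis norm_scaleR abs_numeral)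
    then have "norm (T \<xi>) \<le> 2/3 * r * norm T" using 1 2 by linarith
    moreover have "norm (T \<xi>) = r / norm w * norm (T w)"
      using assms by (simp add: \<xi>_def blinfun.scaleR_right)
    ultimately have "r / norm w * norm (T w) \<le> 2/3 * r * norm T" by simp
    then show ?thesis using False assms by (simp add: field_simps)
  qed simp
  then have "norm T \<le> 2/3 * norm T"
    by (intro norm_blinfun_bound) auto
  then have "T = 0" by simp
  then show False using neg assms by (auto dest!: spec[of _ x])
qed

text \<open>A gliding hump argument: if \<open>\<parallel>T\<^sub>k\<parallel> > 4^k\<close>, the previous lemma
yields a Cauchy sequence with steps of size \<open>3^-k\<close> along which \<open>T\<^sub>k\<close> takes values of size at least
\<open>2/3 * 3^-k * \<parallel>T\<^sub>k\<parallel>\<close>. The limit \<open>l\<close> is within \<open>1/2 * 3^-k\<close> of the \<open>k\<close>-th point, so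
\<open>\<parallel>T\<^sub>k l\<parallel> \<ge> 1/6 * (4/3)^k\<close> is unbounded.\<close>

lemma uniform_boundedness:
  fixes F :: "nat \<Rightarrow> 'a::banach \<Rightarrow>\<^sub>L 'b::real_normed_vector"
  assumes bdd: "\<And>x. \<exists>B. \<forall>n. norm (F n x) \<le> B"
  shows "\<exists>B. \<forall>n. norm (F n) \<le> B"
proof (rule ccontr)
  assume "\<not> ?thesis"
  then have "\<forall>B. \<exists>n. norm (F n) > B" by (meson not_le)
  then have "\<forall>k::nat. \<exists>n. norm (F n) > 4 ^ k" by blast
  then obtain \<nu> where \<nu>: "\<And>k::nat. norm (F (\<nu> k)) > 4 ^ k" by metis
  define T where "T k = F (\<nu> k)" for k
  have "\<forall>k x. \<exists>y. norm (y - x) \<le> (1/3) ^ k \<and> norm (T k y) \<ge> 2/3 * (1/3) ^ k * norm (T k)"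
    by (intro allI exists_large_value_near) simp
  then obtain step where step: "\<And>k x. norm (step k x - x) \<le> (1/3) ^ k"
     "\<And>k x. norm (T k (step k x)) \<ge> 2/3 * (1/3) ^ k * norm (T k)" by metis
  \<comment> \<open>starting point and first index are irrelevant, so step \<open>0\<close> is skipped\<close>
  define x where "x = rec_nat 0 (\<lambda>k y. step (Suc k) y)"
  have x_Suc: "x (Suc k) = step (Suc k) (x k)" for k by (simp add: x_def)
  have dx: "norm (x (Suc k) - x k) \<le> (1/3) ^ Suc k" for k by (simp only: x_Suc step)
  have large: "norm (T (Suc k) (x (Suc k))) \<ge> 2/3 * (1/3) ^ Suc k * norm (T (Suc k))" for k
    by (simp only: x_Suc step)
  have dist: "norm (x (k + m) - x k) \<le> 1/2 * (1/3) ^ k - 1/2 * (1/3) ^ (k + m)" for k m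
  proof (induction m)
    case (Suc m)
    have "norm (x (k + Suc m) - x k) \<le> norm (x (Suc (k + m)) - x (k + m)) + norm (x (k + m) - x k)"
      using norm_triangle_ineq[of "x (Suc (k + m)) - x (k + m)" "x (k + m) - x k"] by simp
    also have "\<dots> \<le> (1/3) ^ Suc (k + m) + (1/2 * (1/3) ^ k - 1/2 * (1/3) ^ (k + m))"
      using dx Suc by (intro add_mono) auto
    finally show ?case by simp
  qed simp
  have dist': "norm (x (k + m) - x k) \<le> 1/2 * (1/3) ^ k" for k m
    using dist[of k m] zero_le_power[of "1/3::real" "k+m"] by linarith
  have "Cauchy x"
  proof (rule metric_CauchyI)
    fix e :: real assume "e > 0"
    obtain N where N: "(1/3::real) ^ N < e" using real_arch_pow_inv[OF \<open>e > 0\<close>, of "1/3"] by auto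
    have "dist (x m) (x n) < e" if "m \<ge> N" "n \<ge> N" for m n
    proof -
      have "norm (x m - x N) \<le> 1/2 * (1/3) ^ N" "norm (x n - x N) \<le> 1/2 * (1/3) ^ N"
        using dist'[of N "m - N"] dist'[of N "n - N"] that by auto
      then show ?thesis using N norm_triangle_ineq4[of "x m - x N" "x n - x N"]
        by (simp add: dist_norm)
    qed
    then show "\<exists>M. \<forall>m\<ge>M. \<forall>n\<ge>M. dist (x m) (x n) < e" by blast
  qed
  then obtain l where l: "x \<longlonglongrightarrow> l" using Cauchy_convergent_iff convergentD by blast
  have near: "norm (l - x k) \<le> 1/2 * (1/3) ^ k" for k
  proof (rule tendsto_upperbound)
    show "(\<lambda>m. norm (x (k + m) - x k)) \<longlonglongrightarrow> norm (l - x k)"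
      using LIMSEQ_ignore_initial_segment[OF l, of k]
      by (intro tendsto_intros) (simp add: add.commute)
  qed (use dist' in auto)
  obtain B where B: "\<And>n. norm (F n l) \<le> B" using bdd by blast
  have small: "(4/3) ^ Suc k \<le> 6 * B" for k
  proof -
    let ?k = "Suc k"
    have "norm (T ?k (x ?k)) \<le> norm (T ?k l) + norm (T ?k (l - x ?k))"
      using norm_triangle_ineq4[of "T ?k l" "T ?k (l - x ?k)"] by (simp add: blinfun.diff_right)
    also have "norm (T ?k (l - x ?k)) \<le> norm (T ?k) * (1/2 * (1/3) ^ ?k)"
      using norm_blinfun[of "T ?k" "l - x ?k"] near[of ?k]
      by (meson mult_left_mono norm_ge_zero order_trans)
    finally have "norm (T ?k l) \<ge> 1/6 * (1/3) ^ ?k * norm (T ?k)"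
      using large[of k] by (simp add: algebra_simps)
    moreover have "1/6 * (1/3) ^ ?k * norm (T ?k) \<ge> 1/6 * (1/3) ^ ?k * 4 ^ ?k"
      using \<nu>[of ?k] by (intro mult_left_mono) (auto simp: T_def)
    moreover have "norm (T ?k l) \<le> B" using B by (simp add: T_def)
    ultimately have "1/6 * (1/3) ^ ?k * 4 ^ ?k \<le> B" by (meson order_trans)
    then have "((1/3) ^ ?k * 4 ^ ?k) \<le> 6 * B" by (simp only: mult.assoc)
    then show ?thesis by (simp only: power_mult_distrib[symmetric]) simp
  qed
  obtain k where "6 * B < (4/3::real) ^ k" using real_arch_pow[of "4/3::real" "6 * B"] by auto
  also have "(4/3::real) ^ k \<le> (4/3) ^ Suc k" by (rule power_increasing) auto
  also have "(4/3::real) ^ Suc k \<le> 6 * B" by (rule small)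
  finally show False by (rule less_irrefl[THEN notE])
qed

section \<open>Cauchy estimates for operator families\<close>

lemma cscale_apply: "blinfun_apply (cscale z) (x, y) = (Re z *\<^sub>R x - Im z *\<^sub>R y, Re z *\<^sub>R y + Im z *\<^sub>R x)"
  by transfer simp

lemma blinfun_compose_assoc: "(a o\<^sub>L b) o\<^sub>L c = a o\<^sub>L (b o\<^sub>L c)"
  by (rule blinfun_eqI) simp

lemma cscale_compose: "cscale z o\<^sub>L cscale w = cscale (z * w)"
  by (rule blinfun_eqI) (auto simp: cscale_apply algebra_simps)

lemma cscale_of_real: "cscale (complex_of_real r) = r *\<^sub>R id_blinfun"
  by (rule blinfun_eqI) (auto simp: cscale_apply scaleR_blinfun.rep_eq)

lemma norm_cscale_le: "norm (cscale z) \<le> 4 * cmod z"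
proof (rule norm_blinfun_bound)
  fix v :: "'a \<times> 'a"
  obtain x y where v: "v = (x, y)" by force
  have a: "norm (Re z *\<^sub>R x - Im z *\<^sub>R y) \<le> cmod z * norm x + cmod z * norm y"
    by (rule order_trans[OF norm_triangle_ineq4])
       (auto intro!: add_mono mult_right_mono abs_Re_le_cmod abs_Im_le_cmod)
  have b: "norm (Re z *\<^sub>R y + Im z *\<^sub>R x) \<le> cmod z * norm y + cmod z * norm x"
    by (rule order_trans[OF norm_triangle_ineq])
       (auto intro!: add_mono mult_right_mono abs_Re_le_cmod abs_Im_le_cmod)
  have "norm (cscale z v) \<le> norm (Re z *\<^sub>R x - Im z *\<^sub>R y) + norm (Re z *\<^sub>R y + Im z *\<^sub>R x)"
    unfolding v cscale_apply by (rule norm_Pair_le)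
  also have "\<dots> \<le> 2 * cmod z * (norm x + norm y)" using a b by (simp add: algebra_simps)
  also have "\<dots> \<le> 2 * cmod z * (norm v + norm v)"
    using norm_fst_le[of x y] norm_snd_le[of y x] by (intro mult_left_mono add_mono) (auto simp: v)
  finally show "norm (cscale z v) \<le> 4 * cmod z * norm v" by simp
qed simp

lemma linear_cscale: "bounded_linear cscale"
proof (rule bounded_linear_intro[where K = 4])
  show "cscale (a + b) = cscale a + cscale b" for a b
    by (rule blinfun_eqI) (auto simp: cscale_apply plus_blinfun.rep_eq algebra_simps)
  show "cscale (r *\<^sub>R a) = r *\<^sub>R cscale a" for r a
    by (rule blinfun_eqI) (auto simp: cscale_apply scaleR_blinfun.rep_eq algebra_simps)
qed (use norm_cscale_le in \<open>simp add: mult.commute\<close>)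

text \<open>Since the sector is a cone, it suffices to find a ball around \<open>1\<close> and to scale it by \<open>t\<close>.\<close>

lemma ball_subset_sector:
  assumes "\<delta> > 0"
  obtains \<eta> where "0 < \<eta>" "\<eta> < 1/2" "\<And>t. t > 0 \<Longrightarrow> cball (complex_of_real t) (2 * \<eta> * t) \<subseteq> sector \<delta>"
proof -
  have "isCont Arg 1" by (intro continuous_at_Arg) (auto simp: complex_nonpos_Reals_iff)
  then have "\<exists>s>0. \<forall>z. dist z 1 < s \<longrightarrow> dist (Arg z) (Arg 1) < \<delta>"
    using assms unfolding continuous_at_eps_delta by blast
  then obtain s where s: "s > 0" "\<And>z. dist z 1 < s \<Longrightarrow> \<bar>Arg z\<bar> < \<delta>"
    by (auto simp: dist_real_def)
  define \<eta> where "\<eta> = min (s/4) (1/4)"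
  show ?thesis
  proof
    show "0 < \<eta>" "\<eta> < 1/2" using s by (auto simp: \<eta>_def)
    fix t :: real assume t: "t > 0"
    show "cball (complex_of_real t) (2 * \<eta> * t) \<subseteq> sector \<delta>"
    proof
      fix z assume "z \<in> cball (complex_of_real t) (2 * \<eta> * t)"
      then have z: "cmod (z - of_real t) \<le> 2 * \<eta> * t" by (simp add: dist_norm norm_minus_commute)
      define w where "w = z / of_real t"
      have zw: "z = of_real t * w" using t by (simp add: w_def)
      have "z - of_real t = of_real t * (w - 1)" using zw by (simp add: algebra_simps)
      then have "t * cmod (w - 1) \<le> 2 * \<eta> * t" using z t by (simp add: norm_mult)
      then have w: "cmod (w - 1) \<le> 2 * \<eta>" using t by (simp add: mult.commute)
      have "\<bar>Arg w\<bar> < \<delta>" using w s by (auto simp: \<eta>_def dist_norm)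
      moreover have "w \<noteq> 0" using w s by (auto simp: \<eta>_def)
      moreover have "Arg z = Arg w" using t zw by (simp add: Arg_times_of_real)
      ultimately show "z \<in> sector \<delta>" using zw t by (auto simp: sector_def)
    qed
  qed
qed

lemma has_vector_derivative_quotient_iff:
  fixes f :: "real \<Rightarrow> 'b::real_normed_vector"
  shows "(f has_vector_derivative f') (at x within U) \<longleftrightarrow> ((\<lambda>y. (f y - f x) /\<^sub>R (y - x)) \<longlongrightarrow> f') (at x within U)"
proof -
  have e: "norm ((f y - f x) - (y - x) *\<^sub>R f') / norm (y - x) = norm ((f y - f x) /\<^sub>R (y - x) - f')" if "y \<noteq> x" for y
  proof -
    have "(f y - f x) /\<^sub>R (y - x) - f' = ((f y - f x) - (y - x) *\<^sub>R f') /\<^sub>R (y - x)"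
      using that by (simp add: scaleR_diff_right)
    then show ?thesis by (simp add: divide_inverse_commute)
  qed
  have "(f has_vector_derivative f') (at x within U) \<longleftrightarrow>
      ((\<lambda>y. norm ((f y - f x) - (y - x) *\<^sub>R f') / norm (y - x)) \<longlongrightarrow> 0) (at x within U)"
    unfolding has_vector_derivative_def has_derivative_iff_norm by (simp add: bounded_linear_scaleR_left)
  also have "\<dots> \<longleftrightarrow> ((\<lambda>y. norm ((f y - f x) /\<^sub>R (y - x) - f')) \<longlongrightarrow> 0) (at x within U)"
    by (rule tendsto_cong) (use e in \<open>auto simp: eventually_at_filter\<close>)
  also have "\<dots> \<longleftrightarrow> ((\<lambda>y. (f y - f x) /\<^sub>R (y - x)) \<longlongrightarrow> f') (at x within U)"
    by (simp add: tendsto_norm_zero_iff LIM_zero_iff)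
  finally show ?thesis .
qed

lemmas vector_derivative_quotient = has_vector_derivative_quotient_iff[THEN iffD1]

text \<open>The estimate follows from the mean value property of the derivative. Put
\<open>\<Phi>(\<rho>) = \<integral> e^(-i\<theta>) F(a + \<rho> e^(i\<theta>)) d\<theta>\<close> and \<open>N(\<rho>) = \<integral> F'(a + \<rho> e^(i\<theta>)) d\<theta>\<close> over a full circle. Integration
by parts in \<open>\<theta>\<close> gives \<open>\<Phi> = \<rho> N\<close>, differentiation in \<open>\<rho>\<close> gives \<open>\<Phi>' = N\<close>. Hence \<open>\<Phi>(\<rho>) / \<rho>\<close> is constant, and
its limit at \<open>0\<close> is \<open>2 \<pi> F' a\<close>. The factor \<open>4\<close> is the norm bound for multiplication by a complex number
of modulus one in the product norm.\<close>

lemma cauchy_estimate: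
  fixes F :: "complex \<Rightarrow> ('a::banach \<times> 'a) \<Rightarrow>\<^sub>L ('a \<times> 'a)"
  assumes r: "r > 0"
    and der: "\<And>z. z \<in> cball a r \<Longrightarrow> (F has_derivative (\<lambda>h. cscale h o\<^sub>L F' z)) (at z)"
    and cont: "continuous_on (cball a r) F'"
    and bound: "\<And>z. z \<in> cball a r \<Longrightarrow> norm (F z) \<le> C"
  shows "norm (F' a) \<le> 4 * C / r"
proof -
  define c where "c \<rho> \<theta> = a + of_real \<rho> * cis \<theta>" for \<rho> \<theta>
  have c_in: "c \<rho> \<theta> \<in> cball a r" if "\<rho> \<in> {0..r}" for \<rho> \<theta>
    using that by (simp add: c_def dist_norm norm_mult)
  have contc: "continuous_on U (\<lambda>(\<rho>, \<theta>). c \<rho> \<theta>)" for U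
    unfolding c_def case_prod_unfold by (intro continuous_intros)
  have contF: "continuous_on (cball a r) F"
    by (meson der has_derivative_continuous has_derivative_at_withinI continuous_on_eq_continuous_within)
  define N where "N \<rho> = integral {0..2*pi} (\<lambda>\<theta>. F' (c \<rho> \<theta>))" for \<rho>
  define \<Phi> where "\<Phi> \<rho> = integral {0..2*pi} (\<lambda>\<theta>. cscale (cis (- \<theta>)) o\<^sub>L F (c \<rho> \<theta>))" for \<rho>
  note lin[continuous_intros] = bounded_linear.continuous_on[OF linear_cscale]
  have contc1: "continuous_on {0..2*pi} (\<lambda>\<theta>. c \<rho> \<theta>)" for \<rho>
    unfolding c_def by (intro continuous_intros)
  have contFc: "continuous_on {0..2*pi} (\<lambda>\<theta>. F (c \<rho> \<theta>))" if "\<rho> \<in> {0..r}" for \<rho>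
    using c_in[OF that] by (intro continuous_on_compose2[OF contF contc1]) blast
  have contF'c: "continuous_on {0..2*pi} (\<lambda>\<theta>. F' (c \<rho> \<theta>))" if "\<rho> \<in> {0..r}" for \<rho>
    using c_in[OF that] by (intro continuous_on_compose2[OF cont contc1]) blast
  have int\<Phi>: "(\<lambda>\<theta>. cscale (cis (- \<theta>)) o\<^sub>L F (c \<rho> \<theta>)) integrable_on {0..2*pi}" if "\<rho> \<in> {0..r}" for \<rho>
    using that by (intro integrable_continuous_real continuous_intros contFc)
  have \<Phi>N: "\<Phi> \<rho> = \<rho> *\<^sub>R N \<rho>" if \<rho>: "\<rho> \<in> {0..r}" for \<rho>
  proof -
    have i2: "(\<lambda>\<theta>. \<rho> *\<^sub>R F' (c \<rho> \<theta>)) integrable_on {0..2*pi}"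
      by (intro integrable_continuous_real continuous_intros contF'c \<rho>)
    have "((\<lambda>\<theta>. cscale (\<i> * cis (- \<theta>)) o\<^sub>L F (c \<rho> \<theta>)) has_vector_derivative
       (cscale (cis (- \<theta>)) o\<^sub>L F (c \<rho> \<theta>)) - \<rho> *\<^sub>R F' (c \<rho> \<theta>)) (at \<theta> within {0..2*pi})" for \<theta>
    proof -
      have 1: "((\<lambda>\<theta>. \<i> * cis (- \<theta>)) has_derivative (\<lambda>h. of_real h * cis (- \<theta>))) (at \<theta> within {0..2*pi})"
        by (rule derivative_eq_intros refl | simp add: fun_eq_iff complex_eq_iff)+
      have 2: "((\<lambda>\<theta>. c \<rho> \<theta>) has_derivative (\<lambda>h. of_real h * (of_real \<rho> * \<i> * cis \<theta>))) (at \<theta> within {0..2*pi})"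
        unfolding c_def by (rule derivative_eq_intros refl | simp add: fun_eq_iff scaleR_conv_of_real)+
      note d1 = bounded_linear.has_derivative[OF linear_cscale 1]
      note d2 = has_derivative_compose[OF 2 der[OF c_in[OF \<rho>]]]
      note d = bounded_bilinear.FDERIV[OF bounded_bilinear_blinfun_compose d1 d2]
      show ?thesis
        unfolding has_vector_derivative_def
      proof (rule has_derivative_eq_rhs[OF d], rule ext)
        fix h
        have "cscale (\<i> * cis (- \<theta>)) o\<^sub>L (cscale (of_real h * (of_real \<rho> * \<i> * cis \<theta>)) o\<^sub>L F' (c \<rho> \<theta>))
          = cscale (\<i> * cis (- \<theta>) * (of_real h * (of_real \<rho> * \<i> * cis \<theta>))) o\<^sub>L F' (c \<rho> \<theta>)"
          by (simp add: blinfun_compose_assoc[symmetric] cscale_compose)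
        also have "\<i> * cis (- \<theta>) * (of_real h * (of_real \<rho> * \<i> * cis \<theta>)) = of_real (- (h * \<rho>))"
        proof -
          have "\<i> * a * (of_real h * (of_real \<rho> * \<i> * b)) = of_real (- (h * \<rho>)) * (a * b)" for a b :: complex
            by (simp add: complex_eq_iff algebra_simps)
          then show ?thesis by (simp add: cis_mult)
        qed
        also have "cscale (of_real (- (h * \<rho>))) o\<^sub>L F' (c \<rho> \<theta>) = - (h * \<rho>) *\<^sub>R F' (c \<rho> \<theta>)"
          unfolding cscale_of_real by (rule blinfun_eqI) (simp add: blinfun.bilinear_simps scaleR_blinfun.rep_eq)
        finally have e1: "cscale (\<i> * cis (- \<theta>)) o\<^sub>L (cscale (of_real h * (of_real \<rho> * \<i> * cis \<theta>)) o\<^sub>L F' (c \<rho> \<theta>))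
          = - (h * \<rho>) *\<^sub>R F' (c \<rho> \<theta>)" .
        have e2: "cscale (of_real h * cis (- \<theta>)) = h *\<^sub>R cscale (cis (- \<theta>))"
          using linear_scale[OF bounded_linear.linear[OF linear_cscale], of h "cis (- \<theta>)"] by (simp add: scaleR_conv_of_real)
        show "(cscale (\<i> * cis (- \<theta>)) o\<^sub>L (cscale (of_real h * (of_real \<rho> * \<i> * cis \<theta>)) o\<^sub>L F' (c \<rho> \<theta>))) +
           (cscale (of_real h * cis (- \<theta>)) o\<^sub>L F (c \<rho> \<theta>)) =
          h *\<^sub>R ((cscale (cis (- \<theta>)) o\<^sub>L F (c \<rho> \<theta>)) - \<rho> *\<^sub>R F' (c \<rho> \<theta>))"
          unfolding e1 e2 by (simp add: bounded_bilinear.scaleR_left[OF bounded_bilinear_blinfun_compose] algebra_simps)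
      qed
    qed
    then have "((\<lambda>\<theta>. (cscale (cis (- \<theta>)) o\<^sub>L F (c \<rho> \<theta>)) - \<rho> *\<^sub>R F' (c \<rho> \<theta>)) has_integral
       (cscale (\<i> * cis (- (2*pi))) o\<^sub>L F (c \<rho> (2*pi))) - (cscale (\<i> * cis (- 0)) o\<^sub>L F (c \<rho> 0))) {0..2*pi}"
      by (intro fundamental_theorem_of_calculus) auto
    moreover have "cis (2*pi) = cis 0" "cis (-(2*pi)) = cis (- 0)"
      by (auto simp: complex_eq_iff)
    ultimately have "integral {0..2*pi} (\<lambda>\<theta>. (cscale (cis (- \<theta>)) o\<^sub>L F (c \<rho> \<theta>)) - \<rho> *\<^sub>R F' (c \<rho> \<theta>)) = 0"
      by (auto simp: c_def dest: integral_unique)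
    also have "integral {0..2*pi} (\<lambda>\<theta>. (cscale (cis (- \<theta>)) o\<^sub>L F (c \<rho> \<theta>)) - \<rho> *\<^sub>R F' (c \<rho> \<theta>)) = \<Phi> \<rho> - \<rho> *\<^sub>R N \<rho>"
      unfolding \<Phi>_def N_def using integral_diff[OF int\<Phi>[OF \<rho>] i2] by simp
    finally show ?thesis by simp
  qed
  have d\<Phi>: "(\<Phi> has_vector_derivative N \<rho>) (at \<rho> within {0..r})" if \<rho>: "\<rho> \<in> {0..r}" for \<rho>
  proof -
    have "((\<lambda>\<rho>. integral (cbox 0 (2*pi)) (\<lambda>\<theta>. cscale (cis (- \<theta>)) o\<^sub>L F (c \<rho> \<theta>))) has_vector_derivative
       integral (cbox 0 (2*pi)) (\<lambda>\<theta>. F' (c \<rho> \<theta>))) (at \<rho> within {0..r})"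
    proof (rule leibniz_rule_vector_derivative[OF _ _ _ \<rho>])
      fix \<rho> \<theta> :: real assume \<rho>: "\<rho> \<in> {0..r}"
      have 2: "((\<lambda>\<rho>. c \<rho> \<theta>) has_derivative (\<lambda>h. of_real h * cis \<theta>)) (at \<rho> within {0..r})"
        unfolding c_def by (rule derivative_eq_intros refl | simp add: fun_eq_iff scaleR_conv_of_real)+
      note d2 = has_derivative_compose[OF 2 der[OF c_in[OF \<rho>]]]
      note d = bounded_linear.has_derivative[OF bounded_bilinear.bounded_linear_right[OF bounded_bilinear_blinfun_compose, of "cscale (cis (- \<theta>))"] d2]
      show "((\<lambda>\<rho>. cscale (cis (- \<theta>)) o\<^sub>L F (c \<rho> \<theta>)) has_vector_derivative F' (c \<rho> \<theta>)) (at \<rho> within {0..r})"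
        unfolding has_vector_derivative_def
      proof (rule has_derivative_eq_rhs[OF d], rule ext)
        fix h
        have "cscale (cis (- \<theta>)) o\<^sub>L (cscale (of_real h * cis \<theta>) o\<^sub>L F' (c \<rho> \<theta>)) = cscale (cis (- \<theta>) * (of_real h * cis \<theta>)) o\<^sub>L F' (c \<rho> \<theta>)"
          by (simp add: blinfun_compose_assoc[symmetric] cscale_compose)
        also have "cis (- \<theta>) * (of_real h * cis \<theta>) = of_real h"
          by (subst mult.left_commute) (simp add: cis_mult)
        also have "cscale (of_real h) o\<^sub>L F' (c \<rho> \<theta>) = h *\<^sub>R F' (c \<rho> \<theta>)"
          unfolding cscale_of_real by (rule blinfun_eqI) (simp add: blinfun.bilinear_simps scaleR_blinfun.rep_eq)
        finally show "cscale (cis (- \<theta>)) o\<^sub>L (cscale (of_real h * cis \<theta>) o\<^sub>L F' (c \<rho> \<theta>)) = h *\<^sub>R F' (c \<rho> \<theta>)" .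
      qed
    next
      show "continuous_on ({0..r} \<times> cbox 0 (2*pi)) (\<lambda>(\<rho>, \<theta>). F' (c \<rho> \<theta>))"
        unfolding case_prod_unfold
        by (intro continuous_on_compose2[OF cont] contc[unfolded case_prod_unfold]) (auto intro: c_in)
    qed (use int\<Phi> in auto)
    then show ?thesis by (simp add: \<Phi>_def[abs_def] N_def)
  qed
  have const: "(1 / \<epsilon>) *\<^sub>R \<Phi> \<epsilon> = (1 / r) *\<^sub>R \<Phi> r" if \<epsilon>: "\<epsilon> \<in> {0<..r}" for \<epsilon>
  proof -
    have "(((\<lambda>\<rho>. (1 / \<rho>) *\<^sub>R \<Phi> \<rho>)) has_derivative (\<lambda>_. 0)) (at \<rho> within {\<epsilon>..r})" if \<rho>: "\<rho> \<in> {\<epsilon>..r}" for \<rho>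
    proof -
      have p: "\<rho> > 0" "\<rho> \<in> {0..r}" using \<rho> \<epsilon> by auto
      have 1: "((\<lambda>\<rho>. 1 / \<rho>) has_field_derivative - 1 / \<rho>\<^sup>2) (at \<rho> within {\<epsilon>..r})"
        using p by (auto intro!: derivative_eq_intros simp: power2_eq_square)
      have 2: "(\<Phi> has_vector_derivative N \<rho>) (at \<rho> within {\<epsilon>..r})"
        using d\<Phi>[OF p(2)] by (rule has_vector_derivative_within_subset) (use \<epsilon> in auto)
      have "((\<lambda>\<rho>. (1 / \<rho>) *\<^sub>R \<Phi> \<rho>) has_vector_derivative (1/\<rho>) *\<^sub>R N \<rho> + (- 1 / \<rho>\<^sup>2) *\<^sub>R \<Phi> \<rho>) (at \<rho> within {\<epsilon>..r})"
        by (rule has_vector_derivative_scaleR[OF 1 2])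
      moreover have "(1/\<rho>) *\<^sub>R N \<rho> + (- 1 / \<rho>\<^sup>2) *\<^sub>R \<Phi> \<rho> = 0"
        using p by (simp add: \<Phi>N power2_eq_square)
      ultimately show ?thesis by (simp add: has_vector_derivative_def)
    qed
    then obtain k where k: "\<And>\<rho>. \<rho> \<in> {\<epsilon>..r} \<Longrightarrow> (1 / \<rho>) *\<^sub>R \<Phi> \<rho> = k"
      using has_derivative_zero_constant[of "{\<epsilon>..r}" "\<lambda>\<rho>. (1 / \<rho>) *\<^sub>R \<Phi> \<rho>"] by auto
    show ?thesis using k[of \<epsilon>] k[of r] \<epsilon> by auto
  qed
  have "N 0 = (1 / r) *\<^sub>R \<Phi> r"
  proof -
    have "((\<lambda>\<rho>. (\<Phi> \<rho> - \<Phi> 0) /\<^sub>R (\<rho> - 0)) \<longlongrightarrow> N 0) (at 0 within {0..r})"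
      by (rule vector_derivative_quotient[OF d\<Phi>]) (use r in simp)
    moreover have "\<Phi> 0 = 0" using \<Phi>N[of 0] r by simp
    ultimately have 1: "((\<lambda>\<rho>. (1 / \<rho>) *\<^sub>R \<Phi> \<rho>) \<longlongrightarrow> N 0) (at 0 within {0..r})"
      by (simp add: divide_inverse)
    have "((\<lambda>\<rho>. (1 / \<rho>) *\<^sub>R \<Phi> \<rho>) \<longlongrightarrow> (1 / r) *\<^sub>R \<Phi> r) (at 0 within {0..r})"
      by (rule tendsto_eventually, unfold eventually_at, intro exI[of _ 1] conjI ballI impI const) auto
    moreover have "at 0 within {0..r} \<noteq> bot" using r by (simp add: at_within_Icc_at_right)
    ultimately show ?thesis using 1 tendsto_unique by blast
  qed
  moreover have "N 0 = (2*pi) *\<^sub>R F' a" by (simp add: N_def c_def)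
  ultimately have eq: "(2*pi) *\<^sub>R F' a = (1 / r) *\<^sub>R \<Phi> r" by simp
  have C: "C \<ge> 0"
    using bound[of a] r by (intro order_trans[OF norm_ge_zero[of "F a"]]) simp
  have "norm (\<Phi> r) \<le> (4 * C) * (2*pi - 0)"
    unfolding \<Phi>_def
  proof (rule integral_bound)
    show "continuous_on {0..2*pi} (\<lambda>\<theta>. cscale (cis (- \<theta>)) o\<^sub>L F (c r \<theta>))"
      using r by (intro continuous_intros contFc) auto
    fix \<theta>
    have "norm (cscale (cis (- \<theta>)) o\<^sub>L F (c r \<theta>)) \<le> norm (cscale (cis (- \<theta>)) :: ('a \<times> 'a) \<Rightarrow>\<^sub>L _) * norm (F (c r \<theta>))"
      by (rule norm_blinfun_compose)
    also have "\<dots> \<le> 4 * C"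
      using norm_cscale_le[of "cis (- \<theta>)"] bound[OF c_in, of r \<theta>] r by (intro mult_mono) auto
    finally show "norm (cscale (cis (- \<theta>)) o\<^sub>L F (c r \<theta>)) \<le> 4 * C" .
  qed auto
  moreover have "2 * pi * norm (F' a) = norm (\<Phi> r) / r"
  proof -
    have "2 * pi * norm (F' a) = norm ((2*pi) *\<^sub>R F' a)" by simp
    also have "\<dots> = norm ((1 / r) *\<^sub>R \<Phi> r)" by (simp only: eq)
    also have "\<dots> = \<bar>1 / r\<bar> * norm (\<Phi> r)" by (rule norm_scaleR)
    also have "\<bar>1 / r\<bar> = 1 / r" by (rule abs_of_pos) (use r in simp)
    also have "1 / r * norm (\<Phi> r) = norm (\<Phi> r) / r" by (simp only: times_divide_eq_left mult_1_left)
    finally show ?thesis .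
  qed
  ultimately have "2 * pi * norm (F' a) \<le> (4 * C) * (2*pi) / r"
    using r by (simp only: divide_right_mono diff_0_right less_imp_le)
  then have "2 * pi * norm (F' a) \<le> 2 * pi * (4 * C / r)" by (simp add: field_simps)
  then show ?thesis by (rule mult_left_le_imp_le) simp
qed

section \<open>Smoothing properties of analytic semigroups\<close>

lemma vector_derivative_bound:
  fixes f :: "real \<Rightarrow> 'b::real_normed_vector"
  assumes der: "\<And>x. x \<in> {a..b} \<Longrightarrow> (f has_vector_derivative f' x) (at x within {a..b})"
    and bnd: "\<And>x. x \<in> {a..b} \<Longrightarrow> norm (f' x) \<le> B"
    and xy: "x \<in> {a..b}" "y \<in> {a..b}"
  shows "norm (f x - f y) \<le> B * \<bar>x - y\<bar>"
proof -
  have "norm (f x - f y) \<le> B * norm (x - y)"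
  proof (rule differentiable_bound[OF _ _ _ xy, where f' = "\<lambda>x h. h *\<^sub>R f' x"])
    fix z assume z: "z \<in> {a..b}"
    show "(f has_derivative (\<lambda>h. h *\<^sub>R f' z)) (at z within {a..b})"
      using der[OF z] by (simp add: has_vector_derivative_def)
    show "onorm (\<lambda>h. h *\<^sub>R f' z) \<le> B"
      using bnd[OF z] by (intro onorm_bound) (auto intro: order_trans[OF norm_ge_zero] simp: mult.commute[of B] mult_left_mono)
  qed simp
  then show ?thesis by simp
qed

text \<open>Otherwise there is a sequence tending to the vertex with unbounded norms; strong convergence along
this sequence contradicts the uniform boundedness principle.\<close>

lemma bounded_near_vertex:
  fixes E :: "complex \<Rightarrow> 'b::banach \<Rightarrow>\<^sub>L 'b"
  assumes "\<And>v. ((\<lambda>z. E z v) \<longlongrightarrow> v) (at 0 within sector \<delta>)"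
  shows "\<exists>r>0. \<exists>C. \<forall>z\<in>sector \<delta>. cmod z < r \<longrightarrow> norm (E z) \<le> C"
proof (rule ccontr)
  assume neg: "\<not> ?thesis"
  have "\<exists>z\<in>sector \<delta>. cmod z < 1 / real (Suc n) \<and> norm (E z) > real n" for n
  proof (rule ccontr)
    assume "\<not> (\<exists>z\<in>sector \<delta>. cmod z < 1 / real (Suc n) \<and> norm (E z) > real n)"
    then have "\<forall>z\<in>sector \<delta>. cmod z < 1 / real (Suc n) \<longrightarrow> norm (E z) \<le> real n" by force
    moreover have "1 / real (Suc n) > 0" by simp
    ultimately show False using neg by blast
  qed
  then have "\<forall>n. \<exists>z. z \<in> sector \<delta> \<and> cmod z < 1 / real (Suc n) \<and> norm (E z) > real n" by blast
  from choice[OF this] obtain Z where Z: "\<And>n. Z n \<in> sector \<delta>" "\<And>n. cmod (Z n) < 1 / real (Suc n)" "\<And>n. norm (E (Z n)) > real n"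
    by blast
  have Z0: "Z \<longlonglongrightarrow> 0"
  proof (rule tendsto_norm_zero_cancel)
    show "(\<lambda>n. norm (Z n)) \<longlonglongrightarrow> 0"
      by (rule tendsto_sandwich[OF _ _ tendsto_const LIMSEQ_inverse_real_of_nat])
         (use less_imp_le[OF Z(2)] in \<open>auto simp: divide_inverse\<close>)
  qed
  have "(\<lambda>n. E (Z n) v) \<longlonglongrightarrow> v" for v
    using assms[of v] Z Z0 unfolding tendsto_at_iff_sequentially comp_def
    by (auto simp: sector_def)
  then have "\<exists>B. \<forall>n. norm (E (Z n) v) \<le> B" for v
    by (meson Bseq_def convergentI convergent_imp_Bseq)
  then obtain B where B: "\<And>n. norm (E (Z n)) \<le> B"
    using uniform_boundedness[of "\<lambda>n. E (Z n)"] by blast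
  obtain n where "real n > B" using reals_Archimedean2 by blast
  then show False using B[of n] Z(3)[of n] by linarith
qed

locale analytic_generator =
  fixes S :: "real \<Rightarrow> 'a::banach \<Rightarrow>\<^sub>L 'a" and D :: "'a set" and A :: "'a \<Rightarrow> 'a"
  assumes analytic: "analytic_semigroup S"
    and generator: "infinitesimal_generator S D A"
begin

lemma S_0 [simp]: "S 0 = id_blinfun"
  and S_add: "0 \<le> t \<Longrightarrow> 0 \<le> r \<Longrightarrow> S (t + r) = S t o\<^sub>L S r"
  and S_right: "((\<lambda>t. S t x) \<longlongrightarrow> x) (at_right 0)"
  using analytic unfolding analytic_semigroup_def C0_semigroup_def by auto

lemma S_add_apply: "0 \<le> t \<Longrightarrow> 0 \<le> r \<Longrightarrow> S (t + r) x = S t (S r x)"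
  by (simp add: S_add)

text \<open>The disc of radius \<open>\<eta> t\<close> around \<open>t\<close> lies in the sector, where the extension \<open>E\<close> is bounded near \<open>0\<close>; the
Cauchy estimate on this disc gives \<open>\<parallel>S' t\<parallel> \<le> K / t\<close>.\<close>

lemma smoothing_near_0:
  "\<exists>K r0 S'. K > 0 \<and> r0 > 0 \<and> (\<forall>t\<in>{0<..<r0}. (S has_vector_derivative S' t) (at t) \<and> norm (S t) \<le> K \<and> norm (S' t) \<le> K / t)"
proof -
  from analytic[unfolded analytic_semigroup_def] obtain \<delta> E where \<delta>: "0 < \<delta>"
    and E: "\<forall>t>0. E (complex_of_real t) = complexify (S t)"
      "\<forall>z\<in>sector \<delta>. \<forall>w\<in>sector \<delta>. E (z + w) = E z o\<^sub>L E w"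
      "\<forall>z\<in>sector \<delta>. \<exists>E'. (E has_derivative (\<lambda>h. cscale h o\<^sub>L E')) (at z)"
      "\<forall>v. ((\<lambda>z. blinfun_apply (E z) v) \<longlongrightarrow> v) (at 0 within sector \<delta>)" by (elim conjE exE)
  have E_real: "\<And>t. t > 0 \<Longrightarrow> E (complex_of_real t) = complexify (S t)" using E(1) by blast
  have E_add: "\<And>z w. z \<in> sector \<delta> \<Longrightarrow> w \<in> sector \<delta> \<Longrightarrow> E (z + w) = E z o\<^sub>L E w" using E(2) by blast
  have E_der: "\<And>z. z \<in> sector \<delta> \<Longrightarrow> \<exists>E'. (E has_derivative (\<lambda>h. cscale h o\<^sub>L E')) (at z)" using E(3) by blast
  have E_lim: "\<And>v. ((\<lambda>z. blinfun_apply (E z) v) \<longlongrightarrow> v) (at 0 within sector \<delta>)" using E(4) by (rule spec)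
  obtain r C where r: "r > 0" and C: "\<And>z. z \<in> sector \<delta> \<Longrightarrow> cmod z < r \<Longrightarrow> norm (E z) \<le> C"
    using bounded_near_vertex[OF E_lim] by blast
  obtain \<eta> where \<eta>: "0 < \<eta>" "\<eta> < 1/2" and ball: "\<And>t. t > 0 \<Longrightarrow> cball (complex_of_real t) (2 * \<eta> * t) \<subseteq> sector \<delta>"
    by (rule ball_subset_sector[OF \<delta>]) blast
  have rS: "of_real t \<in> sector \<delta>" if "t > 0" for t :: real using that \<delta> by (simp add: sector_def)
  \<comment> \<open>\<open>Q\<close> recovers an operator on \<open>X\<close> from its complexification\<close>
  define inl where "inl = Blinfun (\<lambda>x::'a. (x, 0::'a))"
  have inl: "blinfun_apply inl x = (x, 0)" for x
    unfolding inl_def by (subst bounded_linear_Blinfun_apply)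
      (auto intro!: bounded_linear_Pair bounded_linear_ident bounded_linear_zero)
  define Q where "Q G = fst_blinfun o\<^sub>L G o\<^sub>L inl" for G :: "('a \<times> 'a) \<Rightarrow>\<^sub>L ('a \<times> 'a)"
  have Qa: "blinfun_apply (Q G) x = fst (G (x, 0))" for G x by (simp add: Q_def inl)
  have Qn: "norm (Q G) \<le> norm G" for G
  proof (rule norm_blinfun_bound)
    fix x
    have "norm (fst (G (x, 0))) \<le> norm (G (x, 0))"
      by (metis norm_fst_le prod.collapse)
    also have "\<dots> \<le> norm G * norm (x, 0::'a)" by (rule norm_blinfun)
    finally show "norm (Q G x) \<le> norm G * norm x" by (simp add: Qa)
  qed simp
  have Ql: "bounded_linear Q"
    unfolding Q_def by (intro bounded_linear_intros)
  have QE: "Q (E (of_real t)) = S t" if "t > 0" for t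
    by (rule blinfun_eqI) (simp add: Qa E_real[OF that] complexify.rep_eq)
  define K where "K = max 1 (4 * \<bar>C\<bar> / \<eta>)"
  have main: "\<exists>S'. (S has_vector_derivative S') (at t) \<and> norm (S t) \<le> K \<and> norm S' \<le> K / t"
    if t: "t \<in> {0<..<r/2}" for t
  proof -
    have t0: "t > 0" and tr: "2 * t < r" using t by auto
    \<comment> \<open>a point well inside the sector: \<open>E\<close> near \<open>z\<close> is \<open>E\<close> near \<open>w\<close> composed with \<open>E (z - w)\<close>, so the derivative of \<open>E\<close> is continuous\<close>
    define w where "w = complex_of_real (\<eta> * t)"
    have e1: "\<eta> * (\<eta> * t) \<le> 2 * \<eta> * (\<eta> * t)" "\<eta> * t \<le> 2 * \<eta> * t"
      using mult_pos_pos[OF \<eta>(1) mult_pos_pos[OF \<eta>(1) t0]] mult_pos_pos[OF \<eta>(1) t0]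
      unfolding mult.assoc by linarith+
    have wS: "w \<in> sector \<delta>" unfolding w_def by (rule rS) (use \<eta> t0 in auto)
    have cw: "cmod w = \<eta> * t" unfolding w_def using \<eta> t0 by (simp add: norm_mult)
    obtain Ew where Ew: "(E has_derivative (\<lambda>h. cscale h o\<^sub>L Ew)) (at w)" using E_der[OF wS] by blast
    define F' where "F' z = Ew o\<^sub>L E (z - w)" for z
    have zw: "z - w \<in> sector \<delta>" if "z \<in> cball (of_real t) (\<eta> * t)" for z
    proof -
      have "cmod (of_real t - (z - w)) \<le> cmod (of_real t - z) + cmod w"
        using norm_triangle_ineq[of "of_real t - z" w] by (simp add: algebra_simps)
      then have "z - w \<in> cball (of_real t) (2 * \<eta> * t)"
        using that cw by (simp add: dist_norm)
      then show ?thesis using ball[OF t0] by blast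
    qed
    have der: "(E has_derivative (\<lambda>h. cscale h o\<^sub>L F' z)) (at z)" if z: "z \<in> cball (of_real t) (\<eta> * t)" for z
    proof -
      have "((\<lambda>\<zeta>. \<zeta> - (z - w)) has_derivative (\<lambda>h. h)) (at z)" by (auto intro!: derivative_eq_intros)
      moreover have "(E has_derivative (\<lambda>h. cscale h o\<^sub>L Ew)) (at (z - (z - w)))" using Ew by simp
      ultimately have "((\<lambda>\<zeta>. E (\<zeta> - (z - w))) has_derivative (\<lambda>h. cscale h o\<^sub>L Ew)) (at z)"
        by (rule has_derivative_compose)
      then have "((\<lambda>\<zeta>. E (\<zeta> - (z - w)) o\<^sub>L E (z - w)) has_derivative (\<lambda>h. (cscale h o\<^sub>L Ew) o\<^sub>L E (z - w))) (at z)"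
        by (rule bounded_linear.has_derivative[OF bounded_bilinear.bounded_linear_left[OF bounded_bilinear_blinfun_compose]])
      then show ?thesis unfolding F'_def blinfun_compose_assoc
      proof (rule has_derivative_transform_within_open[where s = "ball z (\<eta> * (\<eta> * t))"])
        show "z \<in> ball z (\<eta> * (\<eta> * t))" using \<eta> t0 by simp
        fix \<zeta> assume "\<zeta> \<in> ball z (\<eta> * (\<eta> * t))"
        then have "\<zeta> - (z - w) \<in> ball w (\<eta> * (\<eta> * t))"
          by (simp add: dist_norm algebra_simps norm_minus_commute)
        moreover have "ball w (\<eta> * (\<eta> * t)) \<subseteq> cball w (2 * \<eta> * (\<eta> * t))"
          by (rule subset_trans[OF ball_subset_cball subset_cball[OF e1(1)]])
        moreover have "cball w (2 * \<eta> * (\<eta> * t)) \<subseteq> sector \<delta>" unfolding w_def by (rule ball) (use \<eta> t0 in auto)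
        ultimately have "\<zeta> - (z - w) \<in> sector \<delta>" by blast
        from E_add[OF this zw[OF z]] show "E (\<zeta> - (z - w)) o\<^sub>L E (z - w) = E \<zeta>" by simp
      qed simp
    qed
    have contF': "continuous_on (cball (of_real t) (\<eta> * t)) F'"
    proof -
      have "continuous_on (sector \<delta>) E"
        by (meson E_der has_derivative_continuous has_derivative_at_withinI continuous_on_eq_continuous_within)
      then have "continuous_on (cball (of_real t) (\<eta> * t)) (\<lambda>z. E (z - w))"
        by (rule continuous_on_compose2) (use zw in \<open>auto intro!: continuous_intros\<close>)
      then show ?thesis unfolding F'_def by (intro continuous_intros)
    qed
    have bnd: "norm (E z) \<le> \<bar>C\<bar>" if z: "z \<in> cball (of_real t) (\<eta> * t)" for z
    proof -
      have "cball (complex_of_real t) (\<eta> * t) \<subseteq> cball (of_real t) (2 * \<eta> * t)" by (rule subset_cball[OF e1(2)])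
      then have "z \<in> sector \<delta>" using z ball[OF t0] by blast
      moreover have "cmod z < r"
      proof -
        have "cmod z \<le> cmod (of_real t) + cmod (z - of_real t)" by (metis norm_triangle_sub)
        also have "\<dots> \<le> t + \<eta> * t" using z t0 by (simp add: dist_norm norm_minus_commute)
        also have "\<dots> \<le> t + 1 * t" using \<eta> t0 by (intro add_mono mult_right_mono) auto
        finally show ?thesis using tr by simp
      qed
      ultimately show ?thesis using C by fastforce
    qed
    have est: "norm (F' (of_real t)) \<le> 4 * \<bar>C\<bar> / (\<eta> * t)"
      by (rule cauchy_estimate[OF _ der contF' bnd]) (use \<eta> t0 in auto)
    have "(complex_of_real has_derivative complex_of_real) (at t)" by (auto intro!: derivative_eq_intros)
    moreover have "(E has_derivative (\<lambda>h. cscale h o\<^sub>L F' (of_real t))) (at (of_real t))"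
      by (rule der) (use \<eta> t0 in simp)
    ultimately have "((\<lambda>s. E (complex_of_real s)) has_derivative (\<lambda>h. cscale (of_real h) o\<^sub>L F' (of_real t))) (at t)"
      by (rule has_derivative_compose)
    then have "((\<lambda>s. E (complex_of_real s)) has_derivative (\<lambda>h. h *\<^sub>R F' (of_real t))) (at t)"
      by (rule has_derivative_eq_rhs) (auto simp: cscale_of_real fun_eq_iff intro!: blinfun_eqI simp: blinfun.bilinear_simps)
    then have "((\<lambda>s. Q (E (complex_of_real s))) has_vector_derivative Q (F' (of_real t))) (at t)"
      using bounded_linear.has_vector_derivative[OF Ql] unfolding has_vector_derivative_def by blast
    then have "(S has_vector_derivative Q (F' (of_real t))) (at t)"
      by (rule has_vector_derivative_transform_within_open[of _ _ _ "{0<..}"]) (use t0 QE in auto)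
    moreover have "norm (Q (F' (of_real t))) \<le> K / t"
    proof -
      have "norm (Q (F' (of_real t))) \<le> 4 * \<bar>C\<bar> / (\<eta> * t)" using Qn est order_trans by blast
      also have "\<dots> = (4 * \<bar>C\<bar> / \<eta>) / t" by simp
      also have "\<dots> \<le> K / t" using t0 by (intro divide_right_mono) (auto simp: K_def)
      finally show ?thesis .
    qed
    moreover have "norm (S t) \<le> K"
    proof -
      have "norm (S t) \<le> norm (E (of_real t))" using Qn[of "E (of_real t)"] QE[OF t0] by simp
      also have "\<dots> \<le> \<bar>C\<bar>" using bnd[of "of_real t"] \<eta> t0 by simp
      also have "\<dots> \<le> 4 * \<bar>C\<bar> / \<eta>"
      proof -
        have "\<bar>C\<bar> * \<eta> \<le> \<bar>C\<bar> * 1" using \<eta> by (intro mult_left_mono) auto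
        then show ?thesis unfolding pos_le_divide_eq[OF \<eta>(1)] by linarith
      qed
      finally show ?thesis by (simp add: K_def)
    qed
    ultimately show ?thesis by blast
  qed
  have "K > 0" by (simp add: K_def)
  moreover have "r / 2 > 0" using r by simp
  moreover from main have "\<forall>t\<in>{0<..<r/2}. \<exists>S'. (S has_vector_derivative S') (at t) \<and> norm (S t) \<le> K \<and> norm S' \<le> K / t"
    by blast
  from bchoice[OF this] obtain S' where
    "\<forall>t\<in>{0<..<r/2}. (S has_vector_derivative S' t) (at t) \<and> norm (S t) \<le> K \<and> norm (S' t) \<le> K / t" by blast
  ultimately show ?thesis by blast
qed

text \<open>A bound near \<open>0\<close> extends to \<open>[0, b]\<close> by the semigroup property, at the cost of a power.\<close>

lemma S_bounded: "\<exists>K>0. \<forall>t\<in>{0..b}. norm (S t) \<le> K"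
proof -
  obtain K r0 where K: "K > 0" "r0 > 0" "\<And>t. t \<in> {0<..<r0} \<Longrightarrow> norm (S t) \<le> K"
    using smoothing_near_0 by blast
  define K1 where "K1 = max 1 K"
  have K1: "norm (S t) \<le> K1" if "t \<in> {0..r0/2}" for t
  proof (cases "t = 0")
    case True
    then have "norm (S t) \<le> 1" by (simp add: norm_blinfun_id_le)
    then show ?thesis by (simp add: K1_def le_max_iff_disj)
  next
    case False
    then show ?thesis using that K(2) K(3)[of t] by (simp add: K1_def le_max_iff_disj)
  qed
  have pow: "norm (S t) \<le> K1 ^ Suc n" if "t \<in> {0..real (Suc n) * (r0/2)}" for n t
    using that
  proof (induction n arbitrary: t)
    case 0
    then show ?case using K1 by simp
  next
    case (Suc n)
    have pw: "K1 ^ Suc n \<le> K1 ^ Suc (Suc n)" by (rule power_increasing) (auto simp: K1_def)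
    show ?case
    proof (cases "t \<le> real (Suc n) * (r0/2)")
      case True
      then show ?thesis using Suc pw by force
    next
      case False
      have e1: "real (Suc (Suc n)) * (r0/2) = real (Suc n) * (r0/2) + r0/2"
        by (simp only: of_nat_Suc[of "Suc n"] distrib_right mult_1_left)
      have e2: "1 * (r0/2) \<le> real (Suc n) * (r0/2)" using K(2) by (intro mult_right_mono) auto
      have t1: "t - r0/2 \<in> {0..real (Suc n) * (r0/2)}"
        using Suc.prems[unfolded atLeastAtMost_iff] False e1 e2 unfolding atLeastAtMost_iff mult_1_left by linarith
      have "S t = S (r0/2) o\<^sub>L S (t - r0/2)" using S_add[of "r0/2" "t - r0/2"] t1 K(2) by simp
      then have "norm (S t) \<le> norm (S (r0/2)) * norm (S (t - r0/2))" by (simp add: norm_blinfun_compose)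
      also have "\<dots> \<le> K1 * K1 ^ Suc n" using K1[of "r0/2"] Suc.IH[OF t1] K(2)
        by (intro mult_mono) (auto simp: K1_def)
      finally show ?thesis by simp
    qed
  qed
  obtain n where "real n > b / (r0/2)" using reals_Archimedean2 by blast
  then have "b < real n * (r0/2)" using iffD1[OF pos_divide_less_eq[OF half_gt_zero[OF K(2)]]] by blast
  also have "real n * (r0/2) \<le> real (Suc n) * (r0/2)" using K(2) by (intro mult_right_mono) auto
  finally have bn: "b \<le> real (Suc n) * (r0/2)" by (rule less_imp_le)
  have "\<forall>t\<in>{0..b}. norm (S t) \<le> K1 ^ Suc n"
  proof
    fix t assume "t \<in> {0..b}"
    then have "t \<in> {0..real (Suc n) * (r0/2)}" using bn unfolding atLeastAtMost_iff by linarith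
    then show "norm (S t) \<le> K1 ^ Suc n" by (rule pow)
  qed
  then show ?thesis by (intro exI[of _ "K1 ^ Suc n"]) (auto simp: K1_def)
qed

text \<open>Differentiability and derivative bounds spread from short times to all later times through this
factorisation, which also gives regularity of the derivative itself.\<close>

lemma S_derivative_shift:
  assumes S': "(S has_vector_derivative S') (at a)" and a: "a > 0" and r: "r > 0"
  shows "(S has_vector_derivative (S' o\<^sub>L S r)) (at (a + r))"
proof -
  have "((\<lambda>s. s - r) has_vector_derivative 1) (at (a + r))"
    by (auto intro!: derivative_eq_intros)
  then have "(S \<circ> (\<lambda>s. s - r) has_vector_derivative 1 *\<^sub>R S') (at (a + r))"
    by (rule vector_diff_chain_at) (use S' in simp)
  then have "((\<lambda>s. S (s - r) o\<^sub>L S r) has_vector_derivative (S' o\<^sub>L S r)) (at (a + r))"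
    by (intro bounded_linear.has_vector_derivative[OF bounded_bilinear.bounded_linear_left[OF bounded_bilinear_blinfun_compose]])
       (simp add: comp_def)
  then show ?thesis
  proof (rule has_vector_derivative_transform_within_open[of _ _ _ "{r<..}"])
    fix s assume "s \<in> {r<..}"
    then show "S (s - r) o\<^sub>L S r = S s" using S_add[of "s - r" r] r by simp
  qed (use a in auto)
qed

lemma smoothing:
  "\<exists>K>0. \<exists>S'. \<forall>t\<in>{0<..b}. (S has_vector_derivative S' t) (at t) \<and> norm (S' t) \<le> K / t"
proof -
  obtain K r0 S' where K: "K > 0" "r0 > 0" "\<And>t. t \<in> {0<..<r0} \<Longrightarrow> (S has_vector_derivative S' t) (at t)"
     "\<And>t. t \<in> {0<..<r0} \<Longrightarrow> norm (S' t) \<le> K / t"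
    using smoothing_near_0 by blast
  obtain K1 where K1: "K1 > 0" "\<And>t. t \<in> {0..b} \<Longrightarrow> norm (S t) \<le> K1" using S_bounded by blast
  define a where "a = r0 / 2"
  have a: "a > 0" "a \<in> {0<..<r0}" using K(2) by (auto simp: a_def)
  \<comment> \<open>for \<open>t \<ge> r0\<close> the derivative is bounded by \<open>K / a * K1\<close>, and \<open>1 \<le> \<bar>b\<bar> / t\<close>\<close>
  define K2 where "K2 = max K (K / a * K1 * \<bar>b\<bar>)"
  have "\<exists>S'. (S has_vector_derivative S') (at t) \<and> norm S' \<le> K2 / t" if t: "t \<in> {0<..b}" for t
  proof (cases "t < r0")
    case True
    then have tt: "t \<in> {0<..<r0}" using t by auto
    have "K / t \<le> K2 / t" using t by (intro divide_right_mono) (auto simp: K2_def)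
    then show ?thesis using K(3,4)[OF tt] by (intro exI[of _ "S' t"]) auto
  next
    case False
    have ta: "t - a > 0" using False K(2) by (simp add: a_def)
    have d: "(S has_vector_derivative (S' a o\<^sub>L S (t - a))) (at t)"
      using S_derivative_shift[OF K(3)[OF a(2)] a(1) ta] by simp
    have "norm (S' a o\<^sub>L S (t - a)) \<le> norm (S' a) * norm (S (t - a))" by (rule norm_blinfun_compose)
    also have "\<dots> \<le> K / a * K1" using K(4)[OF a(2)] K1(2)[of "t - a"] t ta a(1) K(1) by (intro mult_mono) auto
    also have "\<dots> \<le> K2 / t"
    proof -
      have "K / a * K1 * t \<le> K / a * K1 * \<bar>b\<bar>" using t a(1) K(1) K1(1) by (intro mult_left_mono) auto
      then have "K / a * K1 * t \<le> K2" by (simp add: K2_def)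
      then show ?thesis using t by (simp add: pos_le_divide_eq)
    qed
    finally show ?thesis using d by blast
  qed
  then have "\<forall>t\<in>{0<..b}. \<exists>S'. (S has_vector_derivative S') (at t) \<and> norm S' \<le> K2 / t" by blast
  from bchoice[OF this] have "\<exists>S'. \<forall>t\<in>{0<..b}. (S has_vector_derivative S' t) (at t) \<and> norm (S' t) \<le> K2 / t" .
  moreover have "K2 > 0" using K(1) by (simp add: K2_def less_max_iff_disj)
  ultimately show ?thesis by blast
qed

lemma S_differentiable: "t > 0 \<Longrightarrow> \<exists>S'. (S has_vector_derivative S') (at t)"
  using smoothing[of t] by auto

text \<open>The error of linear interpolation on \<open>[t, t + h]\<close> is controlled by the Lipschitz constant of \<open>S'\<close>. From
\<open>S'(x) = S'(t/2) S(x - t/2)\<close> and the bound \<open>K / s\<close> for \<open>S'\<close> this constant is \<open>O(t^-2)\<close> on \<open>[t, b]\<close>.\<close>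

lemma second_difference:
  "\<exists>K>0. \<forall>t h \<tau>. 0 < t \<longrightarrow> 0 \<le> h \<longrightarrow> t + h \<le> b \<longrightarrow> \<tau> \<in> {0..1} \<longrightarrow>
     norm (S (t + \<tau> * h) - S t - \<tau> *\<^sub>R (S (t + h) - S t)) \<le> K * h\<^sup>2 / t\<^sup>2"
proof -
  obtain K S' where K: "K > 0" "\<And>t. t \<in> {0<..b} \<Longrightarrow> (S has_vector_derivative S' t) (at t)"
     "\<And>t. t \<in> {0<..b} \<Longrightarrow> norm (S' t) \<le> K / t" using smoothing by blast
  have lip: "norm (S' x - S' y) \<le> 4 * K\<^sup>2 / t\<^sup>2 * \<bar>x - y\<bar>" if t: "t > 0" and x: "x \<in> {t..b}" and y: "y \<in> {t..b}" for t x y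
  proof -
    have tb: "t / 2 \<in> {0<..b}" using t x by auto
    have fac: "S' x = S' (t/2) o\<^sub>L S (x - t/2)" if x: "x \<in> {t..b}" for x
    proof -
      have xt: "x - t/2 > 0" using x t by auto
      have "(S has_vector_derivative (S' (t/2) o\<^sub>L S (x - t/2))) (at x)"
        using S_derivative_shift[OF K(2)[OF tb] _ xt] t by simp
      moreover have "(S has_vector_derivative S' x) (at x)" using K(2) x t by auto
      ultimately show ?thesis using vector_derivative_unique_at by blast
    qed
    have "norm (S (x - t/2) - S (y - t/2)) \<le> (K / (t/2)) * \<bar>(x - t/2) - (y - t/2)\<bar>"
    proof (rule vector_derivative_bound[where a = "t/2" and b = b and f' = S'])
      fix s assume s: "s \<in> {t/2..b}"
      have sb: "s \<in> {0<..b}" using s t by auto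
      show "(S has_vector_derivative S' s) (at s within {t/2..b})"
        by (rule has_vector_derivative_at_within[OF K(2)[OF sb]])
      have "norm (S' s) \<le> K / s" by (rule K(3)[OF sb])
      also have "\<dots> \<le> K / (t/2)" using s t K(1) by (intro divide_left_mono) auto
      finally show "norm (S' s) \<le> K / (t/2)" .
    qed (use x y t in auto)
    then have l: "norm (S (x - t/2) - S (y - t/2)) \<le> (K / (t/2)) * \<bar>x - y\<bar>" by simp
    have "S' x - S' y = S' (t/2) o\<^sub>L (S (x - t/2) - S (y - t/2))"
      using fac[OF x] fac[OF y] by (simp add: bounded_bilinear.diff_right[OF bounded_bilinear_blinfun_compose])
    then have "norm (S' x - S' y) \<le> norm (S' (t/2)) * norm (S (x - t/2) - S (y - t/2))"
      by (simp add: norm_blinfun_compose)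
    also have "\<dots> \<le> (K / (t/2)) * ((K / (t/2)) * \<bar>x - y\<bar>)"
      using K(3)[OF tb] l K(1) t by (intro mult_mono) auto
    also have "\<dots> = 4 * K\<^sup>2 / t\<^sup>2 * \<bar>x - y\<bar>" by (simp add: power2_eq_square)
    finally show ?thesis .
  qed
  have "norm (S (t + \<tau> * h) - S t - \<tau> *\<^sub>R (S (t + h) - S t)) \<le> (8 * K\<^sup>2) * h\<^sup>2 / t\<^sup>2"
    if t: "0 < t" and h: "0 \<le> h" and th: "t + h \<le> b" and \<tau>: "\<tau> \<in> {0..1}" for t h \<tau>
  proof -
    let ?L = "4 * K\<^sup>2 / t\<^sup>2"
    have lin: "norm (S (t + a) - S t - a *\<^sub>R S' t) \<le> (?L * h) * a" if a: "a \<in> {0..h}" for a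
    proof -
      have "norm ((S (t + a) - (t + a) *\<^sub>R S' t) - (S t - t *\<^sub>R S' t)) \<le> (?L * h) * \<bar>(t + a) - t\<bar>"
      proof (rule vector_derivative_bound[where a = t and b = "t + h" and f' = "\<lambda>s. S' s - S' t" and f = "\<lambda>s. S s - s *\<^sub>R S' t"])
        fix s assume s: "s \<in> {t..t+h}"
        have sb: "s \<in> {0<..b}" using s t th by auto
        have "((\<lambda>s. s *\<^sub>R S' t) has_vector_derivative 1 *\<^sub>R S' t) (at s within {t..t+h})"
          by (rule bounded_linear.has_vector_derivative[OF bounded_linear_scaleR_left]) (auto intro!: derivative_eq_intros)
        then show "((\<lambda>s. S s - s *\<^sub>R S' t) has_vector_derivative S' s - S' t) (at s within {t..t+h})"
          using has_vector_derivative_diff[OF has_vector_derivative_at_within[OF K(2)[OF sb]]] by simp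
        have "norm (S' s - S' t) \<le> ?L * \<bar>s - t\<bar>" using lip[OF t, of s t] s th h by auto
        also have "\<dots> \<le> ?L * h" using s by (intro mult_left_mono) auto
        finally show "norm (S' s - S' t) \<le> ?L * h" .
      qed (use a in auto)
      moreover have "(S (t + a) - (t + a) *\<^sub>R S' t) - (S t - t *\<^sub>R S' t) = S (t + a) - S t - a *\<^sub>R S' t"
        by (simp add: algebra_simps)
      ultimately show ?thesis using a by simp
    qed
    have "S (t + \<tau> * h) - S t - \<tau> *\<^sub>R (S (t + h) - S t)
      = (S (t + \<tau> * h) - S t - (\<tau> * h) *\<^sub>R S' t) - \<tau> *\<^sub>R (S (t + h) - S t - h *\<^sub>R S' t)"
      by (simp add: algebra_simps)
    also have "norm \<dots> \<le> norm (S (t + \<tau> * h) - S t - (\<tau> * h) *\<^sub>R S' t) + \<tau> * norm (S (t + h) - S t - h *\<^sub>R S' t)"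
      using norm_triangle_ineq4 \<tau> by (metis abs_of_nonneg atLeastAtMost_iff norm_scaleR)
    also have "\<dots> \<le> (?L * h) * (\<tau> * h) + \<tau> * ((?L * h) * h)"
      using \<tau> h by (intro add_mono mult_left_mono lin) (auto intro: mult_left_le_one_le)
    also have "\<dots> = (8 * K\<^sup>2) * h\<^sup>2 / t\<^sup>2 * \<tau>" by (simp add: power2_eq_square)
    also have "\<dots> \<le> (8 * K\<^sup>2) * h\<^sup>2 / t\<^sup>2 * 1" using \<tau> by (intro mult_left_mono) auto
    finally show ?thesis by simp
  qed
  moreover have "8 * K\<^sup>2 > 0" using K(1) by simp
  ultimately show ?thesis by blast
qed

end


section \<open>Orbits, the generator and the phi operators\<close>

context analytic_generator
begin

lemma continuous_orbit_within: "t \<ge> 0 \<Longrightarrow> continuous (at t within {0..}) (\<lambda>t. S t x)"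
proof (cases "t = 0")
  case True
  then show ?thesis using S_right[of x] by (simp add: continuous_within at_within_Ici_at_right)
next
  case False
  assume "t \<ge> 0"
  then obtain S' where "(S has_vector_derivative S') (at t)" using False S_differentiable[of t] by auto
  then have "continuous (at t) S" by (rule has_vector_derivative_continuous)
  then have "continuous (at t) (\<lambda>t. S t x)"
    by (intro bounded_linear.continuous[OF blinfun.bounded_linear_left])
  then show ?thesis by (rule continuous_at_imp_continuous_at_within)
qed

text \<open>The semigroup need not be norm continuous at \<open>0\<close>. Joint continuity of \<open>(t, x) \<mapsto> S t x\<close> follows from strong
continuity and local boundedness.\<close>

lemma tendsto_orbit:
  assumes a: "(a \<longlongrightarrow> a0) F" and nn: "\<forall>\<^sub>F s in F. 0 \<le> a s" and a0: "0 \<le> a0" and v: "(v \<longlongrightarrow> v0) F"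
  shows "((\<lambda>s. S (a s) (v s)) \<longlongrightarrow> S a0 v0) F"
proof -
  obtain K where K: "K > 0" "\<forall>t\<in>{0..a0+1}. norm (S t) \<le> K" using S_bounded by blast
  have ev: "\<forall>\<^sub>F s in F. a s \<in> {0..a0+1}"
    using nn order_tendstoD(2)[OF a, of "a0 + 1"] by (auto elim: eventually_elim2)
  have "((\<lambda>s. K * norm (v s - v0)) \<longlongrightarrow> 0) F"
    using tendsto_mult_right_zero[OF tendsto_norm_zero[OF LIM_zero[OF v]]] .
  moreover have "\<forall>\<^sub>F s in F. norm (S (a s) (v s - v0)) \<le> K * norm (v s - v0)"
    using ev
  proof eventually_elim
    case (elim s)
    then show ?case using K norm_blinfun[of "S (a s)" "v s - v0"]
      by (meson mult_right_mono norm_ge_zero order_trans)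
  qed
  ultimately have "((\<lambda>s. S (a s) (v s - v0)) \<longlongrightarrow> 0) F" by (rule Lim_null_comparison[rotated])
  moreover have "((\<lambda>s. S (a s) v0) \<longlongrightarrow> S a0 v0) F"
    using continuous_within_tendsto_compose[OF continuous_orbit_within[OF a0, of v0] _ a] nn by simp
  ultimately have "((\<lambda>s. S (a s) (v s - v0) + S (a s) v0) \<longlongrightarrow> 0 + S a0 v0) F" by (rule tendsto_add)
  then show ?thesis by (simp add: blinfun.diff_right)
qed

lemma continuous_on_orbit:
  assumes "continuous_on U a" "\<And>s. s \<in> U \<Longrightarrow> 0 \<le> a s" "continuous_on U v"
  shows "continuous_on U (\<lambda>s. S (a s) (v s))"
  unfolding continuous_on_def
proof
  fix s assume s: "s \<in> U"
  show "((\<lambda>s. S (a s) (v s)) \<longlongrightarrow> S (a s) (v s)) (at s within U)"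
  proof (rule tendsto_orbit)
    show "\<forall>\<^sub>F s in at s within U. 0 \<le> a s" using assms(2) by (auto simp: eventually_at_filter)
  qed (use assms s in \<open>auto simp: continuous_on_def\<close>)
qed

lemma A_eqI:
  assumes "((\<lambda>t. (S t x - x) /\<^sub>R t) \<longlongrightarrow> y) (at_right 0)"
  shows "x \<in> D" "A x = y"
proof -
  show x: "x \<in> D" using generator assms unfolding infinitesimal_generator_def by blast
  then have "((\<lambda>t. (S t x - x) /\<^sub>R t) \<longlongrightarrow> A x) (at_right 0)"
    using generator unfolding infinitesimal_generator_def by blast
  then show "A x = y" using assms tendsto_unique trivial_limit_at_right_real by blast
qed

lemma A_limit: "x \<in> D \<Longrightarrow> ((\<lambda>t. (S t x - x) /\<^sub>R t) \<longlongrightarrow> A x) (at_right 0)"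
  using generator unfolding infinitesimal_generator_def by blast

lemma subspace_D: "subspace D"
proof (rule subspaceI)
  have "((\<lambda>t. (S t 0 - 0) /\<^sub>R t) \<longlongrightarrow> 0) (at_right 0)" by (simp add: blinfun.zero_right)
  then show "0 \<in> D" by (rule A_eqI)
  fix x y assume x: "x \<in> D" and y: "y \<in> D"
  have "((\<lambda>t. (S t x - x) /\<^sub>R t + (S t y - y) /\<^sub>R t) \<longlongrightarrow> A x + A y) (at_right 0)"
    by (intro tendsto_add A_limit x y)
  then have "((\<lambda>t. (S t (x + y) - (x + y)) /\<^sub>R t) \<longlongrightarrow> A x + A y) (at_right 0)"
    by (simp add: blinfun.add_right algebra_simps)
  then show "x + y \<in> D" by (rule A_eqI)
next
  fix c x assume x: "x \<in> D"
  have "((\<lambda>t. c *\<^sub>R ((S t x - x) /\<^sub>R t)) \<longlongrightarrow> c *\<^sub>R A x) (at_right 0)"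
    by (intro tendsto_scaleR tendsto_const A_limit x)
  then have "((\<lambda>t. (S t (c *\<^sub>R x) - c *\<^sub>R x) /\<^sub>R t) \<longlongrightarrow> c *\<^sub>R A x) (at_right 0)"
    by (simp add: blinfun.scaleR_right algebra_simps)
  then show "c *\<^sub>R x \<in> D" by (rule A_eqI)
qed

lemma S_quotient_limit:
  assumes x: "x \<in> D" and t: "t \<ge> 0"
  shows "((\<lambda>e. (S (t + e) x - S t x) /\<^sub>R e) \<longlongrightarrow> S t (A x)) (at_right 0)"
proof -
  have "((\<lambda>e. S t ((S e x - x) /\<^sub>R e)) \<longlongrightarrow> S t (A x)) (at_right 0)"
    by (intro tendsto_intros A_limit x)
  moreover have "\<forall>\<^sub>F e in at_right 0. S t ((S e x - x) /\<^sub>R e) = (S (t + e) x - S t x) /\<^sub>R e"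
    unfolding eventually_at_filter using t by (auto simp: S_add blinfun.scaleR_right blinfun.diff_right)
  ultimately show ?thesis by (rule Lim_transform_eventually)
qed

text \<open>Both sides are limits of the same right-sided difference quotient.\<close>

lemma S_derivative_on_D:
  assumes x: "x \<in> D" and t: "t > 0" and S': "(S has_vector_derivative S') (at t)"
  shows "S' x = S t (A x)"
proof -
  have "((\<lambda>y. (S y x - S t x) /\<^sub>R (y - t)) \<longlongrightarrow> S' x) (at_right t)"
    by (rule vector_derivative_quotient, rule has_vector_derivative_at_within)
       (rule bounded_linear.has_vector_derivative[OF blinfun.bounded_linear_left S'])
  then have "((\<lambda>e. (S (t + e) x - S t x) /\<^sub>R e) \<longlongrightarrow> S' x) (at_right 0)"
    by (subst (asm) at_right_to_0) (simp add: filterlim_filtermap add.commute)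
  then show ?thesis
    using S_quotient_limit[OF x less_imp_le[OF t]] tendsto_unique trivial_limit_at_right_real by blast
qed

text \<open>The integrand is the derivative of \<open>S((1 - \<theta>)\<tau>) (w \<theta>)\<close>: the terms with \<open>A\<close> cancel. At \<open>\<theta> = 1\<close> the
semigroup need not be differentiable, so only the interior of the interval is used. Time is scaled to
\<open>[0, 1]\<close> to match the integrals in the definition of the \<open>\<phi>\<close> operators.\<close>

lemma variation_of_constants:
  assumes \<tau>: "\<tau> > 0" and w: "\<And>\<theta>. \<theta> \<in> {0..1} \<Longrightarrow> w \<theta> \<in> D"
    and der: "\<And>\<theta>. \<theta> \<in> {0..1} \<Longrightarrow> (w has_vector_derivative \<tau> *\<^sub>R (A (w \<theta>) + f \<theta>)) (at \<theta> within {0..1})"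
  shows "((\<lambda>\<theta>. S ((1 - \<theta>) * \<tau>) (\<tau> *\<^sub>R f \<theta>)) has_integral (w 1 - S \<tau> (w 0))) {0..1}"
proof -
  have "((\<lambda>\<theta>. S ((1 - \<theta>) * \<tau>) (\<tau> *\<^sub>R f \<theta>)) has_integral
     S ((1 - 1) * \<tau>) (w 1) - S ((1 - 0) * \<tau>) (w 0)) {0..1}"
  proof (rule fundamental_theorem_of_calculus_interior)
    have cw: "continuous_on {0..1} w"
      unfolding continuous_on_eq_continuous_within
      using der has_vector_derivative_continuous by blast
    show "continuous_on {0..1} (\<lambda>\<theta>. S ((1 - \<theta>) * \<tau>) (w \<theta>))"
      by (rule continuous_on_orbit[OF _ _ cw]) (use \<tau> in \<open>auto intro!: continuous_intros\<close>)
    fix \<theta> :: real assume \<theta>: "\<theta> \<in> {0<..<1}"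
    define s where "s = (1 - \<theta>) * \<tau>"
    have s: "s > 0" using \<theta> \<tau> by (simp add: s_def)
    obtain S' where S': "(S has_vector_derivative S') (at s)" using S_differentiable[OF s] by blast
    have "((\<lambda>\<theta>. (1 - \<theta>) * \<tau>) has_vector_derivative - \<tau>) (at \<theta>)"
      by (auto intro!: derivative_eq_intros simp: has_vector_derivative_def)
    from vector_diff_chain_at[OF this S'[unfolded s_def]]
    have 1: "((\<lambda>\<theta>. S ((1 - \<theta>) * \<tau>)) has_vector_derivative - \<tau> *\<^sub>R S') (at \<theta>)" by (simp add: comp_def)
    have \<theta>I: "\<theta> \<in> {0..1}" using \<theta> by auto
    have 2: "(w has_vector_derivative \<tau> *\<^sub>R (A (w \<theta>) + f \<theta>)) (at \<theta>)"
      using der[OF \<theta>I] \<theta> at_within_interior[of \<theta> "{0..1}"] by simp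
    have "((\<lambda>\<theta>. S ((1 - \<theta>) * \<tau>) (w \<theta>)) has_vector_derivative
       S ((1 - \<theta>) * \<tau>) (\<tau> *\<^sub>R (A (w \<theta>) + f \<theta>)) + (- \<tau> *\<^sub>R S') (w \<theta>)) (at \<theta>)"
      by (rule bounded_bilinear.has_vector_derivative[OF bounded_bilinear_blinfun_apply 1 2])
    moreover have "S' (w \<theta>) = S s (A (w \<theta>))" by (rule S_derivative_on_D[OF w[OF \<theta>I] s S'])
    ultimately show "((\<lambda>\<theta>. S ((1 - \<theta>) * \<tau>) (w \<theta>)) has_vector_derivative S ((1 - \<theta>) * \<tau>) (\<tau> *\<^sub>R f \<theta>)) (at \<theta>)"
      by (simp add: s_def blinfun.bilinear_simps scaleR_right_distrib)
  qed simp
  then show ?thesis by simp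
qed

lemma phi_integrand_continuous:
  assumes "h \<ge> 0"
  shows "continuous_on {0..1} (\<lambda>\<theta>. (\<theta> ^ (k - 1) / fact (k - 1)) *\<^sub>R S ((1 - \<theta>) * h) x)"
  by (intro continuous_on_scaleR continuous_on_orbit) (use assms in \<open>auto intro!: continuous_intros\<close>)

lemma phi_has_integral:
  assumes "h \<ge> 0"
  shows "((\<lambda>\<theta>. (\<theta> ^ (k - 1) / fact (k - 1)) *\<^sub>R S ((1 - \<theta>) * h) x) has_integral phi_op S k h x) {0..1}"
  unfolding phi_op_def using integrable_integral[OF integrable_continuous_real[OF phi_integrand_continuous[OF assms]]] .

lemma phi_weight_le: "\<theta> \<in> {0..1} \<Longrightarrow> \<bar>\<theta> ^ (k - 1) / fact (k - 1)\<bar> \<le> (1::real)"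
proof -
  assume \<theta>: "\<theta> \<in> {0..1}"
  have "\<theta> ^ (k - 1) \<le> 1" using \<theta> by (intro power_le_one) auto
  also have "1 \<le> (fact (k - 1) :: real)" by (rule fact_ge_1)
  finally show ?thesis using \<theta> by (simp add: divide_le_eq_1)
qed

lemma phi_bound:
  assumes K: "\<And>t. t \<in> {0..b} \<Longrightarrow> norm (S t) \<le> K" and h: "0 \<le> h" "h \<le> b"
  shows "norm (phi_op S k h x) \<le> K * norm x"
proof -
  have "norm (phi_op S k h x) \<le> (K * norm x) * (1 - 0)"
    unfolding phi_op_def
  proof (rule integral_bound[OF _ phi_integrand_continuous[OF h(1)]])
    fix \<theta> :: real assume \<theta>: "\<theta> \<in> {0..1}"
    have "(1 - \<theta>) * h \<le> 1 * h" using \<theta> h by (intro mult_right_mono) auto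
    then have "(1 - \<theta>) * h \<in> {0..b}" using \<theta> h by auto
    then have "norm (S ((1 - \<theta>) * h) x) \<le> K * norm x"
      using K norm_blinfun[of "S ((1 - \<theta>) * h)" x] by (meson mult_right_mono norm_ge_zero order_trans)
    then have "\<bar>\<theta> ^ (k - 1) / fact (k - 1)\<bar> * norm (S ((1 - \<theta>) * h) x) \<le> 1 * (K * norm x)"
      by (intro mult_mono phi_weight_le[OF \<theta>]) auto
    then show "norm ((\<theta> ^ (k - 1) / fact (k - 1)) *\<^sub>R S ((1 - \<theta>) * h) x) \<le> K * norm x" by simp
  qed simp
  then show ?thesis by simp
qed

lemma phi_linear:
  assumes h: "h \<ge> 0"
  shows "linear (phi_op S k h)"
proof (rule linearI)
  fix x y c
  have "phi_op S k h (x + y) = phi_op S k h x + phi_op S k h y"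
    by (rule has_integral_unique[OF phi_has_integral[OF h]])
       (use has_integral_add[OF phi_has_integral[OF h] phi_has_integral[OF h]] in \<open>simp add: blinfun.add_right scaleR_right_distrib\<close>)
  then show "phi_op S k h (x + y) = phi_op S k h x + phi_op S k h y" .
  show "phi_op S k h (c *\<^sub>R x) = c *\<^sub>R phi_op S k h x"
    by (rule has_integral_unique[OF phi_has_integral[OF h]])
       (use has_integral_cmul[OF phi_has_integral[OF h], of c] in \<open>simp add: blinfun.scaleR_right mult.commute\<close>)
qed

text \<open>The constant function \<open>x\<close> solves \<open>w' = h (A w - A x)\<close>; apply the variation of constants formula.\<close>

lemma phi_1_A:
  assumes x: "x \<in> D" and h: "h > 0"
  shows "h *\<^sub>R phi_op S 1 h (A x) = S h x - x"
proof -
  have "((\<lambda>\<theta>. S ((1 - \<theta>) * h) (h *\<^sub>R (- A x))) has_integral (x - S h x)) {0..1}"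
    using variation_of_constants[OF h, of "\<lambda>_. x" "\<lambda>_. - A x"] x by simp
  from has_integral_neg[OF this]
  have "((\<lambda>\<theta>. h *\<^sub>R S ((1 - \<theta>) * h) (A x)) has_integral (S h x - x)) {0..1}"
    by (simp add: blinfun.bilinear_simps)
  moreover have "((\<lambda>\<theta>. h *\<^sub>R S ((1 - \<theta>) * h) (A x)) has_integral h *\<^sub>R phi_op S 1 h (A x)) {0..1}"
    using has_integral_cmul[OF phi_has_integral[of h 1 "A x"], of h] h by simp
  ultimately show ?thesis by (metis has_integral_unique)
qed

lemma S_phi_has_integral:
  assumes h: "h \<ge> 0" and t: "t \<ge> 0"
  shows "((\<lambda>\<theta>. (\<theta> ^ (k - 1) / fact (k - 1)) *\<^sub>R S (t + (1 - \<theta>) * h) x) has_integral S t (phi_op S k h x)) {0..1}"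
proof -
  have "((\<lambda>\<theta>. S t ((\<theta> ^ (k - 1) / fact (k - 1)) *\<^sub>R S ((1 - \<theta>) * h) x)) has_integral S t (phi_op S k h x)) {0..1}"
    using has_integral_linear[OF phi_has_integral[OF h] blinfun.bounded_linear_right] by (simp add: comp_def)
  then show ?thesis
    by (rule has_integral_eq[rotated]) (use h t in \<open>simp add: S_add blinfun.scaleR_right\<close>)
qed

text \<open>The operator \<open>\<phi>\<^sub>k(hA)\<close> gains one derivative although the integrand reaches \<open>S 0\<close>, where orbits need not
be differentiable. Integration by parts with \<open>Q r = \<integral>\<^sub>0\<^sup>r S s x ds\<close> expresses \<open>h S(e) \<phi>\<^sub>k(hA) x\<close> as a
function \<open>P e\<close> in which only \<open>Q\<close> depends on \<open>e\<close>, and \<open>Q\<close> is continuously differentiable up to \<open>0\<close>.\<close>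

lemma phi_in_D:
  assumes h: "h > 0"
  shows "phi_op S k h x \<in> D"
proof -
  define W :: "real \<Rightarrow> real" where "W \<theta> = \<theta> ^ (k - 1) / fact (k - 1)" for \<theta>
  define W' :: "real \<Rightarrow> real" where "W' \<theta> = (real (k - 1) * \<theta> ^ (k - 1 - 1)) / fact (k - 1)" for \<theta>
  have dW: "(W has_real_derivative W' \<theta>) (at \<theta> within U)" for \<theta> U
    unfolding W_def W'_def by (auto intro!: derivative_eq_intros)
  define Q where "Q r = integral {0..r} (\<lambda>s. S s x)" for r
  have cS: "continuous_on {0..h+1} (\<lambda>s. S s x)"
    by (rule continuous_on_orbit) (auto intro!: continuous_intros)
  have dQ: "(Q has_vector_derivative S r x) (at r within {0..h+1})" if "r \<in> {0..h+1}" for r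
    unfolding Q_def by (rule integral_has_vector_derivative[OF cS that])
  have cQ: "continuous_on {0..h+1} Q"
    unfolding continuous_on_eq_continuous_within using dQ has_vector_derivative_continuous by blast
  have rng: "(1 - \<theta>) * h + e \<in> {0..h+1}" if "\<theta> \<in> {0..1}" "e \<in> {0..1}" for \<theta> e
  proof -
    have "(1 - \<theta>) * h \<le> 1 * h" using that h by (intro mult_right_mono) auto
    moreover have "0 \<le> (1 - \<theta>) * h" using that h by auto
    ultimately show ?thesis using that unfolding atLeastAtMost_iff mult_1_left by linarith
  qed
  have cW: "continuous_on U W" "continuous_on U W'" for U
    unfolding W_def W'_def by (intro continuous_intros; simp)+
  define P where "P e = integral {0..1} (\<lambda>\<theta>. W' \<theta> *\<^sub>R Q ((1 - \<theta>) * h + e)) - W 1 *\<^sub>R Q e + W 0 *\<^sub>R Q (h + e)" for e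
  have cQe: "continuous_on {0..1} (\<lambda>\<theta>. Q ((1 - \<theta>) * h + e))" if "e \<in> {0..1}" for e
    by (rule continuous_on_compose2[OF cQ]) (use rng that in \<open>auto intro!: continuous_intros\<close>)
  have hP: "h *\<^sub>R S e (phi_op S k h x) = P e" if e: "e \<in> {0..1}" for e
  proof -
    have "((\<lambda>\<theta>. W' \<theta> *\<^sub>R Q ((1 - \<theta>) * h + e) - h *\<^sub>R (W \<theta> *\<^sub>R S (e + (1 - \<theta>) * h) x)) has_integral
       W 1 *\<^sub>R Q ((1 - 1) * h + e) - W 0 *\<^sub>R Q ((1 - 0) * h + e)) {0..1}"
    proof (rule fundamental_theorem_of_calculus)
      fix \<theta> :: real assume \<theta>: "\<theta> \<in> {0..1}"
      have "((\<lambda>\<theta>. (1 - \<theta>) * h + e) has_vector_derivative - h) (at \<theta> within {0..1})"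
        by (auto intro!: derivative_eq_intros simp: has_vector_derivative_def)
      moreover have "(Q has_vector_derivative S ((1 - \<theta>) * h + e) x) (at ((1 - \<theta>) * h + e) within (\<lambda>\<theta>. (1 - \<theta>) * h + e) ` {0..1})"
        by (rule has_vector_derivative_within_subset[OF dQ[OF rng[OF \<theta> e]]]) (use rng e in blast)
      ultimately have "((\<lambda>\<theta>. Q ((1 - \<theta>) * h + e)) has_vector_derivative - h *\<^sub>R S ((1 - \<theta>) * h + e) x) (at \<theta> within {0..1})"
        using vector_diff_chain_within by (fastforce simp: comp_def)
      from has_vector_derivative_scaleR[OF dW this]
      show "((\<lambda>\<theta>. W \<theta> *\<^sub>R Q ((1 - \<theta>) * h + e)) has_vector_derivative
         W' \<theta> *\<^sub>R Q ((1 - \<theta>) * h + e) - h *\<^sub>R (W \<theta> *\<^sub>R S (e + (1 - \<theta>) * h) x)) (at \<theta> within {0..1})"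
        by (simp add: add.commute mult.commute)
    qed simp
    moreover have "((\<lambda>\<theta>. W' \<theta> *\<^sub>R Q ((1 - \<theta>) * h + e) - h *\<^sub>R (W \<theta> *\<^sub>R S (e + (1 - \<theta>) * h) x)) has_integral
       integral {0..1} (\<lambda>\<theta>. W' \<theta> *\<^sub>R Q ((1 - \<theta>) * h + e)) - h *\<^sub>R S e (phi_op S k h x)) {0..1}"
      unfolding W_def
      by (intro has_integral_diff has_integral_cmul S_phi_has_integral integrable_integral integrable_continuous_real
           continuous_on_scaleR cW cQe[OF e]) (use h e in auto)
    ultimately have "integral {0..1} (\<lambda>\<theta>. W' \<theta> *\<^sub>R Q ((1 - \<theta>) * h + e)) - h *\<^sub>R S e (phi_op S k h x)
      = W 1 *\<^sub>R Q ((1 - 1) * h + e) - W 0 *\<^sub>R Q ((1 - 0) * h + e)" by (rule has_integral_unique[symmetric])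
    then show ?thesis by (simp add: P_def algebra_simps)
  qed
  define P' where "P' = integral {0..1} (\<lambda>\<theta>. W' \<theta> *\<^sub>R S ((1 - \<theta>) * h + 0) x) - W 1 *\<^sub>R S 0 x + W 0 *\<^sub>R S h x"
  have shift: "((\<lambda>e. Q (c + e)) has_vector_derivative S (c + e) x) (at e within {0..1})" if "c \<in> {0..h}" "e \<in> {0..1}" for c e
  proof -
    have "((\<lambda>e. c + e) has_vector_derivative 1) (at e within {0..1})"
      by (auto intro!: derivative_eq_intros)
    moreover have "(Q has_vector_derivative S (c + e) x) (at (c + e) within (\<lambda>e. c + e) ` {0..1})"
      by (rule has_vector_derivative_within_subset[OF dQ]) (use that in auto)
    ultimately show ?thesis using vector_diff_chain_within by (fastforce simp: comp_def)
  qed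
  have "((\<lambda>e. integral (cbox 0 1) (\<lambda>\<theta>. W' \<theta> *\<^sub>R Q ((1 - \<theta>) * h + e))) has_vector_derivative
     integral (cbox 0 1) (\<lambda>\<theta>. W' \<theta> *\<^sub>R S ((1 - \<theta>) * h + 0) x)) (at 0 within {0..1})"
  proof (rule leibniz_rule_vector_derivative)
    fix e \<theta> :: real assume e: "e \<in> {0..1}" and \<theta>: "\<theta> \<in> cbox 0 1"
    have "(1 - \<theta>) * h \<in> {0..h}" using rng[of \<theta> 0] \<theta> h by (auto intro: mult_left_le_one_le)
    from bounded_linear.has_vector_derivative[OF bounded_linear_scaleR_right shift[OF this e]]
    show "((\<lambda>e. W' \<theta> *\<^sub>R Q ((1 - \<theta>) * h + e)) has_vector_derivative W' \<theta> *\<^sub>R S ((1 - \<theta>) * h + e) x) (at e within {0..1})" .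
  next
    fix e :: real assume e: "e \<in> {0..1}"
    show "(\<lambda>\<theta>. W' \<theta> *\<^sub>R Q ((1 - \<theta>) * h + e)) integrable_on cbox 0 1"
      unfolding cbox_interval by (intro integrable_continuous_real continuous_on_scaleR cW cQe e)
  next
    show "continuous_on ({0..1} \<times> cbox 0 1) (\<lambda>(e, \<theta>). W' \<theta> *\<^sub>R S ((1 - \<theta>) * h + e) x)"
      unfolding case_prod_unfold
      by (intro continuous_on_scaleR continuous_on_compose2[OF cW(2)[of UNIV]] continuous_on_orbit continuous_intros) (use h in auto)
  qed auto
  then have "((\<lambda>e. integral {0..1} (\<lambda>\<theta>. W' \<theta> *\<^sub>R Q ((1 - \<theta>) * h + e))) has_vector_derivative
     integral {0..1} (\<lambda>\<theta>. W' \<theta> *\<^sub>R S ((1 - \<theta>) * h + 0) x)) (at 0 within {0..1})" by simp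
  then have "(P has_vector_derivative P') (at 0 within {0..1})"
    unfolding P_def[abs_def] P'_def
    using shift[of 0 0] shift[of h 0] h
    by (intro has_vector_derivative_add has_vector_derivative_diff
          bounded_linear.has_vector_derivative[OF bounded_linear_scaleR_right]) auto
  from vector_derivative_quotient[OF this]
  have "((\<lambda>e. (P e - P 0) /\<^sub>R e) \<longlongrightarrow> P') (at_right 0)" by (simp add: at_within_Icc_at_right)
  from tendsto_scaleR[OF tendsto_const[of "1/h"] this]
  have "((\<lambda>e. (1/h) *\<^sub>R ((P e - P 0) /\<^sub>R e)) \<longlongrightarrow> (1/h) *\<^sub>R P') (at_right 0)" .
  moreover have "\<forall>\<^sub>F e in at_right 0. (1/h) *\<^sub>R ((P e - P 0) /\<^sub>R e) = (S e (phi_op S k h x) - phi_op S k h x) /\<^sub>R e"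
  proof (rule eventually_at_rightI[of 0 1])
    fix e :: real assume "e \<in> {0<..<1}"
    then have "P e - P 0 = h *\<^sub>R (S e (phi_op S k h x) - phi_op S k h x)"
      using hP[of e] hP[of 0] by (simp add: scaleR_diff_right)
    then show "(1/h) *\<^sub>R ((P e - P 0) /\<^sub>R e) = (S e (phi_op S k h x) - phi_op S k h x) /\<^sub>R e"
      using h by simp
  qed simp
  ultimately have "((\<lambda>e. (S e (phi_op S k h x) - phi_op S k h x) /\<^sub>R e) \<longlongrightarrow> (1/h) *\<^sub>R P') (at_right 0)"
    by (rule Lim_transform_eventually)
  then show ?thesis by (rule A_eqI)
qed

end


section \<open>Summation of coefficient operators along the semigroup\<close>

text \<open>The property of the coefficient functions that the estimates use. In contrast to validity for a fixed
method it does not mention the nodes, and it is inherited by the linear combinations \<open>\<psi>\<^sub>j\<close> and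
\<open>\<psi>\<^sub>j\<^sub>,\<^sub>i\<close>.\<close>

definition admissible :: "coefficient \<Rightarrow> bool" where
  "admissible cf \<longleftrightarrow> (\<forall>(\<alpha>, k, \<sigma>) \<in> set cf. 1 \<le> k \<and> 0 < \<sigma> \<and> \<sigma> \<le> 1)"

definition coef_size :: "coefficient \<Rightarrow> real" where
  "coef_size cf = (\<Sum>(\<alpha>, k, \<sigma>)\<leftarrow>cf. \<bar>\<alpha>\<bar>)"

lemma admissible_Nil [simp]: "admissible []"
  and admissible_Cons [simp]: "admissible ((\<alpha>, k, \<sigma>) # cf) \<longleftrightarrow> 1 \<le> k \<and> 0 < \<sigma> \<and> \<sigma> \<le> 1 \<and> admissible cf"
  by (auto simp: admissible_def)

lemma coef_size_nonneg: "0 \<le> coef_size cf"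
  unfolding coef_size_def by (rule sum_list_nonneg) auto

lemma coef_size_Cons: "coef_size ((\<alpha>, k, \<sigma>) # cf) = \<bar>\<alpha>\<bar> + coef_size cf"
  by (simp add: coef_size_def)

lemma coef_op_Nil [simp]: "coef_op S [] h x = 0"
  and coef_op_Cons [simp]: "coef_op S ((\<alpha>, k, \<sigma>) # cf) h x = \<alpha> *\<^sub>R phi_op S k (\<sigma> * h) x + coef_op S cf h x"
  by (auto simp: coef_op_def)

lemma integral_power_01: "((\<lambda>\<theta>::real. \<theta> ^ n) has_integral 1 / real (Suc n)) {0..1}"
proof -
  have "((\<lambda>\<theta>::real. \<theta> ^ n) has_integral 1 ^ Suc n / real (Suc n) - 0 ^ Suc n / real (Suc n)) {0..1}"
  proof (rule fundamental_theorem_of_calculus)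
    fix x :: real
    have "((\<lambda>\<theta>. \<theta> ^ Suc n / real (Suc n)) has_real_derivative (real (Suc n) * x ^ n) / real (Suc n)) (at x within {0..1})"
      by (rule DERIV_cdivide) (rule derivative_eq_intros refl | simp)+
    then show "((\<lambda>\<theta>. \<theta> ^ Suc n / real (Suc n)) has_vector_derivative x ^ n) (at x within {0..1})"
      by (simp add: has_real_derivative_iff_has_vector_derivative)
  qed simp
  then show ?thesis by simp
qed

lemma integral_phi_weight:
  assumes "1 \<le> k"
  shows "((\<lambda>\<theta>::real. \<theta> ^ (k - 1) / fact (k - 1)) has_integral 1 / fact k) {0..1}"
    and "((\<lambda>\<theta>::real. \<theta> ^ (k - 1) / fact (k - 1) * (1 - \<theta>)) has_integral 1 / fact (Suc k)) {0..1}"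
proof -
  obtain m where m: "k = Suc m" using assms by (cases k) auto
  have f: "fact k = real (Suc m) * fact m" unfolding m by simp
  have f2: "fact (Suc k) = real (Suc (Suc m)) * (real (Suc m) * fact m)" unfolding m by simp
  show 1: "((\<lambda>\<theta>::real. \<theta> ^ (k - 1) / fact (k - 1)) has_integral 1 / fact k) {0..1}"
    using has_integral_divide[OF integral_power_01[of m], of "fact m"] unfolding f by (simp add: m)
  have "((\<lambda>\<theta>::real. (\<theta> ^ m - \<theta> ^ Suc m) / fact m) has_integral (1 / real (Suc m) - 1 / real (Suc (Suc m))) / fact m) {0..1}"
    by (intro has_integral_divide has_integral_diff integral_power_01)
  moreover have "(1 / real (Suc m) - 1 / real (Suc (Suc m))) / fact m = 1 / fact (Suc k)"
    unfolding f2 by (simp add: divide_simps)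
  ultimately show "((\<lambda>\<theta>::real. \<theta> ^ (k - 1) / fact (k - 1) * (1 - \<theta>)) has_integral 1 / fact (Suc k)) {0..1}"
    by (simp add: m algebra_simps diff_divide_distrib)
qed

context analytic_generator
begin

lemma coef_bound:
  assumes K: "\<And>t. t \<in> {0..b} \<Longrightarrow> norm (S t) \<le> K" and h: "0 \<le> h" "h \<le> b" and cf: "admissible cf"
  shows "norm (coef_op S cf h x) \<le> coef_size cf * K * norm x"
  using cf
proof (induction cf)
  case (Cons c cf)
  obtain \<alpha> k \<sigma> where c: "c = (\<alpha>, k, \<sigma>)" by (cases c)
  have \<sigma>: "0 \<le> \<sigma> * h" "\<sigma> * h \<le> b"
  proof -
    have "\<sigma> * h \<le> 1 * h" using Cons.prems h by (intro mult_right_mono) (auto simp: c)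
    then show "\<sigma> * h \<le> b" using h by simp
    show "0 \<le> \<sigma> * h" using Cons.prems h by (simp add: c)
  qed
  have "norm (coef_op S (c # cf) h x) \<le> \<bar>\<alpha>\<bar> * norm (phi_op S k (\<sigma> * h) x) + norm (coef_op S cf h x)"
    unfolding c coef_op_Cons by (rule order_trans[OF norm_triangle_ineq]) simp
  also have "\<dots> \<le> \<bar>\<alpha>\<bar> * (K * norm x) + coef_size cf * K * norm x"
    using Cons by (intro add_mono mult_left_mono phi_bound[OF K \<sigma>]) (auto simp: c)
  finally show ?case by (simp add: c coef_size_def algebra_simps)
qed (simp add: coef_size_def)

lemma coef_linear:
  assumes h: "h \<ge> 0" and cf: "admissible cf"
  shows "linear (coef_op S cf h)"
  using cf
proof (induction cf)
  case (Cons c cf)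
  obtain \<alpha> k \<sigma> where c: "c = (\<alpha>, k, \<sigma>)" by (cases c)
  have "coef_op S (c # cf) h = (\<lambda>x. \<alpha> *\<^sub>R phi_op S k (\<sigma> * h) x + coef_op S cf h x)"
    by (simp add: c fun_eq_iff)
  moreover have "linear (\<lambda>x. \<alpha> *\<^sub>R phi_op S k (\<sigma> * h) x + coef_op S cf h x)"
    using Cons h by (intro linear_compose_add linear_compose_scale_right phi_linear) (auto simp: c)
  ultimately show ?case by simp
next
  case Nil
  show ?case by (simp add: module_hom_zero coef_op_def)
qed

lemma coef_in_D:
  assumes h: "h > 0" and cf: "admissible cf"
  shows "coef_op S cf h x \<in> D"
  using cf
proof (induction cf)
  case (Cons c cf)
  obtain \<alpha> k \<sigma> where c: "c = (\<alpha>, k, \<sigma>)" by (cases c)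
  show ?case using Cons h unfolding c coef_op_Cons
    by (intro subspace_add[OF subspace_D] subspace_scale[OF subspace_D] phi_in_D) auto
qed (simp add: subspace_0[OF subspace_D])

text \<open>\<open>S(t) \<phi>\<^sub>k(\<sigma>hA) x\<close> is a weighted average of the values \<open>S(t + (1 - \<theta>)\<sigma>h) x\<close>. They are replaced by linear
interpolation between \<open>S t x\<close> and \<open>S (t + h) x\<close>, with an error bounded by the second difference.\<close>

lemma phi_telescoping:
  assumes K: "K > 0" "\<And>t h \<tau>. 0 < t \<Longrightarrow> 0 \<le> h \<Longrightarrow> t + h \<le> b \<Longrightarrow> \<tau> \<in> {0..1} \<Longrightarrow>
     norm (S (t + \<tau> * h) - S t - \<tau> *\<^sub>R (S (t + h) - S t)) \<le> K * h\<^sup>2 / t\<^sup>2"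
    and t: "0 < t" and h: "0 \<le> h" and th: "t + h \<le> b" and k: "1 \<le> k" and \<sigma>: "0 < \<sigma>" "\<sigma> \<le> 1"
  shows "norm (S t (phi_op S k (\<sigma> * h) x) - (1 / fact k) *\<^sub>R S t x - (\<sigma> / fact (Suc k)) *\<^sub>R (S (t + h) x - S t x))
    \<le> K * h\<^sup>2 / t\<^sup>2 * norm x"
proof -
  let ?w = "\<lambda>\<theta>::real. \<theta> ^ (k - 1) / fact (k - 1)"
  let ?\<Delta> = "S (t + h) x - S t x"
  have \<sigma>h: "0 \<le> \<sigma> * h" using \<sigma> h by simp
  have "((\<lambda>\<theta>. ?w \<theta> *\<^sub>R S (t + (1 - \<theta>) * (\<sigma> * h)) x - ?w \<theta> *\<^sub>R S t x - \<sigma> *\<^sub>R (?w \<theta> * (1 - \<theta>)) *\<^sub>R ?\<Delta>) has_integral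
      S t (phi_op S k (\<sigma> * h) x) - (1 / fact k) *\<^sub>R S t x - \<sigma> *\<^sub>R (1 / fact (Suc k)) *\<^sub>R ?\<Delta>) {0..1}"
    by (intro has_integral_diff has_integral_cmul S_phi_has_integral[OF \<sigma>h] has_integral_scaleR_left integral_phi_weight[OF k])
       (use t in simp)
  moreover have "?w \<theta> *\<^sub>R S (t + (1 - \<theta>) * (\<sigma> * h)) x - ?w \<theta> *\<^sub>R S t x - \<sigma> *\<^sub>R (?w \<theta> * (1 - \<theta>)) *\<^sub>R ?\<Delta>
     = ?w \<theta> *\<^sub>R (S (t + ((1 - \<theta>) * \<sigma>) * h) - S t - ((1 - \<theta>) * \<sigma>) *\<^sub>R (S (t + h) - S t)) x" for \<theta>
    by (simp add: blinfun.bilinear_simps scaleR_diff_right mult_ac)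
  moreover have "\<sigma> *\<^sub>R (1 / fact (Suc k)) *\<^sub>R ?\<Delta> = (\<sigma> / fact (Suc k)) *\<^sub>R ?\<Delta>" by (simp del: fact_Suc)
  ultimately have int: "((\<lambda>\<theta>. ?w \<theta> *\<^sub>R (S (t + ((1 - \<theta>) * \<sigma>) * h) - S t - ((1 - \<theta>) * \<sigma>) *\<^sub>R (S (t + h) - S t)) x) has_integral
      S t (phi_op S k (\<sigma> * h) x) - (1 / fact k) *\<^sub>R S t x - (\<sigma> / fact (Suc k)) *\<^sub>R ?\<Delta>) {0..1}"
    by (simp only:)
  have "norm (S t (phi_op S k (\<sigma> * h) x) - (1 / fact k) *\<^sub>R S t x - (\<sigma> / fact (Suc k)) *\<^sub>R ?\<Delta>)
     \<le> (K * h\<^sup>2 / t\<^sup>2 * norm x) * measure lborel (cbox 0 (1::real))"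
  proof (rule has_integral_bound)
    show "0 \<le> K * h\<^sup>2 / t\<^sup>2 * norm x" using K(1) by simp
    show "((\<lambda>\<theta>. ?w \<theta> *\<^sub>R (S (t + ((1 - \<theta>) * \<sigma>) * h) - S t - ((1 - \<theta>) * \<sigma>) *\<^sub>R (S (t + h) - S t)) x) has_integral
      S t (phi_op S k (\<sigma> * h) x) - (1 / fact k) *\<^sub>R S t x - (\<sigma> / fact (Suc k)) *\<^sub>R ?\<Delta>) (cbox 0 1)"
      using int by simp
    fix \<theta> :: real assume "\<theta> \<in> cbox 0 1"
    then have \<theta>: "\<theta> \<in> {0..1}" by simp
    have \<tau>: "(1 - \<theta>) * \<sigma> \<in> {0..1}" using \<theta> \<sigma> by (auto intro: mult_le_one)
    let ?G = "S (t + ((1 - \<theta>) * \<sigma>) * h) - S t - ((1 - \<theta>) * \<sigma>) *\<^sub>R (S (t + h) - S t)"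
    have "norm (?G x) \<le> norm ?G * norm x" by (rule norm_blinfun)
    also have "\<dots> \<le> K * h\<^sup>2 / t\<^sup>2 * norm x" by (intro mult_right_mono K(2)[OF t h th \<tau>]) simp
    finally have "\<bar>?w \<theta>\<bar> * norm (?G x) \<le> 1 * (K * h\<^sup>2 / t\<^sup>2 * norm x)"
      by (intro mult_mono phi_weight_le[OF \<theta>]) auto
    then show "norm (?w \<theta> *\<^sub>R ?G x) \<le> K * h\<^sup>2 / t\<^sup>2 * norm x" by simp
  qed
  then show ?thesis by simp
qed

lemma coef_telescoping:
  assumes K: "K > 0" "\<And>t h \<tau>. 0 < t \<Longrightarrow> 0 \<le> h \<Longrightarrow> t + h \<le> b \<Longrightarrow> \<tau> \<in> {0..1} \<Longrightarrow>
     norm (S (t + \<tau> * h) - S t - \<tau> *\<^sub>R (S (t + h) - S t)) \<le> K * h\<^sup>2 / t\<^sup>2"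
    and t: "0 < t" and h: "0 \<le> h" and th: "t + h \<le> b" and cf: "admissible cf"
  shows "norm (S t (coef_op S cf h x) - (\<Sum>(\<alpha>, k, \<sigma>)\<leftarrow>cf. \<alpha> / fact k) *\<^sub>R S t x
      - (\<Sum>(\<alpha>, k, \<sigma>)\<leftarrow>cf. \<alpha> * \<sigma> / fact (Suc k)) *\<^sub>R (S (t + h) x - S t x))
    \<le> coef_size cf * (K * h\<^sup>2 / t\<^sup>2 * norm x)"
  using cf
proof (induction cf)
  case Nil
  show ?case by (simp add: blinfun.zero_right coef_size_def)
next
  case (Cons c cf)
  obtain \<alpha> k \<sigma> where c: "c = (\<alpha>, k, \<sigma>)" by (cases c)
  let ?\<Delta> = "S (t + h) x - S t x"
  let ?m0 = "\<Sum>(\<alpha>, k, \<sigma>)\<leftarrow>cf. \<alpha> / fact k" and ?m1 = "\<Sum>(\<alpha>, k, \<sigma>)\<leftarrow>cf. \<alpha> * \<sigma> / fact (Suc k)"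
  let ?E = "S t (phi_op S k (\<sigma> * h) x) - (1 / fact k) *\<^sub>R S t x - (\<sigma> / fact (Suc k)) *\<^sub>R ?\<Delta>"
  let ?F = "S t (coef_op S cf h x) - ?m0 *\<^sub>R S t x - ?m1 *\<^sub>R ?\<Delta>"
  have eq: "S t (coef_op S (c # cf) h x) - (\<Sum>(\<alpha>, k, \<sigma>)\<leftarrow>c#cf. \<alpha> / fact k) *\<^sub>R S t x
      - (\<Sum>(\<alpha>, k, \<sigma>)\<leftarrow>c#cf. \<alpha> * \<sigma> / fact (Suc k)) *\<^sub>R ?\<Delta> = \<alpha> *\<^sub>R ?E + ?F"
    unfolding c coef_op_Cons
    by (simp add: blinfun.add_right blinfun.scaleR_right scaleR_left_distrib scaleR_diff_right del: fact_Suc)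
  have "norm (\<alpha> *\<^sub>R ?E + ?F) \<le> \<bar>\<alpha>\<bar> * norm ?E + norm ?F"
    by (rule order_trans[OF norm_triangle_ineq]) simp
  also have "\<dots> \<le> \<bar>\<alpha>\<bar> * (K * h\<^sup>2 / t\<^sup>2 * norm x) + coef_size cf * (K * h\<^sup>2 / t\<^sup>2 * norm x)"
    using Cons.prems by (intro add_mono mult_left_mono Cons.IH phi_telescoping[OF K t h th]) (auto simp: c)
  also have "\<dots> = coef_size (c # cf) * (K * h\<^sup>2 / t\<^sup>2 * norm x)"
    by (simp only: c coef_size_Cons distrib_right)
  finally show ?case unfolding eq .
qed

text \<open>The mean \<open>\<Sum> \<alpha> / k!\<close> is the value of the coefficient function at \<open>0\<close>. When it vanishes, the preceding
lemma with \<open>t = jh\<close> leaves a multiple of \<open>S((j+1)h) x - S(jh) x\<close> and an error \<open>O(1 / j^2)\<close>: the first part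
telescopes, the second one is summable. The term \<open>j = 0\<close>, where the estimate is singular, is bounded
directly.\<close>

lemma sum_orbit_coef_bounded:
  assumes cf: "admissible cf" and mean: "(\<Sum>(\<alpha>, k, \<sigma>)\<leftarrow>cf. \<alpha> / fact k) = 0"
  shows "\<exists>C\<ge>0. \<forall>h n x. 0 < h \<longrightarrow> real n * h \<le> b \<longrightarrow>
     norm (\<Sum>j<n. S (real j * h) (coef_op S cf h x)) \<le> C * norm x"
proof -
  obtain K where K: "K > 0" "\<forall>t\<in>{0..b}. norm (S t) \<le> K" using S_bounded by blast
  obtain L where L: "L > 0" "\<forall>t h \<tau>. 0 < t \<longrightarrow> 0 \<le> h \<longrightarrow> t + h \<le> b \<longrightarrow> \<tau> \<in> {0..1} \<longrightarrow>
     norm (S (t + \<tau> * h) - S t - \<tau> *\<^sub>R (S (t + h) - S t)) \<le> L * h\<^sup>2 / t\<^sup>2" using second_difference by blast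
  define m1 where "m1 = (\<Sum>(\<alpha>, k, \<sigma>)\<leftarrow>cf. \<alpha> * \<sigma> / fact (Suc k))"
  define B where "B = (\<Sum>j. inverse (real j ^ 2))"
  have sB: "summable (\<lambda>j. inverse (real j ^ 2))" by (rule inverse_power_summable) simp
  have B: "(\<Sum>j<n. inverse (real j ^ 2)) \<le> B" for n
    unfolding B_def by (rule sum_le_suminf[OF sB]) auto
  have B0: "B \<ge> 0" using B[of 0] by simp
  define C where "C = coef_size cf * K + \<bar>m1\<bar> * (2 * K) + coef_size cf * L * B"
  have C0: "C \<ge> 0" unfolding C_def using K(1) L(1) B0 coef_size_nonneg[of cf] by (intro add_nonneg_nonneg mult_nonneg_nonneg) auto
  have "norm (\<Sum>j<n. S (real j * h) (coef_op S cf h x)) \<le> C * norm x" if h: "0 < h" and n: "real n * h \<le> b" for h n x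
  proof (cases n)
    case 0
    then show ?thesis using C0 by simp
  next
    case (Suc m)
    let ?f = "\<lambda>j. S (real j * h) (coef_op S cf h x)"
    have jb: "real j * h \<in> {0..b}" if "j \<le> n" for j
    proof -
      have "real j * h \<le> real n * h" using that h by (intro mult_right_mono) auto
      moreover have "0 \<le> real j * h" using h by simp
      ultimately show ?thesis using n unfolding atLeastAtMost_iff by linarith
    qed
    have hb: "h \<le> b" using jb[of 1] Suc by simp
    define R where "R j = ?f (Suc j) - m1 *\<^sub>R (S (real (Suc (Suc j)) * h) x - S (real (Suc j) * h) x)" for j
    have R: "norm (R j) \<le> coef_size cf * L * norm x * inverse (real (Suc j) ^ 2)" if "j < m" for j
    proof -
      have t: "0 < real (Suc j) * h" using h by simp
      have th: "real (Suc j) * h + h \<le> b" using jb[of "Suc (Suc j)"] that Suc by (simp add: algebra_simps)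
      have e: "real (Suc (Suc j)) * h = real (Suc j) * h + h" by (simp add: algebra_simps)
      have "norm (R j) \<le> coef_size cf * (L * h\<^sup>2 / (real (Suc j) * h)\<^sup>2 * norm x)"
        using coef_telescoping[OF L(1) _ t less_imp_le[OF h] th cf, of x] L(2)
        unfolding mean m1_def[symmetric] R_def e by simp
      also have "L * h\<^sup>2 / (real (Suc j) * h)\<^sup>2 = L * inverse (real (Suc j) ^ 2)"
        using h by (simp add: power_mult_distrib divide_inverse)
      finally show ?thesis by (simp add: mult_ac)
    qed
    have "(\<Sum>j<n. ?f j) = ?f 0 + (\<Sum>j<m. ?f (Suc j))" unfolding Suc by (rule sum.lessThan_Suc_shift)
    also have "(\<Sum>j<m. ?f (Suc j)) = (\<Sum>j<m. R j) + (\<Sum>j<m. m1 *\<^sub>R (S (real (Suc (Suc j)) * h) x - S (real (Suc j) * h) x))"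
      by (simp add: R_def flip: sum.distrib)
    also have "(\<Sum>j<m. m1 *\<^sub>R (S (real (Suc (Suc j)) * h) x - S (real (Suc j) * h) x)) = m1 *\<^sub>R (S (real n * h) x - S h x)"
      unfolding scaleR_sum_right[symmetric] sum_lessThan_telescope[of "\<lambda>j. S (real (Suc j) * h) x"] by (simp add: Suc)
    finally have "(\<Sum>j<n. ?f j) = ?f 0 + ((\<Sum>j<m. R j) + m1 *\<^sub>R (S (real n * h) x - S h x))" .
    moreover have tri: "norm (a + (b + m *\<^sub>R c)) \<le> norm a + (norm b + \<bar>m\<bar> * norm c)" for a b c :: 'a and m
      using norm_triangle_ineq[of a "b + m *\<^sub>R c"] norm_triangle_ineq[of b "m *\<^sub>R c"] by simp
    ultimately have "norm (\<Sum>j<n. ?f j) \<le> norm (?f 0) + (norm (\<Sum>j<m. R j) + \<bar>m1\<bar> * norm (S (real n * h) x - S h x))"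
      by (simp only:)
    also have "\<dots> \<le> coef_size cf * K * norm x + (coef_size cf * L * norm x * B + \<bar>m1\<bar> * (K * norm x + K * norm x))"
    proof (intro add_mono mult_left_mono)
      have "norm (coef_op S cf h x) \<le> coef_size cf * K * norm x"
        using K(2) hb h by (intro coef_bound[OF _ _ _ cf, of b]) auto
      then show "norm (?f 0) \<le> coef_size cf * K * norm x" by simp
      have "norm (\<Sum>j<m. R j) \<le> (\<Sum>j<m. coef_size cf * L * norm x * inverse (real (Suc j) ^ 2))"
        by (rule sum_norm_le) (use R in auto)
      also have "\<dots> = coef_size cf * L * norm x * (\<Sum>j<m. inverse (real (Suc j) ^ 2))"
        by (simp only: sum_distrib_left)
      also have "(\<Sum>j<m. inverse (real (Suc j) ^ 2)) = (\<Sum>j<n. inverse (real j ^ 2))"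
        unfolding Suc sum.lessThan_Suc_shift by simp
      also have "coef_size cf * L * norm x * (\<Sum>j<n. inverse (real j ^ 2)) \<le> coef_size cf * L * norm x * B"
        by (intro mult_left_mono B mult_nonneg_nonneg coef_size_nonneg) (use L(1) in auto)
      finally show "norm (\<Sum>j<m. R j) \<le> coef_size cf * L * norm x * B" .
      have Sx: "norm (S t x) \<le> K * norm x" if "t \<in> {0..b}" for t
        using K(2) that norm_blinfun[of "S t" x] by (meson mult_right_mono norm_ge_zero order_trans)
      show "norm (S (real n * h) x - S h x) \<le> K * norm x + K * norm x"
        by (rule order_trans[OF norm_triangle_ineq4 add_mono]) (use Sx[OF jb[of n]] Sx[of h] h hb in auto)
    qed auto
    also have "\<dots> = C * norm x" by (simp add: C_def algebra_simps)
    finally show ?thesis .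
  qed
  then show ?thesis using C0 by blast
qed

text \<open>Summation by parts reduces slowly varying weights \<open>y j\<close> to a constant weight: there are at most \<open>b / h\<close>
differences, each of size \<open>L h\<close>.\<close>

lemma weighted_sum_orbit_coef_bounded:
  assumes cf: "admissible cf" and mean: "(\<Sum>(\<alpha>, k, \<sigma>)\<leftarrow>cf. \<alpha> / fact k) = 0"
  shows "\<exists>C\<ge>0. \<forall>h n y Y L. 0 < h \<longrightarrow> real n * h \<le> b \<longrightarrow> (\<forall>j<n. norm (y j) \<le> Y) \<longrightarrow> 0 \<le> Y \<longrightarrow>
     (\<forall>j. Suc j < n \<longrightarrow> norm (y (Suc j) - y j) \<le> L * h) \<longrightarrow> 0 \<le> L \<longrightarrow>
     norm (\<Sum>j<n. S (real (n - 1 - j) * h) (coef_op S cf h (y j))) \<le> C * (Y + L)"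
proof -
  define b' where "b' = max b 1"
  obtain C where C: "C \<ge> 0" "\<forall>h n x. 0 < h \<longrightarrow> real n * h \<le> b' \<longrightarrow>
     norm (\<Sum>j<n. S (real j * h) (coef_op S cf h x)) \<le> C * norm x"
    using sum_orbit_coef_bounded[OF cf mean] by blast
  have "norm (\<Sum>j<n. S (real (n - 1 - j) * h) (coef_op S cf h (y j))) \<le> C * b' * (Y + L)"
    if h: "0 < h" and n: "real n * h \<le> b" and Y: "\<forall>j<n. norm (y j) \<le> Y" "0 \<le> Y"
      and L: "\<forall>j. Suc j < n \<longrightarrow> norm (y (Suc j) - y j) \<le> L * h" "0 \<le> L" for h n y Y L
  proof (cases n)
    case 0
    then show ?thesis using C Y L by (auto intro!: mult_nonneg_nonneg simp: b'_def)
  next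
    case (Suc m)
    define P where "P k x = (\<Sum>j<k. S (real j * h) (coef_op S cf h x))" for k x
    have P: "norm (P k x) \<le> C * norm x" if "k \<le> n" for k x
    proof -
      have "real k * h \<le> real n * h" using that h by (intro mult_right_mono) auto
      then have "real k * h \<le> b'" using n unfolding b'_def by linarith
      then show ?thesis using C(2) h unfolding P_def by blast
    qed
    have lin: "linear (coef_op S cf h)" using coef_linear[OF _ cf] h by simp
    have Pdiff: "P k (x - z) = P k x - P k z" for k x z
      unfolding P_def sum_subtractf[symmetric] linear_diff[OF lin] blinfun.diff_right ..
    \<comment> \<open>with the partial sums \<open>P\<close>; the offset \<open>q\<close> makes the induction on \<open>k\<close> possible\<close>
    have "(\<Sum>j<Suc k. S (real (q + (k - j)) * h) (coef_op S cf h (y j))) =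
        (P (q + Suc k) (y 0) - P q (y k)) + (\<Sum>j<k. P (q + (k - j)) (y (Suc j) - y j))" for k q
    proof (induction k arbitrary: q)
      case 0
      show ?case by (simp add: P_def)
    next
      case (Suc k)
      have "(\<Sum>j<Suc (Suc k). S (real (q + (Suc k - j)) * h) (coef_op S cf h (y j)))
        = (\<Sum>j<Suc k. S (real (Suc q + (k - j)) * h) (coef_op S cf h (y j))) + S (real q * h) (coef_op S cf h (y (Suc k)))"
        unfolding sum.lessThan_Suc[of _ "Suc k"] by (intro arg_cong2[where f = "(+)"] sum.cong) (auto simp: Suc_diff_le)
      also have "\<dots> = (P (Suc q + Suc k) (y 0) - P (Suc q) (y k)) + (\<Sum>j<k. P (Suc q + (k - j)) (y (Suc j) - y j))
         + S (real q * h) (coef_op S cf h (y (Suc k)))"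
        unfolding Suc.IH ..
      also have "S (real q * h) (coef_op S cf h (y (Suc k))) = P (Suc q) (y (Suc k)) - P q (y (Suc k))"
        by (simp add: P_def)
      also have "(\<Sum>j<k. P (Suc q + (k - j)) (y (Suc j) - y j)) = (\<Sum>j<k. P (q + (Suc k - j)) (y (Suc j) - y j))"
        by (intro sum.cong) (auto simp: Suc_diff_le)
      finally show ?case by (simp add: Pdiff)
    qed
    from this[of 0 m] have "(\<Sum>j<n. S (real (n - 1 - j) * h) (coef_op S cf h (y j))) =
       P n (y 0) + (\<Sum>j<m. P (m - j) (y (Suc j) - y j))"
      by (simp add: Suc P_def)
    also have "norm \<dots> \<le> C * Y + (\<Sum>j<m. C * (L * h))"
    proof (rule order_trans[OF norm_triangle_ineq add_mono])
      show "norm (P n (y 0)) \<le> C * Y"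
        using P[of n "y 0"] Y C Suc by (meson mult_left_mono order_refl order_trans zero_less_Suc)
      show "norm (\<Sum>j<m. P (m - j) (y (Suc j) - y j)) \<le> (\<Sum>j<m. C * (L * h))"
      proof (rule sum_norm_le)
        fix j assume "j \<in> {..<m}"
        then have "norm (y (Suc j) - y j) \<le> L * h" using L Suc by simp
        then show "norm (P (m - j) (y (Suc j) - y j)) \<le> C * (L * h)"
          using P[of "m - j" "y (Suc j) - y j"] C(1) Suc by (meson diff_le_self le_SucI mult_left_mono order_trans)
      qed
    qed
    also have "\<dots> = C * (Y + (real m * h) * L)" by (simp add: algebra_simps)
    also have "\<dots> \<le> C * (b' * Y + b' * L)"
    proof (intro mult_left_mono add_mono mult_right_mono C L)
      show "Y \<le> b' * Y" using Y(2) mult_right_mono[of 1 b' Y] by (simp add: b'_def)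
      have "real m * h \<le> real n * h" using Suc h by (intro mult_right_mono) auto
      then show "real m * h \<le> b'" using n by (simp add: b'_def)
    qed
    finally show ?thesis by (simp add: algebra_simps)
  qed
  moreover have "C * b' \<ge> 0" using C by (simp add: b'_def)
  ultimately show ?thesis by blast
qed

end

section \<open>Linear independence of the phi functions\<close>

definition phi_real :: "nat \<Rightarrow> real \<Rightarrow> real" where
  "phi_real k z = integral {0..1} (\<lambda>\<theta>. \<theta> ^ (k - 1) / fact (k - 1) * exp ((1 - \<theta>) * z))"

definition coef_real :: "coefficient \<Rightarrow> real \<Rightarrow> real" where
  "coef_real cf z = (\<Sum>(\<alpha>, k, \<sigma>)\<leftarrow>cf. \<alpha> * phi_real k (\<sigma> * z))"

lemma phi_real_integrable: "(\<lambda>\<theta>::real. \<theta> ^ n / fact n * exp ((1 - \<theta>) * z)) integrable_on {0..1}"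
  by (intro integrable_continuous_real continuous_intros) auto

lemma phi_real_Suc:
  assumes "1 \<le> k"
  shows "z * phi_real (Suc k) z = phi_real k z - 1 / fact k"
proof -
  obtain m where m: "k = Suc m" using assms by (cases k) auto
  have "((\<lambda>\<theta>::real. \<theta> ^ m / fact m * exp ((1 - \<theta>) * z) - z * (\<theta> ^ k / fact k * exp ((1 - \<theta>) * z))) has_integral
     1 ^ k / fact k * exp ((1 - 1) * z) - 0 ^ k / fact k * exp ((1 - 0) * z)) {0..1}"
  proof (rule fundamental_theorem_of_calculus)
    fix x :: real
    have "((\<lambda>\<theta>. \<theta> ^ k / fact k) has_real_derivative x ^ m / fact m) (at x within {0..1})"
    proof -
      have "((\<lambda>\<theta>. \<theta> ^ k / fact k) has_real_derivative (real k * x ^ m) / fact k) (at x within {0..1})"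
        unfolding m by (rule DERIV_cdivide) (rule derivative_eq_intros refl | simp)+
      then show ?thesis by (simp add: m)
    qed
    moreover have "((\<lambda>\<theta>. exp ((1 - \<theta>) * z)) has_real_derivative exp ((1 - x) * z) * - z) (at x within {0..1})"
      by (auto intro!: derivative_eq_intros)
    ultimately have "((\<lambda>\<theta>. \<theta> ^ k / fact k * exp ((1 - \<theta>) * z)) has_real_derivative
        x ^ m / fact m * exp ((1 - x) * z) + exp ((1 - x) * z) * - z * (x ^ k / fact k)) (at x within {0..1})"
      by (rule DERIV_mult)
    then show "((\<lambda>\<theta>. \<theta> ^ k / fact k * exp ((1 - \<theta>) * z)) has_vector_derivative
       (x ^ m / fact m * exp ((1 - x) * z) - z * (x ^ k / fact k * exp ((1 - x) * z)))) (at x within {0..1})"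
      unfolding has_real_derivative_iff_has_vector_derivative
      by (rule has_vector_derivative_eq_rhs) (simp add: algebra_simps)
  qed simp
  moreover have "((\<lambda>\<theta>::real. \<theta> ^ m / fact m * exp ((1 - \<theta>) * z) - z * (\<theta> ^ k / fact k * exp ((1 - \<theta>) * z))) has_integral
     phi_real k z - z * phi_real (Suc k) z) {0..1}"
    unfolding phi_real_def m diff_Suc_1
    by (intro has_integral_diff has_integral_mult_right integrable_integral phi_real_integrable)
  ultimately have "1 ^ k / fact k * exp ((1 - 1) * z) - 0 ^ k / fact k * exp ((1 - 0) * z) = phi_real k z - z * phi_real (Suc k) z"
    by (rule has_integral_unique)
  then show ?thesis using assms by (simp add: power_0_left)
qed

lemma phi_real_1: "z * phi_real 1 z = exp z - 1"
proof -
  have "((\<lambda>\<theta>::real. z * exp ((1 - \<theta>) * z)) has_integral (- exp ((1 - 1) * z)) - (- exp ((1 - 0) * z))) {0..1}"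
  proof (rule fundamental_theorem_of_calculus)
    fix x :: real
    have "((\<lambda>\<theta>. - exp ((1 - \<theta>) * z)) has_real_derivative z * exp ((1 - x) * z)) (at x within {0..1})"
      by (auto intro!: derivative_eq_intros)
    then show "((\<lambda>\<theta>. - exp ((1 - \<theta>) * z)) has_vector_derivative z * exp ((1 - x) * z)) (at x within {0..1})"
      by (simp add: has_real_derivative_iff_has_vector_derivative)
  qed simp
  moreover have "((\<lambda>\<theta>::real. z * exp ((1 - \<theta>) * z)) has_integral z * phi_real 1 z) {0..1}"
    unfolding phi_real_def using has_integral_mult_right[OF integrable_integral[OF phi_real_integrable[of 0 z]], of z] by simp
  ultimately have "(- exp ((1 - 1) * z)) - (- exp ((1 - 0) * z)) = z * phi_real 1 z"
    by (rule has_integral_unique)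
  then show ?thesis by simp
qed

text \<open>Iterating the recursion gives the remainder of the exponential series, which shows the growth
\<open>exp z / z^k\<close> of \<open>\<phi>\<^sub>k\<close> at infinity.\<close>

lemma power_mult_phi_real: "z ^ Suc k * phi_real (Suc k) z = exp z - (\<Sum>j<Suc k. z ^ j / fact j)"
proof (induction k)
  case 0
  show ?case using phi_real_1[of z] by simp
next
  case (Suc k)
  have "z ^ Suc (Suc k) * phi_real (Suc (Suc k)) z = z ^ Suc k * (z * phi_real (Suc (Suc k)) z)" by simp
  also have "\<dots> = z ^ Suc k * phi_real (Suc k) z - z ^ Suc k / fact (Suc k)"
    unfolding phi_real_Suc[of "Suc k" z, simplified] by (simp add: algebra_simps)
  finally show ?case using Suc by simp
qed

lemma phi_real_nonneg: "0 \<le> phi_real k z"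
  unfolding phi_real_def by (rule integral_nonneg) (use phi_real_integrable[of "k - 1" z] in auto)

lemma power_mult_phi_real_le: "1 \<le> k \<Longrightarrow> 0 < z \<Longrightarrow> z ^ k * phi_real k z \<le> exp z"
  using power_mult_phi_real[of z "k - 1"] by (auto intro!: sum_nonneg)

lemma phi_real_asymptotics:
  assumes "1 \<le> k"
  shows "((\<lambda>z. exp (- z) * z ^ k * phi_real k z) \<longlongrightarrow> 1) at_top"
proof -
  have "((\<lambda>z::real. 1 - (\<Sum>j<k. (z ^ j / exp z) / fact j)) \<longlongrightarrow> 1 - (\<Sum>j<k. 0 / fact j)) at_top"
    by (intro tendsto_intros tendsto_power_div_exp_0) auto
  moreover have "1 - (\<Sum>j<k. (z ^ j / exp z) / fact j) = exp (- z) * z ^ k * phi_real k z" for z :: real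
  proof -
    have "exp (- z) * z ^ k * phi_real k z = exp (- z) * (exp z - (\<Sum>j<k. z ^ j / fact j))"
      using power_mult_phi_real[of z "k - 1"] assms by simp
    also have "\<dots> = 1 - (\<Sum>j<k. (z ^ j / exp z) / fact j)"
      by (simp add: right_diff_distrib exp_minus_inverse sum_distrib_left exp_minus divide_inverse mult_ac)
    finally show ?thesis ..
  qed
  ultimately show ?thesis by simp
qed

text \<open>The growth order of \<open>\<phi>\<^sub>k(\<sigma>z)\<close> is \<open>exp (\<sigma>z) / z^k\<close>: a larger \<open>\<sigma>\<close> wins, and for equal \<open>\<sigma>\<close> a smaller
\<open>k\<close>.\<close>

lemma phi_real_dominated:
  fixes \<sigma> \<sigma>' :: real
  assumes k: "1 \<le> k" and \<sigma>: "0 < \<sigma>" and \<sigma>': "0 < \<sigma>'"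
    and dom: "\<sigma> < \<sigma>' \<or> \<sigma> = \<sigma>' \<and> k' < k"
  shows "((\<lambda>z. exp (- (\<sigma>' * z)) * (\<sigma>' * z) ^ k' * phi_real k (\<sigma> * z)) \<longlongrightarrow> 0) at_top"
proof -
  \<comment> \<open>a majorant: exponential decay if \<open>\<sigma> < \<sigma>'\<close>, otherwise one surplus power of \<open>z\<close>\<close>
  define U where "U z = (if \<sigma> < \<sigma>' then (\<sigma>' / (\<sigma>' - \<sigma>)) ^ k' * (((\<sigma>' - \<sigma>) * z) ^ k' / exp ((\<sigma>' - \<sigma>) * z))
     else inverse (\<sigma>' * z))" for z
  have lim: "(U \<longlongrightarrow> 0) at_top"
  proof (cases "\<sigma> < \<sigma>'")
    case True
    have "filterlim (\<lambda>z. (\<sigma>' - \<sigma>) * z) at_top at_top"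
      using True by (intro filterlim_tendsto_pos_mult_at_top[OF tendsto_const _ filterlim_ident]) auto
    from filterlim_compose[OF tendsto_power_div_exp_0 this, of k']
    have "((\<lambda>z. ((\<sigma>' - \<sigma>) * z) ^ k' / exp ((\<sigma>' - \<sigma>) * z)) \<longlongrightarrow> 0) at_top" .
    from tendsto_mult_right_zero[OF this] show ?thesis unfolding U_def using True by simp
  next
    case False
    have "filterlim (\<lambda>z. \<sigma>' * z) at_top at_top"
      using \<sigma>' by (intro filterlim_tendsto_pos_mult_at_top[OF tendsto_const _ filterlim_ident]) auto
    from tendsto_inverse_0_at_top[OF this] show ?thesis unfolding U_def using False by simp
  qed
  have ev: "\<forall>\<^sub>F z in at_top. norm (exp (- (\<sigma>' * z)) * (\<sigma>' * z) ^ k' * phi_real k (\<sigma> * z)) \<le> U z"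
    using eventually_ge_at_top[of "max (1 / \<sigma>) (1 / \<sigma>')"]
  proof eventually_elim
    case (elim z)
    have "1 / \<sigma> \<le> z" "1 / \<sigma>' \<le> z" using elim by auto
    then have s: "1 \<le> \<sigma> * z" "1 \<le> \<sigma>' * z" using \<sigma> \<sigma>' by (simp_all add: divide_le_eq mult.commute)
    have ph: "phi_real k (\<sigma> * z) \<le> exp (\<sigma> * z) / (\<sigma> * z) ^ k"
      using power_mult_phi_real_le[OF k, of "\<sigma> * z"] s by (simp add: le_divide_eq mult.commute)
    have "norm (exp (- (\<sigma>' * z)) * (\<sigma>' * z) ^ k' * phi_real k (\<sigma> * z)) = exp (- (\<sigma>' * z)) * (\<sigma>' * z) ^ k' * phi_real k (\<sigma> * z)"
      using s phi_real_nonneg[of k "\<sigma> * z"] by simp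
    also have "\<dots> \<le> exp (- (\<sigma>' * z)) * (\<sigma>' * z) ^ k' * (exp (\<sigma> * z) / (\<sigma> * z) ^ k)"
      using s by (intro mult_left_mono ph) auto
    also have "\<dots> \<le> U z"
    proof (cases "\<sigma> < \<sigma>'")
      case True
      have p: "1 \<le> (\<sigma> * z) ^ k" using s by simp
      have "exp (- (\<sigma>' * z)) * (\<sigma>' * z) ^ k' * (exp (\<sigma> * z) / (\<sigma> * z) ^ k) \<le> exp (- (\<sigma>' * z)) * (\<sigma>' * z) ^ k' * (exp (\<sigma> * z) / 1)"
        using s p by (intro mult_left_mono divide_left_mono) auto
      also have "\<dots> = (\<sigma>' * z) ^ k' * (exp (\<sigma> * z) * exp (- (\<sigma>' * z)))" by simp
      also have "exp (\<sigma> * z) * exp (- (\<sigma>' * z)) = inverse (exp ((\<sigma>' - \<sigma>) * z))"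
        by (simp add: exp_add[symmetric] exp_minus[symmetric] algebra_simps)
      also have "(\<sigma>' * z) ^ k' * inverse (exp ((\<sigma>' - \<sigma>) * z)) = U z"
        using True by (simp add: U_def divide_inverse[symmetric] power_mult_distrib power_divide)
      finally show ?thesis .
    next
      case False
      then have eq: "\<sigma> = \<sigma>'" and kk: "k' < k" using dom by auto
      have "exp (- (\<sigma>' * z)) * (\<sigma>' * z) ^ k' * (exp (\<sigma> * z) / (\<sigma> * z) ^ k) = (\<sigma>' * z) ^ k' / (\<sigma>' * z) ^ k"
        unfolding eq by (simp add: exp_minus)
      also have "\<dots> = inverse ((\<sigma>' * z) ^ (k - k'))"
      proof -
        have "(\<sigma>' * z) ^ k = (\<sigma>' * z) ^ k' * (\<sigma>' * z) ^ (k - k')" using kk by (simp add: power_add[symmetric])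
        moreover have "\<sigma>' * z \<noteq> 0" using s by linarith
        then have ne: "(\<sigma>' * z) ^ k' \<noteq> 0" by (rule power_not_zero)
        ultimately show ?thesis by (simp only: nonzero_divide_mult_cancel_left[OF ne] inverse_eq_divide)
      qed
      also have "\<dots> \<le> inverse ((\<sigma>' * z) ^ 1)"
        using s kk by (intro le_imp_inverse_le power_increasing) auto
      finally show ?thesis using False by (simp add: U_def)
    qed
    finally show ?case .
  qed
  show ?thesis by (rule Lim_null_comparison[OF ev lim])
qed

text \<open>Divide a vanishing linear combination by the dominant function (largest \<open>\<sigma>\<close>, then smallest \<open>k\<close>)
and let \<open>z\<close> tend to infinity: its coefficient is \<open>0\<close>. Then remove it and repeat. The coefficients are
vectors, because in the order conditions they are values of other operators.\<close>

lemma phi_real_independent: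
  fixes Y :: "nat \<times> real \<Rightarrow> 'b::real_normed_vector"
  assumes "finite \<Gamma>" and "\<And>k \<sigma>. (k, \<sigma>) \<in> \<Gamma> \<Longrightarrow> 1 \<le> k \<and> 0 < \<sigma>"
    and "\<And>z. 0 < z \<Longrightarrow> (\<Sum>(k, \<sigma>)\<in>\<Gamma>. phi_real k (\<sigma> * z) *\<^sub>R Y (k, \<sigma>)) = 0"
  shows "\<forall>\<gamma>\<in>\<Gamma>. Y \<gamma> = 0"
  using assms
proof (induction "card \<Gamma>" arbitrary: \<Gamma>)
  case 0
  then show ?case by simp
next
  case (Suc n)
  have ne: "\<Gamma> \<noteq> {}" using Suc.hyps(2) by auto
  define s where "s = Max (snd ` \<Gamma>)"
  have fin: "finite (snd ` \<Gamma>)" using Suc.prems(1) by simp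
  have s_in: "s \<in> snd ` \<Gamma>" unfolding s_def by (rule Max_in[OF fin]) (use ne in simp)
  have s_max: "\<sigma> \<le> s" if "(k, \<sigma>) \<in> \<Gamma>" for k \<sigma>
    unfolding s_def by (rule Max_ge[OF fin]) (use that in force)
  define \<Lambda> where "\<Lambda> = {k. (k, s) \<in> \<Gamma>}"
  have "\<Lambda> \<subseteq> fst ` \<Gamma>" unfolding \<Lambda>_def by force
  then have fin\<Lambda>: "finite \<Lambda>" using Suc.prems(1) finite_subset by blast
  have ne\<Lambda>: "\<Lambda> \<noteq> {}" using s_in unfolding \<Lambda>_def by force
  define m where "m = Min \<Lambda>"
  have m_in: "(m, s) \<in> \<Gamma>" using Min_in[OF fin\<Lambda> ne\<Lambda>] unfolding m_def \<Lambda>_def by simp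
  have m_min: "m \<le> k" if "(k, s) \<in> \<Gamma>" for k
    unfolding m_def by (rule Min_le[OF fin\<Lambda>]) (use that in \<open>simp add: \<Lambda>_def\<close>)
  have ms: "1 \<le> m" "0 < s" using Suc.prems(2)[OF m_in] by auto
  define c where "c z = exp (- (s * z)) * (s * z) ^ m" for z
  have top: "filterlim (\<lambda>z. s * z) at_top at_top"
    using ms by (intro filterlim_tendsto_pos_mult_at_top[OF tendsto_const _ filterlim_ident]) auto
  have lim_main: "((\<lambda>z. c z * phi_real m (s * z)) \<longlongrightarrow> 1) at_top"
    unfolding c_def using filterlim_compose[OF phi_real_asymptotics[OF ms(1)] top] .
  have lim_other: "((\<lambda>z. (c z * phi_real (fst \<gamma>) (snd \<gamma> * z)) *\<^sub>R Y \<gamma>) \<longlongrightarrow> 0) at_top" if \<gamma>: "\<gamma> \<in> \<Gamma> - {(m, s)}" for \<gamma>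
  proof -
    obtain k \<sigma> where g: "\<gamma> = (k, \<sigma>)" by (cases \<gamma>)
    have kg: "(k, \<sigma>) \<in> \<Gamma>" "(k, \<sigma>) \<noteq> (m, s)" using \<gamma> g by auto
    have "\<sigma> < s \<or> \<sigma> = s \<and> m < k"
    proof (cases "\<sigma> = s")
      case True
      then have "m \<le> k" "k \<noteq> m" using m_min[of k] kg by auto
      then show ?thesis using True by simp
    next
      case False
      then show ?thesis using s_max[OF kg(1)] by simp
    qed
    then have "((\<lambda>z. c z * phi_real k (\<sigma> * z)) \<longlongrightarrow> 0) at_top"
      unfolding c_def using Suc.prems(2)[OF kg(1)] ms by (intro phi_real_dominated) auto
    from tendsto_scaleR[OF this tendsto_const[of "Y \<gamma>"]] show ?thesis by (simp add: g)
  qed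
  have split: "(\<Sum>(k, \<sigma>)\<in>\<Gamma>. phi_real k (\<sigma> * z) *\<^sub>R Y (k, \<sigma>)) =
      phi_real m (s * z) *\<^sub>R Y (m, s) + (\<Sum>(k, \<sigma>)\<in>\<Gamma> - {(m, s)}. phi_real k (\<sigma> * z) *\<^sub>R Y (k, \<sigma>))" for z
    by (subst sum.remove[OF Suc.prems(1) m_in]) simp
  have "((\<lambda>z. (c z * phi_real m (s * z)) *\<^sub>R Y (m, s) +
     (\<Sum>\<gamma>\<in>\<Gamma> - {(m, s)}. (c z * phi_real (fst \<gamma>) (snd \<gamma> * z)) *\<^sub>R Y \<gamma>)) \<longlongrightarrow> 1 *\<^sub>R Y (m, s) + (\<Sum>\<gamma>\<in>\<Gamma> - {(m, s)}. 0)) at_top"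
    by (intro tendsto_add tendsto_scaleR lim_main tendsto_const tendsto_sum lim_other)
  moreover have "\<forall>\<^sub>F z in at_top. (c z * phi_real m (s * z)) *\<^sub>R Y (m, s) +
     (\<Sum>\<gamma>\<in>\<Gamma> - {(m, s)}. (c z * phi_real (fst \<gamma>) (snd \<gamma> * z)) *\<^sub>R Y \<gamma>) = 0"
    using eventually_gt_at_top[of 0]
  proof eventually_elim
    case (elim z)
    have "c z *\<^sub>R (\<Sum>(k, \<sigma>)\<in>\<Gamma>. phi_real k (\<sigma> * z) *\<^sub>R Y (k, \<sigma>)) = 0" using Suc.prems(3)[OF elim] by simp
    then show ?case unfolding split by (simp add: scaleR_add_right scaleR_sum_right case_prod_unfold)
  qed
  ultimately have "((\<lambda>z::real. 0) \<longlongrightarrow> Y (m, s)) at_top" using Lim_transform_eventually by fastforce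
  then have Y0: "Y (m, s) = 0" using tendsto_unique[OF _ _ tendsto_const] trivial_limit_at_top_linorder by blast
  have "\<forall>\<gamma>\<in>\<Gamma> - {(m, s)}. Y \<gamma> = 0"
  proof (rule Suc.hyps(1))
    show "n = card (\<Gamma> - {(m, s)})" using Suc.hyps(2) m_in Suc.prems(1) by simp
    show "finite (\<Gamma> - {(m, s)})" using Suc.prems(1) by simp
    fix k \<sigma> assume "(k, \<sigma>) \<in> \<Gamma> - {(m, s)}" then show "1 \<le> k \<and> 0 < \<sigma>" using Suc.prems(2) by blast
  next
    fix z :: real assume "0 < z"
    then show "(\<Sum>(k, \<sigma>)\<in>\<Gamma> - {(m, s)}. phi_real k (\<sigma> * z) *\<^sub>R Y (k, \<sigma>)) = 0"
      using Suc.prems(3)[of z] unfolding split Y0 by simp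
  qed
  then show ?case using Y0 by blast
qed

text \<open>A coefficient list may contain the same function several times; this is its total coefficient.\<close>

definition coef_weight :: "coefficient \<Rightarrow> nat \<times> real \<Rightarrow> real" where
  "coef_weight cf \<gamma> = (\<Sum>(\<alpha>, k, \<sigma>)\<leftarrow>cf. if (k, \<sigma>) = \<gamma> then \<alpha> else 0)"

lemma sum_coefficient_regroup:
  fixes F :: "nat \<Rightarrow> real \<Rightarrow> 'b::real_vector"
  assumes "finite \<Gamma>" "snd ` set cf \<subseteq> \<Gamma>"
  shows "(\<Sum>(\<alpha>, k, \<sigma>)\<leftarrow>cf. \<alpha> *\<^sub>R F k \<sigma>) = (\<Sum>\<gamma>\<in>\<Gamma>. coef_weight cf \<gamma> *\<^sub>R F (fst \<gamma>) (snd \<gamma>))"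
  using assms(2)
proof (induction cf)
  case Nil
  show ?case by (simp add: coef_weight_def)
next
  case (Cons c cf)
  obtain \<alpha> k \<sigma> where c: "c = (\<alpha>, k, \<sigma>)" by (cases c)
  have "(\<Sum>\<gamma>\<in>\<Gamma>. coef_weight (c # cf) \<gamma> *\<^sub>R F (fst \<gamma>) (snd \<gamma>)) =
     (\<Sum>\<gamma>\<in>\<Gamma>. (if (k, \<sigma>) = \<gamma> then \<alpha> *\<^sub>R F (fst \<gamma>) (snd \<gamma>) else 0) + coef_weight cf \<gamma> *\<^sub>R F (fst \<gamma>) (snd \<gamma>))"
    by (intro sum.cong) (auto simp: c coef_weight_def scaleR_left_distrib)
  also have "\<dots> = \<alpha> *\<^sub>R F k \<sigma> + (\<Sum>\<gamma>\<in>\<Gamma>. coef_weight cf \<gamma> *\<^sub>R F (fst \<gamma>) (snd \<gamma>))"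
    using Cons.prems assms(1) by (simp add: sum.distrib c)
  finally show ?case using Cons by (simp add: c)
qed

text \<open>By linear independence, a vanishing combination \<open>\<Sum>\<^sub>i cf\<^sub>i(z) y\<^sub>i\<close> vanishes separately for each function
\<open>\<phi>\<^sub>k(\<sigma>z)\<close> that occurs. Therefore any linear map may be substituted for each of these functions.\<close>

lemma coefficient_transfer:
  fixes y :: "'i \<Rightarrow> 'b::real_normed_vector" and q :: "nat \<Rightarrow> real \<Rightarrow> 'b \<Rightarrow> 'c::real_vector"
  assumes I: "finite I" and adm: "\<And>i. i \<in> I \<Longrightarrow> admissible (cf i)"
    and zero: "\<And>z. (\<Sum>i\<in>I. coef_real (cf i) z *\<^sub>R y i) = 0"
    and lin: "\<And>k \<sigma>. 1 \<le> k \<Longrightarrow> 0 < \<sigma> \<Longrightarrow> linear (q k \<sigma>)"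
  shows "(\<Sum>i\<in>I. \<Sum>(\<alpha>, k, \<sigma>)\<leftarrow>cf i. \<alpha> *\<^sub>R q k \<sigma> (y i)) = 0"
proof -
  define \<Gamma> where "\<Gamma> = (\<Union>i\<in>I. snd ` set (cf i))"
  have fin: "finite \<Gamma>" using I by (simp add: \<Gamma>_def)
  have sub: "snd ` set (cf i) \<subseteq> \<Gamma>" if "i \<in> I" for i using that by (auto simp: \<Gamma>_def)
  have pos: "1 \<le> k \<and> 0 < \<sigma>" if "(k, \<sigma>) \<in> \<Gamma>" for k \<sigma>
    using that adm unfolding \<Gamma>_def admissible_def by fastforce
  define Y where "Y \<gamma> = (\<Sum>i\<in>I. coef_weight (cf i) \<gamma> *\<^sub>R y i)" for \<gamma>
  have "\<forall>\<gamma>\<in>\<Gamma>. Y \<gamma> = 0"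
  proof (rule phi_real_independent[OF fin pos])
    fix z :: real
    have "0 = (\<Sum>i\<in>I. (\<Sum>(\<alpha>, k, \<sigma>)\<leftarrow>cf i. \<alpha> *\<^sub>R phi_real k (\<sigma> * z)) *\<^sub>R y i)"
      using zero[of z] by (simp add: coef_real_def)
    also have "\<dots> = (\<Sum>i\<in>I. \<Sum>\<gamma>\<in>\<Gamma>. (coef_weight (cf i) \<gamma> * phi_real (fst \<gamma>) (snd \<gamma> * z)) *\<^sub>R y i)"
      by (intro sum.cong refl) (simp add: sum_coefficient_regroup[OF fin sub] scaleR_sum_left del: real_scaleR_def, simp)
    also have "\<dots> = (\<Sum>\<gamma>\<in>\<Gamma>. \<Sum>i\<in>I. (coef_weight (cf i) \<gamma> * phi_real (fst \<gamma>) (snd \<gamma> * z)) *\<^sub>R y i)" by (rule sum.swap)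
    also have "\<dots> = (\<Sum>(k, \<sigma>)\<in>\<Gamma>. phi_real k (\<sigma> * z) *\<^sub>R Y (k, \<sigma>))"
      by (intro sum.cong refl) (auto simp: Y_def scaleR_sum_right mult.commute)
    finally show "(\<Sum>(k, \<sigma>)\<in>\<Gamma>. phi_real k (\<sigma> * z) *\<^sub>R Y (k, \<sigma>)) = 0" by simp
  qed auto
  moreover have "(\<Sum>i\<in>I. \<Sum>(\<alpha>, k, \<sigma>)\<leftarrow>cf i. \<alpha> *\<^sub>R q k \<sigma> (y i)) = (\<Sum>\<gamma>\<in>\<Gamma>. q (fst \<gamma>) (snd \<gamma>) (Y \<gamma>))"
  proof -
    have "(\<Sum>i\<in>I. \<Sum>(\<alpha>, k, \<sigma>)\<leftarrow>cf i. \<alpha> *\<^sub>R q k \<sigma> (y i)) = (\<Sum>i\<in>I. \<Sum>\<gamma>\<in>\<Gamma>. coef_weight (cf i) \<gamma> *\<^sub>R q (fst \<gamma>) (snd \<gamma>) (y i))"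
      by (intro sum.cong refl) (rule sum_coefficient_regroup[OF fin sub, where F = "\<lambda>k \<sigma>. q k \<sigma> (y _)"])
    also have "\<dots> = (\<Sum>\<gamma>\<in>\<Gamma>. \<Sum>i\<in>I. coef_weight (cf i) \<gamma> *\<^sub>R q (fst \<gamma>) (snd \<gamma>) (y i))" by (rule sum.swap)
    also have "\<dots> = (\<Sum>\<gamma>\<in>\<Gamma>. q (fst \<gamma>) (snd \<gamma>) (Y \<gamma>))"
    proof (intro sum.cong refl)
      fix \<gamma> assume "\<gamma> \<in> \<Gamma>"
      then have l: "linear (q (fst \<gamma>) (snd \<gamma>))" using pos[of "fst \<gamma>" "snd \<gamma>"] lin by simp
      show "(\<Sum>i\<in>I. coef_weight (cf i) \<gamma> *\<^sub>R q (fst \<gamma>) (snd \<gamma>) (y i)) = q (fst \<gamma>) (snd \<gamma>) (Y \<gamma>)"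
        unfolding Y_def linear_sum[OF l] linear_scale[OF l] ..
    qed
    finally show ?thesis .
  qed
  moreover have "q (fst \<gamma>) (snd \<gamma>) 0 = 0" if "\<gamma> \<in> \<Gamma>" for \<gamma>
    using pos[of "fst \<gamma>" "snd \<gamma>"] that by (intro linear_0 lin) auto
  ultimately show ?thesis by simp
qed

lemma (in analytic_generator) coef_op_transfer:
  assumes h: "h \<ge> 0" and I: "finite I" and adm: "\<And>i. i \<in> I \<Longrightarrow> admissible (cf i)"
    and zero: "\<And>z. (\<Sum>i\<in>I. coef_real (cf i) z *\<^sub>R y i) = 0"
  shows "(\<Sum>i\<in>I. coef_op S (cf i) h (y i)) = 0"
  unfolding coef_op_def
  by (rule coefficient_transfer[OF I adm zero]) (use h in \<open>auto intro: phi_linear\<close>)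

section \<open>Scalar form of the matrix order conditions\<close>

definition dmat :: "nat \<Rightarrow> (nat \<Rightarrow> real) \<Rightarrow> real mat" where
  "dmat d f = Matrix.mat d d (\<lambda>(r, q). if r = q then f r else 0)"

text \<open>Multiplication by the nilpotent shift moves from row \<open>r\<close> to row \<open>r + 1\<close>. In an alternating product
of diagonal matrices and shifts each diagonal factor is therefore evaluated in a different row.\<close>

definition shift_mat :: "nat \<Rightarrow> real mat" where
  "shift_mat d = Matrix.mat d d (\<lambda>(r, q). if q = Suc r then 1 else 0)"

lemma dmat_carrier [simp]: "dmat d f \<in> carrier_mat d d"
  and shift_carrier [simp]: "shift_mat d \<in> carrier_mat d d"
  by (simp_all add: dmat_def shift_mat_def)

lemma dmat_index: "r < d \<Longrightarrow> q < d \<Longrightarrow> dmat d f $$ (r, q) = (if r = q then f r else 0)"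
  by (simp add: dmat_def)

lemma dmat_mult_index:
  assumes B: "B \<in> carrier_mat d d" and r: "r < d" and q: "q < d"
  shows "(dmat d f * B) $$ (r, q) = f r * B $$ (r, q)"
proof -
  have "(dmat d f * B) $$ (r, q) = (\<Sum>i<d. dmat d f $$ (r, i) * B $$ (i, q))"
    using B r q by (simp add: scalar_prod_def dmat_def lessThan_atLeast0)
  also have "\<dots> = (\<Sum>i<d. if i = r then f r * B $$ (r, q) else 0)"
    using r by (intro sum.cong) (auto simp: dmat_index)
  finally show ?thesis using r by simp
qed

lemma shift_mult_index:
  assumes B: "B \<in> carrier_mat d d" and r: "Suc r < d" and q: "q < d"
  shows "(shift_mat d * B) $$ (r, q) = B $$ (Suc r, q)"
proof -
  have "(shift_mat d * B) $$ (r, q) = (\<Sum>i<d. shift_mat d $$ (r, i) * B $$ (i, q))"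
    using B r q by (simp add: scalar_prod_def shift_mat_def lessThan_atLeast0)
  also have "\<dots> = (\<Sum>i<d. if i = Suc r then B $$ (Suc r, q) else 0)"
    using r by (intro sum.cong) (auto simp: shift_mat_def)
  finally show ?thesis using r by simp
qed

lemma dmat_shift_mult_index:
  assumes B: "B \<in> carrier_mat d d" and r: "Suc r < d" and q: "q < d"
  shows "(dmat d f * shift_mat d * B) $$ (r, q) = f r * B $$ (Suc r, q)"
    and "(dmat d f * (c \<cdot>\<^sub>m shift_mat d) * B) $$ (r, q) = f r * c * B $$ (Suc r, q)"
proof -
  show 1: "(dmat d f * shift_mat d * B) $$ (r, q) = f r * B $$ (Suc r, q)"
    using B r q
    by (subst assoc_mult_mat[of _ d d _ d _ d]) (auto simp: dmat_mult_index shift_mult_index mult_carrier_mat[of _ d d _ d])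
  have "dmat d f * (c \<cdot>\<^sub>m shift_mat d) * B = c \<cdot>\<^sub>m (dmat d f * shift_mat d * B)"
    using mult_smult_distrib[OF dmat_carrier shift_carrier]
      mult_smult_assoc_mat[OF mult_carrier_mat[OF dmat_carrier shift_carrier] B] by simp
  moreover have "r < dim_row (dmat d f * shift_mat d * B)" "q < dim_col (dmat d f * shift_mat d * B)"
    using B r q by (auto simp: dmat_def)
  ultimately show "(dmat d f * (c \<cdot>\<^sub>m shift_mat d) * B) $$ (r, q) = f r * c * B $$ (Suc r, q)"
    using 1 by simp
qed

lemma smult_dmat: "c \<cdot>\<^sub>m dmat d f = dmat d (\<lambda>r. c * f r)"
  by (rule eq_matI) (auto simp: dmat_def)

lemma dmat_mult: "dmat d f * dmat d g = dmat d (\<lambda>r. f r * g r)"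
proof (rule eq_matI)
  fix i j assume "i < dim_row (dmat d (\<lambda>r. f r * g r))" "j < dim_col (dmat d (\<lambda>r. f r * g r))"
  then have "i < d" "j < d" by (auto simp: dmat_def)
  then show "(dmat d f * dmat d g) $$ (i, j) = dmat d (\<lambda>r. f r * g r) $$ (i, j)"
    by (simp add: dmat_mult_index dmat_index)
qed (auto simp: dmat_def)

lemma pow_dmat: "dmat d f ^\<^sub>m m = dmat d (\<lambda>r. f r ^ m)"
proof (induction m)
  case 0
  show ?case by (rule eq_matI) (auto simp: dmat_def)
next
  case (Suc m)
  then show ?case by (simp add: dmat_mult mult.commute)
qed

lemma mat_exp_dmat: "mat_exp d (dmat d f) = dmat d (\<lambda>r. exp (f r))"
proof (rule eq_matI)
  fix i j assume "i < dim_row (dmat d (\<lambda>r. exp (f r)))" "j < dim_col (dmat d (\<lambda>r. exp (f r)))"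
  then have ij: "i < d" "j < d" by (auto simp: dmat_def)
  show "mat_exp d (dmat d f) $$ (i, j) = dmat d (\<lambda>r. exp (f r)) $$ (i, j)"
    using ij by (auto simp: mat_exp_def pow_dmat dmat_index exp_def divide_inverse mult.commute)
qed (auto simp: dmat_def mat_exp_def)

lemma phi_mat_dmat: "phi_mat d k (dmat d f) = dmat d (\<lambda>r. phi_real k (f r))"
proof (rule eq_matI)
  fix i j assume "i < dim_row (dmat d (\<lambda>r. phi_real k (f r)))" "j < dim_col (dmat d (\<lambda>r. phi_real k (f r)))"
  then have ij: "i < d" "j < d" by (auto simp: dmat_def)
  show "phi_mat d k (dmat d f) $$ (i, j) = dmat d (\<lambda>r. phi_real k (f r)) $$ (i, j)"
    using ij by (auto simp: phi_mat_def smult_dmat mat_exp_dmat dmat_index phi_real_def)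
qed (auto simp: dmat_def phi_mat_def)

lemma coef_mat_dmat: "coef_mat d cf (dmat d f) = dmat d (\<lambda>r. coef_real cf (f r))"
proof (rule eq_matI)
  fix i j assume "i < dim_row (dmat d (\<lambda>r. coef_real cf (f r)))" "j < dim_col (dmat d (\<lambda>r. coef_real cf (f r)))"
  then have ij: "i < d" "j < d" by (auto simp: dmat_def)
  have "sum_list (map (\<lambda>(\<alpha>, k, \<sigma>). \<alpha> * dmat d (\<lambda>r. phi_real k (\<sigma> * f r)) $$ (i, j)) cf)
     = (if i = j then coef_real cf (f i) else 0)"
    unfolding coef_real_def using ij by (induction cf) (auto simp: dmat_index)
  then show "coef_mat d cf (dmat d f) $$ (i, j) = dmat d (\<lambda>r. coef_real cf (f r)) $$ (i, j)"
    using ij by (simp add: coef_mat_def smult_dmat phi_mat_dmat dmat_index)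
qed (auto simp: dmat_def coef_mat_def)

definition scale_coef :: "real \<Rightarrow> coefficient \<Rightarrow> coefficient" where
  "scale_coef c cf = map (\<lambda>(\<alpha>, k, \<sigma>). (c * \<alpha>, k, \<sigma>)) cf"

text \<open>The functions \<open>\<psi>\<^sub>q\<close> and \<open>\<psi>\<^sub>q\<^sub>,\<^sub>i\<close> as coefficient lists. Both are defects of a row \<open>rw\<close> of the scheme with
node \<open>c\<close>, whose sum runs over the stages below \<open>n\<close>: a stage has \<open>n = i\<close> and \<open>c = c\<^sub>i\<close>, the final row has
\<open>n = s + 1\<close> and \<open>c = 1\<close>.\<close>

definition defect_coef :: "erk_method \<Rightarrow> (nat \<Rightarrow> coefficient) \<Rightarrow> nat \<Rightarrow> real \<Rightarrow> nat \<Rightarrow> coefficient" where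
  "defect_coef M rw n c q = (- (c ^ q), q, c) #
     concat (map (\<lambda>k. scale_coef (node M k ^ (q - 1) / fact (q - 1)) (rw k)) [2..<n])"

abbreviation "stage_defect M q i \<equiv> defect_coef M (acoef M i) i (node M i) q"
abbreviation "final_defect M q \<equiv> defect_coef M (bcoef M) (Suc (stages M)) 1 q"

lemma coef_sum_append:
  fixes F :: "real \<times> nat \<times> real \<Rightarrow> 'b::real_vector"
  shows "(\<Sum>c\<leftarrow>concat (map G ks). F c) = (\<Sum>k\<leftarrow>ks. \<Sum>c\<leftarrow>G k. F c)"
  by (induction ks) auto

lemma scale_coef_sum:
  fixes F :: "nat \<Rightarrow> real \<Rightarrow> 'b::real_vector"
  shows "(\<Sum>(\<alpha>, k, \<sigma>)\<leftarrow>scale_coef c cf. \<alpha> *\<^sub>R F k \<sigma>) = c *\<^sub>R (\<Sum>(\<alpha>, k, \<sigma>)\<leftarrow>cf. \<alpha> *\<^sub>R F k \<sigma>)"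
  by (induction cf) (auto simp: scale_coef_def scaleR_add_right)

lemma defect_coef_sum:
  fixes F :: "nat \<Rightarrow> real \<Rightarrow> 'b::real_vector"
  shows "(\<Sum>(\<alpha>, k, \<sigma>)\<leftarrow>defect_coef M rw n c q. \<alpha> *\<^sub>R F k \<sigma>) =
     (\<Sum>k\<in>{2..<n}. (node M k ^ (q - 1) / fact (q - 1)) *\<^sub>R (\<Sum>(\<alpha>, k, \<sigma>)\<leftarrow>rw k. \<alpha> *\<^sub>R F k \<sigma>)) - (c ^ q) *\<^sub>R F q c"
  unfolding defect_coef_def
  by (simp add: coef_sum_append scale_coef_sum sum_list_distinct_conv_sum_set)

lemma coef_real_defect:
  "coef_real (defect_coef M rw n c q) z =
     (\<Sum>k\<in>{2..<n}. (node M k ^ (q - 1) / fact (q - 1)) * coef_real (rw k) z) - c ^ q * phi_real q (c * z)"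
  using defect_coef_sum[of "\<lambda>k \<sigma>. phi_real k (\<sigma> * z)" M rw n c q] by (simp add: coef_real_def)

lemma coef_op_defect:
  "coef_op S (defect_coef M rw n c q) h x =
     (\<Sum>k\<in>{2..<n}. (node M k ^ (q - 1) / fact (q - 1)) *\<^sub>R coef_op S (rw k) h x) - c ^ q *\<^sub>R phi_op S q (c * h) x"
  using defect_coef_sum[of "\<lambda>k \<sigma>. phi_op S k (\<sigma> * h) x" M rw n c q] by (simp add: coef_op_def)

lemma mat_sum_dmat: "mat_sum d I (\<lambda>i. dmat d (f i)) = dmat d (\<lambda>r. \<Sum>i\<in>I. f i r)"
  by (rule eq_matI) (auto simp: mat_sum_def dmat_def)

lemma minus_dmat: "dmat d f - dmat d g = dmat d (\<lambda>r. f r - g r)"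
  by (rule eq_matI) (auto simp: dmat_def)

lemma psi_stage_dmat: "psi_stage M d q i (dmat d f) = dmat d (\<lambda>r. coef_real (stage_defect M q i) (f r))"
  by (simp add: psi_stage_def a_mat_def coef_mat_dmat smult_dmat phi_mat_dmat mat_sum_dmat minus_dmat coef_real_defect)

lemma psi_dmat: "psi M d q (dmat d f) = dmat d (\<lambda>r. coef_real (final_defect M q) (f r))"
  by (simp add: psi_def b_mat_def coef_mat_dmat smult_dmat phi_mat_dmat mat_sum_dmat minus_dmat coef_real_defect
      atLeastLessThanSuc_atLeastAtMost)

lemma b_mat_dmat: "b_mat M d i (dmat d f) = dmat d (\<lambda>r. coef_real (bcoef M i) (f r))"
  and a_mat_dmat: "a_mat M d i j (dmat d f) = dmat d (\<lambda>r. coef_real (acoef M i j) (f r))"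
  by (simp_all add: b_mat_def a_mat_def coef_mat_dmat)

lemma mat_sum_carrier [simp]: "mat_sum d I N \<in> carrier_mat d d"
  and mat_sum_index: "r < d \<Longrightarrow> q < d \<Longrightarrow> mat_sum d I N $$ (r, q) = (\<Sum>i\<in>I. N i $$ (r, q))"
  by (simp_all add: mat_sum_def)

lemma psi_condition_real: "psi_condition M q \<Longrightarrow> coef_real (final_defect M q) z = 0"
proof -
  assume "psi_condition M q"
  then have "psi M 1 q (dmat 1 (\<lambda>_. z)) = 0\<^sub>m 1 1" unfolding psi_condition_def by (meson dmat_carrier)
  then have "dmat 1 (\<lambda>r. coef_real (final_defect M q) z) $$ (0, 0) = 0\<^sub>m 1 1 $$ (0, 0)" unfolding psi_dmat by (rule arg_cong)
  then show ?thesis by (simp add: dmat_index)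
qed

lemma weak_psi_condition_real: "weak_psi_condition M q \<Longrightarrow> coef_real (final_defect M q) 0 = 0"
proof -
  assume "weak_psi_condition M q"
  then have "psi M 1 q (0\<^sub>m 1 1) = 0\<^sub>m 1 1" unfolding weak_psi_condition_def by blast
  moreover have "0\<^sub>m 1 1 = dmat 1 (\<lambda>_. 0)" by (rule eq_matI) (auto simp: dmat_def)
  ultimately have "psi M 1 q (dmat 1 (\<lambda>_. 0)) = 0\<^sub>m 1 1" by simp
  then have "dmat 1 (\<lambda>r. coef_real (final_defect M q) 0) $$ (0, 0) = 0\<^sub>m 1 1 $$ (0, 0)" unfolding psi_dmat by (rule arg_cong)
  then show ?thesis by (simp add: dmat_index)
qed

definition pick4 :: "real \<Rightarrow> real \<Rightarrow> real \<Rightarrow> real \<Rightarrow> nat \<Rightarrow> real" where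
  "pick4 w x y z r = (if r = 0 then w else if r = 1 then x else if r = 2 then y else z)"

lemma pick4_simps [simp]: "pick4 w x y z 0 = w" "pick4 w x y z (Suc 0) = x" "pick4 w x y z 2 = y" "pick4 w x y z 3 = z"
  "pick4 w x y z (Suc (Suc 0)) = y" "pick4 w x y z (Suc (Suc (Suc 0))) = z"
  by (auto simp: pick4_def)

context
  fixes M :: erk_method
  assumes c3: "coupling_conditions_3 M"
begin
text \<open>Here and in the next two lemmas the diagonal of \<open>Z\<close> carries the independent variables and every linear
map is the shift. The entry \<open>(0, m)\<close> of a product with \<open>m\<close> shifts evaluates the \<open>r\<close>-th function at
\<open>z\<^sub>r\<close>.\<close>

lemma tensor_condition_3:
  "(\<Sum>i\<in>{2..stages M}. coef_real (bcoef M i) z0 * coef_real (stage_defect M 2 i) z1) = 0"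
proof -
  let ?Z = "dmat 2 (pick4 z0 z1 0 0)"
  have "mat_sum 2 {2..stages M} (\<lambda>i. b_mat M 2 i ?Z * shift_mat 2 * psi_stage M 2 2 i ?Z) = 0\<^sub>m 2 2"
    using c3 unfolding coupling_conditions_3_def by (meson dmat_carrier shift_carrier)
  then have "mat_sum 2 {2..stages M} (\<lambda>i. b_mat M 2 i ?Z * shift_mat 2 * psi_stage M 2 2 i ?Z) $$ (0, 1) = 0\<^sub>m 2 2 $$ (0, 1)" by simp
  then show ?thesis by (simp add: mat_sum_index b_mat_dmat psi_stage_dmat dmat_shift_mult_index dmat_index)
qed
end

context
  fixes M :: erk_method
  assumes c4: "coupling_conditions_4 M"
begin
lemma tensor_conditions_4:
  "(\<Sum>i\<in>{2..stages M}. coef_real (bcoef M i) z0 * coef_real (stage_defect M 3 i) z1) = 0"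
  "(\<Sum>i\<in>{2..stages M}. coef_real (bcoef M i) z0 * (\<Sum>j\<in>{2..<i}. coef_real (acoef M i j) z1 * coef_real (stage_defect M 2 j) z2)) = 0"
  "(\<Sum>i\<in>{2..stages M}. coef_real (bcoef M i) z0 * node M i * coef_real (stage_defect M 2 i) z1) = 0"
proof -
  let ?Z = "dmat 3 (pick4 z0 z1 z2 0)"
  let ?N = "shift_mat 3"
  let ?m1 = "mat_sum 3 {2..stages M} (\<lambda>i. b_mat M 3 i ?Z * ?N * psi_stage M 3 3 i ?Z)"
  let ?m2 = "mat_sum 3 {2..stages M} (\<lambda>i. b_mat M 3 i ?Z * ?N * mat_sum 3 {2..<i} (\<lambda>j. a_mat M 3 i j ?Z * ?N * psi_stage M 3 2 j ?Z))"
  let ?m3 = "mat_sum 3 {2..stages M} (\<lambda>i. b_mat M 3 i ?Z * (node M i \<cdot>\<^sub>m ?N) * psi_stage M 3 2 i ?Z)"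
  have *: "?m1 = 0\<^sub>m 3 3 \<and> ?m2 = 0\<^sub>m 3 3 \<and> ?m3 = 0\<^sub>m 3 3"
    using c4[unfolded coupling_conditions_4_def, rule_format, OF dmat_carrier shift_carrier shift_carrier] .
  have "?m1 $$ (0, 1) = 0\<^sub>m 3 3 $$ (0, 1)" using * by metis
  then show "(\<Sum>i\<in>{2..stages M}. coef_real (bcoef M i) z0 * coef_real (stage_defect M 3 i) z1) = 0"
    by (simp add: mat_sum_index b_mat_dmat psi_stage_dmat dmat_shift_mult_index dmat_index)
  have "?m2 $$ (0, 2) = 0\<^sub>m 3 3 $$ (0, 2)" using * by metis
  then show "(\<Sum>i\<in>{2..stages M}. coef_real (bcoef M i) z0 * (\<Sum>j\<in>{2..<i}. coef_real (acoef M i j) z1 * coef_real (stage_defect M 2 j) z2)) = 0"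
    by (simp add: mat_sum_index b_mat_dmat a_mat_dmat psi_stage_dmat dmat_shift_mult_index dmat_index)
  have "?m3 $$ (0, 1) = 0\<^sub>m 3 3 $$ (0, 1)" using * by metis
  then show "(\<Sum>i\<in>{2..stages M}. coef_real (bcoef M i) z0 * node M i * coef_real (stage_defect M 2 i) z1) = 0"
    by (simp add: mat_sum_index b_mat_dmat psi_stage_dmat dmat_shift_mult_index dmat_index)
qed
end

context
  fixes M :: erk_method
  assumes c5: "coupling_conditions_5 M"
begin
lemma tensor_conditions_5:
  "(\<Sum>i\<in>{2..stages M}. coef_real (bcoef M i) z0 * coef_real (stage_defect M 4 i) z1) = 0"
  "(\<Sum>i\<in>{2..stages M}. coef_real (bcoef M i) z0 * (\<Sum>j\<in>{2..<i}. coef_real (acoef M i j) z1 * coef_real (stage_defect M 3 j) z2)) = 0"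
  "(\<Sum>i\<in>{2..stages M}. coef_real (bcoef M i) z0 * (\<Sum>j\<in>{2..<i}. coef_real (acoef M i j) z1 *
      (\<Sum>k\<in>{2..<j}. coef_real (acoef M j k) z2 * coef_real (stage_defect M 2 k) z3))) = 0"
  "(\<Sum>i\<in>{2..stages M}. coef_real (bcoef M i) z0 * (\<Sum>j\<in>{2..<i}. coef_real (acoef M i j) z1 * node M j * coef_real (stage_defect M 2 j) z2)) = 0"
  "(\<Sum>i\<in>{2..stages M}. coef_real (bcoef M i) z0 * node M i * coef_real (stage_defect M 3 i) z1) = 0"
  "(\<Sum>i\<in>{2..stages M}. coef_real (bcoef M i) z0 * node M i * (\<Sum>j\<in>{2..<i}. coef_real (acoef M i j) z1 * coef_real (stage_defect M 2 j) z2)) = 0"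
  "(\<Sum>i\<in>{2..stages M}. coef_real (bcoef M i) z0 * (node M i)\<^sup>2 * coef_real (stage_defect M 2 i) z1) = 0"
  "(\<Sum>i\<in>{2..stages M}. coef_real (bcoef M i) z0 * (coef_real (stage_defect M 2 i) z1 * coef_real (stage_defect M 2 i) z2)) = 0"
proof -
  let ?Z = "dmat 4 (pick4 z0 z1 z2 z3)"
  let ?N = "shift_mat 4"
  let ?m1 = "mat_sum 4 {2..stages M} (\<lambda>i. b_mat M 4 i ?Z * ?N * psi_stage M 4 4 i ?Z)"
  let ?m2 = "mat_sum 4 {2..stages M} (\<lambda>i. b_mat M 4 i ?Z * ?N * mat_sum 4 {2..<i} (\<lambda>j. a_mat M 4 i j ?Z * ?N * psi_stage M 4 3 j ?Z))"
  let ?m3 = "mat_sum 4 {2..stages M} (\<lambda>i. b_mat M 4 i ?Z * ?N * mat_sum 4 {2..<i} (\<lambda>j. a_mat M 4 i j ?Z * ?N *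
       mat_sum 4 {2..<j} (\<lambda>k. a_mat M 4 j k ?Z * ?N * psi_stage M 4 2 k ?Z)))"
  let ?m4 = "mat_sum 4 {2..stages M} (\<lambda>i. b_mat M 4 i ?Z * ?N * mat_sum 4 {2..<i} (\<lambda>j. a_mat M 4 i j ?Z * (node M j \<cdot>\<^sub>m ?N) * psi_stage M 4 2 j ?Z))"
  let ?m5 = "mat_sum 4 {2..stages M} (\<lambda>i. b_mat M 4 i ?Z * (node M i \<cdot>\<^sub>m ?N) * psi_stage M 4 3 i ?Z)"
  let ?m6 = "mat_sum 4 {2..stages M} (\<lambda>i. b_mat M 4 i ?Z * (node M i \<cdot>\<^sub>m ?N) * mat_sum 4 {2..<i} (\<lambda>j. a_mat M 4 i j ?Z * ?N * psi_stage M 4 2 j ?Z))"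
  let ?m7 = "mat_sum 4 {2..stages M} (\<lambda>i. b_mat M 4 i ?Z * ((node M i)\<^sup>2 \<cdot>\<^sub>m ?N) * psi_stage M 4 2 i ?Z)"
  have *: "?m1 = 0\<^sub>m 4 4 \<and> ?m2 = 0\<^sub>m 4 4 \<and> ?m3 = 0\<^sub>m 4 4 \<and> ?m4 = 0\<^sub>m 4 4 \<and> ?m5 = 0\<^sub>m 4 4 \<and> ?m6 = 0\<^sub>m 4 4 \<and> ?m7 = 0\<^sub>m 4 4"
    using c5[unfolded coupling_conditions_5_def, THEN conjunct1, rule_format, OF dmat_carrier shift_carrier shift_carrier shift_carrier] .
  note simps = mat_sum_index b_mat_dmat a_mat_dmat psi_stage_dmat dmat_shift_mult_index dmat_index
  have "?m1 $$ (0, 1) = 0\<^sub>m 4 4 $$ (0, 1)" by (simp only: *)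
  then show "(\<Sum>i\<in>{2..stages M}. coef_real (bcoef M i) z0 * coef_real (stage_defect M 4 i) z1) = 0"
    by (simp add: mat_sum_index b_mat_dmat psi_stage_dmat dmat_shift_mult_index dmat_index)
  have "?m2 $$ (0, 2) = 0\<^sub>m 4 4 $$ (0, 2)" by (simp only: *)
  then show "(\<Sum>i\<in>{2..stages M}. coef_real (bcoef M i) z0 * (\<Sum>j\<in>{2..<i}. coef_real (acoef M i j) z1 * coef_real (stage_defect M 3 j) z2)) = 0"
    by (simp add: simps)
  have "?m3 $$ (0, 3) = 0\<^sub>m 4 4 $$ (0, 3)" by (simp only: *)
  then show "(\<Sum>i\<in>{2..stages M}. coef_real (bcoef M i) z0 * (\<Sum>j\<in>{2..<i}. coef_real (acoef M i j) z1 *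
      (\<Sum>k\<in>{2..<j}. coef_real (acoef M j k) z2 * coef_real (stage_defect M 2 k) z3))) = 0"
    by (simp add: simps)
  have "?m4 $$ (0, 2) = 0\<^sub>m 4 4 $$ (0, 2)" by (simp only: *)
  then show "(\<Sum>i\<in>{2..stages M}. coef_real (bcoef M i) z0 * (\<Sum>j\<in>{2..<i}. coef_real (acoef M i j) z1 * node M j * coef_real (stage_defect M 2 j) z2)) = 0"
    by (simp add: simps)
  have "?m5 $$ (0, 1) = 0\<^sub>m 4 4 $$ (0, 1)" by (simp only: *)
  then show "(\<Sum>i\<in>{2..stages M}. coef_real (bcoef M i) z0 * node M i * coef_real (stage_defect M 3 i) z1) = 0"
    by (simp add: mat_sum_index b_mat_dmat psi_stage_dmat dmat_shift_mult_index dmat_index)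
  have "?m6 $$ (0, 2) = 0\<^sub>m 4 4 $$ (0, 2)" by (simp only: *)
  then show "(\<Sum>i\<in>{2..stages M}. coef_real (bcoef M i) z0 * node M i * (\<Sum>j\<in>{2..<i}. coef_real (acoef M i j) z1 * coef_real (stage_defect M 2 j) z2)) = 0"
    by (simp add: simps)
  have "?m7 $$ (0, 1) = 0\<^sub>m 4 4 $$ (0, 1)" by (simp only: *)
  then show "(\<Sum>i\<in>{2..stages M}. coef_real (bcoef M i) z0 * (node M i)\<^sup>2 * coef_real (stage_defect M 2 i) z1) = 0"
    by (simp add: mat_sum_index b_mat_dmat psi_stage_dmat dmat_shift_mult_index dmat_index)
  \<comment> \<open>reads row \<open>1\<close> of the first argument and row \<open>2\<close> of the second, so that the two defects are evaluated at different variables\<close>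
  define B :: "real Matrix.vec \<Rightarrow> real Matrix.vec \<Rightarrow> real Matrix.vec"
    where "B x y = Matrix.vec 4 (\<lambda>r. if r = 0 then vec_index x 1 * vec_index y 2 else 0)" for x y
  have bil: "bilinear_map 4 B"
    unfolding bilinear_map_def B_def by (auto intro!: eq_vecI simp: algebra_simps)
  let ?x = "unit_vec 4 1 :: real Matrix.vec" and ?y = "unit_vec 4 2 :: real Matrix.vec"
  let ?v = "vec_sum 4 {2..stages M} (\<lambda>i. b_mat M 4 i ?Z *\<^sub>v B (psi_stage M 4 2 i ?Z *\<^sub>v ?x) (psi_stage M 4 2 i ?Z *\<^sub>v ?y))"
  have v0: "?v = 0\<^sub>v 4"
    using c5[unfolded coupling_conditions_5_def, THEN conjunct2, rule_format, OF dmat_carrier bil unit_vec_carrier unit_vec_carrier] .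
  have dv: "vec_index (dmat 4 f *\<^sub>v w) r = f r * vec_index w r" if "r < 4" "w \<in> carrier_vec 4" for f w r
  proof -
    have "vec_index (dmat 4 f *\<^sub>v w) r = (\<Sum>i<4. dmat 4 f $$ (r, i) * vec_index w i)"
      using that by (simp add: scalar_prod_def dmat_def lessThan_atLeast0)
    also have "\<dots> = (\<Sum>i<4. if i = r then f r * vec_index w r else 0)"
      using that by (intro sum.cong) (auto simp: dmat_index)
    finally show ?thesis using that by simp
  qed
  have Bc: "B x y \<in> carrier_vec 4" for x y by (simp add: B_def)
  have "vec_index ?v 0 = vec_index (0\<^sub>v 4) 0" by (simp only: v0)
  then show "(\<Sum>i\<in>{2..stages M}. coef_real (bcoef M i) z0 * (coef_real (stage_defect M 2 i) z1 * coef_real (stage_defect M 2 i) z2)) = 0"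
    by (simp add: vec_sum_def b_mat_dmat psi_stage_dmat dv Bc) (simp add: B_def dv)
qed
end

section \<open>Order conditions for operators\<close>

lemma admissible_valid:
  assumes M: "valid_erk_method M" and cf: "valid_coefficient M cf"
  shows "admissible cf"
proof -
  have "1 \<le> k \<and> 0 < \<sigma> \<and> \<sigma> \<le> 1" if "(\<alpha>, k, \<sigma>) \<in> set cf" for \<alpha> k \<sigma>
  proof -
    have "1 \<le> k \<and> (\<sigma> = 1 \<or> \<sigma> \<in> node M ` {2..stages M})"
      using cf that unfolding valid_coefficient_def by blast
    then show ?thesis using M unfolding valid_erk_method_def by auto
  qed
  then show ?thesis unfolding admissible_def by blast
qed

lemma admissible_scale: "admissible cf \<Longrightarrow> admissible (scale_coef c cf)"
  unfolding admissible_def scale_coef_def by auto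

lemma admissible_defect:
  assumes "\<And>k. k \<in> {2..<n} \<Longrightarrow> admissible (rw k)" "1 \<le> q" "0 < c" "c \<le> 1"
  shows "admissible (defect_coef M rw n c q)"
proof -
  have "admissible (concat (map (\<lambda>k. scale_coef (node M k ^ (q - 1) / fact (q - 1)) (rw k)) [2..<n]))"
    using admissible_scale[OF assms(1)] unfolding admissible_def by auto
  then show ?thesis using assms(2-) unfolding defect_coef_def by simp
qed

lemma coef_real_0:
  assumes "admissible cf"
  shows "coef_real cf 0 = (\<Sum>(\<alpha>, k, \<sigma>)\<leftarrow>cf. \<alpha> / fact k)"
  using assms
proof (induction cf)
  case (Cons c cf)
  obtain \<alpha> k \<sigma> where c: "c = (\<alpha>, k, \<sigma>)" by (cases c)
  have "phi_real k 0 = 1 / fact k"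
    unfolding phi_real_def using integral_unique[OF integral_phi_weight(1)[of k]] Cons.prems by (simp add: c)
  then show ?case using Cons by (simp add: c coef_real_def)
qed (simp add: coef_real_def)

context analytic_generator
begin

text \<open>One step of the passage from scalars to operators, applied from the inside to the outside: the innermost
coefficient function is replaced by its operator, the next linear map is applied, and the outer functions
remain scalar factors.\<close>

lemma annihilation_step:
  assumes h: "h \<ge> 0" and I: "finite I" and adm: "\<And>i. i \<in> I \<Longrightarrow> admissible (cf i)" and J: "linear J"
    and zero: "\<And>z. (\<Sum>i\<in>I. (w i * coef_real (cf i) z) *\<^sub>R y i) = 0"
  shows "(\<Sum>i\<in>I. w i *\<^sub>R J (coef_op S (cf i) h (y i))) = 0"
proof -
  have "(\<Sum>i\<in>I. coef_op S (cf i) h (w i *\<^sub>R y i)) = 0"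
    by (rule coef_op_transfer[OF h I adm]) (use zero in \<open>simp_all add: mult.commute\<close>)
  then have "J (\<Sum>i\<in>I. coef_op S (cf i) h (w i *\<^sub>R y i)) = 0" by (simp add: linear_0[OF J])
  then have "(\<Sum>i\<in>I. J (coef_op S (cf i) h (w i *\<^sub>R y i))) = 0" by (simp add: linear_sum[OF J])
  moreover have "J (coef_op S (cf i) h (w i *\<^sub>R y i)) = w i *\<^sub>R J (coef_op S (cf i) h (y i))" if "i \<in> I" for i
    by (simp add: linear_scale[OF coef_linear[OF h adm[OF that]]] linear_scale[OF J])
  ultimately show ?thesis by simp
qed

lemma operator_chain_1:
  assumes h: "h \<ge> 0" and I: "finite I" and b: "\<And>i. i \<in> I \<Longrightarrow> admissible (b i)" and p: "\<And>i. i \<in> I \<Longrightarrow> admissible (p i)"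
    and J: "linear J" and zero: "\<And>z0 z1. (\<Sum>i\<in>I. coef_real (b i) z0 * c i * coef_real (p i) z1) = 0"
  shows "(\<Sum>i\<in>I. coef_op S (b i) h (c i *\<^sub>R J (coef_op S (p i) h x))) = 0"
proof (rule coef_op_transfer[OF h I b])
  fix z0
  have "(\<Sum>i\<in>I. (coef_real (b i) z0 * c i) *\<^sub>R J (coef_op S (p i) h x)) = 0"
    by (rule annihilation_step[OF h I p J]) (simp_all add: zero flip: scaleR_sum_left)
  then show "(\<Sum>i\<in>I. coef_real (b i) z0 *\<^sub>R (c i *\<^sub>R J (coef_op S (p i) h x))) = 0" by simp
qed

lemma operator_chain_2:
  assumes h: "h \<ge> 0" and I: "finite I" and I': "\<And>i. i \<in> I \<Longrightarrow> finite (I' i)"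
    and b: "\<And>i. i \<in> I \<Longrightarrow> admissible (b i)" and a: "\<And>i j. i \<in> I \<Longrightarrow> j \<in> I' i \<Longrightarrow> admissible (a i j)"
    and p: "\<And>i j. i \<in> I \<Longrightarrow> j \<in> I' i \<Longrightarrow> admissible (p j)"
    and J: "linear J" "linear J'"
    and zero: "\<And>z0 z1 z2. (\<Sum>i\<in>I. coef_real (b i) z0 * c i * (\<Sum>j\<in>I' i. coef_real (a i j) z1 * c' j * coef_real (p j) z2)) = 0"
  shows "(\<Sum>i\<in>I. coef_op S (b i) h (c i *\<^sub>R J (\<Sum>j\<in>I' i. coef_op S (a i j) h (c' j *\<^sub>R J' (coef_op S (p j) h x))))) = 0"
proof -
  let ?N = "Sigma I I'"
  have N: "finite ?N" using I I' by auto
  let ?y2 = "\<lambda>\<nu>. c' (snd \<nu>) *\<^sub>R J' (coef_op S (p (snd \<nu>)) h x)"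
  let ?y1 = "\<lambda>\<nu>. J (coef_op S (a (fst \<nu>) (snd \<nu>)) h (?y2 \<nu>))"
  have s0: "(\<Sum>\<nu>\<in>?N. coef_real (b (fst \<nu>)) z0 * c (fst \<nu>) * coef_real (a (fst \<nu>) (snd \<nu>)) z1 * c' (snd \<nu>) * coef_real (p (snd \<nu>)) z2) = 0" for z0 z1 z2
    using zero[of z0 z1 z2] I I' by (simp add: sum.Sigma sum_distrib_left case_prod_unfold mult.assoc)
  have s1: "(\<Sum>\<nu>\<in>?N. (coef_real (b (fst \<nu>)) z0 * c (fst \<nu>) * coef_real (a (fst \<nu>) (snd \<nu>)) z1 * c' (snd \<nu>)) *\<^sub>R J' (coef_op S (p (snd \<nu>)) h x)) = 0" for z0 z1
    by (rule annihilation_step[OF h N _ J(2)]) (use p in \<open>auto simp: s0 simp flip: scaleR_sum_left\<close>)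
  have s2: "(\<Sum>\<nu>\<in>?N. (coef_real (b (fst \<nu>)) z0 * c (fst \<nu>)) *\<^sub>R ?y1 \<nu>) = 0" for z0
    by (rule annihilation_step[OF h N _ J(1)]) (use a s1 in auto)
  have "(\<Sum>\<nu>\<in>?N. coef_op S (b (fst \<nu>)) h (c (fst \<nu>) *\<^sub>R ?y1 \<nu>)) = 0"
    by (rule coef_op_transfer[OF h N]) (use b s2 in auto)
  then have "(\<Sum>i\<in>I. \<Sum>j\<in>I' i. coef_op S (b i) h (c i *\<^sub>R ?y1 (i, j))) = 0"
    using I I' by (simp add: sum.Sigma case_prod_unfold)
  moreover have "(\<Sum>j\<in>I' i. coef_op S (b i) h (c i *\<^sub>R ?y1 (i, j))) =
      coef_op S (b i) h (c i *\<^sub>R J (\<Sum>j\<in>I' i. coef_op S (a i j) h (c' j *\<^sub>R J' (coef_op S (p j) h x))))" if "i \<in> I" for i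
    by (simp add: linear_sum[OF J(1)] scaleR_sum_right linear_sum[OF coef_linear[OF h b[OF that]]])
  ultimately show ?thesis by simp
qed

lemma operator_chain_3:
  assumes h: "h \<ge> 0" and I: "finite I" and I': "\<And>i. finite (I' i)"
    and b: "\<And>i. i \<in> I \<Longrightarrow> admissible (b i)" and a: "\<And>i j. i \<in> I \<Longrightarrow> j \<in> I' i \<Longrightarrow> admissible (a i j)"
    and a': "\<And>i j k. i \<in> I \<Longrightarrow> j \<in> I' i \<Longrightarrow> k \<in> I' j \<Longrightarrow> admissible (a j k)"
    and p: "\<And>i j k. i \<in> I \<Longrightarrow> j \<in> I' i \<Longrightarrow> k \<in> I' j \<Longrightarrow> admissible (p k)"
    and J: "linear J"
    and zero: "\<And>z0 z1 z2 z3. (\<Sum>i\<in>I. coef_real (b i) z0 * (\<Sum>j\<in>I' i. coef_real (a i j) z1 *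
       (\<Sum>k\<in>I' j. coef_real (a j k) z2 * coef_real (p k) z3))) = 0"
  shows "(\<Sum>i\<in>I. coef_op S (b i) h (J (\<Sum>j\<in>I' i. coef_op S (a i j) h (J (\<Sum>k\<in>I' j. coef_op S (a j k) h (J (coef_op S (p k) h x))))))) = 0"
proof -
  let ?N = "Sigma I (\<lambda>i. Sigma (I' i) I')"
  have N: "finite ?N" using I I' by auto
  let ?i = "\<lambda>\<nu>. fst \<nu>" and ?j = "\<lambda>\<nu>. fst (snd \<nu>)" and ?k = "\<lambda>\<nu>. snd (snd \<nu>)"
  let ?y3 = "\<lambda>\<nu>. J (coef_op S (p (?k \<nu>)) h x)"
  let ?y2 = "\<lambda>\<nu>. J (coef_op S (a (?j \<nu>) (?k \<nu>)) h (?y3 \<nu>))"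
  let ?y1 = "\<lambda>\<nu>. J (coef_op S (a (?i \<nu>) (?j \<nu>)) h (?y2 \<nu>))"
  have s0: "(\<Sum>\<nu>\<in>?N. coef_real (b (?i \<nu>)) z0 * coef_real (a (?i \<nu>) (?j \<nu>)) z1 * coef_real (a (?j \<nu>) (?k \<nu>)) z2 * coef_real (p (?k \<nu>)) z3) = 0" for z0 z1 z2 z3
    using zero[of z0 z1 z2 z3] I I' by (simp add: sum.Sigma sum_distrib_left case_prod_unfold mult.assoc)
  have s1: "(\<Sum>\<nu>\<in>?N. (coef_real (b (?i \<nu>)) z0 * coef_real (a (?i \<nu>) (?j \<nu>)) z1 * coef_real (a (?j \<nu>) (?k \<nu>)) z2) *\<^sub>R ?y3 \<nu>) = 0" for z0 z1 z2
    by (rule annihilation_step[OF h N _ J]) (use p in \<open>auto simp: s0 simp flip: scaleR_sum_left\<close>)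
  have s2: "(\<Sum>\<nu>\<in>?N. (coef_real (b (?i \<nu>)) z0 * coef_real (a (?i \<nu>) (?j \<nu>)) z1) *\<^sub>R ?y2 \<nu>) = 0" for z0 z1
    by (rule annihilation_step[OF h N _ J]) (use a' s1 in auto)
  have s3: "(\<Sum>\<nu>\<in>?N. coef_real (b (?i \<nu>)) z0 *\<^sub>R ?y1 \<nu>) = 0" for z0
    by (rule annihilation_step[OF h N _ J]) (use a s2 in auto)
  have "(\<Sum>\<nu>\<in>?N. coef_op S (b (?i \<nu>)) h (?y1 \<nu>)) = 0"
    by (rule coef_op_transfer[OF h N]) (use b s3 in auto)
  then have "(\<Sum>i\<in>I. \<Sum>j\<in>I' i. \<Sum>k\<in>I' j. coef_op S (b i) h (?y1 (i, j, k))) = 0"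
    using I I' by (simp add: sum.Sigma case_prod_unfold)
  moreover have "(\<Sum>j\<in>I' i. \<Sum>k\<in>I' j. coef_op S (b i) h (?y1 (i, j, k))) =
      coef_op S (b i) h (J (\<Sum>j\<in>I' i. coef_op S (a i j) h (J (\<Sum>k\<in>I' j. coef_op S (a j k) h (J (coef_op S (p k) h x))))))" if i: "i \<in> I" for i
  proof -
    have "coef_op S (a i j) h (J (\<Sum>k\<in>I' j. coef_op S (a j k) h (?y3 (i, j, k)))) =
       (\<Sum>k\<in>I' j. coef_op S (a i j) h (?y2 (i, j, k)))" if j: "j \<in> I' i" for j
      by (simp add: linear_sum[OF J] linear_sum[OF coef_linear[OF h a[OF i j]]])
    then show ?thesis by (simp add: linear_sum[OF J] linear_sum[OF coef_linear[OF h b[OF i]]])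
  qed
  ultimately show ?thesis by simp
qed

text \<open>The two arguments of \<open>B\<close> are treated one after the other: in the second step the linear map substituted
for \<open>\<phi>\<^sub>k(\<sigma>z)\<close> is \<open>w \<mapsto> B (\<phi>\<^sub>k(\<sigma>hA) x) w\<close>.\<close>

lemma operator_bilinear:
  assumes h: "h \<ge> 0" and I: "finite I" and b: "\<And>i. i \<in> I \<Longrightarrow> admissible (b i)" and p: "\<And>i. i \<in> I \<Longrightarrow> admissible (p i)"
    and B1: "\<And>y. linear (\<lambda>x. B x y)" and B2: "\<And>x. linear (B x)"
    and zero: "\<And>z0 z1 z2. (\<Sum>i\<in>I. coef_real (b i) z0 * (coef_real (p i) z1 * coef_real (p i) z2)) = 0"
  shows "(\<Sum>i\<in>I. coef_op S (b i) h (B (coef_op S (p i) h x) (coef_op S (p i) h y))) = 0"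
proof (rule coef_op_transfer[OF h I b])
  fix z0
  have s1: "(\<Sum>i\<in>I. (coef_real (b i) z0 * coef_real (p i) z1) *\<^sub>R coef_op S (p i) h y) = 0" for z1
    by (rule annihilation_step[OF h I p linear_id, unfolded id_apply]) (simp_all add: mult.assoc zero flip: scaleR_sum_left)
  have "(\<Sum>i\<in>I. \<Sum>(\<alpha>, k, \<sigma>)\<leftarrow>p i. \<alpha> *\<^sub>R B (phi_op S k (\<sigma> * h) x) (coef_real (b i) z0 *\<^sub>R coef_op S (p i) h y)) = 0"
    by (rule coefficient_transfer[OF I p, where q = "\<lambda>k \<sigma> w. B (phi_op S k (\<sigma> * h) x) w"])
       (use s1 B2 in \<open>simp_all add: mult.commute\<close>)
  moreover have "(\<Sum>(\<alpha>, k, \<sigma>)\<leftarrow>cf. \<alpha> *\<^sub>R B (phi_op S k (\<sigma> * h) x) w) = B (coef_op S cf h x) w" for cf w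
    by (induction cf) (auto simp: linear_0[OF B1] linear_add[OF B1] linear_scale[OF B1])
  ultimately have "(\<Sum>i\<in>I. B (coef_op S (p i) h x) (coef_real (b i) z0 *\<^sub>R coef_op S (p i) h y)) = 0"
    by (simp only:)
  then show "(\<Sum>i\<in>I. coef_real (b i) z0 *\<^sub>R B (coef_op S (p i) h x) (coef_op S (p i) h y)) = 0"
    by (simp add: linear_scale[OF B2])
qed simp_all

end

section \<open>Smooth families of multilinear maps along a curve\<close>

lemma prod_list_norm_nonneg [simp]:
  "0 \<le> prod_list (map (\<lambda>x. norm (f x)) xs)" "0 \<le> prod_list (map (norm \<circ> f) xs)"
  by (induction xs) auto

definition bounded_multilinear :: "nat \<Rightarrow> real \<Rightarrow> ('b::real_normed_vector list \<Rightarrow> 'c::real_normed_vector) \<Rightarrow> bool" where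
  "bounded_multilinear k M L \<longleftrightarrow> multilinear_map k L \<and> 0 \<le> M \<and>
     (\<forall>vs. length vs = k \<longrightarrow> norm (L vs) \<le> M * prod_list (map norm vs))"

lemma multilinear_slot:
  "multilinear_map k L \<Longrightarrow> length vs = k \<Longrightarrow> i < k \<Longrightarrow> linear (\<lambda>v. L (vs[i := v]))"
  unfolding multilinear_map_def by blast

lemma multilinear_head:
  assumes "multilinear_map (Suc k) L" "length vs = k"
  shows "linear (\<lambda>v. L (v # vs))"
  using multilinear_slot[OF assms(1), of "undefined # vs" 0] assms(2) by simp

lemma bounded_multilinear_tail:
  assumes L: "bounded_multilinear (Suc k) M L"
  shows "bounded_multilinear k (M * norm x) (\<lambda>vs. L (x # vs))"
proof -
  have "linear (\<lambda>v. L (x # vs[i := v]))" if "length vs = k" "i < k" for vs i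
    using multilinear_slot[of "Suc k" L "x # vs" "Suc i"] L that unfolding bounded_multilinear_def by simp
  moreover have "norm (L (x # vs)) \<le> M * norm x * prod_list (map norm vs)" if "length vs = k" for vs
    using L that unfolding bounded_multilinear_def by (auto simp: mult.assoc dest!: spec[of _ "x # vs"])
  ultimately show ?thesis using L unfolding bounded_multilinear_def multilinear_map_def by auto
qed

lemma tendsto_prod_list_norm:
  assumes "list_all2 (\<lambda>x l. ((\<lambda>s. x s) \<longlongrightarrow> l) F) xs ls"
  shows "((\<lambda>s. prod_list (map norm (map (\<lambda>x. x s) xs))) \<longlongrightarrow> prod_list (map norm ls)) F"
  using assms by (induction rule: list_all2_induct) (auto intro!: tendsto_intros)

text \<open>Induction on the number of arguments: the first argument is split into its limit and a null sequence.\<close>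

lemma bounded_multilinear_tendsto:
  assumes "list_all2 (\<lambda>x l. ((\<lambda>s. x s) \<longlongrightarrow> l) F) xs ls" "bounded_multilinear (length xs) M L"
  shows "((\<lambda>s. L (map (\<lambda>x. x s) xs)) \<longlongrightarrow> L ls) F"
  using assms
proof (induction arbitrary: L M rule: list_all2_induct)
  case Nil
  then show ?case by simp
next
  case (Cons x xs l ls)
  have L: "bounded_multilinear (Suc (length xs)) M L" using Cons.prems by simp
  have len: "length xs = length ls" using Cons.hyps(2) by (rule list_all2_lengthD)
  have "((\<lambda>s. M * (norm (x s - l) * prod_list (map norm (map (\<lambda>x. x s) xs)))) \<longlongrightarrow> M * (0 * prod_list (map norm ls))) F"
    by (intro tendsto_mult tendsto_const tendsto_norm_zero LIM_zero tendsto_prod_list_norm Cons.hyps)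
  then have z: "((\<lambda>s. M * (norm (x s - l) * prod_list (map norm (map (\<lambda>x. x s) xs)))) \<longlongrightarrow> 0) F"
    by (simp only: mult_zero_left mult_zero_right)
  have bnd: "norm (L ((x s - l) # map (\<lambda>x. x s) xs)) \<le> M * (norm (x s - l) * prod_list (map norm (map (\<lambda>x. x s) xs)))" for s
    using L unfolding bounded_multilinear_def by (auto dest!: spec[of _ "(x s - l) # map (\<lambda>x. x s) xs"])
  have 1: "((\<lambda>s. L ((x s - l) # map (\<lambda>x. x s) xs)) \<longlongrightarrow> 0) F"
    by (rule Lim_null_comparison[OF _ z]) (intro always_eventually allI bnd)
  have 2: "((\<lambda>s. L (l # map (\<lambda>x. x s) xs)) \<longlongrightarrow> L (l # ls)) F"
    using Cons.IH[OF bounded_multilinear_tail[OF L, of l]] .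
  have lin: "linear (\<lambda>v. L (v # map (\<lambda>x. x s) xs))" for s
    using L by (intro multilinear_head[where k = "length xs"]) (auto simp: bounded_multilinear_def)
  show ?case using tendsto_add[OF 1 2] by (simp add: linear_diff[OF lin])
qed

lemma bounded_multilinear_vector_derivative:
  assumes "list_all2 (\<lambda>x x'. (x has_vector_derivative x') (at t within U)) xs xs'" "bounded_multilinear (length xs) M L"
  shows "((\<lambda>s. L (map (\<lambda>x. x s) xs)) has_vector_derivative
     (\<Sum>i<length xs. L ((map (\<lambda>x. x t) xs)[i := xs' ! i]))) (at t within U)"
  using assms
proof (induction arbitrary: L M rule: list_all2_induct)
  case Nil
  then show ?case by simp
next
  case (Cons x xs x' xs')
  have L: "bounded_multilinear (Suc (length xs)) M L" using Cons.prems by simp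
  have lin: "linear (\<lambda>v. L (v # map (\<lambda>x. x s) xs))" for s
    using L by (intro multilinear_head[where k = "length xs"]) (auto simp: bounded_multilinear_def)
  have cont: "list_all2 (\<lambda>x l. ((\<lambda>s. x s) \<longlongrightarrow> l) (at t within U)) xs (map (\<lambda>x. x t) xs)"
    using Cons.hyps(2) by (auto simp: list_all2_conv_all_nth continuous_within dest!: has_vector_derivative_continuous)
  have "list_all2 (\<lambda>x l. ((\<lambda>s. x s) \<longlongrightarrow> l) (at t within U)) ((\<lambda>s. (x s - x t) /\<^sub>R (s - t)) # xs) (x' # map (\<lambda>x. x t) xs)"
    using cont vector_derivative_quotient[OF Cons.hyps(1)] by simp
  from bounded_multilinear_tendsto[OF this, of M L] L
  have 1: "((\<lambda>s. L ((x s - x t) /\<^sub>R (s - t) # map (\<lambda>x. x s) xs)) \<longlongrightarrow> L (x' # map (\<lambda>x. x t) xs)) (at t within U)" by simp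
  have 2: "((\<lambda>s. (L (x t # map (\<lambda>x. x s) xs) - L (x t # map (\<lambda>x. x t) xs)) /\<^sub>R (s - t)) \<longlongrightarrow>
      (\<Sum>i<length xs. L (x t # (map (\<lambda>x. x t) xs)[i := xs' ! i]))) (at t within U)"
    using Cons.IH[OF bounded_multilinear_tail[OF L, of "x t"]] by (rule vector_derivative_quotient)
  have "L ((x s - x t) /\<^sub>R (s - t) # map (\<lambda>x. x s) xs) + (L (x t # map (\<lambda>x. x s) xs) - L (x t # map (\<lambda>x. x t) xs)) /\<^sub>R (s - t)
     = (L (map (\<lambda>x. x s) (x # xs)) - L (map (\<lambda>x. x t) (x # xs))) /\<^sub>R (s - t)" for s
    by (simp add: linear_scale[OF lin] linear_diff[OF lin] scaleR_diff_right scaleR_add_right)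
  then have "((\<lambda>s. (L (map (\<lambda>x. x s) (x # xs)) - L (map (\<lambda>x. x t) (x # xs))) /\<^sub>R (s - t)) \<longlongrightarrow>
     L (x' # map (\<lambda>x. x t) xs) + (\<Sum>i<length xs. L (x t # (map (\<lambda>x. x t) xs)[i := xs' ! i]))) (at t within U)"
    using tendsto_add[OF 1 2] by simp
  moreover have "(\<Sum>i<length (x # xs). L ((map (\<lambda>x. x t) (x # xs))[i := (x' # xs') ! i])) =
     L (x' # map (\<lambda>x. x t) xs) + (\<Sum>i<length xs. L (x t # (map (\<lambda>x. x t) xs)[i := xs' ! i]))"
    by (simp add: sum.lessThan_Suc_shift del: sum.lessThan_Suc)
  ultimately show ?case unfolding has_vector_derivative_quotient_iff by simp
qed

text \<open>The derivatives of a function of which only the orders \<open>1, ..., p\<close> are bounded, with one common bound. The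
function itself, \<open>G 0\<close>, may be unbounded.\<close>

locale frechet_jet =
  fixes W :: "'b::real_normed_vector set" and G :: "nat \<Rightarrow> 'b \<Rightarrow> 'b list \<Rightarrow> 'c::real_normed_vector"
    and p :: nat and M :: real
  assumes G_multilinear: "k \<le> p \<Longrightarrow> x \<in> W \<Longrightarrow> multilinear_map k (G k x)"
    and M_nonneg: "0 \<le> M"
    and G_bounded: "1 \<le> k \<Longrightarrow> k \<le> p \<Longrightarrow> x \<in> W \<Longrightarrow> length vs = k \<Longrightarrow> norm (G k x vs) \<le> M * prod_list (map norm vs)"
    and G_derivative: "k < p \<Longrightarrow> x \<in> W \<Longrightarrow> \<epsilon> > 0 \<Longrightarrow> \<exists>\<eta>>0. \<forall>y\<in>W. norm (y - x) < \<eta> \<longrightarrow>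
              (\<forall>vs. length vs = k \<longrightarrow>
                 norm (G k y vs - G k x vs - G (Suc k) x ((y - x) # vs))
                   \<le> \<epsilon> * norm (y - x) * prod_list (map norm vs))"
begin

lemma G_bounded_multilinear:
  assumes "k \<le> p" "x \<in> W"
  shows "\<exists>B. bounded_multilinear k B (G k x)"
proof (cases "k = 0")
  case True
  then show ?thesis using G_multilinear[OF assms] unfolding bounded_multilinear_def
    by (intro exI[of _ "norm (G 0 x [])"]) auto
next
  case False
  then show ?thesis using G_multilinear[OF assms] G_bounded[of k x] assms M_nonneg unfolding bounded_multilinear_def
    by (intro exI[of _ M]) auto
qed

text \<open>Chain rule for the base point combined with the product rule for the arguments. The remainder of
the Frechet derivative is uniform over bounded arguments, so the arguments may move at the same time.\<close>

lemma G_chain_rule: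
  assumes k: "k < p" and \<gamma>W: "\<And>s. s \<in> U \<Longrightarrow> \<gamma> s \<in> W" and t: "t \<in> U"
    and \<gamma>': "(\<gamma> has_vector_derivative \<gamma>') (at t within U)"
    and xs: "list_all2 (\<lambda>x x'. (x has_vector_derivative x') (at t within U)) xs xs'" and len: "length xs = k"
  shows "((\<lambda>s. G k (\<gamma> s) (map (\<lambda>x. x s) xs)) has_vector_derivative
     G (Suc k) (\<gamma> t) (\<gamma>' # map (\<lambda>x. x t) xs) + (\<Sum>i<k. G k (\<gamma> t) ((map (\<lambda>x. x t) xs)[i := xs' ! i]))) (at t within U)"
proof -
  let ?X = "\<lambda>s. map (\<lambda>x. x s) xs"
  let ?F = "at t within U"
  have xt: "\<gamma> t \<in> W" using \<gamma>W t .
  obtain B where B: "bounded_multilinear k B (G k (\<gamma> t))" using G_bounded_multilinear[of k "\<gamma> t"] k xt by auto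
  obtain B' where B': "bounded_multilinear (Suc k) B' (G (Suc k) (\<gamma> t))" using G_bounded_multilinear[of "Suc k" "\<gamma> t"] k xt by auto
  have cont: "list_all2 (\<lambda>x l. ((\<lambda>s. x s) \<longlongrightarrow> l) ?F) xs (?X t)"
    using xs by (auto simp: list_all2_conv_all_nth continuous_within dest!: has_vector_derivative_continuous)
  have \<gamma>q: "((\<lambda>s. (\<gamma> s - \<gamma> t) /\<^sub>R (s - t)) \<longlongrightarrow> \<gamma>') ?F" using \<gamma>' by (rule vector_derivative_quotient)
  have \<gamma>c: "(\<gamma> \<longlongrightarrow> \<gamma> t) ?F" using has_vector_derivative_continuous[OF \<gamma>'] by (simp add: continuous_within)
  have "list_all2 (\<lambda>x l. ((\<lambda>s. x s) \<longlongrightarrow> l) ?F) ((\<lambda>s. (\<gamma> s - \<gamma> t) /\<^sub>R (s - t)) # xs) (\<gamma>' # ?X t)"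
    using cont \<gamma>q by simp
  from bounded_multilinear_tendsto[OF this, of B' "G (Suc k) (\<gamma> t)"] B' len
  have 1: "((\<lambda>s. G (Suc k) (\<gamma> t) ((\<gamma> s - \<gamma> t) /\<^sub>R (s - t) # ?X s)) \<longlongrightarrow> G (Suc k) (\<gamma> t) (\<gamma>' # ?X t)) ?F" by simp
  have 2: "((\<lambda>s. (G k (\<gamma> t) (?X s) - G k (\<gamma> t) (?X t)) /\<^sub>R (s - t)) \<longlongrightarrow> (\<Sum>i<k. G k (\<gamma> t) ((?X t)[i := xs' ! i]))) ?F"
    using bounded_multilinear_vector_derivative[OF xs, of B "G k (\<gamma> t)"] B len by (auto intro: vector_derivative_quotient)
  let ?rem = "\<lambda>s. G k (\<gamma> s) (?X s) - G k (\<gamma> t) (?X s) - G (Suc k) (\<gamma> t) ((\<gamma> s - \<gamma> t) # ?X s)"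
  have 3: "((\<lambda>s. ?rem s /\<^sub>R (s - t)) \<longlongrightarrow> 0) ?F"
  proof (rule tendstoI)
    fix e :: real assume e: "e > 0"
    define P where "P = prod_list (map norm (?X t)) + 1"
    have P1: "P \<ge> 1" unfolding P_def by simp
    define Q where "Q = norm \<gamma>' + 1"
    have Q1: "Q \<ge> 1" by (simp add: Q_def)
    define \<epsilon> where "\<epsilon> = e / (2 * (P * Q))"
    have PQ: "P * Q > 0" using P1 Q1 by (intro mult_pos_pos) linarith+
    then have \<epsilon>: "\<epsilon> > 0" using e by (simp add: \<epsilon>_def)
    obtain \<eta> where \<eta>: "\<eta> > 0" "\<forall>y\<in>W. norm (y - \<gamma> t) < \<eta> \<longrightarrow> (\<forall>vs. length vs = k \<longrightarrow>
                 norm (G k y vs - G k (\<gamma> t) vs - G (Suc k) (\<gamma> t) ((y - \<gamma> t) # vs)) \<le> \<epsilon> * norm (y - \<gamma> t) * prod_list (map norm vs))"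
      using G_derivative[OF k xt \<epsilon>] by blast
    have ev1: "\<forall>\<^sub>F s in ?F. norm (\<gamma> s - \<gamma> t) < \<eta>"
      using tendstoD[OF \<gamma>c \<eta>(1)] by (simp add: dist_norm)
    have ev2: "\<forall>\<^sub>F s in ?F. prod_list (map norm (?X s)) < P"
      by (rule order_tendstoD(2)[OF tendsto_prod_list_norm[OF cont]]) (simp add: P_def)
    have ev3: "\<forall>\<^sub>F s in ?F. norm ((\<gamma> s - \<gamma> t) /\<^sub>R (s - t)) < Q"
      by (rule order_tendstoD(2)[OF tendsto_norm[OF \<gamma>q]]) (simp add: Q_def)
    have ev4: "\<forall>\<^sub>F s in ?F. s \<in> U" by (auto simp: eventually_at_filter)
    show "\<forall>\<^sub>F s in ?F. dist (?rem s /\<^sub>R (s - t)) 0 < e"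
      using ev1 ev2 ev3 ev4
    proof eventually_elim
      case (elim s)
      have r: "norm (?rem s) \<le> \<epsilon> * norm (\<gamma> s - \<gamma> t) * prod_list (map norm (?X s))"
        by (rule \<eta>(2)[rule_format, OF \<gamma>W[OF elim(4)] elim(1)]) (simp add: len)
      have "norm (?rem s /\<^sub>R (s - t)) = inverse \<bar>s - t\<bar> * norm (?rem s)" by simp
      also have "\<dots> \<le> inverse \<bar>s - t\<bar> * (\<epsilon> * norm (\<gamma> s - \<gamma> t) * prod_list (map norm (?X s)))"
        by (intro mult_left_mono r) simp
      also have "\<dots> = \<epsilon> * (norm ((\<gamma> s - \<gamma> t) /\<^sub>R (s - t)) * prod_list (map norm (?X s)))" by simp
      also have "\<dots> \<le> \<epsilon> * (Q * P)"
        using elim \<epsilon> Q1 by (intro mult_left_mono mult_mono) auto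
      also have "\<dots> = e / 2" using PQ P1 Q1 by (auto simp: \<epsilon>_def field_simps)
      also have "\<dots> < e" using e by simp
      finally show ?case by (simp add: dist_norm)
    qed
  qed
  have lin: "linear (\<lambda>v. G (Suc k) (\<gamma> t) (v # ?X s))" for s
    using B' len by (intro multilinear_head[where k = k]) (auto simp: bounded_multilinear_def)
  have "?rem s /\<^sub>R (s - t) + G (Suc k) (\<gamma> t) ((\<gamma> s - \<gamma> t) /\<^sub>R (s - t) # ?X s) + (G k (\<gamma> t) (?X s) - G k (\<gamma> t) (?X t)) /\<^sub>R (s - t)
    = (G k (\<gamma> s) (?X s) - G k (\<gamma> t) (?X t)) /\<^sub>R (s - t)" for s
    unfolding linear_scale[OF lin] by (simp add: scaleR_diff_right)
  then show ?thesis unfolding has_vector_derivative_quotient_iff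
    using tendsto_add[OF tendsto_add[OF 3 1] 2] by simp
qed

end

text \<open>\<open>F t\<close> is a family of maps \<open>w \<mapsto> F t w\<close>, with \<open>m\<close> time derivatives that are taken for each fixed \<open>w\<close> but
bounded by a multiple of a weight \<open>N w\<close>. For linear maps and \<open>N = norm\<close> the bounds are bounds in operator
norm, for bilinear maps on pairs one takes the product of the norms, and for plain curves \<open>N = 1\<close>. This
avoids derivatives of operator-valued functions.\<close>

primrec smooth :: "real set \<Rightarrow> ('w \<Rightarrow> real) \<Rightarrow> nat \<Rightarrow> (real \<Rightarrow> 'w \<Rightarrow> 'b::real_normed_vector) \<Rightarrow> bool" where
  "smooth U N 0 F \<longleftrightarrow> (\<exists>C\<ge>0. \<forall>t\<in>U. \<forall>w. norm (F t w) \<le> C * N w)"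
| "smooth U N (Suc m) F \<longleftrightarrow> (\<exists>C\<ge>0. \<forall>t\<in>U. \<forall>w. norm (F t w) \<le> C * N w) \<and>
     (\<exists>F'. (\<forall>t\<in>U. \<forall>w. ((\<lambda>s. F s w) has_vector_derivative F' t w) (at t within U)) \<and> smooth U N m F')"

lemma smooth_bounded: "smooth U N m F \<Longrightarrow> \<exists>C\<ge>0. \<forall>t\<in>U. \<forall>w. norm (F t w) \<le> C * N w"
  by (cases m) auto

lemma smooth_Suc_D: "smooth U N (Suc m) F \<Longrightarrow> smooth U N m F"
proof (induction m arbitrary: F)
  case (Suc m)
  from Suc.prems obtain F' where "\<forall>t\<in>U. \<forall>w. ((\<lambda>s. F s w) has_vector_derivative F' t w) (at t within U)"
    "smooth U N (Suc m) F'" unfolding smooth.simps(2)[of U N "Suc m" F] by blast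
  moreover from this have "smooth U N m F'" by (intro Suc.IH)
  moreover have "\<exists>C\<ge>0. \<forall>t\<in>U. \<forall>w. norm (F t w) \<le> C * N w"
    using Suc.prems unfolding smooth.simps(2)[of U N "Suc m" F] by blast
  ultimately show ?case unfolding smooth.simps(2)[of U N m F] by blast
qed (simp only: smooth.simps)

lemma smooth_mono: "smooth U N m F \<Longrightarrow> m' \<le> m \<Longrightarrow> smooth U N m' F"
proof (induction m)
  case (Suc m)
  then show ?case using smooth_Suc_D by (metis le_Suc_eq)
qed simp

lemma smooth_cong:
  assumes "smooth U N m F" "\<And>t w. t \<in> U \<Longrightarrow> F t w = H t w"
  shows "smooth U N m H"
proof (cases m)
  case 0
  then show ?thesis using assms by auto
next
  case (Suc n)
  then obtain F' where F': "\<forall>t\<in>U. \<forall>w. ((\<lambda>s. F s w) has_vector_derivative F' t w) (at t within U)" "smooth U N n F'"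
    using assms by auto
  have "\<forall>t\<in>U. \<forall>w. ((\<lambda>s. H s w) has_vector_derivative F' t w) (at t within U)"
  proof (intro ballI allI)
    fix t w assume t: "t \<in> U"
    show "((\<lambda>s. H s w) has_vector_derivative F' t w) (at t within U)"
      by (rule has_vector_derivative_transform[OF t _ F'(1)[rule_format, OF t]]) (use assms(2) in simp)
  qed
  moreover have "\<exists>C\<ge>0. \<forall>t\<in>U. \<forall>w. norm (H t w) \<le> C * N w" using smooth_bounded[OF assms(1)] assms(2) by auto
  ultimately show ?thesis using F'(2) Suc by auto
qed

lemma smooth_add: "smooth U N m F \<Longrightarrow> smooth U N m H \<Longrightarrow> smooth U N m (\<lambda>t w. F t w + H t w)"
proof (induction m arbitrary: F H)
  case 0
  then obtain C C' where "C \<ge> 0" "\<forall>t\<in>U. \<forall>w. norm (F t w) \<le> C * N w" "C' \<ge> 0" "\<forall>t\<in>U. \<forall>w. norm (H t w) \<le> C' * N w"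
    by auto
  note C = this
  have "norm (F t w + H t w) \<le> (C + C') * N w" if "t \<in> U" for t w
    unfolding distrib_right by (rule order_trans[OF norm_triangle_ineq add_mono]) (use C that in blast)+
  then show ?case using C(1,3) by (auto intro!: exI[of _ "C + C'"])
next
  case (Suc m)
  obtain F' where F': "\<forall>t\<in>U. \<forall>w. ((\<lambda>s. F s w) has_vector_derivative F' t w) (at t within U)" "smooth U N m F'"
    using Suc.prems(1) by auto
  obtain H' where H': "\<forall>t\<in>U. \<forall>w. ((\<lambda>s. H s w) has_vector_derivative H' t w) (at t within U)" "smooth U N m H'"
    using Suc.prems(2) by auto
  have "smooth U N m (\<lambda>t w. F t w + H t w)"
    by (rule Suc.IH[OF smooth_Suc_D[OF Suc.prems(1)] smooth_Suc_D[OF Suc.prems(2)]])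
  from smooth_bounded[OF this] Suc.IH[OF F'(2) H'(2)] F'(1) H'(1) show ?case
    by (auto intro!: exI[of _ "\<lambda>t w. F' t w + H' t w"] has_vector_derivative_add)
qed

lemma smooth_zero: "smooth U N m (\<lambda>t w. 0)"
proof (induction m)
  case (Suc m)
  then show ?case by (auto intro!: exI[of _ "\<lambda>t w. 0"] exI[of _ 0])
qed (auto intro!: exI[of _ 0])

lemma smooth_sum: "finite K \<Longrightarrow> (\<And>i. i \<in> K \<Longrightarrow> smooth U N m (F i)) \<Longrightarrow> smooth U N m (\<lambda>t w. \<Sum>i\<in>K. F i t w)"
  by (induction rule: finite_induct) (auto simp: smooth_zero intro: smooth_add)

lemma smooth_constant: "0 \<le> C \<Longrightarrow> (\<And>w. norm (v w) \<le> C * N w) \<Longrightarrow> smooth U N m (\<lambda>t w. v w)"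
  by (cases m) (auto intro!: exI[of _ C] exI[of _ "\<lambda>t w. 0"] smooth_zero)

lemma smooth_Pair: "smooth U N m F \<Longrightarrow> smooth U N m H \<Longrightarrow> smooth U N m (\<lambda>t w. (F t w, H t w))"
proof (induction m arbitrary: F H)
  case 0
  then obtain C C' where "C \<ge> 0" "\<forall>t\<in>U. \<forall>w. norm (F t w) \<le> C * N w" "C' \<ge> 0" "\<forall>t\<in>U. \<forall>w. norm (H t w) \<le> C' * N w"
    by auto
  note C = this
  have "norm (F t w, H t w) \<le> (C + C') * N w" if "t \<in> U" for t w
    unfolding distrib_right by (rule order_trans[OF norm_Pair_le add_mono]) (use C that in blast)+
  then show ?case using C(1,3) by (auto intro!: exI[of _ "C + C'"])
next
  case (Suc m)
  obtain F' where F': "\<forall>t\<in>U. \<forall>w. ((\<lambda>s. F s w) has_vector_derivative F' t w) (at t within U)" "smooth U N m F'"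
    using Suc.prems(1) by auto
  obtain H' where H': "\<forall>t\<in>U. \<forall>w. ((\<lambda>s. H s w) has_vector_derivative H' t w) (at t within U)" "smooth U N m H'"
    using Suc.prems(2) by auto
  have "smooth U N m (\<lambda>t w. (F t w, H t w))"
    by (rule Suc.IH[OF smooth_Suc_D[OF Suc.prems(1)] smooth_Suc_D[OF Suc.prems(2)]])
  from smooth_bounded[OF this] Suc.IH[OF F'(2) H'(2)] F'(1) H'(1) show ?case
    by (auto intro!: exI[of _ "\<lambda>t w. (F' t w, H' t w)"] has_vector_derivative_Pair)
qed

lemma smooth_identity: "smooth {a..b} (\<lambda>w. 1) m (\<lambda>t w. t)"
proof (cases m)
  case 0
  then show ?thesis by (auto intro!: exI[of _ "\<bar>a\<bar> + \<bar>b\<bar>"])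
next
  case (Suc n)
  have "smooth {a..b} (\<lambda>w. 1) n (\<lambda>t w. 1::real)" by (rule smooth_constant[of 1]) auto
  then show ?thesis unfolding Suc smooth.simps
    by (intro conjI exI[of _ "\<bar>a\<bar> + \<bar>b\<bar>"] exI[of _ "\<lambda>t w. 1"]) auto
qed

lemma smooth_of_C_k:
  assumes "C_k_on_interval p u a b"
  shows "smooth {a..b} (\<lambda>w::'w. 1) p (\<lambda>t w. u t)"
proof -
  obtain v where v0: "\<forall>t\<in>{a..b}. v 0 t = u t"
    and dv: "\<forall>k<p. \<forall>t\<in>{a..b}. (v k has_vector_derivative v (Suc k) t) (at t within {a..b})"
    and cv: "continuous_on {a..b} (v p)"
    using assms unfolding C_k_on_interval_def by blast
  have cont: "continuous_on {a..b} (v k)" if "k \<le> p" for k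
  proof (cases "k = p")
    case False
    then show ?thesis using dv that unfolding continuous_on_eq_continuous_within
      by (meson has_vector_derivative_continuous le_neq_implies_less)
  qed (use cv in simp)
  have bnd: "\<exists>C\<ge>0. \<forall>t\<in>{a..b}. norm (v k t) \<le> C" if "k \<le> p" for k
  proof -
    have "bounded (v k ` {a..b})" using compact_continuous_image[OF cont[OF that] compact_Icc] compact_imp_bounded by blast
    then obtain C where "\<forall>t\<in>{a..b}. norm (v k t) \<le> C" unfolding bounded_iff by auto
    then show ?thesis by (intro exI[of _ "max 0 C"]) (auto simp: le_max_iff_disj)
  qed
  have "smooth {a..b} (\<lambda>w::'w. 1) m (\<lambda>t w. v k t)" if "k + m \<le> p" for k m
    using that
  proof (induction m arbitrary: k)
    case 0
    then show ?case using bnd[of k] by auto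
  next
    case (Suc m)
    have "smooth {a..b} (\<lambda>w::'w. 1) m (\<lambda>t w. v (Suc k) t)" by (rule Suc.IH) (use Suc.prems in simp)
    moreover have "\<forall>t\<in>{a..b}. (v k has_vector_derivative v (Suc k) t) (at t within {a..b})" using dv Suc.prems by auto
    ultimately show ?case using bnd[of k] Suc.prems by auto
  qed
  from this[of 0 p] show ?thesis by (rule smooth_cong) (use v0 in auto)
qed

text \<open>Differentiation of \<open>G k (\<gamma> t) [v\<^sub>1 t, ..., v\<^sub>k t]\<close> yields terms of the same form: either \<open>k\<close> grows by one
with the new argument \<open>\<gamma>'\<close>, or one of the arguments is differentiated. The order \<open>k = 0\<close> is excluded because
the function itself need not be bounded.\<close>

lemma (in frechet_jet) smooth_G:
  fixes \<gamma> :: "real \<Rightarrow> 'b" and vs :: "((real \<Rightarrow> 'w \<Rightarrow> 'b) \<times> ('w \<Rightarrow> real)) list"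
  assumes \<gamma>W: "\<And>s. s \<in> U \<Longrightarrow> \<gamma> s \<in> W" and \<gamma>: "smooth U (\<lambda>w::'w. 1) p (\<lambda>t w. \<gamma> t)"
    and k: "1 \<le> length vs" "length vs + m \<le> p"
    and vs: "\<And>v N. (v, N) \<in> set vs \<Longrightarrow> smooth U N m v \<and> (\<forall>w. 0 \<le> N w)"
  shows "smooth U (\<lambda>w. prod_list (map (\<lambda>(v, N). N w) vs)) m (\<lambda>t w. G (length vs) (\<gamma> t) (map (\<lambda>(v, N). v t w) vs))"
  using k vs
proof (induction m arbitrary: vs)
  case 0
  have "\<exists>C\<ge>0. \<forall>t\<in>U. \<forall>w. prod_list (map norm (map (\<lambda>(v, N). v t w) vs)) \<le> C * prod_list (map (\<lambda>(v, N). N w) vs)"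
    using 0(3)
  proof (induction vs)
    case Nil
    then show ?case by (auto intro!: exI[of _ 1])
  next
    case (Cons c vs)
    obtain v N where c: "c = (v, N)" by (cases c)
    obtain C where C: "C \<ge> 0" "\<forall>t\<in>U. \<forall>w. prod_list (map norm (map (\<lambda>(v, N). v t w) vs)) \<le> C * prod_list (map (\<lambda>(v, N). N w) vs)"
      using Cons by (meson list.set_intros(2))
    obtain C' where C': "C' \<ge> 0" "\<forall>t\<in>U. \<forall>w. norm (v t w) \<le> C' * N w"
      using Cons.prems[of v N] smooth_bounded[of U N 0 v] by (auto simp: c)
    have N: "0 \<le> N w" for w using Cons.prems[of v N] by (simp add: c)
    have "prod_list (map norm (map (\<lambda>(v, N). v t w) (c # vs))) \<le> (C' * C) * prod_list (map (\<lambda>(v, N). N w) (c # vs))" if "t \<in> U" for t w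
    proof -
      have "norm (v t w) * prod_list (map norm (map (\<lambda>(v, N). v t w) vs)) \<le> (C' * N w) * (C * prod_list (map (\<lambda>(v, N). N w) vs))"
        using C C' N that by (intro mult_mono mult_nonneg_nonneg) (auto)
      then show ?thesis by (simp add: c mult_ac)
    qed
    then show ?case using C(1) C'(1) by (intro exI[of _ "C' * C"]) auto
  qed
  then obtain C where C: "C \<ge> 0" "\<forall>t\<in>U. \<forall>w. prod_list (map norm (map (\<lambda>(v, N). v t w) vs)) \<le> C * prod_list (map (\<lambda>(v, N). N w) vs)"
    by blast
  have "norm (G (length vs) (\<gamma> t) (map (\<lambda>(v, N). v t w) vs)) \<le> (M * C) * prod_list (map (\<lambda>(v, N). N w) vs)" if "t \<in> U" for t w
  proof -
    have "norm (G (length vs) (\<gamma> t) (map (\<lambda>(v, N). v t w) vs)) \<le> M * prod_list (map norm (map (\<lambda>(v, N). v t w) vs))"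
      using 0 \<gamma>W that by (intro G_bounded) auto
    also have "\<dots> \<le> M * (C * prod_list (map (\<lambda>(v, N). N w) vs))" using C that M_nonneg by (intro mult_left_mono) auto
    finally show ?thesis by (simp add: mult_ac)
  qed
  then show ?case using C(1) M_nonneg by (auto intro!: exI[of _ "M * C"])
next
  case (Suc m)
  let ?k = "length vs"
  let ?N = "\<lambda>w. prod_list (map (\<lambda>(v, N). N w) vs)"
  have bdd: "\<exists>C\<ge>0. \<forall>t\<in>U. \<forall>w. norm (G ?k (\<gamma> t) (map (\<lambda>(v, N). v t w) vs)) \<le> C * ?N w"
  proof (rule smooth_bounded[where m = m], rule Suc.IH)
    show "1 \<le> ?k" "?k + m \<le> p" using Suc.prems by auto
    fix v N assume "(v, N) \<in> set vs"
    then show "smooth U N m v \<and> (\<forall>w. 0 \<le> N w)" using Suc.prems(3)[of v N] smooth_Suc_D by blast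
  qed
  have "p \<noteq> 0" using Suc.prems by auto
  then obtain p' where p': "p = Suc p'" by (cases p) auto
  obtain \<gamma>f where \<gamma>f: "\<forall>t\<in>U. \<forall>w::'w. (\<gamma> has_vector_derivative \<gamma>f t w) (at t within U)" "smooth U (\<lambda>w. 1) p' \<gamma>f"
    using \<gamma> unfolding p' by auto
  have "\<forall>c\<in>set vs. \<exists>v'. (\<forall>t\<in>U. \<forall>w. ((\<lambda>s. fst c s w) has_vector_derivative v' t w) (at t within U)) \<and> smooth U (snd c) m v'"
    using Suc.prems(3) by fastforce
  from bchoice[OF this] obtain dv where dv: "\<And>c. c \<in> set vs \<Longrightarrow> (\<forall>t\<in>U. \<forall>w. ((\<lambda>s. fst c s w) has_vector_derivative dv c t w) (at t within U)) \<and> smooth U (snd c) m (dv c)"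
    by blast
  let ?F' = "\<lambda>t w. G (Suc ?k) (\<gamma> t) (\<gamma>f t w # map (\<lambda>(v, N). v t w) vs) +
      (\<Sum>i<?k. G ?k (\<gamma> t) (map (\<lambda>(v, N). v t w) (vs[i := (dv (vs ! i), snd (vs ! i))])))"
  have d: "((\<lambda>s. G ?k (\<gamma> s) (map (\<lambda>(v, N). v s w) vs)) has_vector_derivative ?F' t w) (at t within U)" if t: "t \<in> U" for t w
  proof -
    define xs where "xs = map (\<lambda>(v, N) s. v s w) vs"
    have ch: "((\<lambda>s. G ?k (\<gamma> s) (map (\<lambda>x. x s) xs)) has_vector_derivative
      G (Suc ?k) (\<gamma> t) (\<gamma>f t w # map (\<lambda>x. x t) xs) +
      (\<Sum>i<?k. G ?k (\<gamma> t) ((map (\<lambda>x. x t) xs)[i := map (\<lambda>c. dv c t w) vs ! i]))) (at t within U)"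
    proof (rule G_chain_rule[OF _ \<gamma>W t])
      show "?k < p" using Suc.prems by auto
      show "(\<gamma> has_vector_derivative \<gamma>f t w) (at t within U)" using \<gamma>f t by blast
      show "list_all2 (\<lambda>x x'. (x has_vector_derivative x') (at t within U)) xs (map (\<lambda>c. dv c t w) vs)"
        using dv t by (auto simp: xs_def list_all2_conv_all_nth case_prod_unfold)
    qed (auto simp: xs_def)
    have m1: "map (\<lambda>x. x s) xs = map (\<lambda>(v, N). v s w) vs" for s
      by (simp add: xs_def comp_def case_prod_unfold)
    have m2: "(map (\<lambda>x. x t) xs)[i := map (\<lambda>c. dv c t w) vs ! i] =
       map (\<lambda>(v, N). v t w) (vs[i := (dv (vs ! i), snd (vs ! i))])" if "i < ?k" for i
      using that by (simp add: xs_def map_update comp_def case_prod_unfold)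
    have e: "(\<Sum>i<?k. G ?k (\<gamma> t) ((map (\<lambda>x. x t) xs)[i := map (\<lambda>c. dv c t w) vs ! i])) =
       (\<Sum>i<?k. G ?k (\<gamma> t) (map (\<lambda>(v, N). v t w) (vs[i := (dv (vs ! i), snd (vs ! i))])))"
      by (intro sum.cong refl arg_cong[where f = "G ?k (\<gamma> t)"] m2) simp
    from ch[unfolded e, unfolded m1] show ?thesis .
  qed
  have s1: "smooth U ?N m (\<lambda>t w. G (Suc ?k) (\<gamma> t) (\<gamma>f t w # map (\<lambda>(v, N). v t w) vs))"
  proof -
    have "smooth U (\<lambda>w. prod_list (map (\<lambda>(v, N). N w) ((\<gamma>f, \<lambda>w. 1) # vs))) m
       (\<lambda>t w. G (length ((\<gamma>f, \<lambda>w. 1) # vs)) (\<gamma> t) (map (\<lambda>(v, N). v t w) ((\<gamma>f, \<lambda>w. 1) # vs)))"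
    proof (rule Suc.IH)
      fix v N assume "(v, N) \<in> set ((\<gamma>f, \<lambda>w. 1) # vs)"
      then consider "v = \<gamma>f" "N = (\<lambda>w. 1)" | "(v, N) \<in> set vs" by auto
      then show "smooth U N m v \<and> (\<forall>w. 0 \<le> N w)"
      proof cases
        case 1
        have "m \<le> p'" using Suc.prems(1,2) p' by simp
        from smooth_mono[OF \<gamma>f(2) this] 1 show ?thesis by simp
      next
        case 2
        then show ?thesis using Suc.prems(3) smooth_Suc_D by blast
      qed
    qed (use Suc.prems in auto)
    then show ?thesis by simp
  qed
  have s2: "smooth U ?N m (\<lambda>t w. G ?k (\<gamma> t) (map (\<lambda>(v, N). v t w) (vs[i := (dv (vs ! i), snd (vs ! i))])))" if i: "i < ?k" for i
  proof -
    let ?vs = "vs[i := (dv (vs ! i), snd (vs ! i))]"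
    have "smooth U (\<lambda>w. prod_list (map (\<lambda>(v, N). N w) ?vs)) m (\<lambda>t w. G (length ?vs) (\<gamma> t) (map (\<lambda>(v, N). v t w) ?vs))"
    proof (rule Suc.IH)
      fix v N assume "(v, N) \<in> set ?vs"
      then consider "(v, N) = (dv (vs ! i), snd (vs ! i))" | "(v, N) \<in> set vs"
        using set_update_subset_insert by fastforce
      then show "smooth U N m v \<and> (\<forall>w. 0 \<le> N w)"
      proof cases
        case 1
        then show ?thesis using dv[of "vs ! i"] Suc.prems(3)[of "fst (vs ! i)" "snd (vs ! i)"] i by auto
      next
        case 2
        then show ?thesis using Suc.prems(3) smooth_Suc_D by blast
      qed
    qed (use Suc.prems in auto)
    moreover have "map (\<lambda>(v, N). N w) ?vs = map (\<lambda>(v, N). N w) vs" for w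
      using i by (intro nth_equalityI) (auto simp: nth_list_update case_prod_unfold)
    ultimately show ?thesis by simp
  qed
  have "smooth U ?N m ?F'" by (intro smooth_add s1 smooth_sum s2) auto
  with d have "\<exists>F'. (\<forall>t\<in>U. \<forall>w. ((\<lambda>s. G ?k (\<gamma> s) (map (\<lambda>(v, N). v s w) vs)) has_vector_derivative F' t w) (at t within U)) \<and> smooth U ?N m F'"
    by (intro exI[of _ ?F'] conjI ballI allI)
  then show ?case unfolding smooth.simps(2) using bdd by (intro conjI)
qed

section \<open>Taylor expansion of the nonlinearity along the solution\<close>

text \<open>The bound omits the factorial, so that each induction step is one application of the mean value inequality.\<close>

lemma vector_taylor_bound:
  fixes F :: "nat \<Rightarrow> real \<Rightarrow> 'b::real_normed_vector"
  assumes der: "\<And>k t. k < m \<Longrightarrow> t \<in> {a..b} \<Longrightarrow> (F k has_vector_derivative F (Suc k) t) (at t within {a..b})"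
    and bnd: "\<And>t. t \<in> {a..b} \<Longrightarrow> norm (F m t) \<le> B"
    and t: "t \<in> {a..b}" and s: "0 \<le> s" "t + s \<le> b"
  shows "norm (F 0 (t + s) - (\<Sum>k<m. (s ^ k / fact k) *\<^sub>R F k t)) \<le> B * s ^ m"
  using der bnd s
proof (induction m arbitrary: F s)
  case 0
  then show ?case using t by auto
next
  case (Suc m)
  have B: "0 \<le> B" using Suc.prems(2)[OF t] norm_ge_zero order_trans by blast
  define H where "H r = F 0 (t + r) - (\<Sum>k<Suc m. (r ^ k / fact k) *\<^sub>R F k t)" for r
  define H' where "H' r = F 1 (t + r) - (\<Sum>k<m. (r ^ k / fact k) *\<^sub>R F (Suc k) t)" for r
  have IH: "norm (H' r) \<le> B * s ^ m" if r: "r \<in> {0..s}" for r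
  proof -
    have "norm (F (Suc 0) (t + r) - (\<Sum>k<m. (r ^ k / fact k) *\<^sub>R F (Suc k) t)) \<le> B * r ^ m"
      by (rule Suc.IH[of "\<lambda>k. F (Suc k)"]) (use Suc.prems r in auto)
    also have "\<dots> \<le> B * s ^ m" using r B by (intro mult_left_mono power_mono) auto
    finally show ?thesis by (simp add: H'_def)
  qed
  have "(H has_vector_derivative H' r) (at r within {0..s})" if r: "r \<in> {0..s}" for r
  proof -
    have tr: "t + r \<in> {a..b}" using r t Suc.prems by auto
    have 1: "((\<lambda>r. t + r) has_vector_derivative 1) (at r within {0..s})" by (auto intro!: derivative_eq_intros)
    have 2: "(F 0 has_vector_derivative F 1 (t + r)) (at (t + r) within (\<lambda>r. t + r) ` {0..s})"
    proof (rule has_vector_derivative_within_subset)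
      show "(F 0 has_vector_derivative F 1 (t + r)) (at (t + r) within {a..b})" using Suc.prems(1)[of 0, OF _ tr] by simp
    qed (use t Suc.prems in auto)
    have d0: "((\<lambda>r. F 0 (t + r)) has_vector_derivative F 1 (t + r)) (at r within {0..s})"
      using vector_diff_chain_within[OF 1 2] by (simp add: comp_def)
    have dk: "((\<lambda>r. (r ^ k / fact k) *\<^sub>R x) has_vector_derivative (real k * r ^ (k - 1) / fact k) *\<^sub>R x) (at r within {0..s})" for k and x :: 'b
    proof -
      have "((\<lambda>r. r ^ k / fact k) has_real_derivative real k * r ^ (k - 1) / fact k) (at r within {0..s})"
        by (auto intro!: derivative_eq_intros)
      from has_vector_derivative_scaleR[OF this has_vector_derivative_const[of x]] show ?thesis by simp
    qed
    have "((\<lambda>r. F 0 (t + r) - (\<Sum>k<Suc m. (r ^ k / fact k) *\<^sub>R F k t)) has_vector_derivative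
       F 1 (t + r) - (\<Sum>k<Suc m. (real k * r ^ (k - 1) / fact k) *\<^sub>R F k t)) (at r within {0..s})"
      by (intro has_vector_derivative_diff has_vector_derivative_sum d0 dk)
    moreover have "(\<Sum>k<Suc m. (real k * r ^ (k - 1) / fact k) *\<^sub>R F k t) = (\<Sum>k<m. (r ^ k / fact k) *\<^sub>R F (Suc k) t)"
    proof -
      have "real (Suc k) * r ^ k / fact (Suc k) = r ^ k / fact k" for k
        by (simp only: fact_Suc of_nat_mult) (simp del: of_nat_Suc)
      then show ?thesis unfolding sum.lessThan_Suc_shift by (simp del: fact_Suc of_nat_Suc)
    qed
    ultimately show ?thesis unfolding H_def[abs_def] H'_def by simp
  qed
  from vector_derivative_bound[OF this IH, of s 0]
  have "norm (H s - H 0) \<le> B * s ^ m * \<bar>s - 0\<bar>" using Suc.prems(3) by simp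
  moreover have "H 0 = 0" unfolding H_def sum.lessThan_Suc_shift by simp
  ultimately show ?case using Suc.prems(3) by (simp add: H_def mult_ac del: sum.lessThan_Suc)
qed

lemma smooth_derivatives:
  assumes "smooth U N m F"
  shows "\<exists>Fs. Fs 0 = F \<and> (\<forall>k<m. \<forall>t\<in>U. \<forall>w. ((\<lambda>s. Fs k s w) has_vector_derivative Fs (Suc k) t w) (at t within U)) \<and>
     (\<exists>C\<ge>0. \<forall>k\<le>m. \<forall>t\<in>U. \<forall>w. norm (Fs k t w) \<le> C * N w)"
  using assms
proof (induction m arbitrary: F)
  case 0
  then obtain C where "C \<ge> 0" "\<forall>t\<in>U. \<forall>w. norm (F t w) \<le> C * N w" by auto
  then show ?case by (intro exI[of _ "\<lambda>k. F"]) auto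
next
  case (Suc m)
  obtain C where C: "C \<ge> 0" "\<forall>t\<in>U. \<forall>w. norm (F t w) \<le> C * N w" using smooth_bounded[OF Suc.prems] by blast
  obtain F' where F': "\<forall>t\<in>U. \<forall>w. ((\<lambda>s. F s w) has_vector_derivative F' t w) (at t within U)" "smooth U N m F'"
    using Suc.prems by auto
  obtain Fs C' where Fs: "Fs 0 = F'" "\<forall>k<m. \<forall>t\<in>U. \<forall>w. ((\<lambda>s. Fs k s w) has_vector_derivative Fs (Suc k) t w) (at t within U)"
    and C': "C' \<ge> 0" "\<forall>k\<le>m. \<forall>t\<in>U. \<forall>w. norm (Fs k t w) \<le> C' * N w"
    using Suc.IH[OF F'(2)] by blast
  define H where "H k = (case k of 0 \<Rightarrow> F | Suc j \<Rightarrow> Fs j)" for k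
  have H: "H 0 = F" "H (Suc j) = Fs j" for j by (simp_all add: H_def)
  have "\<forall>k<Suc m. \<forall>t\<in>U. \<forall>w. ((\<lambda>s. H k s w) has_vector_derivative H (Suc k) t w) (at t within U)"
  proof (intro allI impI)
    fix k assume "k < Suc m"
    then show "\<forall>t\<in>U. \<forall>w. ((\<lambda>s. H k s w) has_vector_derivative H (Suc k) t w) (at t within U)"
      by (cases k) (use F'(1) Fs in \<open>simp_all add: H\<close>)
  qed
  moreover have "norm (H k t w) \<le> max C C' * N w" if "k \<le> Suc m" "t \<in> U" for k t w
  proof (cases "0 \<le> N w")
    case True
    have "norm (H k t w) \<le> (if k = 0 then C else C') * N w" using C C' that by (cases k) (auto simp: H)
    also have "\<dots> \<le> max C C' * N w" using True by (intro mult_right_mono) auto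
    finally show ?thesis .
  next
    case False
    have "norm (F t w) \<le> C * N w" using C that by blast
    then have "0 \<le> C * N w" by (rule order_trans[OF norm_ge_zero])
    then have "C = 0" using False C(1) by (simp add: zero_le_mult_iff)
    have "norm (Fs 0 t w) \<le> C' * N w" using C' that by blast
    then have "0 \<le> C' * N w" by (rule order_trans[OF norm_ge_zero])
    then have "C' = 0" using False C'(1) by (simp add: zero_le_mult_iff)
    show ?thesis using C C' \<open>C = 0\<close> \<open>C' = 0\<close> that by (cases k) (auto simp: H)
  qed
  ultimately show ?case using H(1) C(1) by (intro exI[of _ H]) (auto intro!: exI[of _ "max C C'"])
qed

text \<open>By uniqueness of derivatives, applied to sums and multiples of the arguments.\<close>

lemma vector_derivative_linear:
  fixes F :: "real \<Rightarrow> 'b::real_normed_vector \<Rightarrow> 'c::real_normed_vector"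
  assumes ab: "a < b" and t: "t \<in> {a..b}" and lin: "\<And>s. s \<in> {a..b} \<Longrightarrow> linear (F s)"
    and der: "\<And>w. ((\<lambda>s. F s w) has_vector_derivative F' w) (at t within {a..b})"
  shows "linear F'"
proof (rule linearI)
  have uniq: "x = y" if "(H has_vector_derivative x) (at t within {a..b})" "(H has_vector_derivative y) (at t within {a..b})" for H :: "real \<Rightarrow> 'c" and x y
  proof (rule vector_derivative_unique_within[OF _ that])
    show "at t within {a..b} \<noteq> bot" using ab t by (simp add: trivial_limit_within)
  qed
  fix x y c
  show "F' (x + y) = F' x + F' y"
    by (rule uniq[OF der], rule has_vector_derivative_transform[OF t _ has_vector_derivative_add[OF der der]])
       (simp add: linear_add[OF lin])
  show "F' (c *\<^sub>R x) = c *\<^sub>R F' x"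
    by (rule uniq[OF der], rule has_vector_derivative_transform[OF t _ bounded_linear.has_vector_derivative[OF bounded_linear_scaleR_right der]])
       (simp add: linear_scale[OF lin])
qed

locale erk_problem = analytic_generator S D A for S :: "real \<Rightarrow> 'a::banach \<Rightarrow>\<^sub>L 'a" and D A +
  fixes g :: "real \<Rightarrow> 'a \<Rightarrow> 'a" and u :: "real \<Rightarrow> 'a" and t0 T R :: real and p :: nat and M :: erk_method
  assumes t0T: "t0 < T"
    and u_in_D: "\<And>t. t \<in> {t0..T} \<Longrightarrow> u t \<in> D"
    and u_derivative: "\<And>t. t \<in> {t0..T} \<Longrightarrow> (u has_vector_derivative A (u t) + g t (u t)) (at t within {t0..T})"
    and u_smooth: "C_k_on_interval p u t0 T"
    and R_pos: "R > 0"
    and g_smooth: "bounded_frechet_differentiable p (\<lambda>(t, x). g t x) (strip t0 T u R)"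
    and g_lipschitz: "\<exists>L. \<forall>t\<in>{t0..T}. L-lipschitz_on (ball (u t) R) (g t)"
    and p_ge: "2 \<le> p" and p_le: "p \<le> 5"
    and valid: "valid_erk_method M"
    and conditions: "stiff_conditions_weakened M p"
begin

lemma jet_exists:
  "\<exists>G K. frechet_jet (strip t0 T u R) G p K \<and> (\<forall>t\<in>{t0..T}. \<forall>x. norm (x - u t) < R \<longrightarrow> G 0 (t, x) [] = g t x)"
proof -
  from g_smooth[unfolded bounded_frechet_differentiable_def] obtain G K
    where G0: "\<forall>x\<in>strip t0 T u R. G 0 x [] = (\<lambda>(t, x). g t x) x"
    and G1: "\<forall>k\<le>p. \<forall>x\<in>strip t0 T u R. multilinear_map k (G k x)"
    and G2: "\<forall>k\<in>{1..p}. \<forall>x\<in>strip t0 T u R. \<forall>vs. length vs = k \<longrightarrow> norm (G k x vs) \<le> K * prod_list (map norm vs)"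
    and G3: "\<forall>k<p. \<forall>x\<in>strip t0 T u R. \<forall>\<epsilon>>0. \<exists>\<eta>>0. \<forall>y\<in>strip t0 T u R. norm (y - x) < \<eta> \<longrightarrow>
              (\<forall>vs. length vs = k \<longrightarrow> norm (G k y vs - G k x vs - G (Suc k) x ((y - x) # vs)) \<le> \<epsilon> * norm (y - x) * prod_list (map norm vs))"
    by (elim exE conjE)
  have "frechet_jet (strip t0 T u R) G p (max 0 K)"
  proof
    fix k x and vs :: "(real \<times> 'a) list" assume "1 \<le> k" "k \<le> p" "x \<in> strip t0 T u R" "length vs = k"
    then have "norm (G k x vs) \<le> K * prod_list (map norm vs)" using G2 by auto
    also have "\<dots> \<le> max 0 K * prod_list (map norm vs)" by (intro mult_right_mono) auto
    finally show "norm (G k x vs) \<le> max 0 K * prod_list (map norm vs)" .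
  next
    fix k x and \<epsilon> :: real assume "k < p" "x \<in> strip t0 T u R" "\<epsilon> > 0"
    then show "\<exists>\<eta>>0. \<forall>y\<in>strip t0 T u R. norm (y - x) < \<eta> \<longrightarrow> (\<forall>vs. length vs = k \<longrightarrow>
        norm (G k y vs - G k x vs - G (Suc k) x ((y - x) # vs)) \<le> \<epsilon> * norm (y - x) * prod_list (map norm vs))"
      using G3 by blast
  qed (use G1 in auto)
  moreover have "\<forall>t\<in>{t0..T}. \<forall>x. norm (x - u t) < R \<longrightarrow> G 0 (t, x) [] = g t x"
    using G0 by (auto simp: strip_def)
  ultimately show ?thesis by blast
qed

lemma curve_smooth: "smooth {t0..T} (\<lambda>w::'w. 1) p (\<lambda>t w. (t, u t))"
  by (intro smooth_Pair smooth_identity smooth_of_C_k u_smooth)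

lemma curve_in_strip: "t \<in> {t0..T} \<Longrightarrow> (t, u t) \<in> strip t0 T u R"
  using R_pos by (simp add: strip_def)

lemma nonlinearity_smooth:
  "\<exists>F. F 0 = (\<lambda>t. g t (u t)) \<and> (\<forall>k<p. \<forall>t\<in>{t0..T}. (F k has_vector_derivative F (Suc k) t) (at t within {t0..T})) \<and>
     (\<exists>C\<ge>0. \<forall>k. 1 \<le> k \<longrightarrow> k \<le> p \<longrightarrow> (\<forall>t\<in>{t0..T}. norm (F k t) \<le> C))"
proof -
  obtain G K where jet: "frechet_jet (strip t0 T u R) G p K"
    and G0: "\<forall>t\<in>{t0..T}. \<forall>x. norm (x - u t) < R \<longrightarrow> G 0 (t, x) [] = g t x" using jet_exists by blast
  interpret frechet_jet "strip t0 T u R" G p K by (rule jet)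
  obtain p' where p': "p = Suc p'" using p_ge by (cases p) auto
  obtain \<gamma>f where \<gamma>f: "\<forall>t\<in>{t0..T}. \<forall>w::unit. ((\<lambda>t. (t, u t)) has_vector_derivative \<gamma>f t w) (at t within {t0..T})" "smooth {t0..T} (\<lambda>w. 1) p' \<gamma>f"
    using curve_smooth[where ?'w = unit] unfolding p' smooth.simps(2) by (elim conjE exE)
  let ?vs = "[(\<gamma>f, \<lambda>w::unit. 1::real)]"
  have "smooth {t0..T} (\<lambda>w. prod_list (map (\<lambda>(v, N). N w) ?vs)) p' (\<lambda>t w. G (length ?vs) (t, u t) (map (\<lambda>(v, N). v t w) ?vs))"
    by (rule smooth_G[OF curve_in_strip curve_smooth]) (use \<gamma>f(2) p' in auto)
  then have "smooth {t0..T} (\<lambda>w::unit. 1) p' (\<lambda>t w. G 1 (t, u t) [\<gamma>f t w])" by simp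
  from smooth_derivatives[OF this] obtain Fs C where Fs: "Fs 0 = (\<lambda>t w::unit. G 1 (t, u t) [\<gamma>f t w])"
    "\<forall>k<p'. \<forall>t\<in>{t0..T}. \<forall>w. ((\<lambda>s. Fs k s w) has_vector_derivative Fs (Suc k) t w) (at t within {t0..T})"
    and C: "C \<ge> 0" "\<forall>k\<le>p'. \<forall>t\<in>{t0..T}. \<forall>w. norm (Fs k t w) \<le> C * 1" by blast
  define F where "F k = (case k of 0 \<Rightarrow> (\<lambda>t. g t (u t)) | Suc j \<Rightarrow> (\<lambda>t. Fs j t ()))" for k
  have F: "F 0 = (\<lambda>t. g t (u t))" "F (Suc j) = (\<lambda>t. Fs j t ())" for j by (simp_all add: F_def)
  have d0: "(F 0 has_vector_derivative F (Suc 0) t) (at t within {t0..T})" if t: "t \<in> {t0..T}" for t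
  proof -
    have "((\<lambda>s. G 0 (s, u s) (map (\<lambda>x. x s) [])) has_vector_derivative
       G (Suc 0) (t, u t) (\<gamma>f t () # map (\<lambda>x. x t) []) + (\<Sum>i<0. G 0 (t, u t) ((map (\<lambda>x. x t) [])[i := [] ! i]))) (at t within {t0..T})"
      by (rule G_chain_rule[where \<gamma> = "\<lambda>t. (t, u t)", OF _ curve_in_strip t]) (use p_ge \<gamma>f t in auto)
    then have "((\<lambda>s. G 0 (s, u s) []) has_vector_derivative F (Suc 0) t) (at t within {t0..T})" by (simp add: F Fs(1))
    then show ?thesis
      by (rule has_vector_derivative_transform[OF t, rotated]) (use G0 R_pos in \<open>simp add: F\<close>)
  qed
  have "(F k has_vector_derivative F (Suc k) t) (at t within {t0..T})" if "k < p" "t \<in> {t0..T}" for k t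
    using that d0 Fs(2) p' by (cases k) (auto simp: F)
  moreover have "norm (F k t) \<le> C" if "1 \<le> k" "k \<le> p" "t \<in> {t0..T}" for k t
    using that C(2) p' by (cases k) (auto simp: F)
  ultimately show ?thesis using F(1) C(1) by blast
qed

text \<open>Taylor's formula along the segment from \<open>u t\<close> to \<open>u t + E\<close> at fixed time.\<close>

lemma segment_expansion:
  assumes jet: "frechet_jet (strip t0 T u R) G p K"
    and G0: "\<forall>t\<in>{t0..T}. \<forall>x. norm (x - u t) < R \<longrightarrow> G 0 (t, x) [] = g t x"
    and t: "t \<in> {t0..T}" and E: "norm E < R" and m: "1 \<le> m" "m \<le> p"
  shows "norm (g t (u t + E) - (\<Sum>k<m. (1 / fact k) *\<^sub>R G k (t, u t) (replicate k (0, E)))) \<le> K * norm E ^ m"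
proof -
  interpret frechet_jet "strip t0 T u R" G p K by (rule jet)
  define F where "F k s = G k (t, u t + s *\<^sub>R E) (replicate k (0, E))" for k s
  have inW: "(t, u t + s *\<^sub>R E) \<in> strip t0 T u R" if "s \<in> {0..1}" for s
  proof -
    have "\<bar>s\<bar> * norm E \<le> 1 * norm E" using that by (intro mult_right_mono) auto
    then show ?thesis using t E by (simp add: strip_def)
  qed
  have "norm (F 0 (0 + 1) - (\<Sum>k<m. (1 ^ k / fact k) *\<^sub>R F k 0)) \<le> (K * norm E ^ m) * 1 ^ m"
  proof (rule vector_taylor_bound[where a = 0 and b = 1])
    fix k and s :: real assume k: "k < m" and s: "s \<in> {0..1}"
    have kp: "k < p" using k m by simp
    have "((\<lambda>s. (t, u t + s *\<^sub>R E)) has_vector_derivative (0, E)) (at s within {0..1})"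
      by (auto intro!: derivative_eq_intros simp: has_vector_derivative_def)
    then have "((\<lambda>s. G k (t, u t + s *\<^sub>R E) (map (\<lambda>x. x s) (replicate k (\<lambda>s. (0, E))))) has_vector_derivative
       G (Suc k) (t, u t + s *\<^sub>R E) ((0, E) # map (\<lambda>x. x s) (replicate k (\<lambda>s. (0, E)))) +
       (\<Sum>i<k. G k (t, u t + s *\<^sub>R E) ((map (\<lambda>x. x s) (replicate k (\<lambda>s. (0, E))))[i := replicate k 0 ! i]))) (at s within {0..1})"
      by (intro G_chain_rule[where \<gamma> = "\<lambda>s. (t, u t + s *\<^sub>R E)"]) (use kp s inW in \<open>auto simp: list_all2_conv_all_nth\<close>)
    moreover have "G k (t, u t + s *\<^sub>R E) ((replicate k (0, E))[i := 0]) = 0" if "i < k" for i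
      using linear_0[OF multilinear_slot[OF G_multilinear[OF less_imp_le[OF kp] inW[OF s]], of "replicate k (0, E)" i]] that by simp
    ultimately show "(F k has_vector_derivative F (Suc k) s) (at s within {0..1})"
      unfolding F_def[abs_def] by simp
  next
    fix s :: real assume s: "s \<in> {0..1}"
    have "norm (F m s) \<le> K * prod_list (map norm (replicate m (0::real, E)))"
      unfolding F_def by (rule G_bounded[OF m inW[OF s]]) simp
    then show "norm (F m s) \<le> K * norm E ^ m" by (simp add: norm_Pair)
  qed auto
  then show ?thesis using G0 t E by (simp add: F_def)
qed

text \<open>\<open>J t\<close> is the partial derivative of \<open>g\<close> in the second variable at \<open>(t, u t)\<close>, \<open>K t\<close> and \<open>L t\<close> are its first
and second time derivatives along the solution, and \<open>B t\<close> is the second partial derivative in the second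
variable, each of them for \<open>p\<close> large enough to use it. All derivatives are frozen at time \<open>t\<close> while the difference is taken at time \<open>t + \<tau>\<close>. For
perturbations \<open>E = O(\<tau>^2)\<close> the last four bounds are of the orders \<open>2\<close>, \<open>3\<close>, \<open>4\<close> and \<open>5\<close>.\<close>

lemma nonlinearity_expansion:
  "\<exists>J K L B C. 0 \<le> C \<and>
    (\<forall>t\<in>{t0..T}. linear (J t) \<and> linear (K t) \<and> linear (L t) \<and> (\<forall>y. linear (\<lambda>x. B t x y)) \<and> (\<forall>x. linear (B t x)) \<and>
       (\<forall>w. norm (J t w) \<le> C * norm w \<and> norm (K t w) \<le> C * norm w \<and> norm (L t w) \<le> C * norm w) \<and>
       (\<forall>x y. norm (B t x y) \<le> C * norm x * norm y)) \<and>
    (\<forall>t \<tau> E. t0 \<le> t \<longrightarrow> 0 \<le> \<tau> \<longrightarrow> t + \<tau> \<le> T \<longrightarrow> norm E < R \<longrightarrow>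
      norm (g (t + \<tau>) (u (t + \<tau>) + E) - g (t + \<tau>) (u (t + \<tau>))) \<le> C * norm E \<and>
      (3 \<le> p \<longrightarrow> norm (g (t + \<tau>) (u (t + \<tau>) + E) - g (t + \<tau>) (u (t + \<tau>)) - J t E) \<le> C * (\<tau> * norm E + norm E ^ 2)) \<and>
      (4 \<le> p \<longrightarrow> norm (g (t + \<tau>) (u (t + \<tau>) + E) - g (t + \<tau>) (u (t + \<tau>)) - J t E - \<tau> *\<^sub>R K t E) \<le> C * (\<tau> ^ 2 * norm E + norm E ^ 2)) \<and>
      (5 \<le> p \<longrightarrow> norm (g (t + \<tau>) (u (t + \<tau>) + E) - g (t + \<tau>) (u (t + \<tau>)) - J t E - \<tau> *\<^sub>R K t E - (\<tau> ^ 2 / 2) *\<^sub>R L t E - (1 / 2) *\<^sub>R B t E E)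
          \<le> C * (\<tau> ^ 3 * norm E + \<tau> * norm E ^ 2 + norm E ^ 3)))"
proof -
  obtain G K where jet: "frechet_jet (strip t0 T u R) G p K"
    and G0: "\<forall>t\<in>{t0..T}. \<forall>x. norm (x - u t) < R \<longrightarrow> G 0 (t, x) [] = g t x" using jet_exists by blast
  interpret frechet_jet "strip t0 T u R" G p K by (rule jet)
  \<comment> \<open>one derivative of \<open>g\<close> is spent on \<open>J\<close>, so \<open>J\<close> is differentiable \<open>m = p - 1\<close> times\<close>
  define m where "m = p - 1"
  have pm: "p = Suc m" "1 \<le> m" using p_ge by (auto simp: m_def)
  let ?c = "\<lambda>(t::real) (w::'a). (0::real, w)"
  have cs: "smooth {t0..T} norm k ?c" for k by (rule smooth_constant[of 1]) (auto simp: norm_Pair)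
  let ?vc = "[(?c, norm :: 'a \<Rightarrow> real)]"
  have "smooth {t0..T} (\<lambda>w. prod_list (map (\<lambda>(v, N). N w) ?vc)) m (\<lambda>t w. G (length ?vc) (t, u t) (map (\<lambda>(v, N). v t w) ?vc))"
    by (rule smooth_G[OF curve_in_strip curve_smooth]) (use cs pm in auto)
  then have "smooth {t0..T} norm m (\<lambda>t w. G 1 (t, u t) [(0, w)])" by simp
  from smooth_derivatives[OF this] obtain Fs C1 where Fs0: "Fs 0 = (\<lambda>t w. G 1 (t, u t) [(0, w)])"
    and Fs: "\<forall>k<m. \<forall>t\<in>{t0..T}. \<forall>w. ((\<lambda>s. Fs k s w) has_vector_derivative Fs (Suc k) t w) (at t within {t0..T})"
    and C1: "C1 \<ge> 0" "\<forall>k\<le>m. \<forall>t\<in>{t0..T}. \<forall>w. norm (Fs k t w) \<le> C1 * norm w" by blast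
  have pair_linear: "linear (\<lambda>w::'a. (0::real, w))" by (rule linearI) auto
  have Fs_linear: "linear (Fs k t)" if "k \<le> m" "t \<in> {t0..T}" for k t
    using that
  proof (induction k arbitrary: t)
    case 0
    have "linear (\<lambda>v. G 1 (t, u t) [v])"
      using multilinear_slot[OF G_multilinear[of 1 "(t, u t)"], of "[undefined]" 0] curve_in_strip[OF 0(2)] pm by simp
    from linear_compose[OF pair_linear this] show ?case by (simp add: Fs0 comp_def)
  next
    case (Suc k)
    show ?case
      by (rule vector_derivative_linear[OF t0T Suc.prems(2) Suc.IH]) (use Fs Suc.prems in auto)
  qed
  have Fs_taylor: "norm (Fs 0 (t + s) w - (\<Sum>k<n. (s ^ k / fact k) *\<^sub>R Fs k t w)) \<le> (C1 * norm w) * s ^ n"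
    if "n \<le> m" "t0 \<le> t" "0 \<le> s" "t + s \<le> T" for n t s w
    by (rule vector_taylor_bound[where a = t0 and b = T and F = "\<lambda>k t. Fs k t w"]) (use that Fs C1 in auto)
  \<comment> \<open>coefficients that do not occur for the given \<open>p\<close> are set to \<open>0\<close>, so that they are linear and bounded\<close>
  define B where "B t x y = (if 3 \<le> p \<and> t \<in> {t0..T} then G 2 (t, u t) [(0, x), (0, y)] else 0)" for t x y
  define Fs' where "Fs' k = (if k \<le> m then Fs k else (\<lambda>t w. 0))" for k
  let ?e1 = "\<lambda>(t::real) (w::'a\<times>'a). (0::real, fst w)" and ?e2 = "\<lambda>(t::real) (w::'a\<times>'a). (0::real, snd w)"
  have es: "smooth {t0..T} (\<lambda>w. norm (fst w)) k ?e1" "smooth {t0..T} (\<lambda>w. norm (snd w)) k ?e2" for k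
    by (rule smooth_constant[of 1]; simp add: norm_Pair)+
  have B_lip: "\<exists>C\<ge>0. \<forall>t s x y. t0 \<le> t \<longrightarrow> 0 \<le> s \<longrightarrow> t + s \<le> T \<longrightarrow> norm (B (t + s) x y - B t x y) \<le> C * norm x * norm y * s" if p3: "3 \<le> p"
  proof -
    let ?vs = "[(?e1, \<lambda>w::'a\<times>'a. norm (fst w)), (?e2, \<lambda>w. norm (snd w))]"
    have sm: "smooth {t0..T} (\<lambda>w. norm (fst w) * norm (snd w)) k (\<lambda>t w. G 2 (t, u t) [(0, fst w), (0, snd w)])" if "2 + k \<le> p" for k
    proof -
      have "smooth {t0..T} (\<lambda>w. prod_list (map (\<lambda>(v, N). N w) ?vs)) k (\<lambda>t w. G (length ?vs) (t, u t) (map (\<lambda>(v, N). v t w) ?vs))"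
        by (rule smooth_G[OF curve_in_strip curve_smooth]) (use es that in auto)
      then show ?thesis by (simp add: numeral_2_eq_2)
    qed
    from smooth_derivatives[OF sm[of 1]] p3 obtain Bs C2 where Bs0: "Bs 0 = (\<lambda>t w. G 2 (t, u t) [(0, fst w), (0, snd w)])"
      and Bs: "\<forall>k<1. \<forall>t\<in>{t0..T}. \<forall>w. ((\<lambda>s. Bs k s w) has_vector_derivative Bs (Suc k) t w) (at t within {t0..T})"
      and C2: "C2 \<ge> 0" "\<forall>k\<le>1. \<forall>t\<in>{t0..T}. \<forall>w. norm (Bs k t w) \<le> C2 * (norm (fst w) * norm (snd w))" by auto
    have B0: "Bs 0 t (x, y) = B t x y" if "t \<in> {t0..T}" for t x y using that p3 by (simp add: Bs0 B_def)
    have "norm (B (t + s) x y - B t x y) \<le> C2 * norm x * norm y * s" if ts: "t0 \<le> t" "0 \<le> s" "t + s \<le> T" for t s x y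
    proof -
      have "norm (Bs 0 (t + s) (x, y) - (\<Sum>k<1. (s ^ k / fact k) *\<^sub>R Bs k t (x, y))) \<le> (C2 * (norm x * norm y)) * s ^ 1"
      proof (rule vector_taylor_bound[where a = t0 and b = T and F = "\<lambda>k t. Bs k t (x, y)"])
        fix r assume "r \<in> {t0..T}"
        then show "norm (Bs 1 r (x, y)) \<le> C2 * (norm x * norm y)"
          using C2(2)[rule_format, of 1 r "(x, y)"] by simp
      qed (use ts Bs in auto)
      then show ?thesis using B0[of t] B0[of "t + s"] ts by (simp add: mult.assoc)
    qed
    then show ?thesis using C2(1) by blast
  qed
  obtain C3 where C3: "C3 \<ge> 0" "3 \<le> p \<longrightarrow> (\<forall>t s x y. t0 \<le> t \<longrightarrow> 0 \<le> s \<longrightarrow> t + s \<le> T \<longrightarrow> norm (B (t + s) x y - B t x y) \<le> C3 * norm x * norm y * s)"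
    using B_lip by (cases "3 \<le> p") auto
  define C where "C = C1 + C3 + K"
  have K0: "K \<ge> 0" by (rule M_nonneg)
  have Cge: "C \<ge> C1" "C \<ge> K" "C \<ge> 0" using C1(1) C3(1) K0 by (auto simp: C_def)
  have le: "c * x \<le> C * x" if "c \<le> C" "0 \<le> x" for c x using that by (rule mult_right_mono)
  have B1: "linear (\<lambda>x. B t x y)" for t y
  proof (cases "3 \<le> p \<and> t \<in> {t0..T}")
    case True
    then have "linear (\<lambda>v. G 2 (t, u t) [v, (0, y)])"
      using multilinear_slot[OF G_multilinear[of 2 "(t, u t)"], of "[undefined, (0, y)]" 0] curve_in_strip[of t] by simp
    from linear_compose[OF pair_linear this] show ?thesis using True by (simp add: B_def comp_def)
  next
    case False
    then have "B t x y = 0" for x by (auto simp: B_def)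
    then show ?thesis by (simp add: module_hom_zero)
  qed
  have B2: "linear (B t x)" for t x
  proof (cases "3 \<le> p \<and> t \<in> {t0..T}")
    case True
    then have "linear (\<lambda>v. G 2 (t, u t) [(0, x), v])"
      using multilinear_slot[OF G_multilinear[of 2 "(t, u t)"], of "[(0, x), undefined]" 1] curve_in_strip[of t] by simp
    from linear_compose[OF pair_linear this] have "linear (\<lambda>y. G 2 (t, u t) [(0, x), (0, y)])" by (simp add: comp_def)
    moreover have "B t x = (\<lambda>y. G 2 (t, u t) [(0, x), (0, y)])" using True by (simp add: B_def fun_eq_iff)
    ultimately show ?thesis by simp
  next
    case False
    then have "B t x = (\<lambda>y. 0)" by (auto simp: B_def)
    then show ?thesis by (simp add: module_hom_zero)
  qed
  have Bn: "norm (B t x y) \<le> C * norm x * norm y" for t x y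
  proof (cases "3 \<le> p \<and> t \<in> {t0..T}")
    case True
    then have "norm (B t x y) \<le> K * prod_list (map norm [(0::real, x), (0, y)])"
      using G_bounded[of 2 "(t, u t)" "[(0, x), (0, y)]"] curve_in_strip[of t] p_ge by (simp add: B_def)
    also have "\<dots> = K * (norm x * norm y)" by (simp add: norm_Pair)
    also have "\<dots> \<le> C * (norm x * norm y)" using Cge by (intro le) auto
    finally show ?thesis by (simp add: mult.assoc)
  next
    case False
    then have "B t x y = 0" by (auto simp: B_def)
    then show ?thesis using Cge by simp
  qed
  have Fs'_linear: "linear (Fs' k t)" if "t \<in> {t0..T}" for k t
    using that Fs_linear by (auto simp: Fs'_def module_hom_zero)
  have Fs'_bound: "norm (Fs' k t w) \<le> C * norm w" if "t \<in> {t0..T}" for k t w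
  proof (cases "k \<le> m")
    case True
    then have "norm (Fs' k t w) \<le> C1 * norm w" using that C1 by (simp add: Fs'_def)
    also have "\<dots> \<le> C * norm w" using Cge by (intro le) auto
    finally show ?thesis .
  next
    case False
    then show ?thesis using Cge by (simp add: Fs'_def)
  qed
  have main: "norm (g (t + \<tau>) (u (t + \<tau>) + E) - g (t + \<tau>) (u (t + \<tau>))) \<le> C * norm E \<and>
      (3 \<le> p \<longrightarrow> norm (g (t + \<tau>) (u (t + \<tau>) + E) - g (t + \<tau>) (u (t + \<tau>)) - Fs' 0 t E) \<le> C * (\<tau> * norm E + norm E ^ 2)) \<and>
      (4 \<le> p \<longrightarrow> norm (g (t + \<tau>) (u (t + \<tau>) + E) - g (t + \<tau>) (u (t + \<tau>)) - Fs' 0 t E - \<tau> *\<^sub>R Fs' 1 t E) \<le> C * (\<tau> ^ 2 * norm E + norm E ^ 2)) \<and>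
      (5 \<le> p \<longrightarrow> norm (g (t + \<tau>) (u (t + \<tau>) + E) - g (t + \<tau>) (u (t + \<tau>)) - Fs' 0 t E - \<tau> *\<^sub>R Fs' 1 t E - (\<tau> ^ 2 / 2) *\<^sub>R Fs' 2 t E - (1 / 2) *\<^sub>R B t E E)
          \<le> C * (\<tau> ^ 3 * norm E + \<tau> * norm E ^ 2 + norm E ^ 3))"
    if t: "t0 \<le> t" and \<tau>: "0 \<le> \<tau>" "t + \<tau> \<le> T" and E: "norm E < R" for t \<tau> E
  proof -
    let ?s = "t + \<tau>"
    let ?\<Delta> = "g ?s (u ?s + E) - g ?s (u ?s)"
    have s: "?s \<in> {t0..T}" "t \<in> {t0..T}" using t \<tau> by auto
    have g0: "G 0 (?s, u ?s) [] = g ?s (u ?s)" using G0 s R_pos by simp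
    have e1: "norm (?\<Delta>) \<le> K * norm E"
      using segment_expansion[OF jet G0 s(1) E, of 1] pm g0 by simp
    have e2: "norm (?\<Delta> - Fs 0 ?s E) \<le> K * norm E ^ 2"
      using segment_expansion[OF jet G0 s(1) E, of 2] p_ge g0 by (simp add: numeral_2_eq_2 Fs0 diff_diff_eq)
    have e3: "norm (?\<Delta> - Fs 0 ?s E - (1 / 2) *\<^sub>R B ?s E E) \<le> K * norm E ^ 3" if "3 \<le> p"
      using segment_expansion[OF jet G0 s(1) E, of 3] that g0 s by (simp add: numeral_2_eq_2 numeral_3_eq_3 Fs0 diff_diff_eq add.assoc B_def)
    have t1: "norm (Fs 0 ?s E - Fs' 0 t E) \<le> C1 * norm E * \<tau>"
      using Fs_taylor[of 1 t \<tau> E] pm t \<tau> by (simp add: Fs'_def)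
    have t2: "norm (Fs 0 ?s E - Fs' 0 t E - \<tau> *\<^sub>R Fs' 1 t E) \<le> C1 * norm E * \<tau> ^ 2" if "4 \<le> p"
      using Fs_taylor[of 2 t \<tau> E] that pm t \<tau> by (simp add: Fs'_def numeral_2_eq_2 diff_diff_eq)
    have t3: "norm (Fs 0 ?s E - Fs' 0 t E - \<tau> *\<^sub>R Fs' 1 t E - (\<tau> ^ 2 / 2) *\<^sub>R Fs' 2 t E) \<le> C1 * norm E * \<tau> ^ 3" if "5 \<le> p"
      using Fs_taylor[of 3 t \<tau> E] that pm t \<tau> by (simp add: Fs'_def numeral_2_eq_2 numeral_3_eq_3 diff_diff_eq add.assoc)
    have b1: "norm ((1 / 2) *\<^sub>R B ?s E E - (1 / 2) *\<^sub>R B t E E) \<le> C3 * norm E * norm E * \<tau>" if "3 \<le> p"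
    proof -
      have "norm (B ?s E E - B t E E) \<le> C3 * norm E * norm E * \<tau>" using C3(2) that t \<tau> by simp
      moreover have "norm ((1 / 2) *\<^sub>R B ?s E E - (1 / 2) *\<^sub>R B t E E) \<le> norm (B ?s E E - B t E E)"
        unfolding scaleR_diff_right[symmetric] by simp
      ultimately show ?thesis by linarith
    qed
    have r1: "norm ?\<Delta> \<le> C * norm E" using e1 le[OF Cge(2), of "norm E"] by simp
    have r2: "norm (?\<Delta> - Fs' 0 t E) \<le> C * (\<tau> * norm E + norm E ^ 2)"
    proof -
      have "norm (?\<Delta> - Fs' 0 t E) \<le> K * norm E ^ 2 + C1 * norm E * \<tau>"
        using norm_triangle_ineq[of "?\<Delta> - Fs 0 ?s E" "Fs 0 ?s E - Fs' 0 t E"] e2 t1 by simp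
      also have "\<dots> \<le> C * norm E ^ 2 + C * (norm E * \<tau>)"
        unfolding mult.assoc using Cge \<tau> by (intro add_mono le) auto
      finally show ?thesis by (simp add: algebra_simps)
    qed
    have r3: "norm (?\<Delta> - Fs' 0 t E - \<tau> *\<^sub>R Fs' 1 t E) \<le> C * (\<tau> ^ 2 * norm E + norm E ^ 2)" if p4: "4 \<le> p"
    proof -
      have eq: "?\<Delta> - Fs' 0 t E - \<tau> *\<^sub>R Fs' 1 t E = (?\<Delta> - Fs 0 ?s E) + (Fs 0 ?s E - Fs' 0 t E - \<tau> *\<^sub>R Fs' 1 t E)" by simp
      have "norm (?\<Delta> - Fs' 0 t E - \<tau> *\<^sub>R Fs' 1 t E) \<le> K * norm E ^ 2 + C1 * norm E * \<tau> ^ 2"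
        unfolding eq
        by (rule order_trans[OF norm_triangle_ineq add_mono[OF e2 t2[OF p4]]])
      also have "\<dots> \<le> C * norm E ^ 2 + C * (norm E * \<tau> ^ 2)"
        unfolding mult.assoc using Cge \<tau> by (intro add_mono le) auto
      finally show ?thesis by (simp add: algebra_simps)
    qed
    have r4: "norm (?\<Delta> - Fs' 0 t E - \<tau> *\<^sub>R Fs' 1 t E - (\<tau> ^ 2 / 2) *\<^sub>R Fs' 2 t E - (1 / 2) *\<^sub>R B t E E) \<le> C * (\<tau> ^ 3 * norm E + \<tau> * norm E ^ 2 + norm E ^ 3)" if p5: "5 \<le> p"
    proof -
      let ?X = "?\<Delta> - Fs 0 ?s E - (1 / 2) *\<^sub>R B ?s E E" and ?Y = "Fs 0 ?s E - Fs' 0 t E - \<tau> *\<^sub>R Fs' 1 t E - (\<tau> ^ 2 / 2) *\<^sub>R Fs' 2 t E"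
        and ?Z = "(1 / 2) *\<^sub>R B ?s E E - (1 / 2) *\<^sub>R B t E E"
      have eq: "?\<Delta> - Fs' 0 t E - \<tau> *\<^sub>R Fs' 1 t E - (\<tau> ^ 2 / 2) *\<^sub>R Fs' 2 t E - (1 / 2) *\<^sub>R B t E E = ?X + ?Y + ?Z" by simp
      have nX: "norm ?X \<le> K * norm E ^ 3" and nY: "norm ?Y \<le> C1 * (norm E * \<tau> ^ 3)" and nZ: "norm ?Z \<le> C3 * (norm E ^ 2 * \<tau>)"
        using e3 t3[OF p5] b1 p5 by (auto simp: mult.assoc power2_eq_square)
      have tri: "norm (x + y + z) \<le> norm x + norm y + norm z" for x y z :: 'a
        by (rule order_trans[OF norm_triangle_ineq add_right_mono[OF norm_triangle_ineq]])
      have "norm (?X + ?Y + ?Z) \<le> K * norm E ^ 3 + C1 * (norm E * \<tau> ^ 3) + C3 * (norm E ^ 2 * \<tau>)"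
        by (rule order_trans[OF tri add_mono[OF add_mono[OF nX nY] nZ]])
      moreover have "K * norm E ^ 3 + C1 * (norm E * \<tau> ^ 3) + C3 * (norm E ^ 2 * \<tau>) \<le> C * norm E ^ 3 + C * (norm E * \<tau> ^ 3) + C * (norm E ^ 2 * \<tau>)"
        using Cge C1(1) K0 \<tau> by (intro add_mono le) (auto simp: C_def)
      moreover have "C * norm E ^ 3 + C * (norm E * \<tau> ^ 3) + C * (norm E ^ 2 * \<tau>) = C * (\<tau> ^ 3 * norm E + \<tau> * norm E ^ 2 + norm E ^ 3)"
        by (simp add: algebra_simps)
      ultimately show ?thesis unfolding eq by linarith
    qed
    show ?thesis using r1 r2 r3 r4 by blast
  qed
  have props: "\<forall>t\<in>{t0..T}. linear (Fs' 0 t) \<and> linear (Fs' 1 t) \<and> linear (Fs' 2 t) \<and> (\<forall>y. linear (\<lambda>x. B t x y)) \<and> (\<forall>x. linear (B t x)) \<and>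
       (\<forall>w. norm (Fs' 0 t w) \<le> C * norm w \<and> norm (Fs' 1 t w) \<le> C * norm w \<and> norm (Fs' 2 t w) \<le> C * norm w) \<and>
       (\<forall>x y. norm (B t x y) \<le> C * norm x * norm y)"
    by (intro ballI conjI allI Fs'_linear Fs'_bound B1 B2 Bn)
  show ?thesis
    by (rule exI[of _ "Fs' 0"], rule exI[of _ "Fs' 1"], rule exI[of _ "Fs' 2"], rule exI[of _ B], rule exI[of _ C],
        rule conjI[OF Cge(3) conjI[OF props]], (rule allI)+, (rule impI)+, rule main)
qed

end


section \<open>Orders in the step size\<close>

context erk_problem
begin

text \<open>Uniformity in the starting time \<open>t\<close> is part of the notion, since the local errors of all steps are
added up.\<close>

definition ord :: "nat \<Rightarrow> (real \<Rightarrow> real \<Rightarrow> 'a) \<Rightarrow> bool" where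
  "ord k F \<longleftrightarrow> (\<exists>C h0. 0 \<le> C \<and> 0 < h0 \<and> (\<forall>t h. t0 \<le> t \<longrightarrow> 0 < h \<longrightarrow> h \<le> h0 \<longrightarrow> t + h \<le> T \<longrightarrow> norm (F t h) \<le> C * h ^ k))"

lemma ordI:
  assumes "0 \<le> C" "0 < h0" "\<And>t h. t0 \<le> t \<Longrightarrow> 0 < h \<Longrightarrow> h \<le> h0 \<Longrightarrow> t + h \<le> T \<Longrightarrow> norm (F t h) \<le> C * h ^ k"
  shows "ord k F"
  unfolding ord_def using assms by blast

lemma ordE:
  assumes "ord k F"
  obtains C h0 where "0 \<le> C" "0 < h0" "h0 \<le> 1"
    "\<And>t h. t0 \<le> t \<Longrightarrow> 0 < h \<Longrightarrow> h \<le> h0 \<Longrightarrow> t + h \<le> T \<Longrightarrow> norm (F t h) \<le> C * h ^ k"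
proof -
  obtain C h0 where C: "0 \<le> C" "0 < h0" "\<forall>t h. t0 \<le> t \<longrightarrow> 0 < h \<longrightarrow> h \<le> h0 \<longrightarrow> t + h \<le> T \<longrightarrow> norm (F t h) \<le> C * h ^ k"
    using assms unfolding ord_def by (elim exE conjE)
  show ?thesis
    by (rule that[of C "min h0 1"]) (use C in auto)
qed

lemma ord_add:
  assumes "ord k F" "ord k H"
  shows "ord k (\<lambda>t h. F t h + H t h)"
proof -
  obtain C h0 where C: "0 \<le> C" "0 < h0" "\<And>t h. t0 \<le> t \<Longrightarrow> 0 < h \<Longrightarrow> h \<le> h0 \<Longrightarrow> t + h \<le> T \<Longrightarrow> norm (F t h) \<le> C * h ^ k"
    using assms(1) by (rule ordE) blast
  obtain C' h0' where C': "0 \<le> C'" "0 < h0'" "\<And>t h. t0 \<le> t \<Longrightarrow> 0 < h \<Longrightarrow> h \<le> h0' \<Longrightarrow> t + h \<le> T \<Longrightarrow> norm (H t h) \<le> C' * h ^ k"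
    using assms(2) by (rule ordE) blast
  show ?thesis
  proof (rule ordI[of "C + C'" "min h0 h0'"])
    fix t h assume th: "t0 \<le> t" "0 < h" "h \<le> min h0 h0'" "t + h \<le> T"
    show "norm (F t h + H t h) \<le> (C + C') * h ^ k"
      unfolding distrib_right
      by (rule order_trans[OF norm_triangle_ineq add_mono[OF C(3) C'(3)]]) (use th in auto)
  qed (use C C' in auto)
qed

lemma ord_zero: "ord k (\<lambda>t h. 0)"
  by (rule ordI[of 0 1]) auto

lemma ord_sum: "finite I \<Longrightarrow> (\<And>i. i \<in> I \<Longrightarrow> ord k (F i)) \<Longrightarrow> ord k (\<lambda>t h. \<Sum>i\<in>I. F i t h)"
  by (induction rule: finite_induct) (auto intro: ord_zero ord_add)

lemma ord_cong:
  assumes "ord k F" "\<And>t h. t0 \<le> t \<Longrightarrow> 0 < h \<Longrightarrow> t + h \<le> T \<Longrightarrow> H t h = F t h"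
  shows "ord k H"
  using assms(1) by (rule ordE) (rule ordI, use assms(2) in auto)

lemma ord_mono:
  assumes "ord k F" "k' \<le> k"
  shows "ord k' F"
proof -
  obtain C h0 where C: "0 \<le> C" "0 < h0" "h0 \<le> 1" "\<And>t h. t0 \<le> t \<Longrightarrow> 0 < h \<Longrightarrow> h \<le> h0 \<Longrightarrow> t + h \<le> T \<Longrightarrow> norm (F t h) \<le> C * h ^ k"
    using assms(1) by (rule ordE) blast
  show ?thesis
  proof (rule ordI[OF C(1,2)])
    fix t h assume th: "t0 \<le> t" "0 < h" "h \<le> h0" "t + h \<le> T"
    have "h ^ k \<le> h ^ k'" using th C(3) assms(2) by (intro power_decreasing) auto
    then show "norm (F t h) \<le> C * h ^ k'" using C(1) C(4)[OF th] by (meson mult_left_mono order_trans)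
  qed
qed

lemma ord_power:
  assumes "ord k F" "n = k + j"
  shows "ord n (\<lambda>t h. h ^ j *\<^sub>R F t h)"
proof -
  obtain C h0 where C: "0 \<le> C" "0 < h0" "\<And>t h. t0 \<le> t \<Longrightarrow> 0 < h \<Longrightarrow> h \<le> h0 \<Longrightarrow> t + h \<le> T \<Longrightarrow> norm (F t h) \<le> C * h ^ k"
    using assms(1) by (rule ordE) blast
  show ?thesis
  proof (rule ordI[OF C(1,2)])
    fix t h assume th: "t0 \<le> t" "0 < h" "h \<le> h0" "t + h \<le> T"
    have "norm (h ^ j *\<^sub>R F t h) = h ^ j * norm (F t h)" using th by simp
    also have "\<dots> \<le> h ^ j * (C * h ^ k)" using th by (intro mult_left_mono C(3)) auto
    finally show "norm (h ^ j *\<^sub>R F t h) \<le> C * h ^ n" by (simp add: assms(2) power_add mult_ac)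
  qed
qed

definition uniformly_bounded :: "(real \<Rightarrow> real \<Rightarrow> 'a \<Rightarrow> 'a) \<Rightarrow> bool" where
  "uniformly_bounded \<Phi> \<longleftrightarrow> (\<exists>C\<ge>0. \<forall>t h x. t0 \<le> t \<longrightarrow> 0 < h \<longrightarrow> t + h \<le> T \<longrightarrow> norm (\<Phi> t h x) \<le> C * norm x)"

lemma ord_apply:
  assumes "uniformly_bounded \<Phi>" "ord k F"
  shows "ord k (\<lambda>t h. \<Phi> t h (F t h))"
proof -
  obtain K where K: "K \<ge> 0" "\<forall>t h x. t0 \<le> t \<longrightarrow> 0 < h \<longrightarrow> t + h \<le> T \<longrightarrow> norm (\<Phi> t h x) \<le> K * norm x"
    using assms(1) unfolding uniformly_bounded_def by blast
  obtain C h0 where C: "0 \<le> C" "0 < h0" "\<And>t h. t0 \<le> t \<Longrightarrow> 0 < h \<Longrightarrow> h \<le> h0 \<Longrightarrow> t + h \<le> T \<Longrightarrow> norm (F t h) \<le> C * h ^ k"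
    using assms(2) by (rule ordE) blast
  show ?thesis
  proof (rule ordI[OF _ C(2)])
    show "0 \<le> K * C" using K C by simp
    fix t h assume th: "t0 \<le> t" "0 < h" "h \<le> h0" "t + h \<le> T"
    have "norm (\<Phi> t h (F t h)) \<le> K * norm (F t h)" using K th by blast
    also have "\<dots> \<le> K * (C * h ^ k)" by (intro mult_left_mono C(3) th K)
    finally show "norm (\<Phi> t h (F t h)) \<le> K * C * h ^ k" by (simp add: mult.assoc)
  qed
qed

lemma uniformly_bounded_coef: "admissible cf \<Longrightarrow> uniformly_bounded (\<lambda>t h. coef_op S cf h)"
proof -
  assume cf: "admissible cf"
  obtain K where K: "K > 0" "\<forall>t\<in>{0..T - t0}. norm (S t) \<le> K" using S_bounded by blast
  have "norm (coef_op S cf h x) \<le> coef_size cf * K * norm x" if "t0 \<le> t" "0 < h" "t + h \<le> T" for t h x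
    by (rule coef_bound[OF _ _ _ cf, of "T - t0"]) (use K that in auto)
  moreover have "0 \<le> coef_size cf * K" using K(1) coef_size_nonneg[of cf] by simp
  ultimately show ?thesis unfolding uniformly_bounded_def by blast
qed

lemma ord_const:
  assumes "\<And>t. t \<in> {t0..T} \<Longrightarrow> norm (y t) \<le> C"
  shows "ord 0 (\<lambda>t h. y t)"
proof (rule ordI[of "max 0 C" 1])
  fix t h assume "t0 \<le> t" "0 < h" "t + h \<le> T"
  then show "norm (y t) \<le> max 0 C * h ^ 0" using assms[of t] by (simp add: le_max_iff_disj)
qed auto

abbreviation "b_op i h \<equiv> coef_op S (bcoef M i) h"
abbreviation "a_op i j h \<equiv> coef_op S (acoef M i j) h"
abbreviation "defect_op q i h \<equiv> coef_op S (stage_defect M q i) h"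

lemma node_range: "i \<in> {2..stages M} \<Longrightarrow> 0 < node M i \<and> node M i \<le> 1"
  using valid unfolding valid_erk_method_def by blast

lemma admissible_b: "i \<in> {2..stages M} \<Longrightarrow> admissible (bcoef M i)"
  by (rule admissible_valid[OF valid]) (use valid in \<open>auto simp: valid_erk_method_def\<close>)

lemma admissible_a: "i \<in> {2..stages M} \<Longrightarrow> j \<in> {2..<i} \<Longrightarrow> admissible (acoef M i j)"
  by (rule admissible_valid[OF valid]) (use valid in \<open>auto simp: valid_erk_method_def\<close>)

lemma admissible_stage_defect: "i \<in> {2..stages M} \<Longrightarrow> 1 \<le> q \<Longrightarrow> admissible (stage_defect M q i)"
  using node_range by (intro admissible_defect admissible_a) auto

lemma admissible_final_defect: "1 \<le> q \<Longrightarrow> admissible (final_defect M q)"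
  by (intro admissible_defect admissible_b) auto

lemma ord_scaleR:
  assumes "ord k X"
  shows "ord k (\<lambda>t h. c *\<^sub>R X t h)"
proof (rule ord_apply[OF _ assms])
  show "uniformly_bounded (\<lambda>t h x. c *\<^sub>R x)"
    unfolding uniformly_bounded_def by (intro exI[of _ "\<bar>c\<bar>"]) simp
qed

lemma ord_Suc:
  assumes "ord k X" "n = Suc k"
  shows "ord n (\<lambda>t h. h *\<^sub>R X t h)"
  using ord_power[OF assms(1), of n 1] assms(2) by simp

lemma a_linear:
  assumes "i \<in> {2..stages M}" "j \<in> {2..<i}" "0 < h"
  shows "linear (a_op i j h)"
  by (rule coef_linear) (use admissible_a[OF assms(1,2)] assms(3) in auto)

lemma b_linear:
  assumes "i \<in> {2..stages M}" "0 < h"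
  shows "linear (b_op i h)"
  by (rule coef_linear) (use admissible_b[OF assms(1)] assms(2) in auto)

lemma ord_a_sum:
  assumes "i \<in> {2..stages M}" "\<And>j. j \<in> {2..stages M} \<Longrightarrow> j < i \<Longrightarrow> ord k (X j)"
  shows "ord k (\<lambda>t h. \<Sum>j\<in>{2..<i}. a_op i j h (X j t h))"
  using assms by (intro ord_sum ord_apply[OF uniformly_bounded_coef[OF admissible_a]]) auto

lemma ord_b_sum:
  assumes "\<And>i. i \<in> {2..stages M} \<Longrightarrow> ord k (X i)"
  shows "ord k (\<lambda>t h. \<Sum>i\<in>{2..stages M}. b_op i h (X i t h))"
  using assms by (intro ord_sum ord_apply[OF uniformly_bounded_coef[OF admissible_b]]) auto

lemma node_time:
  assumes "i \<in> {2..stages M}" "0 < h"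
  shows "0 \<le> node M i * h \<and> node M i * h \<le> h"
  using node_range[OF assms(1)] assms(2) by (auto simp: mult_le_cancel_right1)

lemma node_time_le:
  assumes "i \<in> {2..stages M}" "0 < h" "t + h \<le> T"
  shows "t + node M i * h \<le> T"
  using node_time[OF assms(1,2)] assms(3) by linarith

lemma admissible_defect_Suc:
  assumes "i \<in> {2..stages M}"
  shows "admissible (stage_defect M (Suc q) i)"
  by (rule admissible_stage_defect[OF assms]) simp

lemma admissible_defect_inner:
  assumes "i \<in> {2..stages M}" "j \<in> {2..<i}"
  shows "admissible (stage_defect M (Suc q) j)"
  using assms by (intro admissible_defect_Suc) auto

lemma admissible_a_inner:
  assumes "i \<in> {2..stages M}" "j \<in> {2..<i}" "k \<in> {2..<j}"
  shows "admissible (acoef M j k)"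
  using assms by (intro admissible_a) auto

lemma admissible_defect_innermost:
  assumes "i \<in> {2..stages M}" "j \<in> {2..<i}" "k \<in> {2..<j}"
  shows "admissible (stage_defect M (Suc q) k)"
  using assms by (intro admissible_defect_Suc) auto

lemma psi_op_zero:
  assumes "q \<in> {2..<p}" "0 < h"
  shows "coef_op S (final_defect M q) h x = 0"
proof -
  have "psi_condition M q" using conditions assms(1) unfolding stiff_conditions_weakened_def by blast
  from psi_condition_real[OF this] have "(\<Sum>i\<in>{0::nat}. coef_real (final_defect M q) z *\<^sub>R x) = 0" for z by simp
  from coef_op_transfer[OF less_imp_le[OF assms(2)] _ _ this] show ?thesis using admissible_final_defect[of q] assms(1) by simp
qed

definition U :: "real \<Rightarrow> real \<Rightarrow> nat \<Rightarrow> 'a" where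
  "U t h i = erk_stage M S A g h t (u t) i"

definition E :: "nat \<Rightarrow> real \<Rightarrow> real \<Rightarrow> 'a" where
  "E i t h = U t h i - u (t + node M i * h)"

definition \<Delta> :: "nat \<Rightarrow> real \<Rightarrow> real \<Rightarrow> 'a" where
  "\<Delta> i t h = g (t + node M i * h) (U t h i) - g (t + node M i * h) (u (t + node M i * h))"

end


section \<open>The local error\<close>

text \<open>The error terms of the expansion of \<open>g\<close> for the perturbation \<open>e = O(h^2)\<close> of a stage at the distance \<open>\<tau> \<le> h\<close>.\<close>

lemma perturbation_powers:
  fixes \<tau> h e Q :: real
  assumes "0 \<le> \<tau>" "\<tau> \<le> h" "h \<le> 1" "0 \<le> e" "e \<le> Q * h ^ 2" "0 \<le> Q"
  shows "\<tau> * e + e ^ 2 \<le> (Q + Q ^ 2) * h ^ 3" "\<tau> ^ 2 * e + e ^ 2 \<le> (Q + Q ^ 2) * h ^ 4"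
    "\<tau> ^ 3 * e + \<tau> * e ^ 2 + e ^ 3 \<le> (Q + Q ^ 2 + Q ^ 3) * h ^ 5"
proof -
  have h: "0 \<le> h" using assms by linarith
  have e2: "e ^ 2 \<le> Q ^ 2 * h ^ 4" using power_mono[OF assms(5,4), of 2] by (simp add: power_mult_distrib power_mult[symmetric])
  have e3: "e ^ 3 \<le> Q ^ 3 * h ^ 6" using power_mono[OF assms(5,4), of 3] by (simp add: power_mult_distrib power_mult[symmetric])
  have t2: "\<tau> ^ 2 \<le> h ^ 2" and t3: "\<tau> ^ 3 \<le> h ^ 3" using assms by (auto intro: power_mono)
  have h43: "h ^ 4 \<le> h ^ 3" and h65: "h ^ 6 \<le> h ^ 5" using h assms by (auto intro!: power_decreasing)
  have a: "\<tau> * e \<le> h * (Q * h ^ 2)" using assms h by (intro mult_mono) auto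
  have "Q ^ 2 * h ^ 4 \<le> Q ^ 2 * h ^ 3" using h43 by (intro mult_left_mono) auto
  then show "\<tau> * e + e ^ 2 \<le> (Q + Q ^ 2) * h ^ 3" using a e2 by (simp add: algebra_simps power3_eq_cube power2_eq_square)
  have b: "\<tau> ^ 2 * e \<le> h ^ 2 * (Q * h ^ 2)" using assms h t2 by (intro mult_mono) auto
  have b': "h ^ 2 * (Q * h ^ 2) = Q * h ^ 4" by (simp add: power_add[symmetric] mult.left_commute)
  show "\<tau> ^ 2 * e + e ^ 2 \<le> (Q + Q ^ 2) * h ^ 4" using b e2 unfolding b' distrib_right by linarith
  have c: "\<tau> ^ 3 * e \<le> h ^ 3 * (Q * h ^ 2)" using assms h t3 by (intro mult_mono) auto
  have c': "h ^ 3 * (Q * h ^ 2) = Q * h ^ 5" by (simp add: power_add[symmetric] mult.left_commute)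
  have d: "\<tau> * e ^ 2 \<le> h * (Q ^ 2 * h ^ 4)" using assms h e2 by (intro mult_mono) auto
  have d': "h * (Q ^ 2 * h ^ 4) = Q ^ 2 * h ^ 5" by (simp add: mult.left_commute power_Suc[symmetric] del: power_Suc)
  have f: "Q ^ 3 * h ^ 6 \<le> Q ^ 3 * h ^ 5" using h65 assms by (intro mult_left_mono) auto
  show "\<tau> ^ 3 * e + \<tau> * e ^ 2 + e ^ 3 \<le> (Q + Q ^ 2 + Q ^ 3) * h ^ 5"
    using c d e3 f unfolding c' d' distrib_right by linarith
qed

text \<open>All expansions below refer to one fixed sequence of derivatives of \<open>f(t) = g(t, u(t))\<close>. The bound excludes
\<open>f\<close> itself, because the derivatives of \<open>g\<close> are bounded from order one on.\<close>

locale erk_derivatives = erk_problem +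
  fixes F :: "nat \<Rightarrow> real \<Rightarrow> 'a" and CF :: real
  assumes F0: "F 0 = (\<lambda>t. g t (u t))"
    and Fd: "\<And>k t. k < p \<Longrightarrow> t \<in> {t0..T} \<Longrightarrow> (F k has_vector_derivative F (Suc k) t) (at t within {t0..T})"
    and Fb: "\<And>k t. 1 \<le> k \<Longrightarrow> k \<le> p \<Longrightarrow> t \<in> {t0..T} \<Longrightarrow> norm (F k t) \<le> CF"
begin

text \<open>Stages and final step are treated at once, as rows with coefficients \<open>rw\<close> and node \<open>c\<close>. The exact solution
is \<open>u(t + ch) = S(ch) u(t) + \<Sum>\<^sub>k (ch)^(k+1) \<phi>\<^sub>k\<^sub>+\<^sub>1(chA) f^(k)(t) + O(h^(p+1))\<close> by variation of constants and
Taylor expansion of \<open>f\<close>. Expanding \<open>f(t + c\<^sub>j h)\<close> in the row in the same way, the term with \<open>k = 0\<close> cancels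
and the terms with \<open>k \<ge> 1\<close> combine to the defects \<open>\<psi>\<^sub>k\<^sub>+\<^sub>1\<close> or \<open>\<psi>\<^sub>k\<^sub>+\<^sub>1\<^sub>,\<^sub>i\<close>. What remains is the
influence of the stage errors.\<close>

lemma row_expansion:
  assumes rw: "\<And>j. j \<in> {2..<n} \<Longrightarrow> admissible (rw j)" and n: "n \<le> Suc (stages M)" and c: "0 < c" "c \<le> 1"
  shows "ord (Suc p) (\<lambda>t h. (u t + (c * h) *\<^sub>R phi_op S 1 (c * h) (A (u t) + g t (u t))
      + h *\<^sub>R (\<Sum>j\<in>{2..<n}. coef_op S (rw j) h (g (t + node M j * h) (U t h j) - g t (u t)))) - u (t + c * h)
      - (\<Sum>k\<in>{1..<p}. h ^ Suc k *\<^sub>R coef_op S (defect_coef M rw n c (Suc k)) h (F k t))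
      - h *\<^sub>R (\<Sum>j\<in>{2..<n}. coef_op S (rw j) h (g (t + node M j * h) (U t h j) - g (t + node M j * h) (u (t + node M j * h)))))"
proof -
  obtain K where K: "K > 0" "\<forall>t\<in>{0..T - t0}. norm (S t) \<le> K" using S_bounded by blast
  have C0: "0 \<le> CF" using Fb[of p t0] p_ge t0T by (intro order_trans[OF norm_ge_zero]) auto
  define \<rho> where "\<rho> t \<sigma> = g (t + \<sigma>) (u (t + \<sigma>)) - (\<Sum>k<p. (\<sigma> ^ k / fact k) *\<^sub>R F k t)" for t \<sigma>
  have \<rho>: "norm (\<rho> t \<sigma>) \<le> CF * \<sigma> ^ p" if "t0 \<le> t" "0 \<le> \<sigma>" "t + \<sigma> \<le> T" for t \<sigma>
    using vector_taylor_bound[of p t0 T F CF t \<sigma>] Fd Fb[of p] p_ge that unfolding F0 \<rho>_def by simp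
  have node: "0 < node M j \<and> node M j \<le> 1" if "j \<in> {2..<n}" for j using node_range[of j] that n by auto
  have split_p: "{..<p} = insert 0 {1..<p}" using p_ge by auto
  \<comment> \<open>the defect of the exact solution in its own Taylor expansion\<close>
  define dd where "dd t h = (u (t + c * h) - S (c * h) (u t)) - (\<Sum>k<p. (c * h) ^ Suc k *\<^sub>R phi_op S (Suc k) (c * h) (F k t))" for t h
  have dd: "norm (dd t h) \<le> K * CF * h ^ Suc p" if th: "t0 \<le> t" "0 < h" "t + h \<le> T" for t h
  proof -
    define \<tau> where "\<tau> = c * h"
    have \<tau>: "0 < \<tau>" "\<tau> \<le> h" using c th by (auto simp: \<tau>_def mult_le_cancel_right1)
    have rng: "t + \<theta> * \<tau> \<in> {t0..T}" if "\<theta> \<in> {0..1}" for \<theta>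
    proof -
      have "\<theta> * \<tau> \<le> 1 * \<tau>" using that \<tau> by (intro mult_right_mono) auto
      moreover have "0 \<le> \<theta> * \<tau>" using that \<tau> by simp
      ultimately show ?thesis using th \<tau> unfolding atLeastAtMost_iff mult_1_left by linarith
    qed
    have 1: "((\<lambda>\<theta>. S ((1 - \<theta>) * \<tau>) (\<tau> *\<^sub>R g (t + \<theta> * \<tau>) (u (t + \<theta> * \<tau>)))) has_integral (u (t + 1 * \<tau>) - S \<tau> (u (t + 0 * \<tau>)))) {0..1}"
    proof (rule variation_of_constants[OF \<tau>(1)])
      fix \<theta> :: real assume \<theta>: "\<theta> \<in> {0..1}"
      show "u (t + \<theta> * \<tau>) \<in> D" by (rule u_in_D[OF rng[OF \<theta>]])
      have a: "((\<lambda>\<theta>. t + \<theta> * \<tau>) has_vector_derivative \<tau>) (at \<theta> within {0..1})"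
        by (auto intro!: derivative_eq_intros simp: has_vector_derivative_def)
      have b: "(u has_vector_derivative A (u (t + \<theta> * \<tau>)) + g (t + \<theta> * \<tau>) (u (t + \<theta> * \<tau>))) (at (t + \<theta> * \<tau>) within (\<lambda>\<theta>. t + \<theta> * \<tau>) ` {0..1})"
        by (rule has_vector_derivative_within_subset[OF u_derivative[OF rng[OF \<theta>]]]) (use rng in blast)
      show "((\<lambda>\<theta>. u (t + \<theta> * \<tau>)) has_vector_derivative \<tau> *\<^sub>R (A (u (t + \<theta> * \<tau>)) + g (t + \<theta> * \<tau>) (u (t + \<theta> * \<tau>)))) (at \<theta> within {0..1})"
        using vector_diff_chain_within[OF a b] by (simp add: comp_def)
    qed
    have 2: "((\<lambda>\<theta>. \<Sum>k<p. \<tau> ^ Suc k *\<^sub>R (\<theta> ^ (Suc k - 1) / fact (Suc k - 1)) *\<^sub>R S ((1 - \<theta>) * \<tau>) (F k t)) has_integral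
       (\<Sum>k<p. \<tau> ^ Suc k *\<^sub>R phi_op S (Suc k) \<tau> (F k t))) {0..1}"
      by (intro has_integral_sum has_integral_cmul phi_has_integral) (use \<tau> in auto)
    have e: "S ((1 - \<theta>) * \<tau>) (\<tau> *\<^sub>R g (t + \<theta> * \<tau>) (u (t + \<theta> * \<tau>))) - (\<Sum>k<p. \<tau> ^ Suc k *\<^sub>R (\<theta> ^ (Suc k - 1) / fact (Suc k - 1)) *\<^sub>R S ((1 - \<theta>) * \<tau>) (F k t))
       = \<tau> *\<^sub>R S ((1 - \<theta>) * \<tau>) (\<rho> t (\<theta> * \<tau>))" for \<theta>
      unfolding \<rho>_def
      by (simp add: blinfun.diff_right blinfun.sum_right blinfun.scaleR_right scaleR_diff_right scaleR_sum_right power_mult_distrib mult_ac)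
    have "((\<lambda>\<theta>. \<tau> *\<^sub>R S ((1 - \<theta>) * \<tau>) (\<rho> t (\<theta> * \<tau>))) has_integral dd t h) (cbox 0 1)"
      using has_integral_diff[OF 1 2] unfolding e by (simp add: dd_def \<tau>_def)
    then have "norm (dd t h) \<le> (K * CF * h ^ Suc p) * measure lborel (cbox 0 (1::real))"
    proof (rule has_integral_bound[rotated])
      show "0 \<le> K * CF * h ^ Suc p" using K C0 th by simp
      fix \<theta> :: real assume "\<theta> \<in> cbox 0 1"
      then have \<theta>: "\<theta> \<in> {0..1}" by simp
      have "(1 - \<theta>) * \<tau> \<le> 1 * \<tau>" using \<theta> \<tau> by (intro mult_right_mono) auto
      moreover have "0 \<le> (1 - \<theta>) * \<tau>" using \<theta> \<tau> by simp
      ultimately have inb: "(1 - \<theta>) * \<tau> \<in> {0..T - t0}" using th \<tau> unfolding atLeastAtMost_iff mult_1_left by linarith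
      have "norm (\<rho> t (\<theta> * \<tau>)) \<le> CF * (\<theta> * \<tau>) ^ p" using rng[OF \<theta>] th \<theta> \<tau> by (intro \<rho>) auto
      also have "\<dots> \<le> CF * h ^ p"
      proof (intro mult_left_mono power_mono C0)
        have "\<theta> * \<tau> \<le> 1 * \<tau>" using \<theta> \<tau> by (intro mult_right_mono) auto
        then show "\<theta> * \<tau> \<le> h" using \<tau>(2) unfolding mult_1_left by linarith
      qed (use \<theta> \<tau> in auto)
      finally have r: "norm (\<rho> t (\<theta> * \<tau>)) \<le> CF * h ^ p" .
      have "norm (S ((1 - \<theta>) * \<tau>) (\<rho> t (\<theta> * \<tau>))) \<le> norm (S ((1 - \<theta>) * \<tau>)) * norm (\<rho> t (\<theta> * \<tau>))" by (rule norm_blinfun)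
      also have "\<dots> \<le> K * (CF * h ^ p)" using K inb r by (intro mult_mono) auto
      finally have "\<tau> * norm (S ((1 - \<theta>) * \<tau>) (\<rho> t (\<theta> * \<tau>))) \<le> h * (K * (CF * h ^ p))"
        using \<tau> th by (intro mult_mono) auto
      then show "norm (\<tau> *\<^sub>R S ((1 - \<theta>) * \<tau>) (\<rho> t (\<theta> * \<tau>))) \<le> K * CF * h ^ Suc p" using \<tau> by (simp add: mult_ac)
    qed
    then show ?thesis by simp
  qed
  have ord_dd: "ord (Suc p) (\<lambda>t h. - dd t h)"
    by (rule ordI[of "K * CF" 1]) (use dd K C0 in auto)
  have ord_\<rho>: "ord p (\<lambda>t h. \<rho> t (node M j * h))" if j: "j \<in> {2..<n}" for j
  proof (rule ordI[of CF 1])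
    fix t h assume th: "t0 \<le> t" "0 < h" "t + h \<le> T"
    have nh: "0 \<le> node M j * h" "node M j * h \<le> h" using node[OF j] th by (auto simp: mult_le_cancel_right1)
    have "t + node M j * h \<le> T" using th nh by linarith
    then have "norm (\<rho> t (node M j * h)) \<le> CF * (node M j * h) ^ p" by (rule \<rho>[OF th(1) nh(1)])
    also have "\<dots> \<le> CF * h ^ p" using nh C0 by (intro mult_left_mono power_mono) auto
    finally show "norm (\<rho> t (node M j * h)) \<le> CF * h ^ p" .
  qed (use C0 in auto)
  have "ord (Suc p) (\<lambda>t h. - dd t h + h ^ 1 *\<^sub>R (\<Sum>j\<in>{2..<n}. coef_op S (rw j) h (\<rho> t (node M j * h))))"
    by (intro ord_add ord_dd ord_power[where k = p] ord_sum ord_apply[OF uniformly_bounded_coef[OF rw]] ord_\<rho>) auto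
  then show ?thesis
  proof (rule ord_cong)
    fix t h assume th: "t0 \<le> t" "0 < h" "t + h \<le> T"
    have t_in: "t \<in> {t0..T}" using th by auto
    have ch: "0 < c * h" using c th by simp
    let ?a = "\<lambda>j. coef_op S (rw j) h"
    let ?G = "\<lambda>j. g (t + node M j * h) (U t h j) - g (t + node M j * h) (u (t + node M j * h))"
    let ?P = "\<lambda>k. (c * h) ^ Suc k *\<^sub>R phi_op S (Suc k) (c * h) (F k t)"
    have F0t: "F 0 t = g t (u t)" by (simp add: F0)
    have lin1: "linear (phi_op S 1 (c * h))" by (rule phi_linear) (use ch in simp)
    have e0: "u t + (c * h) *\<^sub>R phi_op S 1 (c * h) (A (u t) + g t (u t)) = S (c * h) (u t) + ?P 0"
      unfolding linear_add[OF lin1] scaleR_add_right phi_1_A[OF u_in_D[OF t_in] ch] F0t by simp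
    have ej: "?a j (g (t + node M j * h) (U t h j) - g t (u t)) =
        ?a j (?G j) + (\<Sum>k\<in>{1..<p}. ((node M j * h) ^ k / fact k) *\<^sub>R ?a j (F k t)) + ?a j (\<rho> t (node M j * h))" if j: "j \<in> {2..<n}" for j
    proof -
      have lin: "linear (?a j)" by (rule coef_linear) (use th rw[OF j] in auto)
      have "(\<Sum>k<p. ((node M j * h) ^ k / fact k) *\<^sub>R F k t) = g t (u t) + (\<Sum>k\<in>{1..<p}. ((node M j * h) ^ k / fact k) *\<^sub>R F k t)"
        unfolding split_p by (simp add: F0t)
      then have "g (t + node M j * h) (U t h j) - g t (u t) = ?G j + (\<Sum>k\<in>{1..<p}. ((node M j * h) ^ k / fact k) *\<^sub>R F k t) + \<rho> t (node M j * h)"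
        unfolding \<rho>_def by simp
      then have "?a j (g (t + node M j * h) (U t h j) - g t (u t)) = ?a j (?G j + (\<Sum>k\<in>{1..<p}. ((node M j * h) ^ k / fact k) *\<^sub>R F k t) + \<rho> t (node M j * h))"
        by (rule arg_cong)
      then show ?thesis by (simp only: linear_add[OF lin] linear_sum[OF lin] linear_scale[OF lin])
    qed
    have esum: "(\<Sum>j\<in>{2..<n}. ?a j (g (t + node M j * h) (U t h j) - g t (u t))) =
       (\<Sum>j\<in>{2..<n}. ?a j (?G j)) + (\<Sum>j\<in>{2..<n}. \<Sum>k\<in>{1..<p}. ((node M j * h) ^ k / fact k) *\<^sub>R ?a j (F k t)) + (\<Sum>j\<in>{2..<n}. ?a j (\<rho> t (node M j * h)))"
      unfolding sum.distrib[symmetric] by (intro sum.cong refl ej)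
    have edef: "(\<Sum>k\<in>{1..<p}. h ^ Suc k *\<^sub>R coef_op S (defect_coef M rw n c (Suc k)) h (F k t)) =
       h *\<^sub>R (\<Sum>j\<in>{2..<n}. \<Sum>k\<in>{1..<p}. ((node M j * h) ^ k / fact k) *\<^sub>R ?a j (F k t)) - (\<Sum>k\<in>{1..<p}. ?P k)"
    proof -
      have "h ^ Suc k *\<^sub>R coef_op S (defect_coef M rw n c (Suc k)) h (F k t) =
         (\<Sum>j\<in>{2..<n}. h *\<^sub>R (((node M j * h) ^ k / fact k) *\<^sub>R ?a j (F k t))) - ?P k" for k
        unfolding coef_op_defect
        by (simp add: scaleR_diff_right scaleR_sum_right power_mult_distrib mult_ac del: fact_Suc)
      then have "(\<Sum>k\<in>{1..<p}. h ^ Suc k *\<^sub>R coef_op S (defect_coef M rw n c (Suc k)) h (F k t)) =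
         (\<Sum>k\<in>{1..<p}. \<Sum>j\<in>{2..<n}. h *\<^sub>R (((node M j * h) ^ k / fact k) *\<^sub>R ?a j (F k t))) - (\<Sum>k\<in>{1..<p}. ?P k)"
        by (simp only: sum_subtractf)
      also have "(\<Sum>k\<in>{1..<p}. \<Sum>j\<in>{2..<n}. h *\<^sub>R (((node M j * h) ^ k / fact k) *\<^sub>R ?a j (F k t))) =
         h *\<^sub>R (\<Sum>j\<in>{2..<n}. \<Sum>k\<in>{1..<p}. ((node M j * h) ^ k / fact k) *\<^sub>R ?a j (F k t))"
        by (subst sum.swap) (simp only: scaleR_sum_right)
      finally show ?thesis .
    qed
    have edd: "dd t h = (u (t + c * h) - S (c * h) (u t)) - (?P 0 + (\<Sum>k\<in>{1..<p}. ?P k))"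
      unfolding dd_def split_p by simp
    show "u t + (c * h) *\<^sub>R phi_op S 1 (c * h) (A (u t) + g t (u t))
      + h *\<^sub>R (\<Sum>j\<in>{2..<n}. ?a j (g (t + node M j * h) (U t h j) - g t (u t))) - u (t + c * h)
      - (\<Sum>k\<in>{1..<p}. h ^ Suc k *\<^sub>R coef_op S (defect_coef M rw n c (Suc k)) h (F k t))
      - h *\<^sub>R (\<Sum>j\<in>{2..<n}. ?a j (?G j)) = - dd t h + h ^ 1 *\<^sub>R (\<Sum>j\<in>{2..<n}. ?a j (\<rho> t (node M j * h)))"
      unfolding e0 esum edef edd scaleR_add_right power_one_right by simp
  qed
qed

lemma ord_F:
  assumes "1 \<le> k" "k \<le> p"
  shows "ord 0 (\<lambda>t h. F k t)"
  by (rule ord_const) (rule Fb[OF assms])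

lemma ord_defect:
  assumes "i \<in> {2..stages M}" "1 \<le> k" "k \<le> p"
  shows "ord 0 (\<lambda>t h. defect_op (Suc k) i h (F k t))"
  by (rule ord_apply[OF uniformly_bounded_coef[OF admissible_stage_defect[OF assms(1)]] ord_F[OF assms(2,3)]]) simp

lemma stage_expansion:
  assumes i: "i \<in> {2..stages M}"
  shows "ord (Suc p) (\<lambda>t h. E i t h - (\<Sum>k\<in>{1..<p}. h ^ Suc k *\<^sub>R defect_op (Suc k) i h (F k t)) - h *\<^sub>R (\<Sum>j\<in>{2..<i}. a_op i j h (\<Delta> j t h)))"
proof (rule ord_cong[OF row_expansion[where rw = "acoef M i" and n = i and c = "node M i"]])
  show "admissible (acoef M i j)" if "j \<in> {2..<i}" for j by (rule admissible_a[OF i that])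
  fix t h
  show "E i t h - (\<Sum>k\<in>{1..<p}. h ^ Suc k *\<^sub>R defect_op (Suc k) i h (F k t)) - h *\<^sub>R (\<Sum>j\<in>{2..<i}. a_op i j h (\<Delta> j t h)) =
     u t + (node M i * h) *\<^sub>R phi_op S 1 (node M i * h) (A (u t) + g t (u t)) +
       h *\<^sub>R (\<Sum>j = 2..<i. a_op i j h (g (t + node M j * h) (U t h j) - g t (u t))) - u (t + node M i * h) -
       (\<Sum>k = 1..<p. h ^ Suc k *\<^sub>R defect_op (Suc k) i h (F k t)) -
       h *\<^sub>R (\<Sum>j = 2..<i. a_op i j h (g (t + node M j * h) (U t h j) - g (t + node M j * h) (u (t + node M j * h))))"
    unfolding E_def \<Delta>_def U_def by (subst erk_stage.simps) (rule refl)
qed (use p_ge i node_range[OF i] in auto)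

lemma stage_expansion_truncated:
  assumes i: "i \<in> {2..stages M}" and m: "1 \<le> m" "m \<le> p"
  shows "ord (Suc m) (\<lambda>t h. E i t h - (\<Sum>k\<in>{1..<m}. h ^ Suc k *\<^sub>R defect_op (Suc k) i h (F k t)) - h *\<^sub>R (\<Sum>j\<in>{2..<i}. a_op i j h (\<Delta> j t h)))"
proof -
  have tail: "ord (Suc m) (\<lambda>t h. \<Sum>k\<in>{m..<p}. h ^ Suc k *\<^sub>R defect_op (Suc k) i h (F k t))"
  proof (rule ord_sum)
    fix k assume k: "k \<in> {m..<p}"
    have "ord (Suc k) (\<lambda>t h. h ^ Suc k *\<^sub>R defect_op (Suc k) i h (F k t))"
      by (rule ord_power[OF ord_defect[OF i]]) (use k m in auto)
    then show "ord (Suc m) (\<lambda>t h. h ^ Suc k *\<^sub>R defect_op (Suc k) i h (F k t))" by (rule ord_mono) (use k in simp)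
  qed simp
  have "{1..<p} = {1..<m} \<union> {m..<p}" using m by auto
  then have eq: "(\<Sum>k\<in>{1..<p}. h ^ Suc k *\<^sub>R defect_op (Suc k) i h (F k t)) =
      (\<Sum>k\<in>{1..<m}. h ^ Suc k *\<^sub>R defect_op (Suc k) i h (F k t)) + (\<Sum>k\<in>{m..<p}. h ^ Suc k *\<^sub>R defect_op (Suc k) i h (F k t))" for t h
    by (simp only:) (rule sum.union_disjoint; auto)
  show ?thesis
  proof (rule ord_cong[OF ord_add[OF ord_mono[OF stage_expansion[OF i]] tail]])
    fix t h
    show "E i t h - (\<Sum>k\<in>{1..<m}. h ^ Suc k *\<^sub>R defect_op (Suc k) i h (F k t)) - h *\<^sub>R (\<Sum>j\<in>{2..<i}. a_op i j h (\<Delta> j t h)) =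
      E i t h - (\<Sum>k\<in>{1..<p}. h ^ Suc k *\<^sub>R defect_op (Suc k) i h (F k t)) - h *\<^sub>R (\<Sum>j\<in>{2..<i}. a_op i j h (\<Delta> j t h)) +
      (\<Sum>k\<in>{m..<p}. h ^ Suc k *\<^sub>R defect_op (Suc k) i h (F k t))"
      unfolding eq by simp
  qed (use m in simp)
qed

lemma U_eq:
  shows "U t h i = u (t + node M i * h) + E i t h"
  by (simp add: E_def)

lemma stage_error_small:
  assumes oE: "ord 2 (E i)"
  shows "\<exists>h0 Q. 0 < h0 \<and> h0 \<le> 1 \<and> 0 \<le> Q \<and> (\<forall>t h. t0 \<le> t \<longrightarrow> 0 < h \<longrightarrow> h \<le> h0 \<longrightarrow> t + h \<le> T \<longrightarrow>
      norm (E i t h) \<le> Q * h ^ 2 \<and> norm (E i t h) < R)"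
proof -
  obtain Q h1 where Q: "0 \<le> Q" "0 < h1" "h1 \<le> 1" "\<And>t h. t0 \<le> t \<Longrightarrow> 0 < h \<Longrightarrow> h \<le> h1 \<Longrightarrow> t + h \<le> T \<Longrightarrow> norm (E i t h) \<le> Q * h ^ 2"
    using oE by (rule ordE) blast
  define h0 where "h0 = min h1 (R / (Q + 1))"
  have h0: "0 < h0" "h0 \<le> h1" "h0 \<le> R / (Q + 1)" using Q R_pos by (auto simp: h0_def)
  have "norm (E i t h) \<le> Q * h ^ 2 \<and> norm (E i t h) < R" if th: "t0 \<le> t" "0 < h" "h \<le> h0" "t + h \<le> T" for t h
  proof
    show a: "norm (E i t h) \<le> Q * h ^ 2" using Q(4) th h0 by auto
    have "h ^ 2 \<le> h ^ 1" using th h0 Q(3) by (intro power_decreasing) auto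
    then have "Q * h ^ 2 \<le> Q * h" using Q(1) by (simp add: mult_left_mono)
    also have "\<dots> < (Q + 1) * h" using th by simp
    also have "\<dots> \<le> (Q + 1) * (R / (Q + 1))" using th h0 Q(1) by (intro mult_left_mono) auto
    also have "\<dots> = R" using Q(1) by simp
    finally show "norm (E i t h) < R" using a by simp
  qed
  then show ?thesis using h0 Q by (intro exI[of _ h0] exI[of _ Q]) auto
qed

lemma step_expansion:
  shows "ord (Suc p) (\<lambda>t h. erk_step M S A g h t (u t) - u (t + h) - (\<Sum>k\<in>{1..<p}. h ^ Suc k *\<^sub>R coef_op S (final_defect M (Suc k)) h (F k t))
      - h *\<^sub>R (\<Sum>i\<in>{2..stages M}. b_op i h (\<Delta> i t h)))"
proof (rule ord_cong[OF row_expansion[where rw = "bcoef M" and n = "Suc (stages M)" and c = 1]])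
  show "admissible (bcoef M j)" if "j \<in> {2..<Suc (stages M)}" for j using that by (intro admissible_b) auto
  fix t h
  show "erk_step M S A g h t (u t) - u (t + h) - (\<Sum>k\<in>{1..<p}. h ^ Suc k *\<^sub>R coef_op S (final_defect M (Suc k)) h (F k t))
    - h *\<^sub>R (\<Sum>i\<in>{2..stages M}. b_op i h (\<Delta> i t h)) =
     u t + (1 * h) *\<^sub>R phi_op S 1 (1 * h) (A (u t) + g t (u t)) +
       h *\<^sub>R (\<Sum>j = 2..<Suc (stages M). b_op j h (g (t + node M j * h) (U t h j) - g t (u t))) - u (t + 1 * h) -
       (\<Sum>k = 1..<p. h ^ Suc k *\<^sub>R coef_op S (final_defect M (Suc k)) h (F k t)) -
       h *\<^sub>R (\<Sum>j = 2..<Suc (stages M). b_op j h (g (t + node M j * h) (U t h j) - g (t + node M j * h) (u (t + node M j * h))))"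
    unfolding erk_step_def \<Delta>_def U_def atLeastLessThanSuc_atLeastAtMost mult_1_left ..
qed (use p_ge in auto)

end

text \<open>The Taylor coefficients of \<open>g\<close> provided by lemma \<open>nonlinearity_expansion\<close>, as fixed parameters.\<close>

locale erk_expansion = erk_derivatives +
  fixes J K L :: "real \<Rightarrow> 'a \<Rightarrow> 'a" and B :: "real \<Rightarrow> 'a \<Rightarrow> 'a \<Rightarrow> 'a" and C :: real
  assumes C0: "0 \<le> C"
    and derivatives_linear: "\<And>t. t \<in> {t0..T} \<Longrightarrow> linear (J t) \<and> linear (K t) \<and> linear (L t) \<and> (\<forall>y. linear (\<lambda>x. B t x y)) \<and> (\<forall>x. linear (B t x))"
    and derivatives_bounded: "\<And>t w. t \<in> {t0..T} \<Longrightarrow> norm (J t w) \<le> C * norm w \<and> norm (K t w) \<le> C * norm w \<and> norm (L t w) \<le> C * norm w"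
    and B_bounded: "\<And>t x y. t \<in> {t0..T} \<Longrightarrow> norm (B t x y) \<le> C * norm x * norm y"
    and nonlinearity_expanded: "\<And>t \<tau> e. t0 \<le> t \<Longrightarrow> 0 \<le> \<tau> \<Longrightarrow> t + \<tau> \<le> T \<Longrightarrow> norm e < R \<Longrightarrow>
      norm (g (t + \<tau>) (u (t + \<tau>) + e) - g (t + \<tau>) (u (t + \<tau>))) \<le> C * norm e \<and>
      (3 \<le> p \<longrightarrow> norm (g (t + \<tau>) (u (t + \<tau>) + e) - g (t + \<tau>) (u (t + \<tau>)) - J t e) \<le> C * (\<tau> * norm e + norm e ^ 2)) \<and>
      (4 \<le> p \<longrightarrow> norm (g (t + \<tau>) (u (t + \<tau>) + e) - g (t + \<tau>) (u (t + \<tau>)) - J t e - \<tau> *\<^sub>R K t e) \<le> C * (\<tau> ^ 2 * norm e + norm e ^ 2)) \<and>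
      (5 \<le> p \<longrightarrow> norm (g (t + \<tau>) (u (t + \<tau>) + e) - g (t + \<tau>) (u (t + \<tau>)) - J t e - \<tau> *\<^sub>R K t e - (\<tau> ^ 2 / 2) *\<^sub>R L t e - (1 / 2) *\<^sub>R B t e e)
          \<le> C * (\<tau> ^ 3 * norm e + \<tau> * norm e ^ 2 + norm e ^ 3))"
begin

lemma coupling_3: "3 \<le> p \<Longrightarrow> coupling_conditions_3 M"
  and coupling_4: "4 \<le> p \<Longrightarrow> coupling_conditions_4 M"
  and coupling_5: "5 \<le> p \<Longrightarrow> coupling_conditions_5 M"
  using conditions unfolding stiff_conditions_weakened_def by blast+

lemma expansion_linear:
  assumes "t0 \<le> t" "0 < h" "t + h \<le> T"
  shows J_linear: "linear (J t)" and K_linear: "linear (K t)" and L_linear: "linear (L t)" and B_linear_left: "linear (\<lambda>x. B t x y)" and B_linear_right: "linear (B t x)"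
  using derivatives_linear[of t] assms by auto

lemma expansion_bounded:
  shows J_bounded: "uniformly_bounded (\<lambda>t h. J t)" and K_bounded: "uniformly_bounded (\<lambda>t h. K t)" and L_bounded: "uniformly_bounded (\<lambda>t h. L t)"
  unfolding uniformly_bounded_def by (intro exI[of _ C] conjI C0 allI impI; use derivatives_bounded in auto)+

lemma ord_B:
  assumes X: "ord k X" and Y: "ord l Y"
  shows "ord (k + l) (\<lambda>t h. B t (X t h) (Y t h))"
proof -
  obtain C1 h1 where C1: "0 \<le> C1" "0 < h1" "\<And>t h. t0 \<le> t \<Longrightarrow> 0 < h \<Longrightarrow> h \<le> h1 \<Longrightarrow> t + h \<le> T \<Longrightarrow> norm (X t h) \<le> C1 * h ^ k"
    using X by (rule ordE) blast
  obtain C2 h2 where C2: "0 \<le> C2" "0 < h2" "\<And>t h. t0 \<le> t \<Longrightarrow> 0 < h \<Longrightarrow> h \<le> h2 \<Longrightarrow> t + h \<le> T \<Longrightarrow> norm (Y t h) \<le> C2 * h ^ l"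
    using Y by (rule ordE) blast
  show ?thesis
  proof (rule ordI[of "C * (C1 * C2)" "min h1 h2"])
    fix t h assume th: "t0 \<le> t" "0 < h" "h \<le> min h1 h2" "t + h \<le> T"
    have "norm (B t (X t h) (Y t h)) \<le> C * (norm (X t h) * norm (Y t h))" using B_bounded[of t "X t h" "Y t h"] th by (simp add: mult.assoc)
    also have "\<dots> \<le> C * ((C1 * h ^ k) * (C2 * h ^ l))"
      using th C1 C2 C0 by (intro mult_left_mono mult_mono) auto
    finally show "norm (B t (X t h) (Y t h)) \<le> C * (C1 * C2) * h ^ (k + l)" by (simp add: power_add mult_ac)
  qed (use C0 C1 C2 in auto)
qed

text \<open>Once the stage error is known to be \<open>O(h^2)\<close>, the Taylor bounds for \<open>g\<close> become orders in \<open>h\<close>. The hypothesis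
is kept explicit because the first of these lemmas is used in the induction that proves it.\<close>

lemma nonlinear_error_2:
  assumes i: "i \<in> {2..stages M}" and oE: "ord 2 (E i)"
  shows "ord 2 (\<Delta> i)"
proof -
  obtain h0 Q where hQ: "0 < h0" "h0 \<le> 1" "0 \<le> Q" and sm: "\<forall>t h. t0 \<le> t \<longrightarrow> 0 < h \<longrightarrow> h \<le> h0 \<longrightarrow> t + h \<le> T \<longrightarrow>
    norm (E i t h) \<le> Q * h ^ 2 \<and> norm (E i t h) < R" using stage_error_small[OF oE] by blast
  show ?thesis
  proof (rule ordI[OF _ hQ(1)])
    show "0 \<le> C * Q" using C0 hQ by simp
    fix t h assume th: "t0 \<le> t" "0 < h" "h \<le> h0" "t + h \<le> T"
    have e: "norm (E i t h) \<le> Q * h ^ 2" "norm (E i t h) < R" using sm th by auto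
    have "norm (\<Delta> i t h) \<le> C * norm (E i t h)"
      unfolding \<Delta>_def U_eq by (rule nonlinearity_expanded[THEN conjunct1]) (use th node_time[OF i th(2)] node_time_le[OF i th(2,4)] e in auto)
    also have "\<dots> \<le> C * (Q * h ^ 2)" by (intro mult_left_mono e C0)
    finally show "norm (\<Delta> i t h) \<le> C * Q * h ^ 2" by (simp add: mult.assoc)
  qed
qed

lemma nonlinear_error_3:
  assumes i: "i \<in> {2..stages M}" and oE: "ord 2 (E i)" and p3: "3 \<le> p"
  shows "ord 3 (\<lambda>t h. \<Delta> i t h - J t (E i t h))"
proof -
  obtain h0 Q where hQ: "0 < h0" "h0 \<le> 1" "0 \<le> Q" and sm: "\<forall>t h. t0 \<le> t \<longrightarrow> 0 < h \<longrightarrow> h \<le> h0 \<longrightarrow> t + h \<le> T \<longrightarrow>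
    norm (E i t h) \<le> Q * h ^ 2 \<and> norm (E i t h) < R" using stage_error_small[OF oE] by blast
  show ?thesis
  proof (rule ordI[OF _ hQ(1)])
    show "0 \<le> C * (Q + Q ^ 2)" using C0 hQ by simp
    fix t h assume th: "t0 \<le> t" "0 < h" "h \<le> h0" "t + h \<le> T"
    have e: "norm (E i t h) \<le> Q * h ^ 2" "norm (E i t h) < R" using sm th by auto
    have "norm (\<Delta> i t h - J t (E i t h)) \<le> C * (node M i * h * norm (E i t h) + norm (E i t h) ^ 2)"
      unfolding \<Delta>_def U_eq by (rule nonlinearity_expanded[THEN conjunct2, THEN conjunct1, rule_format]) (use th node_time[OF i th(2)] node_time_le[OF i th(2,4)] e p3 in auto)
    also have "\<dots> \<le> C * ((Q + Q ^ 2) * h ^ 3)"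
      by (intro mult_left_mono C0 perturbation_powers(1)) (use node_time[OF i th(2)] th hQ e in auto)
    finally show "norm (\<Delta> i t h - J t (E i t h)) \<le> C * (Q + Q ^ 2) * h ^ 3" by (simp add: mult.assoc)
  qed
qed

lemma nonlinear_error_4:
  assumes i: "i \<in> {2..stages M}" and oE: "ord 2 (E i)" and p4: "4 \<le> p"
  shows "ord 4 (\<lambda>t h. \<Delta> i t h - J t (E i t h) - (node M i * h) *\<^sub>R K t (E i t h))"
proof -
  obtain h0 Q where hQ: "0 < h0" "h0 \<le> 1" "0 \<le> Q" and sm: "\<forall>t h. t0 \<le> t \<longrightarrow> 0 < h \<longrightarrow> h \<le> h0 \<longrightarrow> t + h \<le> T \<longrightarrow>
    norm (E i t h) \<le> Q * h ^ 2 \<and> norm (E i t h) < R" using stage_error_small[OF oE] by blast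
  show ?thesis
  proof (rule ordI[OF _ hQ(1)])
    show "0 \<le> C * (Q + Q ^ 2)" using C0 hQ by simp
    fix t h assume th: "t0 \<le> t" "0 < h" "h \<le> h0" "t + h \<le> T"
    have e: "norm (E i t h) \<le> Q * h ^ 2" "norm (E i t h) < R" using sm th by auto
    have "norm (\<Delta> i t h - J t (E i t h) - (node M i * h) *\<^sub>R K t (E i t h)) \<le> C * ((node M i * h) ^ 2 * norm (E i t h) + norm (E i t h) ^ 2)"
      unfolding \<Delta>_def U_eq by (rule nonlinearity_expanded[THEN conjunct2, THEN conjunct2, THEN conjunct1, rule_format]) (use th node_time[OF i th(2)] node_time_le[OF i th(2,4)] e p4 in auto)
    also have "\<dots> \<le> C * ((Q + Q ^ 2) * h ^ 4)"
      by (intro mult_left_mono C0 perturbation_powers(2)) (use node_time[OF i th(2)] th hQ e in auto)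
    finally show "norm (\<Delta> i t h - J t (E i t h) - (node M i * h) *\<^sub>R K t (E i t h)) \<le> C * (Q + Q ^ 2) * h ^ 4" by (simp add: mult.assoc)
  qed
qed

lemma nonlinear_error_5:
  assumes i: "i \<in> {2..stages M}" and oE: "ord 2 (E i)" and p5: "5 \<le> p"
  shows "ord 5 (\<lambda>t h. \<Delta> i t h - J t (E i t h) - (node M i * h) *\<^sub>R K t (E i t h) - ((node M i * h) ^ 2 / 2) *\<^sub>R L t (E i t h) - (1 / 2) *\<^sub>R B t (E i t h) (E i t h))"
proof -
  obtain h0 Q where hQ: "0 < h0" "h0 \<le> 1" "0 \<le> Q" and sm: "\<forall>t h. t0 \<le> t \<longrightarrow> 0 < h \<longrightarrow> h \<le> h0 \<longrightarrow> t + h \<le> T \<longrightarrow>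
    norm (E i t h) \<le> Q * h ^ 2 \<and> norm (E i t h) < R" using stage_error_small[OF oE] by blast
  show ?thesis
  proof (rule ordI[OF _ hQ(1)])
    show "0 \<le> C * (Q + Q ^ 2 + Q ^ 3)" using C0 hQ by simp
    fix t h assume th: "t0 \<le> t" "0 < h" "h \<le> h0" "t + h \<le> T"
    have e: "norm (E i t h) \<le> Q * h ^ 2" "norm (E i t h) < R" using sm th by auto
    have "norm (\<Delta> i t h - J t (E i t h) - (node M i * h) *\<^sub>R K t (E i t h) - ((node M i * h) ^ 2 / 2) *\<^sub>R L t (E i t h) - (1 / 2) *\<^sub>R B t (E i t h) (E i t h))
        \<le> C * ((node M i * h) ^ 3 * norm (E i t h) + node M i * h * norm (E i t h) ^ 2 + norm (E i t h) ^ 3)"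
      unfolding \<Delta>_def U_eq by (rule nonlinearity_expanded[THEN conjunct2, THEN conjunct2, THEN conjunct2, rule_format]) (use th node_time[OF i th(2)] node_time_le[OF i th(2,4)] e p5 in auto)
    also have "\<dots> \<le> C * ((Q + Q ^ 2 + Q ^ 3) * h ^ 5)"
      by (intro mult_left_mono C0 perturbation_powers(3)) (use node_time[OF i th(2)] th hQ e in auto)
    finally show "norm (\<Delta> i t h - J t (E i t h) - (node M i * h) *\<^sub>R K t (E i t h) - ((node M i * h) ^ 2 / 2) *\<^sub>R L t (E i t h) - (1 / 2) *\<^sub>R B t (E i t h) (E i t h))
        \<le> C * (Q + Q ^ 2 + Q ^ 3) * h ^ 5" by (simp add: mult.assoc)
  qed
qed

text \<open>Induction over the stages: the defect starts at \<open>h^2\<close>, and the errors of earlier stages enter with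
another factor \<open>h\<close>.\<close>

lemma stage_error_order_2:
  assumes "i \<in> {2..stages M}"
  shows "ord 2 (E i)"
  using assms
proof (induction i rule: less_induct)
  case (less i)
  have "ord 2 (\<lambda>t h. \<Sum>j\<in>{2..<i}. a_op i j h (\<Delta> j t h))"
    by (rule ord_a_sum[OF less.prems]) (use less in \<open>auto intro: nonlinear_error_2\<close>)
  then have "ord 3 (\<lambda>t h. h ^ 1 *\<^sub>R (\<Sum>j\<in>{2..<i}. a_op i j h (\<Delta> j t h)))" by (rule ord_power) simp
  then have 1: "ord 2 (\<lambda>t h. h ^ 1 *\<^sub>R (\<Sum>j\<in>{2..<i}. a_op i j h (\<Delta> j t h)))" by (rule ord_mono) simp
  have 2: "ord 2 (\<lambda>t h. E i t h - (\<Sum>k\<in>{1..<1}. h ^ Suc k *\<^sub>R defect_op (Suc k) i h (F k t)) - h *\<^sub>R (\<Sum>j\<in>{2..<i}. a_op i j h (\<Delta> j t h)))"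
    using stage_expansion_truncated[OF less.prems, of 1] p_ge by (simp add: numeral_2_eq_2)
  show ?case by (rule ord_cong[OF ord_add[OF 2 1]]) simp
qed

lemma nonlinear_order_2:
  assumes "i \<in> {2..stages M}"
  shows "ord 2 (\<Delta> i)"
  by (rule nonlinear_error_2[OF assms stage_error_order_2[OF assms]])

text \<open>The coefficients of \<open>h^2\<close>, \<open>h^3\<close>, \<open>h^4\<close> in the expansions of the stage error \<open>E\<close> and of the induced error
\<open>\<Delta>\<close> of the nonlinearity. They still depend on \<open>h\<close> through the bounded operators \<open>\<phi>\<^sub>k(\<sigma>hA)\<close>. The recursion
alternates: \<open>H\<^sub>k\<close> collects the terms of order \<open>h^k\<close> of the expansion of \<open>g\<close>, and \<open>E\<^sub>k\<^sub>+\<^sub>1\<close> consists of the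
defect \<open>\<psi>\<^sub>k\<^sub>+\<^sub>1\<^sub>,\<^sub>i\<close> and the \<open>H\<^sub>k\<close> of the earlier stages.\<close>

definition E2 :: "nat \<Rightarrow> real \<Rightarrow> real \<Rightarrow> 'a" where
  "E2 i t h = defect_op 2 i h (F 1 t)"

definition E3 :: "nat \<Rightarrow> real \<Rightarrow> real \<Rightarrow> 'a" where
  "E3 i t h = defect_op 3 i h (F 2 t) + (\<Sum>j\<in>{2..<i}. a_op i j h (J t (E2 j t h)))"

definition E4 :: "nat \<Rightarrow> real \<Rightarrow> real \<Rightarrow> 'a" where
  "E4 i t h = defect_op 4 i h (F 3 t) + (\<Sum>j\<in>{2..<i}. a_op i j h (J t (E3 j t h) + node M j *\<^sub>R K t (E2 j t h)))"

definition H2 :: "nat \<Rightarrow> real \<Rightarrow> real \<Rightarrow> 'a" where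
  "H2 i t h = J t (E2 i t h)"

definition H3 :: "nat \<Rightarrow> real \<Rightarrow> real \<Rightarrow> 'a" where
  "H3 i t h = J t (E3 i t h) + node M i *\<^sub>R K t (E2 i t h)"

definition H4 :: "nat \<Rightarrow> real \<Rightarrow> real \<Rightarrow> 'a" where
  "H4 i t h = J t (E4 i t h) + node M i *\<^sub>R K t (E3 i t h) + (node M i ^ 2 / 2) *\<^sub>R L t (E2 i t h) + (1 / 2) *\<^sub>R B t (E2 i t h) (E2 i t h)"

lemma ord_E2:
  assumes "i \<in> {2..stages M}"
  shows "ord 0 (E2 i)"
  using ord_defect[OF assms, of 1] p_ge unfolding E2_def[abs_def] by (simp add: numeral_2_eq_2)

lemma sum_upto_2:
  fixes f :: "nat \<Rightarrow> 'a"
  shows "(\<Sum>k\<in>{1..<2::nat}. f k) = f 1"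
  by (simp add: numeral_2_eq_2)

lemma sum_upto_3:
  fixes f :: "nat \<Rightarrow> 'a"
  shows "(\<Sum>k\<in>{1..<3::nat}. f k) = f 1 + f 2"
  by (simp add: numeral_2_eq_2 numeral_3_eq_3)

lemma sum_upto_4:
  fixes f :: "nat \<Rightarrow> 'a"
  shows "(\<Sum>k\<in>{1..<4::nat}. f k) = f 1 + f 2 + f 3"
  by (simp add: numeral_eq_Suc)

lemma Suc_numerals:
  shows "Suc 1 = 2" "Suc 2 = 3" "Suc 3 = 4" "Suc 4 = 5"
  by auto

lemma stage_error_order_3:
  assumes i: "i \<in> {2..stages M}" and p3: "3 \<le> p"
  shows "ord 3 (\<lambda>t h. E i t h - h ^ 2 *\<^sub>R E2 i t h)"
proof -
  have 1: "ord 3 (\<lambda>t h. E i t h - h ^ 2 *\<^sub>R defect_op 2 i h (F 1 t) - h *\<^sub>R (\<Sum>j\<in>{2..<i}. a_op i j h (\<Delta> j t h)))"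
    using stage_expansion_truncated[OF i, of 2] p3 unfolding sum_upto_2 Suc_numerals by simp
  have 2: "ord 3 (\<lambda>t h. h *\<^sub>R (\<Sum>j\<in>{2..<i}. a_op i j h (\<Delta> j t h)))"
    by (rule ord_Suc[OF ord_a_sum[OF i nonlinear_order_2]]) auto
  show ?thesis by (rule ord_cong[OF ord_add[OF 1 2]]) (simp add: E2_def)
qed

lemma nonlinear_order_3:
  assumes i: "i \<in> {2..stages M}" and p3: "3 \<le> p"
  shows "ord 3 (\<lambda>t h. \<Delta> i t h - h ^ 2 *\<^sub>R H2 i t h)"
proof (rule ord_cong[OF ord_add[OF nonlinear_error_3[OF i stage_error_order_2[OF i] p3] ord_apply[OF J_bounded stage_error_order_3[OF i p3]]]])
  fix t h assume th: "t0 \<le> t" "0 < h" "t + h \<le> T"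
  show "\<Delta> i t h - h ^ 2 *\<^sub>R H2 i t h = \<Delta> i t h - J t (E i t h) + J t (E i t h - h ^ 2 *\<^sub>R E2 i t h)"
    by (simp add: H2_def linear_diff[OF J_linear[OF th]] linear_scale[OF J_linear[OF th]])
qed

lemma stage_error_order_4:
  assumes i: "i \<in> {2..stages M}" and p4: "4 \<le> p"
  shows "ord 4 (\<lambda>t h. E i t h - h ^ 2 *\<^sub>R E2 i t h - h ^ 3 *\<^sub>R E3 i t h)"
proof -
  have 1: "ord 4 (\<lambda>t h. E i t h - (h ^ 2 *\<^sub>R defect_op 2 i h (F 1 t) + h ^ 3 *\<^sub>R defect_op 3 i h (F 2 t)) - h *\<^sub>R (\<Sum>j\<in>{2..<i}. a_op i j h (\<Delta> j t h)))"
    using stage_expansion_truncated[OF i, of 3] p4 unfolding sum_upto_3 Suc_numerals by simp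
  have 2: "ord 4 (\<lambda>t h. h *\<^sub>R (\<Sum>j\<in>{2..<i}. a_op i j h (\<Delta> j t h - h ^ 2 *\<^sub>R H2 j t h)))"
    by (rule ord_Suc[OF ord_a_sum[OF i nonlinear_order_3]]) (use p4 in auto)
  show ?thesis
  proof (rule ord_cong[OF ord_add[OF 1 2]])
    fix t h assume th: "t0 \<le> t" "0 < h" "t + h \<le> T"
    have "(\<Sum>j\<in>{2..<i}. a_op i j h (\<Delta> j t h - h ^ 2 *\<^sub>R H2 j t h)) = (\<Sum>j\<in>{2..<i}. a_op i j h (\<Delta> j t h)) - h ^ 2 *\<^sub>R (\<Sum>j\<in>{2..<i}. a_op i j h (H2 j t h))"
      unfolding scaleR_sum_right sum_subtractf[symmetric]
      by (intro sum.cong refl) (simp add: linear_diff[OF a_linear[OF i _ th(2)]] linear_scale[OF a_linear[OF i _ th(2)]])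
    then show "E i t h - h ^ 2 *\<^sub>R E2 i t h - h ^ 3 *\<^sub>R E3 i t h = E i t h - (h ^ 2 *\<^sub>R defect_op 2 i h (F 1 t) + h ^ 3 *\<^sub>R defect_op 3 i h (F 2 t)) -
         h *\<^sub>R (\<Sum>j\<in>{2..<i}. a_op i j h (\<Delta> j t h)) + h *\<^sub>R (\<Sum>j\<in>{2..<i}. a_op i j h (\<Delta> j t h - h ^ 2 *\<^sub>R H2 j t h))"
      by (simp add: E2_def E3_def H2_def scaleR_add_right scaleR_diff_right power2_eq_square power3_eq_cube)
  qed
qed

lemma nonlinear_order_4:
  assumes i: "i \<in> {2..stages M}" and p4: "4 \<le> p"
  shows "ord 4 (\<lambda>t h. \<Delta> i t h - h ^ 2 *\<^sub>R H2 i t h - h ^ 3 *\<^sub>R H3 i t h)"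
proof -
  have 1: "ord 4 (\<lambda>t h. J t (E i t h - h ^ 2 *\<^sub>R E2 i t h - h ^ 3 *\<^sub>R E3 i t h))" by (rule ord_apply[OF J_bounded stage_error_order_4[OF i p4]])
  have "ord 3 (\<lambda>t h. node M i *\<^sub>R K t (E i t h - h ^ 2 *\<^sub>R E2 i t h))"
    using p4 by (intro ord_scaleR ord_apply[OF K_bounded stage_error_order_3[OF i]]) simp
  then have 2: "ord 4 (\<lambda>t h. h *\<^sub>R (node M i *\<^sub>R K t (E i t h - h ^ 2 *\<^sub>R E2 i t h)))" by (rule ord_Suc) simp
  show ?thesis
  proof (rule ord_cong[OF ord_add[OF ord_add[OF nonlinear_error_4[OF i stage_error_order_2[OF i] p4] 1] 2]])
    fix t h assume th: "t0 \<le> t" "0 < h" "t + h \<le> T"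
    show "\<Delta> i t h - h ^ 2 *\<^sub>R H2 i t h - h ^ 3 *\<^sub>R H3 i t h = \<Delta> i t h - J t (E i t h) - (node M i * h) *\<^sub>R K t (E i t h) +
       J t (E i t h - h ^ 2 *\<^sub>R E2 i t h - h ^ 3 *\<^sub>R E3 i t h) + h *\<^sub>R (node M i *\<^sub>R K t (E i t h - h ^ 2 *\<^sub>R E2 i t h))"
      by (simp add: H2_def H3_def linear_diff[OF J_linear[OF th]] linear_scale[OF J_linear[OF th]] linear_diff[OF K_linear[OF th]] linear_scale[OF K_linear[OF th]]
          scaleR_add_right scaleR_diff_right power2_eq_square power3_eq_cube mult_ac)
  qed
qed

lemma stage_error_order_5:
  assumes i: "i \<in> {2..stages M}" and p5: "5 \<le> p"
  shows "ord 5 (\<lambda>t h. E i t h - h ^ 2 *\<^sub>R E2 i t h - h ^ 3 *\<^sub>R E3 i t h - h ^ 4 *\<^sub>R E4 i t h)"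
proof -
  have 1: "ord 5 (\<lambda>t h. E i t h - (h ^ 2 *\<^sub>R defect_op 2 i h (F 1 t) + h ^ 3 *\<^sub>R defect_op 3 i h (F 2 t) + h ^ 4 *\<^sub>R defect_op 4 i h (F 3 t)) - h *\<^sub>R (\<Sum>j\<in>{2..<i}. a_op i j h (\<Delta> j t h)))"
    using stage_expansion_truncated[OF i, of 4] p5 unfolding sum_upto_4 Suc_numerals by simp
  have 2: "ord 5 (\<lambda>t h. h *\<^sub>R (\<Sum>j\<in>{2..<i}. a_op i j h (\<Delta> j t h - h ^ 2 *\<^sub>R H2 j t h - h ^ 3 *\<^sub>R H3 j t h)))"
    by (rule ord_Suc[OF ord_a_sum[OF i nonlinear_order_4]]) (use p5 in auto)
  show ?thesis
  proof (rule ord_cong[OF ord_add[OF 1 2]])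
    fix t h assume th: "t0 \<le> t" "0 < h" "t + h \<le> T"
    have e: "(\<Sum>j\<in>{2..<i}. a_op i j h (\<Delta> j t h - h ^ 2 *\<^sub>R H2 j t h - h ^ 3 *\<^sub>R H3 j t h)) =
        (\<Sum>j\<in>{2..<i}. a_op i j h (\<Delta> j t h)) - h ^ 2 *\<^sub>R (\<Sum>j\<in>{2..<i}. a_op i j h (H2 j t h)) - h ^ 3 *\<^sub>R (\<Sum>j\<in>{2..<i}. a_op i j h (H3 j t h))"
      unfolding scaleR_sum_right sum_subtractf[symmetric]
      by (intro sum.cong refl) (simp add: linear_diff[OF a_linear[OF i _ th(2)]] linear_scale[OF a_linear[OF i _ th(2)]])
    have E34: "E3 i t h = defect_op 3 i h (F 2 t) + (\<Sum>j\<in>{2..<i}. a_op i j h (H2 j t h))"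
      "E4 i t h = defect_op 4 i h (F 3 t) + (\<Sum>j\<in>{2..<i}. a_op i j h (H3 j t h))" by (simp_all add: E3_def E4_def H2_def H3_def)
    have pw: "h ^ 4 = h * h ^ 3" "h ^ 3 = h * h ^ 2" by (simp_all add: numeral_eq_Suc)
    show "E i t h - h ^ 2 *\<^sub>R E2 i t h - h ^ 3 *\<^sub>R E3 i t h - h ^ 4 *\<^sub>R E4 i t h =
       E i t h - (h ^ 2 *\<^sub>R defect_op 2 i h (F 1 t) + h ^ 3 *\<^sub>R defect_op 3 i h (F 2 t) + h ^ 4 *\<^sub>R defect_op 4 i h (F 3 t)) -
         h *\<^sub>R (\<Sum>j\<in>{2..<i}. a_op i j h (\<Delta> j t h)) + h *\<^sub>R (\<Sum>j\<in>{2..<i}. a_op i j h (\<Delta> j t h - h ^ 2 *\<^sub>R H2 j t h - h ^ 3 *\<^sub>R H3 j t h))"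
      unfolding e E34 E2_def unfolding pw by (simp add: scaleR_add_right scaleR_diff_right)
  qed
qed

lemma nonlinear_order_5:
  assumes i: "i \<in> {2..stages M}" and p5: "5 \<le> p"
  shows "ord 5 (\<lambda>t h. \<Delta> i t h - h ^ 2 *\<^sub>R H2 i t h - h ^ 3 *\<^sub>R H3 i t h - h ^ 4 *\<^sub>R H4 i t h)"
proof -
  have p3: "3 \<le> p" and p4: "4 \<le> p" using p5 by auto
  have 1: "ord 5 (\<lambda>t h. J t (E i t h - h ^ 2 *\<^sub>R E2 i t h - h ^ 3 *\<^sub>R E3 i t h - h ^ 4 *\<^sub>R E4 i t h))" by (rule ord_apply[OF J_bounded stage_error_order_5[OF i p5]])
  have 2: "ord 5 (\<lambda>t h. h *\<^sub>R (node M i *\<^sub>R K t (E i t h - h ^ 2 *\<^sub>R E2 i t h - h ^ 3 *\<^sub>R E3 i t h)))"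
    by (rule ord_Suc[OF ord_scaleR[OF ord_apply[OF K_bounded stage_error_order_4[OF i p4]]]]) simp
  have 3: "ord 5 (\<lambda>t h. h ^ 2 *\<^sub>R ((node M i ^ 2 / 2) *\<^sub>R L t (E i t h - h ^ 2 *\<^sub>R E2 i t h)))"
    by (rule ord_power[OF ord_scaleR[OF ord_apply[OF L_bounded stage_error_order_3[OF i p3]]]]) simp
  have q: "ord 2 (\<lambda>t h. h ^ 2 *\<^sub>R E2 i t h)" by (rule ord_power[OF ord_E2[OF i]]) simp
  have 4: "ord 5 (\<lambda>t h. (1/2) *\<^sub>R (B t (E i t h - h ^ 2 *\<^sub>R E2 i t h) (E i t h) + B t (h ^ 2 *\<^sub>R E2 i t h) (E i t h - h ^ 2 *\<^sub>R E2 i t h)))"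
    using ord_B[OF stage_error_order_3[OF i p3] stage_error_order_2[OF i]] ord_B[OF q stage_error_order_3[OF i p3]] by (intro ord_scaleR ord_add) simp_all
  show ?thesis
  proof (rule ord_cong[OF ord_add[OF ord_add[OF ord_add[OF ord_add[OF nonlinear_error_5[OF i stage_error_order_2[OF i] p5] 1] 2] 3] 4]])
    fix t h assume th: "t0 \<le> t" "0 < h" "t + h \<le> T"
    have pw: "h ^ 4 = h * (h * (h * h))" "h ^ 3 = h * (h * h)" "h ^ 2 = h * h" by (simp_all add: numeral_eq_Suc)
    have Jx: "J t (E i t h - h ^ 2 *\<^sub>R E2 i t h - h ^ 3 *\<^sub>R E3 i t h - h ^ 4 *\<^sub>R E4 i t h) =
       J t (E i t h) - h ^ 2 *\<^sub>R J t (E2 i t h) - h ^ 3 *\<^sub>R J t (E3 i t h) - h ^ 4 *\<^sub>R J t (E4 i t h)"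
      by (simp only: linear_diff[OF J_linear[OF th]] linear_scale[OF J_linear[OF th]])
    have Kx: "h *\<^sub>R (node M i *\<^sub>R K t (E i t h - h ^ 2 *\<^sub>R E2 i t h - h ^ 3 *\<^sub>R E3 i t h)) =
       (node M i * h) *\<^sub>R K t (E i t h) - h ^ 3 *\<^sub>R (node M i *\<^sub>R K t (E2 i t h)) - h ^ 4 *\<^sub>R (node M i *\<^sub>R K t (E3 i t h))"
      by (simp add: linear_diff[OF K_linear[OF th]] linear_scale[OF K_linear[OF th]] scaleR_diff_right pw mult_ac)
    have Lx: "h ^ 2 *\<^sub>R ((node M i ^ 2 / 2) *\<^sub>R L t (E i t h - h ^ 2 *\<^sub>R E2 i t h)) =
       ((node M i * h) ^ 2 / 2) *\<^sub>R L t (E i t h) - h ^ 4 *\<^sub>R ((node M i ^ 2 / 2) *\<^sub>R L t (E2 i t h))"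
      by (simp add: linear_diff[OF L_linear[OF th]] linear_scale[OF L_linear[OF th]] scaleR_diff_right power_mult_distrib pw mult_ac)
    have Bx: "B t (E i t h - h ^ 2 *\<^sub>R E2 i t h) (E i t h) + B t (h ^ 2 *\<^sub>R E2 i t h) (E i t h - h ^ 2 *\<^sub>R E2 i t h) =
       B t (E i t h) (E i t h) - h ^ 4 *\<^sub>R B t (E2 i t h) (E2 i t h)"
      by (simp add: linear_diff[OF B_linear_left[OF th]] linear_scale[OF B_linear_left[OF th]] linear_diff[OF B_linear_right[OF th]] linear_scale[OF B_linear_right[OF th]] scaleR_diff_right pw mult_ac)
    show "\<Delta> i t h - h ^ 2 *\<^sub>R H2 i t h - h ^ 3 *\<^sub>R H3 i t h - h ^ 4 *\<^sub>R H4 i t h =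
       \<Delta> i t h - J t (E i t h) - (node M i * h) *\<^sub>R K t (E i t h) - ((node M i * h) ^ 2 / 2) *\<^sub>R L t (E i t h) - (1 / 2) *\<^sub>R B t (E i t h) (E i t h) +
       J t (E i t h - h ^ 2 *\<^sub>R E2 i t h - h ^ 3 *\<^sub>R E3 i t h - h ^ 4 *\<^sub>R E4 i t h) +
       h *\<^sub>R (node M i *\<^sub>R K t (E i t h - h ^ 2 *\<^sub>R E2 i t h - h ^ 3 *\<^sub>R E3 i t h)) +
       h ^ 2 *\<^sub>R ((node M i ^ 2 / 2) *\<^sub>R L t (E i t h - h ^ 2 *\<^sub>R E2 i t h)) +
       (1/2) *\<^sub>R (B t (E i t h - h ^ 2 *\<^sub>R E2 i t h) (E i t h) + B t (h ^ 2 *\<^sub>R E2 i t h) (E i t h - h ^ 2 *\<^sub>R E2 i t h))"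
      unfolding Jx Kx Lx Bx H2_def H3_def H4_def scaleR_add_right scaleR_diff_right by (simp add: mult.commute)
  qed
qed

lemma finite_stages:
  shows "finite {2..stages M}" "\<And>i. finite {2..<i::nat}"
  by auto

text \<open>In this and the next two lemmas each elementary differential in \<open>H\<^sub>k\<close> is annihilated by one of the
coupling conditions of order \<open>k + 1\<close>.\<close>

lemma H2_cancels:
  assumes th: "t0 \<le> t" "0 < h" "t + h \<le> T" and p3: "3 \<le> p"
  shows "(\<Sum>i\<in>{2..stages M}. b_op i h (H2 i t h)) = 0"
  using operator_chain_1[where c = "\<lambda>_. 1" and x = "F 1 t", OF less_imp_le[OF th(2)] finite_stages(1) admissible_b admissible_defect_Suc[of _ 1] J_linear[OF th]]
    tensor_condition_3[OF coupling_3[OF p3]] unfolding Suc_numerals H2_def E2_def by simp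

lemma H3_cancels:
  assumes th: "t0 \<le> t" "0 < h" "t + h \<le> T" and p4: "4 \<le> p"
  shows "(\<Sum>i\<in>{2..stages M}. b_op i h (H3 i t h)) = 0"
proof -
  note h0 = less_imp_le[OF th(2)] and T4 = tensor_conditions_4[OF coupling_4[OF p4]]
  have z1: "(\<Sum>i\<in>{2..stages M}. b_op i h (J t (defect_op 3 i h (F 2 t)))) = 0"
    using operator_chain_1[where c = "\<lambda>_. 1" and x = "F 2 t", OF h0 finite_stages(1) admissible_b admissible_defect_Suc[of _ 2] J_linear[OF th]] T4(1) unfolding Suc_numerals by simp
  have z2: "(\<Sum>i\<in>{2..stages M}. b_op i h (J t (\<Sum>j\<in>{2..<i}. a_op i j h (J t (E2 j t h))))) = 0"
    using operator_chain_2[where c = "\<lambda>_. 1" and c' = "\<lambda>_. 1" and x = "F 1 t", OF h0 finite_stages admissible_b admissible_a admissible_defect_inner[of _ _ 1] J_linear[OF th] J_linear[OF th]] T4(2)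
    unfolding Suc_numerals E2_def by simp
  have z3: "(\<Sum>i\<in>{2..stages M}. b_op i h (node M i *\<^sub>R K t (E2 i t h))) = 0"
    using operator_chain_1[where c = "node M" and x = "F 1 t", OF h0 finite_stages(1) admissible_b admissible_defect_Suc[of _ 1] K_linear[OF th]] T4(3) unfolding Suc_numerals E2_def by simp
  have "(\<Sum>i\<in>{2..stages M}. b_op i h (H3 i t h)) = (\<Sum>i\<in>{2..stages M}. b_op i h (J t (defect_op 3 i h (F 2 t))) +
     b_op i h (J t (\<Sum>j\<in>{2..<i}. a_op i j h (J t (E2 j t h)))) + b_op i h (node M i *\<^sub>R K t (E2 i t h)))"
    by (intro sum.cong refl) (simp only: H3_def E3_def linear_add[OF J_linear[OF th]] linear_add[OF b_linear[OF _ th(2)]])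
  then show ?thesis by (simp only: sum.distrib z1 z2 z3 add_0_left)
qed

lemma H4_cancels:
  assumes th: "t0 \<le> t" "0 < h" "t + h \<le> T" and p5: "5 \<le> p"
  shows "(\<Sum>i\<in>{2..stages M}. b_op i h (H4 i t h)) = 0"
proof -
  note h0 = less_imp_le[OF th(2)] and T5 = tensor_conditions_5[OF coupling_5[OF p5]]
  let ?S = "\<lambda>i. \<Sum>j\<in>{2..<i}. a_op i j h (J t (E2 j t h))"
  let ?S3 = "\<lambda>i. \<Sum>j\<in>{2..<i}. a_op i j h (J t (defect_op 3 j h (F 2 t)))"
  let ?SS = "\<lambda>i. \<Sum>j\<in>{2..<i}. a_op i j h (J t (?S j))"
  let ?SK = "\<lambda>i. \<Sum>j\<in>{2..<i}. a_op i j h (node M j *\<^sub>R K t (E2 j t h))"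
  have z1: "(\<Sum>i\<in>{2..stages M}. b_op i h (J t (defect_op 4 i h (F 3 t)))) = 0"
    using operator_chain_1[where c = "\<lambda>_. 1" and x = "F 3 t", OF h0 finite_stages(1) admissible_b admissible_defect_Suc[of _ 3] J_linear[OF th]] T5(1) unfolding Suc_numerals by simp
  have z2: "(\<Sum>i\<in>{2..stages M}. b_op i h (J t (?S3 i))) = 0"
    using operator_chain_2[where c = "\<lambda>_. 1" and c' = "\<lambda>_. 1" and x = "F 2 t", OF h0 finite_stages admissible_b admissible_a admissible_defect_inner[of _ _ 2] J_linear[OF th] J_linear[OF th]] T5(2) unfolding Suc_numerals by simp
  have z3: "(\<Sum>i\<in>{2..stages M}. b_op i h (J t (?SS i))) = 0"
    unfolding E2_def
    using operator_chain_3[where x = "F 1 t", OF h0 finite_stages admissible_b admissible_a admissible_a_inner admissible_defect_innermost[of _ _ _ 1] J_linear[OF th]] T5(3) unfolding Suc_numerals by simp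
  have z4: "(\<Sum>i\<in>{2..stages M}. b_op i h (J t (?SK i))) = 0"
    using operator_chain_2[where c = "\<lambda>_. 1" and c' = "node M" and x = "F 1 t", OF h0 finite_stages admissible_b admissible_a admissible_defect_inner[of _ _ 1] J_linear[OF th] K_linear[OF th]] T5(4) unfolding Suc_numerals E2_def by simp
  have z5: "(\<Sum>i\<in>{2..stages M}. b_op i h (node M i *\<^sub>R K t (defect_op 3 i h (F 2 t)))) = 0"
    using operator_chain_1[where c = "node M" and x = "F 2 t", OF h0 finite_stages(1) admissible_b admissible_defect_Suc[of _ 2] K_linear[OF th]] T5(5) unfolding Suc_numerals by simp
  have z6: "(\<Sum>i\<in>{2..stages M}. b_op i h (node M i *\<^sub>R K t (?S i))) = 0"
    using operator_chain_2[where c = "node M" and c' = "\<lambda>_. 1" and x = "F 1 t", OF h0 finite_stages admissible_b admissible_a admissible_defect_inner[of _ _ 1] K_linear[OF th] J_linear[OF th]] T5(6) unfolding Suc_numerals E2_def by simp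
  have z7: "(\<Sum>i\<in>{2..stages M}. b_op i h (node M i ^ 2 *\<^sub>R L t (E2 i t h))) = 0"
    using operator_chain_1[where c = "\<lambda>i. node M i ^ 2" and x = "F 1 t", OF h0 finite_stages(1) admissible_b admissible_defect_Suc[of _ 1] L_linear[OF th]] T5(7) unfolding Suc_numerals E2_def by simp
  have z8: "(\<Sum>i\<in>{2..stages M}. b_op i h (B t (E2 i t h) (E2 i t h))) = 0"
    using operator_bilinear[where x = "F 1 t" and y = "F 1 t", OF h0 finite_stages(1) admissible_b admissible_defect_Suc[of _ 1] B_linear_left[OF th] B_linear_right[OF th]] T5(8) unfolding Suc_numerals E2_def by simp
  have inner: "(\<Sum>j\<in>{2..<i}. a_op i j h (J t (E3 j t h) + node M j *\<^sub>R K t (E2 j t h))) = ?S3 i + ?SS i + ?SK i" if i: "i \<in> {2..stages M}" for i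
    unfolding sum.distrib[symmetric]
    by (intro sum.cong refl) (simp only: E3_def linear_add[OF J_linear[OF th]] linear_add[OF a_linear[OF i _ th(2)]])
  have half: "(node M i ^ 2 / 2) *\<^sub>R L t (E2 i t h) = (1/2) *\<^sub>R (node M i ^ 2 *\<^sub>R L t (E2 i t h))" for i by simp
  have "(\<Sum>i\<in>{2..stages M}. b_op i h (H4 i t h)) = (\<Sum>i\<in>{2..stages M}.
      (b_op i h (J t (defect_op 4 i h (F 3 t))) + (b_op i h (J t (?S3 i)) + b_op i h (J t (?SS i)) + b_op i h (J t (?SK i)))) +
      (b_op i h (node M i *\<^sub>R K t (defect_op 3 i h (F 2 t))) + b_op i h (node M i *\<^sub>R K t (?S i))) +
      (1/2) *\<^sub>R b_op i h (node M i ^ 2 *\<^sub>R L t (E2 i t h)) + (1/2) *\<^sub>R b_op i h (B t (E2 i t h) (E2 i t h)))"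
  proof (intro sum.cong refl)
    fix i assume i: "i \<in> {2..stages M}"
    have KE3: "node M i *\<^sub>R K t (E3 i t h) = node M i *\<^sub>R K t (defect_op 3 i h (F 2 t)) + node M i *\<^sub>R K t (?S i)"
      by (simp only: E3_def linear_add[OF K_linear[OF th]] scaleR_add_right)
    have JE4: "J t (E4 i t h) = J t (defect_op 4 i h (F 3 t)) + (J t (?S3 i) + J t (?SS i) + J t (?SK i))"
      by (simp only: E4_def inner[OF i] linear_add[OF J_linear[OF th]])
    show "b_op i h (H4 i t h) = (b_op i h (J t (defect_op 4 i h (F 3 t))) + (b_op i h (J t (?S3 i)) + b_op i h (J t (?SS i)) + b_op i h (J t (?SK i)))) +
      (b_op i h (node M i *\<^sub>R K t (defect_op 3 i h (F 2 t))) + b_op i h (node M i *\<^sub>R K t (?S i))) +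
      (1/2) *\<^sub>R b_op i h (node M i ^ 2 *\<^sub>R L t (E2 i t h)) + (1/2) *\<^sub>R b_op i h (B t (E2 i t h) (E2 i t h))"
      by (simp only: H4_def KE3 JE4 half linear_add[OF b_linear[OF i th(2)]] linear_scale[OF b_linear[OF i th(2)]])
  qed
  then show ?thesis by (simp only: sum.distrib scaleR_sum_right[symmetric] z1 z2 z3 z4 z5 z6 z7 z8 scaleR_zero_right add_0_left)
qed

lemma final_sum_order_of_cancellation:
  assumes "\<And>i. i \<in> {2..stages M} \<Longrightarrow> ord p (\<lambda>t h. \<Delta> i t h - X i t h)" and "\<And>t h. t0 \<le> t \<Longrightarrow> 0 < h \<Longrightarrow> t + h \<le> T \<Longrightarrow> (\<Sum>i\<in>{2..stages M}. b_op i h (X i t h)) = 0"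
  shows "ord p (\<lambda>t h. \<Sum>i\<in>{2..stages M}. b_op i h (\<Delta> i t h))"
proof (rule ord_cong[OF ord_b_sum[OF assms(1)]])
  fix t h assume th: "t0 \<le> t" "0 < h" "t + h \<le> T"
  have "(\<Sum>i\<in>{2..stages M}. b_op i h (\<Delta> i t h - X i t h)) = (\<Sum>i\<in>{2..stages M}. b_op i h (\<Delta> i t h)) - (\<Sum>i\<in>{2..stages M}. b_op i h (X i t h))"
    unfolding sum_subtractf[symmetric] by (intro sum.cong refl) (simp only: linear_diff[OF b_linear[OF _ th(2)]])
  then show "(\<Sum>i\<in>{2..stages M}. b_op i h (\<Delta> i t h)) = (\<Sum>i\<in>{2..stages M}. b_op i h (\<Delta> i t h - X i t h))" using assms(2)[OF th] by simp
qed

text \<open>The sum is multiplied by \<open>h\<close> in the final row, so order \<open>p\<close> suffices for a local error \<open>O(h^(p+1))\<close>. For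
\<open>p = 2\<close> this is the order of the stage errors; beyond that the leading terms cancel.\<close>

lemma final_sum_order:
  shows "ord p (\<lambda>t h. \<Sum>i\<in>{2..stages M}. b_op i h (\<Delta> i t h))"
proof -
  have "p = 2 \<or> p = 3 \<or> p = 4 \<or> p = 5" using p_ge p_le by auto
  then consider (2) "p = 2" | (3) "p = 3" | (4) "p = 4" | (5) "p = 5" by blast
  then show ?thesis
  proof cases
    case 2
    show ?thesis unfolding 2 by (rule ord_b_sum[OF nonlinear_order_2])
  next
    case 3
    show ?thesis
    proof (rule final_sum_order_of_cancellation[of "\<lambda>i t h. h ^ 2 *\<^sub>R H2 i t h"])
      show "ord p (\<lambda>t h. \<Delta> i t h - h ^ 2 *\<^sub>R H2 i t h)" if "i \<in> {2..stages M}" for i using nonlinear_order_3[OF that] 3 by simp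
      fix t h assume th: "t0 \<le> t" "0 < h" "t + h \<le> T"
      have "(\<Sum>i\<in>{2..stages M}. b_op i h (h ^ 2 *\<^sub>R H2 i t h)) = h ^ 2 *\<^sub>R (\<Sum>i\<in>{2..stages M}. b_op i h (H2 i t h))"
        unfolding scaleR_sum_right by (intro sum.cong refl) (simp only: linear_scale[OF b_linear[OF _ th(2)]])
      then show "(\<Sum>i\<in>{2..stages M}. b_op i h (h ^ 2 *\<^sub>R H2 i t h)) = 0" using H2_cancels[OF th] 3 by simp
    qed
  next
    case 4
    show ?thesis
    proof (rule final_sum_order_of_cancellation[of "\<lambda>i t h. h ^ 2 *\<^sub>R H2 i t h + h ^ 3 *\<^sub>R H3 i t h"])
      show "ord p (\<lambda>t h. \<Delta> i t h - (h ^ 2 *\<^sub>R H2 i t h + h ^ 3 *\<^sub>R H3 i t h))" if "i \<in> {2..stages M}" for i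
        using nonlinear_order_4[OF that] 4 by (simp add: diff_diff_eq)
      fix t h assume th: "t0 \<le> t" "0 < h" "t + h \<le> T"
      have "(\<Sum>i\<in>{2..stages M}. b_op i h (h ^ 2 *\<^sub>R H2 i t h + h ^ 3 *\<^sub>R H3 i t h)) = h ^ 2 *\<^sub>R (\<Sum>i\<in>{2..stages M}. b_op i h (H2 i t h)) + h ^ 3 *\<^sub>R (\<Sum>i\<in>{2..stages M}. b_op i h (H3 i t h))"
        unfolding scaleR_sum_right sum.distrib[symmetric]
        by (intro sum.cong refl) (simp only: linear_add[OF b_linear[OF _ th(2)]] linear_scale[OF b_linear[OF _ th(2)]])
      then show "(\<Sum>i\<in>{2..stages M}. b_op i h (h ^ 2 *\<^sub>R H2 i t h + h ^ 3 *\<^sub>R H3 i t h)) = 0" using H2_cancels[OF th] H3_cancels[OF th] 4 by simp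
    qed
  next
    case 5
    show ?thesis
    proof (rule final_sum_order_of_cancellation[of "\<lambda>i t h. h ^ 2 *\<^sub>R H2 i t h + h ^ 3 *\<^sub>R H3 i t h + h ^ 4 *\<^sub>R H4 i t h"])
      show "ord p (\<lambda>t h. \<Delta> i t h - (h ^ 2 *\<^sub>R H2 i t h + h ^ 3 *\<^sub>R H3 i t h + h ^ 4 *\<^sub>R H4 i t h))" if "i \<in> {2..stages M}" for i
        using nonlinear_order_5[OF that] 5 by (simp add: diff_diff_eq add.assoc)
      fix t h assume th: "t0 \<le> t" "0 < h" "t + h \<le> T"
      have "(\<Sum>i\<in>{2..stages M}. b_op i h (h ^ 2 *\<^sub>R H2 i t h + h ^ 3 *\<^sub>R H3 i t h + h ^ 4 *\<^sub>R H4 i t h)) =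
          h ^ 2 *\<^sub>R (\<Sum>i\<in>{2..stages M}. b_op i h (H2 i t h)) + h ^ 3 *\<^sub>R (\<Sum>i\<in>{2..stages M}. b_op i h (H3 i t h)) + h ^ 4 *\<^sub>R (\<Sum>i\<in>{2..stages M}. b_op i h (H4 i t h))"
        unfolding scaleR_sum_right sum.distrib[symmetric]
        by (intro sum.cong refl) (simp only: linear_add[OF b_linear[OF _ th(2)]] linear_scale[OF b_linear[OF _ th(2)]])
      then show "(\<Sum>i\<in>{2..stages M}. b_op i h (h ^ 2 *\<^sub>R H2 i t h + h ^ 3 *\<^sub>R H3 i t h + h ^ 4 *\<^sub>R H4 i t h)) = 0"
        using H2_cancels[OF th] H3_cancels[OF th] H4_cancels[OF th] 5 by simp
    qed
  qed
qed

lemma local_error_expansion: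
  "ord (Suc p) (\<lambda>t h. erk_step M S A g h t (u t) - u (t + h) - h ^ p *\<^sub>R coef_op S (final_defect M p) h (F (p - 1) t))"
proof (rule ord_cong[OF ord_add[OF step_expansion ord_Suc[OF final_sum_order]]])
  fix t h assume th: "t0 \<le> t" "0 < h" "t + h \<le> T"
  have ins: "{1..<p} = insert (p - 1) {1..<p - 1}" using p_ge by auto
  have "(\<Sum>k\<in>{1..<p - 1}. h ^ Suc k *\<^sub>R coef_op S (final_defect M (Suc k)) h (F k t)) = 0"
    by (rule sum.neutral) (use psi_op_zero[OF _ th(2)] in auto)
  then have "(\<Sum>k\<in>{1..<p}. h ^ Suc k *\<^sub>R coef_op S (final_defect M (Suc k)) h (F k t)) = h ^ Suc (p - 1) *\<^sub>R coef_op S (final_defect M (Suc (p - 1))) h (F (p - 1) t)"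
    unfolding ins by (subst sum.insert) auto
  also have "Suc (p - 1) = p" using p_ge by simp
  finally have eq: "(\<Sum>k\<in>{1..<p}. h ^ Suc k *\<^sub>R coef_op S (final_defect M (Suc k)) h (F k t)) = h ^ p *\<^sub>R coef_op S (final_defect M p) h (F (p - 1) t)" .
  show "erk_step M S A g h t (u t) - u (t + h) - h ^ p *\<^sub>R coef_op S (final_defect M p) h (F (p - 1) t) =
    erk_step M S A g h t (u t) - u (t + h) - (\<Sum>k\<in>{1..<p}. h ^ Suc k *\<^sub>R coef_op S (final_defect M (Suc k)) h (F k t))
    - h *\<^sub>R (\<Sum>i\<in>{2..stages M}. b_op i h (\<Delta> i t h)) + h *\<^sub>R (\<Sum>i\<in>{2..stages M}. b_op i h (\<Delta> i t h))"
    unfolding eq by simp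
qed simp

end

context erk_derivatives
begin

text \<open>The term with \<open>\<psi>\<^sub>p(hA)\<close> is only \<open>O(h^p)\<close> because of the weakened condition. It is kept explicitly, since its
contributions cancel only after summation over the steps.\<close>

lemma local_error:
  shows "\<And>i. i \<in> {2..stages M} \<Longrightarrow> ord 2 (\<lambda>t h. erk_stage M S A g h t (u t) i - u (t + node M i * h))"
    and "ord (Suc p) (\<lambda>t h. erk_step M S A g h t (u t) - u (t + h) - h ^ p *\<^sub>R coef_op S (final_defect M p) h (F (p - 1) t))"
proof -
  from nonlinearity_expansion obtain J K L B C where C0: "0 \<le> C" and
    a: "\<forall>t\<in>{t0..T}. linear (J t) \<and> linear (K t) \<and> linear (L t) \<and> (\<forall>y. linear (\<lambda>x. B t x y)) \<and> (\<forall>x. linear (B t x)) \<and>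
     (\<forall>w. norm (J t w) \<le> C * norm w \<and> norm (K t w) \<le> C * norm w \<and> norm (L t w) \<le> C * norm w) \<and>
     (\<forall>x y. norm (B t x y) \<le> C * norm x * norm y)" and
    b: "\<forall>t \<tau> E. t0 \<le> t \<longrightarrow> 0 \<le> \<tau> \<longrightarrow> t + \<tau> \<le> T \<longrightarrow> norm E < R \<longrightarrow>
    norm (g (t + \<tau>) (u (t + \<tau>) + E) - g (t + \<tau>) (u (t + \<tau>))) \<le> C * norm E \<and>
    (3 \<le> p \<longrightarrow> norm (g (t + \<tau>) (u (t + \<tau>) + E) - g (t + \<tau>) (u (t + \<tau>)) - J t E) \<le> C * (\<tau> * norm E + norm E ^ 2)) \<and>
    (4 \<le> p \<longrightarrow> norm (g (t + \<tau>) (u (t + \<tau>) + E) - g (t + \<tau>) (u (t + \<tau>)) - J t E - \<tau> *\<^sub>R K t E) \<le> C * (\<tau> ^ 2 * norm E + norm E ^ 2)) \<and>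
    (5 \<le> p \<longrightarrow> norm (g (t + \<tau>) (u (t + \<tau>) + E) - g (t + \<tau>) (u (t + \<tau>)) - J t E - \<tau> *\<^sub>R K t E - (\<tau> ^ 2 / 2) *\<^sub>R L t E - (1 / 2) *\<^sub>R B t E E)
        \<le> C * (\<tau> ^ 3 * norm E + \<tau> * norm E ^ 2 + norm E ^ 3))"
    by (elim exE conjE)
  interpret erk_expansion S D A g u t0 T R p M F CF J K L B C
  proof (unfold_locales, rule C0)
    fix t assume "t \<in> {t0..T}"
    note a' = a[rule_format, OF this]
    then show "linear (J t) \<and> linear (K t) \<and> linear (L t) \<and> (\<forall>y. linear (\<lambda>x. B t x y)) \<and> (\<forall>x. linear (B t x))"
      by (elim conjE) (intro conjI)
    show "norm (J t w) \<le> C * norm w \<and> norm (K t w) \<le> C * norm w \<and> norm (L t w) \<le> C * norm w" for w using a' by (elim conjE) (erule spec)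
    show "norm (B t x y) \<le> C * norm x * norm y" for x y using a' by (elim conjE) blast
  qed (rule b[rule_format])
  show "ord 2 (\<lambda>t h. erk_stage M S A g h t (u t) i - u (t + node M i * h))" if "i \<in> {2..stages M}" for i
    using stage_error_order_2[OF that] unfolding E_def U_def .
  show "ord (Suc p) (\<lambda>t h. erk_step M S A g h t (u t) - u (t + h) - h ^ p *\<^sub>R coef_op S (final_defect M p) h (F (p - 1) t))"
    by (rule local_error_expansion)
qed

end


section \<open>Stability and convergence\<close>

text \<open>The recursive inequality may be proved under the hypothesis that the bound holds at all earlier
indices. This keeps the numerical solution inside the strip where the nonlinearity is controlled.\<close>

lemma discrete_gronwall:
  fixes x :: "nat \<Rightarrow> real"
  assumes c: "0 \<le> c"
    and step: "\<And>n. n \<le> N \<Longrightarrow> (\<And>j. j < n \<Longrightarrow> x j \<le> a * (1 + c) ^ j) \<Longrightarrow> x n \<le> a + c * (\<Sum>j<n. x j)"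
    and n: "n \<le> N"
  shows "x n \<le> a * (1 + c) ^ n"
  using n
proof (induction n rule: less_induct)
  case (less n)
  have geometric: "a + c * (\<Sum>j<m. a * (1 + c) ^ j) = a * (1 + c) ^ m" for m
    by (induction m) (simp_all add: algebra_simps)
  have IH: "x j \<le> a * (1 + c) ^ j" if "j < n" for j using less that by simp
  have "x n \<le> a + c * (\<Sum>j<n. x j)" by (rule step[OF less.prems IH])
  also have "\<dots> \<le> a + c * (\<Sum>j<n. a * (1 + c) ^ j)"
    using c by (intro add_left_mono mult_left_mono sum_mono IH) auto
  finally show ?case unfolding geometric .
qed

context analytic_generator
begin

lemma phi_1_row:
  assumes "v \<in> D" "\<tau> > 0"
  shows "v + \<tau> *\<^sub>R phi_op S 1 \<tau> (A v + w) = S \<tau> v + \<tau> *\<^sub>R phi_op S 1 \<tau> w"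
proof -
  have "\<tau> *\<^sub>R phi_op S 1 \<tau> (A v + w) = \<tau> *\<^sub>R phi_op S 1 \<tau> (A v) + \<tau> *\<^sub>R phi_op S 1 \<tau> w"
    using linear_add[OF phi_linear[of \<tau> 1]] assms(2) by (simp add: scaleR_add_right)
  then show ?thesis using phi_1_A[OF assms] by simp
qed

lemma solve_recursion:
  assumes "e 0 = 0" "0 \<le> h"
  shows "e n = (\<Sum>j<n. S (real (n - 1 - j) * h) (e (Suc j) - S h (e j)))"
proof (induction n)
  case 0
  then show ?case using assms(1) by simp
next
  case (Suc n)
  let ?r = "\<lambda>j. e (Suc j) - S h (e j)"
  have "S h (e n) = (\<Sum>j<n. S h (S (real (n - 1 - j) * h) (?r j)))"
    by (subst Suc.IH) (rule blinfun.sum_right)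
  also have "\<dots> = (\<Sum>j<n. S (real (Suc n - 1 - j) * h) (?r j))"
  proof (rule sum.cong[OF refl])
    fix j assume "j \<in> {..<n}"
    then have "real (Suc n - 1 - j) = 1 + real (n - 1 - j)" by (simp add: of_nat_diff)
    then have eq: "real (Suc n - 1 - j) * h = h + real (n - 1 - j) * h" by (simp only: distrib_right mult_1_left)
    show "S h (S (real (n - 1 - j) * h) (?r j)) = S (real (Suc n - 1 - j) * h) (?r j)"
      unfolding eq using assms(2) by (intro S_add_apply[symmetric]) auto
  qed
  finally have "(\<Sum>j<Suc n. S (real (Suc n - 1 - j) * h) (?r j)) = S h (e n) + ?r n" by simp
  then show ?case by simp
qed

text \<open>The operator \<open>A\<close> acts on the difference only through \<open>S \<tau> (v - w)\<close>, by lemma \<open>phi_1_row\<close>; everything else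
is a Lipschitz perturbation with a factor \<open>h\<close>.\<close>

lemma row_stability:
  assumes D: "v \<in> D" "w \<in> D" and \<tau>: "0 < \<tau>" "\<tau> \<le> h" and h: "h \<le> b"
    and K: "\<And>t. t \<in> {0..b} \<Longrightarrow> norm (S t) \<le> K"
    and adm: "\<And>j. j \<in> J \<Longrightarrow> admissible (rw j)"
    and x: "norm (x - y) \<le> G" and X: "\<And>j. j \<in> J \<Longrightarrow> norm (X j - Y j) \<le> G"
  shows "norm ((v + \<tau> *\<^sub>R phi_op S 1 \<tau> (A v + x) + h *\<^sub>R (\<Sum>j\<in>J. coef_op S (rw j) h (X j - x)))
     - (w + \<tau> *\<^sub>R phi_op S 1 \<tau> (A w + y) + h *\<^sub>R (\<Sum>j\<in>J. coef_op S (rw j) h (Y j - y))) - S \<tau> (v - w))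
     \<le> h * ((1 + 2 * (\<Sum>j\<in>J. coef_size (rw j))) * K * G)"
proof -
  have h0: "0 \<le> h" "0 \<le> b" using \<tau> h by auto
  have K0: "0 \<le> K" by (rule order_trans[OF norm_ge_zero K[of 0]]) (use h0 in simp)
  have G0: "0 \<le> G" using x norm_ge_zero[of "x - y"] by linarith
  let ?Z = "\<lambda>j. (X j - Y j) - (x - y)"
  have eq: "(v + \<tau> *\<^sub>R phi_op S 1 \<tau> (A v + x) + h *\<^sub>R (\<Sum>j\<in>J. coef_op S (rw j) h (X j - x)))
     - (w + \<tau> *\<^sub>R phi_op S 1 \<tau> (A w + y) + h *\<^sub>R (\<Sum>j\<in>J. coef_op S (rw j) h (Y j - y))) - S \<tau> (v - w)
     = \<tau> *\<^sub>R phi_op S 1 \<tau> (x - y) + h *\<^sub>R (\<Sum>j\<in>J. coef_op S (rw j) h (?Z j))"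
  proof -
    have "coef_op S (rw j) h (X j - x) - coef_op S (rw j) h (Y j - y) = coef_op S (rw j) h (?Z j)" if "j \<in> J" for j
      unfolding linear_diff[OF coef_linear[OF h0(1) adm[OF that]], symmetric] by (rule arg_cong[of _ _ "coef_op S (rw j) h"]) simp
    then have "(\<Sum>j\<in>J. coef_op S (rw j) h (X j - x)) - (\<Sum>j\<in>J. coef_op S (rw j) h (Y j - y)) = (\<Sum>j\<in>J. coef_op S (rw j) h (?Z j))"
      unfolding sum_subtractf[symmetric] by (rule sum.cong[OF refl])
    moreover have "phi_op S 1 \<tau> (x - y) = phi_op S 1 \<tau> x - phi_op S 1 \<tau> y"
      by (rule linear_diff[OF phi_linear]) (use \<tau> in simp)
    ultimately show ?thesis
      unfolding phi_1_row[OF D(1) \<tau>(1)] phi_1_row[OF D(2) \<tau>(1)] blinfun.diff_right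
      by (simp add: scaleR_diff_right flip: \<open>_ = (\<Sum>j\<in>J. coef_op S (rw j) h (?Z j))\<close>)
  qed
  have 1: "norm (\<tau> *\<^sub>R phi_op S 1 \<tau> (x - y)) \<le> h * (K * G)"
  proof -
    have "norm (phi_op S 1 \<tau> (x - y)) \<le> K * norm (x - y)" by (rule phi_bound[OF K]) (use \<tau> h in auto)
    also have "\<dots> \<le> K * G" using x K0 by (rule mult_left_mono)
    finally have "\<tau> * norm (phi_op S 1 \<tau> (x - y)) \<le> h * (K * G)" using \<tau> h0 by (intro mult_mono) auto
    then show ?thesis using \<tau> by simp
  qed
  have 2: "norm (\<Sum>j\<in>J. coef_op S (rw j) h (?Z j)) \<le> (\<Sum>j\<in>J. coef_size (rw j)) * (K * (2 * G))"
    unfolding sum_distrib_right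
  proof (rule sum_norm_le)
    fix j assume j: "j \<in> J"
    have "norm (?Z j) \<le> 2 * G" using norm_triangle_ineq4[of "X j - Y j" "x - y"] x X[OF j] by linarith
    have "norm (coef_op S (rw j) h (?Z j)) \<le> coef_size (rw j) * K * norm (?Z j)"
      by (rule coef_bound[OF K h0(1) h adm[OF j]])
    also have "\<dots> \<le> coef_size (rw j) * K * (2 * G)"
      using \<open>norm (?Z j) \<le> 2 * G\<close> K0 coef_size_nonneg[of "rw j"] by (intro mult_left_mono) auto
    finally show "norm (coef_op S (rw j) h (?Z j)) \<le> coef_size (rw j) * (K * (2 * G))" by (simp add: mult.assoc)
  qed
  have 3: "norm (h *\<^sub>R (\<Sum>j\<in>J. coef_op S (rw j) h (?Z j))) \<le> h * ((\<Sum>j\<in>J. coef_size (rw j)) * (K * (2 * G)))"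
    unfolding norm_scaleR using 2 h0 by (simp add: mult_left_mono)
  show ?thesis unfolding eq
    by (rule order_trans[OF norm_triangle_ineq order_trans[OF add_mono[OF 1 3]]]) (simp add: algebra_simps)
qed

end

context erk_problem
begin

lemma erk_step_in_D:
  assumes v: "v \<in> D" and h: "h > 0"
  shows "erk_step M S A g h t v \<in> D"
proof -
  have "(\<Sum>i\<in>{2..stages M}. coef_op S (bcoef M i) h (g (t + node M i * h) (erk_stage M S A g h t v i) - g t v)) \<in> D"
    using h by (intro subspace_sum[OF subspace_D] coef_in_D admissible_b)
  then show ?thesis
    unfolding erk_step_def using v h
    by (intro subspace_add[OF subspace_D] subspace_scale[OF subspace_D] phi_in_D)
qed

end

context erk_derivatives
begin

text \<open>The stages of the exact solution stay within \<open>R/2\<close> of the solution curve for small \<open>h\<close>. By induction over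
the stages, the perturbed stages differ from them by at most \<open>K + 1\<close> times the perturbation of the initial
value, where \<open>K\<close> bounds the semigroup and the summand \<open>1\<close> absorbs the terms with a factor \<open>h\<close>. So they stay
in the ball of radius \<open>R\<close> as well, where \<open>g\<close> is Lipschitz continuous.\<close>

lemma stability:
  obtains C h0 \<rho> where "0 \<le> C" "0 < h0" "0 < \<rho>"
    "\<And>t h v. t0 \<le> t \<Longrightarrow> 0 < h \<Longrightarrow> h \<le> h0 \<Longrightarrow> t + h \<le> T \<Longrightarrow> v \<in> D \<Longrightarrow> norm (v - u t) \<le> \<rho> \<Longrightarrow>
       norm (erk_step M S A g h t v - erk_step M S A g h t (u t) - S h (v - u t)) \<le> h * (C * norm (v - u t))"
proof -
  let ?I = "{2..stages M}"
  obtain K where K: "K > 0" "\<forall>t\<in>{0..T - t0}. norm (S t) \<le> K" using S_bounded by blast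
  obtain L where L: "\<And>t. t \<in> {t0..T} \<Longrightarrow> L-lipschitz_on (ball (u t) R) (g t)" using g_lipschitz by blast
  have L0: "0 \<le> L" using lipschitz_on_nonneg[OF L[of t0]] t0T by auto
  have lip: "norm (g t x - g t y) \<le> L * norm (x - y)" if "t \<in> {t0..T}" "norm (x - u t) < R" "norm (y - u t) < R" for t x y
    using lipschitz_onD[OF L[OF that(1)], of x y] that(2,3) by (simp add: dist_norm norm_minus_commute)
  have "\<forall>\<^sub>F h in at_right 0. \<forall>i\<in>?I. \<forall>t. t0 \<le> t \<longrightarrow> t + h \<le> T \<longrightarrow> norm (erk_stage M S A g h t (u t) i - u (t + node M i * h)) < R / 2"
  proof (rule eventually_ball_finite, simp, rule ballI)
    fix i assume i: "i \<in> ?I"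
    have stage_order: "ord 2 (\<lambda>t h. erk_stage M S A g h t (u t) i - u (t + node M i * h))" by (rule local_error(1)[OF i])
    obtain C h1 where C: "0 \<le> C" "0 < h1" "\<forall>t h. t0 \<le> t \<longrightarrow> 0 < h \<longrightarrow> h \<le> h1 \<longrightarrow> t + h \<le> T \<longrightarrow>
        norm (erk_stage M S A g h t (u t) i - u (t + node M i * h)) \<le> C * h ^ 2"
      using stage_order unfolding ord_def by (elim exE conjE)
    have "((\<lambda>h::real. C * h ^ 2) \<longlongrightarrow> C * 0 ^ 2) (at_right 0)" by (intro tendsto_intros)
    then have "\<forall>\<^sub>F h in at_right 0. C * h ^ 2 < R / 2" by (rule order_tendstoD(2)) (use R_pos in simp)
    moreover have "\<forall>\<^sub>F h in at_right 0. h \<in> {0<..<h1}" by (rule eventually_at_right_real[OF C(2)])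
    ultimately show "\<forall>\<^sub>F h in at_right 0. \<forall>t. t0 \<le> t \<longrightarrow> t + h \<le> T \<longrightarrow> norm (erk_stage M S A g h t (u t) i - u (t + node M i * h)) < R / 2"
    proof eventually_elim
      case (elim h)
      then show ?case using C(3)[rule_format, of _ h] by (intro allI impI) (rule order_le_less_trans, auto)
    qed
  qed
  then obtain h1 where h1: "0 < h1" "\<And>h i t. 0 < h \<Longrightarrow> h < h1 \<Longrightarrow> i \<in> ?I \<Longrightarrow> t0 \<le> t \<Longrightarrow> t + h \<le> T \<Longrightarrow>
      norm (erk_stage M S A g h t (u t) i - u (t + node M i * h)) < R / 2"
    unfolding eventually_at_right_field by blast
  \<comment> \<open>one bound for the coefficients of all rows\<close>
  define W where "W = (\<Sum>i\<in>?I. \<Sum>j\<in>{2..<i}. coef_size (acoef M i j)) + (\<Sum>i\<in>?I. coef_size (bcoef M i))"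
  have Wb: "(\<Sum>i\<in>?I. coef_size (bcoef M i)) \<le> W"
    unfolding W_def by (simp add: sum_nonneg coef_size_nonneg)
  have Wa: "(\<Sum>j\<in>{2..<i}. coef_size (acoef M i j)) \<le> W" if i: "i \<in> ?I" for i
  proof -
    have "(\<Sum>j\<in>{2..<i}. coef_size (acoef M i j)) \<le> (\<Sum>i\<in>?I. \<Sum>j\<in>{2..<i}. coef_size (acoef M i j))"
      by (rule member_le_sum[OF i]) (simp_all add: sum_nonneg coef_size_nonneg)
    moreover have "0 \<le> (\<Sum>i\<in>?I. coef_size (bcoef M i))" by (simp add: sum_nonneg coef_size_nonneg)
    ultimately show ?thesis unfolding W_def by linarith
  qed
  define \<Gamma> where "\<Gamma> = (1 + 2 * W) * K * (L * (K + 1))"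
  have W0: "0 \<le> W" using Wb sum_nonneg[of ?I "\<lambda>i. coef_size (bcoef M i)"] coef_size_nonneg by fastforce
  have \<Gamma>0: "0 \<le> \<Gamma>" unfolding \<Gamma>_def using W0 K L0 by auto
  \<comment> \<open>\<open>h \<Gamma> \<le> 1\<close> keeps the stage constant at \<open>K + 1\<close>\<close>
  define h0 where "h0 = min (h1 / 2) (1 / (\<Gamma> + 1))"
  \<comment> \<open>chosen such that \<open>(K + 1) \<rho> = R / 2\<close>\<close>
  define \<rho> where "\<rho> = R / (2 * (K + 1))"
  have \<rho>: "0 < \<rho>" "\<rho> * (K + 1) = R / 2" "\<rho> < R" unfolding \<rho>_def using R_pos K by (auto simp: field_simps add_pos_pos)
  show ?thesis
  proof (rule that[of \<Gamma> h0 \<rho>])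
    show "0 \<le> \<Gamma>" "0 < h0" "0 < \<rho>" using \<Gamma>0 h1(1) \<rho> unfolding h0_def by auto
    fix t h v assume t: "t0 \<le> t" and h: "0 < h" "h \<le> h0" and th: "t + h \<le> T" and v: "v \<in> D" "norm (v - u t) \<le> \<rho>"
    have hh1: "h < h1" using h h1 unfolding h0_def by linarith
    have h\<Gamma>: "h * \<Gamma> \<le> 1"
    proof -
      have "h * (\<Gamma> + 1) \<le> 1" using h \<Gamma>0 unfolding h0_def by (simp add: field_simps)
      then show ?thesis using h by (simp add: algebra_simps)
    qed
    have tT: "t \<in> {t0..T}" using t th h by auto
    let ?e = "norm (v - u t)"
    let ?U = "erk_stage M S A g h t v" and ?V = "erk_stage M S A g h t (u t)"
    let ?G = "L * (K + 1) * ?e"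
    have KG: "L * ?e \<le> ?G" using K L0 by (simp add: algebra_simps)
    have g0: "norm (g t v - g t (u t)) \<le> ?G"
      using lip[OF tT, of v "u t"] v \<rho>(3) R_pos KG by auto
    have node_time: "t + node M j * h \<in> {t0..T}" if "j \<in> ?I" for j
    proof -
      have "0 \<le> node M j * h" "node M j * h \<le> 1 * h" using node_range[OF that] h by (auto intro: mult_right_mono)
      then show ?thesis using t th by auto
    qed
    have gstage: "norm (g (t + node M j * h) (?U j) - g (t + node M j * h) (?V j)) \<le> ?G"
      if j: "j \<in> ?I" and d: "norm (?U j - ?V j) \<le> (K + 1) * ?e" for j
    proof -
      let ?u = "u (t + node M j * h)"
      have V: "norm (?V j - ?u) < R / 2" by (rule h1(2)[OF h(1) hh1 j t th])
      have "(K + 1) * ?e \<le> (K + 1) * \<rho>" using v K by (intro mult_left_mono) auto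
      then have "norm (?U j - ?V j) \<le> R / 2" using d \<rho>(2) by (simp add: mult.commute)
      then have "norm (?U j - ?u) < R" using V norm_triangle_ineq[of "?U j - ?V j" "?V j - ?u"] by simp
      moreover have "norm (?V j - ?u) < R" using V R_pos by linarith
      ultimately have "norm (g (t + node M j * h) (?U j) - g (t + node M j * h) (?V j)) \<le> L * norm (?U j - ?V j)"
        by (rule lip[OF node_time[OF j]])
      also have "\<dots> \<le> L * ((K + 1) * ?e)" using d L0 by (rule mult_left_mono)
      finally show ?thesis by (simp add: mult.assoc)
    qed
    have weight: "h * ((1 + 2 * w) * K * ?G) \<le> h * (\<Gamma> * ?e)" if "w \<le> W" for w
    proof -
      have "(1 + 2 * w) * (K * ?G) \<le> (1 + 2 * W) * (K * ?G)" using that K L0 by (intro mult_right_mono) auto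
      then show ?thesis using h unfolding \<Gamma>_def by (intro mult_left_mono) (simp_all add: mult.assoc)
    qed
    have Kb: "\<And>s. s \<in> {0..T - t0} \<Longrightarrow> norm (S s) \<le> K" using K(2) by blast
    have hb: "h \<le> T - t0" using t th by linarith
    have uD: "u t \<in> D" by (rule u_in_D[OF tT])
    have stages: "norm (?U i - ?V i) \<le> (K + 1) * ?e" if "i \<in> ?I" for i
      using that
    proof (induction i rule: less_induct)
      case (less i)
      have c: "0 < node M i * h" "node M i * h \<le> h" using node_range[OF less.prems] h by (auto simp: mult_left_le_one_le)
      have IH: "norm (g (t + node M j * h) (?U j) - g (t + node M j * h) (?V j)) \<le> ?G" if "j \<in> {2..<i}" for j
        using less that by (intro gstage) auto
      have "norm (?U i - ?V i - S (node M i * h) (v - u t)) \<le> h * ((1 + 2 * (\<Sum>j\<in>{2..<i}. coef_size (acoef M i j))) * K * ?G)"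
        unfolding erk_stage.simps[of M S A g h t v i] erk_stage.simps[of M S A g h t "u t" i]
        by (rule row_stability[OF v(1) uD c hb Kb admissible_a[OF less.prems] g0 IH])
      also have "\<dots> \<le> h * (\<Gamma> * ?e)" by (rule weight[OF Wa[OF less.prems]])
      also have "\<dots> \<le> ?e" using mult_right_mono[OF h\<Gamma>, of ?e] by (simp add: mult.assoc)
      finally have a: "norm (?U i - ?V i - S (node M i * h) (v - u t)) \<le> ?e" .
      have "norm (S (node M i * h) (v - u t)) \<le> norm (S (node M i * h)) * ?e" by (rule norm_blinfun)
      also have "\<dots> \<le> K * ?e" using c hb by (intro mult_right_mono Kb) auto
      finally have "norm (S (node M i * h) (v - u t)) \<le> K * ?e" .
      then show ?case
        using a norm_triangle_ineq[of "?U i - ?V i - S (node M i * h) (v - u t)" "S (node M i * h) (v - u t)"]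
        unfolding diff_add_cancel distrib_right by linarith
    qed
    have "norm (erk_step M S A g h t v - erk_step M S A g h t (u t) - S h (v - u t)) \<le> h * ((1 + 2 * (\<Sum>i\<in>?I. coef_size (bcoef M i))) * K * ?G)"
      unfolding erk_step_def
      by (rule row_stability[OF v(1) uD h(1) order_refl hb Kb admissible_b g0 gstage[OF _ stages]])
    also have "\<dots> \<le> h * (\<Gamma> * ?e)" by (rule weight[OF Wb])
    finally show "norm (erk_step M S A g h t v - erk_step M S A g h t (u t) - S h (v - u t)) \<le> h * (\<Gamma> * ?e)" .
  qed
qed

text \<open>The solved error recursion bounds \<open>\<parallel>e\<^sub>m\<parallel>\<close> by \<open>a h^p + b h \<Sum>\<^sub>j \<parallel>e\<^sub>j\<parallel>\<close>. The first part of \<open>a\<close> is the bound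
for the accumulated terms with \<open>\<psi>\<^sub>p(hA)\<close>, the second one sums at most \<open>(T - t0) / h\<close> local errors of size
\<open>O(h^(p+1))\<close>.\<close>

lemma convergence:
  "\<exists>C h0. h0 > 0 \<and> (\<forall>h n. 0 < h \<and> h \<le> h0 \<and> t0 + real n * h \<le> T \<longrightarrow>
     norm (erk_solution M S A g h t0 (u t0) n - u (t0 + real n * h)) \<le> C * h ^ p)"
proof -
  have CF: "0 \<le> CF" using Fb[of p t0] p_ge t0T by (intro order_trans[OF norm_ge_zero]) auto
  obtain \<Gamma> h1 \<rho> where \<Gamma>: "0 \<le> \<Gamma>" "0 < h1" "0 < \<rho>"
    and stab: "\<And>t h v. t0 \<le> t \<Longrightarrow> 0 < h \<Longrightarrow> h \<le> h1 \<Longrightarrow> t + h \<le> T \<Longrightarrow> v \<in> D \<Longrightarrow> norm (v - u t) \<le> \<rho> \<Longrightarrow>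
       norm (erk_step M S A g h t v - erk_step M S A g h t (u t) - S h (v - u t)) \<le> h * (\<Gamma> * norm (v - u t))"
    using stability by blast
  have step_order: "ord (Suc p) (\<lambda>t h. erk_step M S A g h t (u t) - u (t + h) - h ^ p *\<^sub>R coef_op S (final_defect M p) h (F (p - 1) t))"
    by (rule local_error(2))
  obtain CL h2 where CL: "0 \<le> CL" "0 < h2"
    and loc: "\<forall>t h. t0 \<le> t \<longrightarrow> 0 < h \<longrightarrow> h \<le> h2 \<longrightarrow> t + h \<le> T \<longrightarrow>
      norm (erk_step M S A g h t (u t) - u (t + h) - h ^ p *\<^sub>R coef_op S (final_defect M p) h (F (p - 1) t)) \<le> CL * h ^ Suc p"
    using step_order unfolding ord_def by (elim exE conjE)
  obtain K where K: "K > 0" "\<forall>t\<in>{0..T - t0}. norm (S t) \<le> K" using S_bounded by blast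
  have adm: "admissible (final_defect M p)" by (rule admissible_final_defect) (use p_ge in simp)
  have "weak_psi_condition M p" using conditions unfolding stiff_conditions_weakened_def by blast
  then have mean: "(\<Sum>(\<alpha>, k, \<sigma>)\<leftarrow>final_defect M p. \<alpha> / fact k) = 0"
    using weak_psi_condition_real coef_real_0[OF adm] by simp
  obtain Cw where Cw: "0 \<le> Cw" and wsum: "\<And>h n y Y L. 0 < h \<Longrightarrow> real n * h \<le> T - t0 \<Longrightarrow> (\<And>j. j < n \<Longrightarrow> norm (y j) \<le> Y) \<Longrightarrow> 0 \<le> Y \<Longrightarrow>
     (\<And>j. Suc j < n \<Longrightarrow> norm (y (Suc j) - y j) \<le> L * h) \<Longrightarrow> 0 \<le> L \<Longrightarrow>
     norm (\<Sum>j<n. S (real (n - 1 - j) * h) (coef_op S (final_defect M p) h (y j))) \<le> Cw * (Y + L)"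
    using weighted_sum_orbit_coef_bounded[OF adm mean, of "T - t0"] by blast
  define a where "a = Cw * (CF + CF) + K * CL * (T - t0)"
  define b where "b = K * \<Gamma>"
  have a0: "0 \<le> a" and b0: "0 \<le> b" unfolding a_def b_def using Cw CF K CL t0T \<Gamma> by auto
  define C where "C = a * exp (b * (T - t0))"
  have C0: "0 \<le> C" unfolding C_def using a0 by simp
  \<comment> \<open>the last entry gives \<open>C h^p \<le> \<rho>\<close>, so that the stability estimate applies to every step\<close>
  define h0 where "h0 = Min {h1, h2, 1, \<rho> / (C + 1)}"
  have h0: "0 < h0" "h0 \<le> h1" "h0 \<le> h2" "h0 \<le> 1" "h0 \<le> \<rho> / (C + 1)" unfolding h0_def using \<Gamma> CL C0 by (auto simp: Min_gr_iff)
  show ?thesis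
  proof (rule exI[of _ C], rule exI[of _ h0], intro conjI allI impI h0(1))
    fix h n assume hn: "0 < h \<and> h \<le> h0 \<and> t0 + real n * h \<le> T"
    then have h: "0 < h" "h \<le> h0" and nT: "t0 + real n * h \<le> T" by auto
    have small: "C * h ^ p \<le> \<rho>"
    proof -
      have "h ^ p \<le> h ^ 1" using h h0 p_ge by (intro power_decreasing) auto
      then have "C * h ^ p \<le> C * h" using C0 by (intro mult_left_mono) auto
      moreover have "(C + 1) * h \<le> \<rho>" using order_trans[OF h(2) h0(5)] C0 by (simp add: field_simps)
      ultimately show ?thesis using h by (simp add: algebra_simps)
    qed
    let ?t = "\<lambda>j. t0 + real j * h"
    let ?v = "erk_solution M S A g h t0 (u t0)"
    define e where "e j = ?v j - u (?t j)" for j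
    define y where "y j = F (p - 1) (?t j)" for j
    define \<Psi> where "\<Psi> = coef_op S (final_defect M p) h"
    have vD: "?v j \<in> D" for j
      by (induction j) (use u_in_D[of t0] t0T h in \<open>auto intro: erk_step_in_D\<close>)
    have tmono: "?t j \<le> ?t n" if "j \<le> n" for j using that h by (simp add: mult_right_mono)
    have tT: "?t j \<in> {t0..T}" if "j \<le> n" for j
      using order_trans[OF tmono[OF that] nT] h by auto
    have t_Suc: "?t (Suc j) = ?t j + h" for j by (simp add: algebra_simps)
    have growth: "a * h ^ p * (1 + b * h) ^ j \<le> C * h ^ p" if "j \<le> n" for j
    proof -
      have "(1 + b * h) ^ j \<le> exp (b * h) ^ j" using b0 h exp_ge_add_one_self[of "b * h"] by (intro power_mono) auto
      also have "exp (b * h) ^ j = exp (b * (real j * h))" by (simp add: exp_of_nat_mult[symmetric] mult_ac)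
      also have "\<dots> \<le> exp (b * (T - t0))" using tT[OF that] b0 by (simp add: mult_left_mono)
      finally have "(a * h ^ p) * (1 + b * h) ^ j \<le> (a * h ^ p) * exp (b * (T - t0))" using a0 h by (intro mult_left_mono) auto
      then show ?thesis unfolding C_def by (simp add: mult_ac)
    qed
    have "norm (e n) \<le> a * h ^ p * (1 + b * h) ^ n"
    proof (rule discrete_gronwall[where N = n])
      show "0 \<le> b * h" using b0 h by simp
      fix m assume m: "m \<le> n" and prev: "\<And>j. j < m \<Longrightarrow> norm (e j) \<le> a * h ^ p * (1 + b * h) ^ j"
      define r where "r j = e (Suc j) - S h (e j) - h ^ p *\<^sub>R \<Psi> (y j)" for j
      have mT: "real m * h \<le> T - t0" using tT[OF m] by auto
      have r: "norm (r j) \<le> h * (\<Gamma> * norm (e j)) + CL * h ^ Suc p" if j: "j < m" for j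
      proof -
        have th: "t0 \<le> ?t j" "?t j + h \<le> T" using tT[of "Suc j"] j m h t_Suc[of j] by auto
        have ej: "norm (?v j - u (?t j)) \<le> \<rho>" using prev[OF j] growth[of j] small j m unfolding e_def by linarith
        have eq: "r j = (erk_step M S A g h (?t j) (?v j) - erk_step M S A g h (?t j) (u (?t j)) - S h (e j)) +
            (erk_step M S A g h (?t j) (u (?t j)) - u (?t j + h) - h ^ p *\<^sub>R \<Psi> (y j))"
          unfolding r_def e_def[of "Suc j"] t_Suc by simp
        show ?thesis unfolding eq
          using stab[OF th(1) h(1) _ th(2) vD ej] loc[rule_format, OF th(1) h(1) _ th(2)] h h0
          unfolding e_def y_def \<Psi>_def by (intro order_trans[OF norm_triangle_ineq] add_mono) auto
      qed
      have sum_y: "norm (\<Sum>j<m. S (real (m - 1 - j) * h) (\<Psi> (y j))) \<le> Cw * (CF + CF)"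
        unfolding \<Psi>_def
      proof (rule wsum[OF h(1) mT _ CF _ CF])
        show "norm (y j) \<le> CF" if "j < m" for j unfolding y_def using that m p_ge by (intro Fb tT) auto
        show "norm (y (Suc j) - y j) \<le> CF * h" if j: "Suc j < m" for j
        proof -
          have "norm (F (p - 1) (?t (Suc j)) - F (p - 1) (?t j)) \<le> CF * \<bar>?t (Suc j) - ?t j\<bar>"
            by (rule vector_derivative_bound[where f' = "F p"]) (use Fd[of "p - 1"] Fb[of p] p_ge tT[of j] tT[of "Suc j"] j m in auto)
          then show ?thesis unfolding y_def t_Suc using h by simp
        qed
      qed
      have sum_r: "norm (\<Sum>j<m. S (real (m - 1 - j) * h) (r j)) \<le> (\<Sum>j<m. K * (h * (\<Gamma> * norm (e j)) + CL * h ^ Suc p))"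
      proof (rule sum_norm_le)
        fix j assume "j \<in> {..<m}"
        then have j: "j < m" by simp
        have "real (m - 1 - j) * h \<le> real m * h" using h by (intro mult_right_mono) auto
        then have "real (m - 1 - j) * h \<in> {0..T - t0}"
          unfolding atLeastAtMost_iff using h by (intro conjI order_trans[OF _ mT]) auto
        then have "norm (S (real (m - 1 - j) * h)) * norm (r j) \<le> K * (h * (\<Gamma> * norm (e j)) + CL * h ^ Suc p)"
          using K r[OF j] by (intro mult_mono) auto
        then show "norm (S (real (m - 1 - j) * h) (r j)) \<le> K * (h * (\<Gamma> * norm (e j)) + CL * h ^ Suc p)"
          by (rule order_trans[OF norm_blinfun])
      qed
      have "e m = (\<Sum>j<m. S (real (m - 1 - j) * h) (e (Suc j) - S h (e j)))"
        by (rule solve_recursion) (use h in \<open>auto simp: e_def\<close>)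
      also have "\<dots> = h ^ p *\<^sub>R (\<Sum>j<m. S (real (m - 1 - j) * h) (\<Psi> (y j))) + (\<Sum>j<m. S (real (m - 1 - j) * h) (r j))"
        unfolding scaleR_sum_right sum.distrib[symmetric] blinfun.scaleR_right[symmetric] blinfun.add_right[symmetric] r_def by simp
      finally have decomposition: "e m = h ^ p *\<^sub>R (\<Sum>j<m. S (real (m - 1 - j) * h) (\<Psi> (y j))) + (\<Sum>j<m. S (real (m - 1 - j) * h) (r j))" .
      have em: "norm (e m) \<le> h ^ p * norm (\<Sum>j<m. S (real (m - 1 - j) * h) (\<Psi> (y j))) + norm (\<Sum>j<m. S (real (m - 1 - j) * h) (r j))"
        unfolding decomposition by (rule order_trans[OF norm_triangle_ineq]) (use h in simp)
      have 1: "h ^ p * norm (\<Sum>j<m. S (real (m - 1 - j) * h) (\<Psi> (y j))) \<le> h ^ p * (Cw * (CF + CF))"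
        using sum_y h by (intro mult_left_mono) auto
      have 2: "(\<Sum>j<m. K * (h * (\<Gamma> * norm (e j)) + CL * h ^ Suc p)) = b * h * (\<Sum>j<m. norm (e j)) + real m * h * (K * CL * h ^ p)"
        unfolding b_def by (simp add: sum.distrib sum_distrib_left distrib_left mult_ac)
      have 3: "real m * h * (K * CL * h ^ p) \<le> (T - t0) * (K * CL * h ^ p)"
        using mT K CL h by (intro mult_right_mono) auto
      have 4: "a * h ^ p = h ^ p * (Cw * (CF + CF)) + (T - t0) * (K * CL * h ^ p)"
        unfolding a_def by (simp add: algebra_simps)
      show "norm (e m) \<le> a * h ^ p + b * h * (\<Sum>j<m. norm (e j))"
        using em sum_r 1 3 unfolding 2 4 by linarith
    qed simp
    then show "norm (?v n - u (?t n)) \<le> C * h ^ p" using growth[of n] unfolding e_def by linarith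
  qed
qed

end

theorem theorem3p1:
  fixes S :: "real \<Rightarrow> 'a::banach \<Rightarrow>\<^sub>L 'a"
    and D :: "'a set" and A :: "'a \<Rightarrow> 'a"
    and g :: "real \<Rightarrow> 'a \<Rightarrow> 'a"
    and u :: "real \<Rightarrow> 'a" and u0 :: 'a
    and t0 T R :: real
    and p :: nat
    and M :: erk_method
  assumes "t0 < T"
    and "analytic_semigroup S" and "infinitesimal_generator S D A"
    and "u t0 = u0"
    and "\<And>t. t \<in> {t0..T} \<Longrightarrow> u t \<in> D"
    and "\<And>t. t \<in> {t0..T} \<Longrightarrow>
           (u has_vector_derivative A (u t) + g t (u t)) (at t within {t0..T})"
    and "C_k_on_interval p u t0 T"
    and "R > 0"
    and "bounded_frechet_differentiable p (\<lambda>(t, x). g t x) (strip t0 T u R)"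
    and "\<exists>L. \<forall>t\<in>{t0..T}. L-lipschitz_on (ball (u t) R) (g t)"
    and "2 \<le> p" and "p \<le> 5"
    and "valid_erk_method M"
    and "stiff_conditions_weakened M p"
  shows "\<exists>C h0. h0 > 0 \<and>
           (\<forall>h n. 0 < h \<and> h \<le> h0 \<and> t0 + real n * h \<le> T \<longrightarrow>
              norm (erk_solution M S A g h t0 u0 n - u (t0 + real n * h)) \<le> C * h ^ p)"
proof -
  interpret erk_problem S D A g u t0 T R p M
    using assms by unfold_locales auto
  obtain F CF where F: "F 0 = (\<lambda>t. g t (u t))"
      "\<And>k t. k < p \<Longrightarrow> t \<in> {t0..T} \<Longrightarrow> (F k has_vector_derivative F (Suc k) t) (at t within {t0..T})"
      "\<And>k t. 1 \<le> k \<Longrightarrow> k \<le> p \<Longrightarrow> t \<in> {t0..T} \<Longrightarrow> norm (F k t) \<le> CF"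
    using nonlinearity_smooth by blast
  interpret erk_derivatives S D A g u t0 T R p M F CF
    using F by unfold_locales auto
  show ?thesis using convergence unfolding \<open>u t0 = u0\<close> .
qed

end
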